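(* Let $\Omega\subset\mathbb{R}^n$, $n\ge2$, be a nonempty open bounded convex set, and let $\Lambda_\infty$, $\Lambda_{sing}$, $r_\Lambda$, $v_r$ and problem $(P)_\Lambda$ be as defined in the context. We have: (i) If $\Lambda_{sing}\le\Lambda_\infty$, $(P)_\Lambda$ admits a unique solution (given by $v_{r_\Lambda}$) if and only if $\Lambda>\Lambda_\infty$. (ii) If $\Lambda_{sing}>\Lambda_\infty$, $(P)_\Lambda$ admits a unique solution (given by $v_{r_\Lambda}$) if and only if $\Lambda\ge\Lambda_{sing}$.
   Context: $\mathrm{Lip}_1(\Omega):=\{u\in W^{1,\infty}(\Omega):\ u\ge0 \text{ in }\Omega,\ u=1\text{ on }\partial\Omega\}$ (elements regarded as continuous functions on $\overline\Omega$). For $\Lambda>0$, $J_\Lambda(u):=\|\nabla u\|_\infty+\Lambda\,|\{x\in\Omega:u(x)>0\}|$ for $u\in\mathrm{Lip}_1(\Omega)$, with $\|\cdot\|_\infty$ the $L^\infty(\Omega)$ norm and $|\cdot|$ Lebesgue measure. Problem $(P)_\Lambda$ is to minimize $J_\Lambda$ over $\mathrm{Lip}_1(\Omega)$; a solution is a minimizer. $\Lambda_\infty:=\inf\{\Lambda>0:(P)_\Lambda\text{ admits a non-constant solution}\}$. $R_\Omega$ is the inradius of $\Omega$; $\Omega_r:=\{x\in\Omega:\mathrm{dist}(x,\partial\Omega)>r\}$; $|\partial\Omega_r|$ is the $(n-1)$-dimensional Hausdorff measure of $\partial\Omega_r$; $v_r(x):=[1-\frac1r\mathrm{dist}(x,\partial\Omega)]_+$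 for $x\in\overline\Omega$, $r\in(0,R_\Omega]$. There is a unique $r^*\in(0,R_\Omega)$ with $|\partial\Omega_{r^*}|/|\Omega_{r^*}|=1/r^*$, and $\Lambda_\infty=1/(r^*|\Omega_{r^*}|)$. For $\Lambda\ge\Lambda_\infty$, $r_\Lambda$ is the smallest root $r$ of the equation $\frac{1}{r^2|\partial\Omega_r|}=\Lambda$; one has $r_{\Lambda_\infty}=r^*$, and the map $\mathcal R:\Lambda\mapsto r_\Lambda$ is monotone decreasing from $[\Lambda_\infty,+\infty)$ to $(0,r^*]$. The cut locus $\Sigma$ of $\Omega$ is the closure of the set of points where $\mathrm{dist}(\cdot,\partial\Omega)$ is not differentiable. The singular radius of $\Omega$ is $r_{sing}:=\mathrm{dist}(\Sigma,\partial\Omega)$, and $\Lambda_{sing}:=\mathcal R^{-1}(r_{sing})$. The radius $r_{sing}$ may be smaller or larger than $r^*$ depending on $\Omega$ (and consequently $\Lambda_{sing}$ may be larger or smaller than $\Lambda_\infty$). *)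

theory Defs
  imports "HOL-Analysis.Analysis" "HOL-Probability.Essential_Supremum"
begin

subsection \<open>The Sobolev space of order one with exponent infinity\<close>

primrec Ck :: "nat \<Rightarrow> ('a::euclidean_space \<Rightarrow> real) \<Rightarrow> bool" where
  "Ck 0 \<phi> \<longleftrightarrow> continuous_on UNIV \<phi>"
| "Ck (Suc k) \<phi> \<longleftrightarrow> \<phi> differentiable_on UNIV \<and>
     (\<forall>b\<in>Basis. Ck k (\<lambda>x. frechet_derivative \<phi> (at x) b))"

definition test_functions :: "'a::euclidean_space set \<Rightarrow> ('a \<Rightarrow> real) set" where
  "test_functions \<Omega> = {\<phi>. (\<forall>k. Ck k \<phi>) \<and>
     compact (closure {x. \<phi> x \<noteq> 0}) \<and> closure {x. \<phi> x \<noteq> 0} \<subseteq> \<Omega>}"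

definition Linf :: "'a::euclidean_space set \<Rightarrow> ('a \<Rightarrow> 'b::euclidean_space) set" where
  "Linf \<Omega> = {g. g \<in> borel_measurable (lebesgue_on \<Omega>) \<and>
     (\<exists>C. AE x in lebesgue_on \<Omega>. norm (g x) \<le> C)}"

definition Linf_norm :: "'a::euclidean_space set \<Rightarrow> ('a \<Rightarrow> 'b::euclidean_space) \<Rightarrow> real" where
  "Linf_norm \<Omega> g = real_of_ereal (esssup (lebesgue_on \<Omega>) (\<lambda>x. ereal (norm (g x))))"

definition has_weak_gradient ::
    "'a::euclidean_space set \<Rightarrow> ('a \<Rightarrow> real) \<Rightarrow> ('a \<Rightarrow> 'a) \<Rightarrow> bool" where
  "has_weak_gradient \<Omega> u g \<longleftrightarrow> (\<forall>\<phi>\<in>test_functions \<Omega>. \<forall>b\<in>Basis.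
     (LINT x|lebesgue_on \<Omega>. u x * frechet_derivative \<phi> (at x) b) =
     - (LINT x|lebesgue_on \<Omega>. (g x \<bullet> b) * \<phi> x))"

definition W1inf :: "'a::euclidean_space set \<Rightarrow> ('a \<Rightarrow> real) set" where
  "W1inf \<Omega> = {u \<in> Linf \<Omega>. \<exists>g\<in>Linf \<Omega>. has_weak_gradient \<Omega> u g}"

text \<open>The weak gradient is unique up to null sets, so its norm does not depend on the
  representative that is chosen here.\<close>

definition weak_gradient :: "'a::euclidean_space set \<Rightarrow> ('a \<Rightarrow> real) \<Rightarrow> 'a \<Rightarrow> 'a" where
  "weak_gradient \<Omega> u = (SOME g. g \<in> Linf \<Omega> \<and> has_weak_gradient \<Omega> u g)"

subsection \<open>The minimization problem\<close>

text \<open>Elements of \<open>Lip1 \<Omega>\<close> are functions on the closure of \<open>\<Omega>\<close>: their values elsewhere are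
  irrelevant, and two of them are identified when they agree on the closure.\<close>

definition Lip1 :: "'a::euclidean_space set \<Rightarrow> ('a \<Rightarrow> real) set" where
  "Lip1 \<Omega> = {u \<in> W1inf \<Omega>. continuous_on (closure \<Omega>) u \<and>
     (\<forall>x\<in>\<Omega>. 0 \<le> u x) \<and> (\<forall>x\<in>frontier \<Omega>. u x = 1)}"

definition J :: "'a::euclidean_space set \<Rightarrow> real \<Rightarrow> ('a \<Rightarrow> real) \<Rightarrow> real" where
  "J \<Omega> \<Lambda> u = Linf_norm \<Omega> (weak_gradient \<Omega> u) + \<Lambda> * measure lebesgue {x\<in>\<Omega>. u x > 0}"

definition solution :: "'a::euclidean_space set \<Rightarrow> real \<Rightarrow> ('a \<Rightarrow> real) \<Rightarrow> bool" where
  "solution \<Omega> \<Lambda> u \<longleftrightarrow> is_arg_min (J \<Omega> \<Lambda>) (\<lambda>w. w \<in> Lip1 \<Omega>) u"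

definition unique_solution :: "'a::euclidean_space set \<Rightarrow> real \<Rightarrow> ('a \<Rightarrow> real) \<Rightarrow> bool" where
  "unique_solution \<Omega> \<Lambda> u \<longleftrightarrow> solution \<Omega> \<Lambda> u \<and>
     (\<forall>w. solution \<Omega> \<Lambda> w \<longrightarrow> (\<forall>x\<in>closure \<Omega>. w x = u x))"

definition Lambda_inf :: "'a::euclidean_space set \<Rightarrow> real" where
  "Lambda_inf \<Omega> = Inf {\<Lambda>. 0 < \<Lambda> \<and> (\<exists>u. solution \<Omega> \<Lambda> u \<and> \<not> u constant_on closure \<Omega>)}"

subsection \<open>Hausdorff measure\<close>

text \<open>The weight \<open>unit_ball_vol s * (diameter / 2) ^ s\<close> is the normalization for which the
  \<open>s\<close>-dimensional measure is the usual surface area. The case distinction on the empty set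
  only matters for \<open>s = 0\<close>, where it yields the counting measure.\<close>

definition hausdorff_content ::
    "nat \<Rightarrow> real \<Rightarrow> 'a::euclidean_space set \<Rightarrow> ennreal" where
  "hausdorff_content s \<delta> A =
     (INF U \<in> {U :: nat \<Rightarrow> 'a set. A \<subseteq> (\<Union>i. U i) \<and> (\<forall>i. bounded (U i) \<and> diameter (U i) \<le> \<delta>)}.
        \<Sum>i. if U i = {} then 0 else ennreal (unit_ball_vol (real s) * (diameter (U i) / 2) ^ s))"

definition hausdorff_measure :: "nat \<Rightarrow> 'a::euclidean_space set \<Rightarrow> ennreal" where
  "hausdorff_measure s A = (SUP \<delta>\<in>{0<..}. hausdorff_content s \<delta> A)"

definition perimeter :: "'a::euclidean_space set \<Rightarrow> real" where
  "perimeter A = enn2real (hausdorff_measure (DIM('a) - 1) (frontier A))"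

subsection \<open>Parallel sets and the associated radii\<close>

definition bdist :: "'a::euclidean_space set \<Rightarrow> 'a \<Rightarrow> real" where
  "bdist \<Omega> x = infdist x (frontier \<Omega>)"

definition inradius :: "'a::euclidean_space set \<Rightarrow> real" where
  "inradius \<Omega> = Sup {r. \<exists>x. ball x r \<subseteq> \<Omega>}"

definition inner_parallel :: "'a::euclidean_space set \<Rightarrow> real \<Rightarrow> 'a set" where
  "inner_parallel \<Omega> r = {x\<in>\<Omega>. bdist \<Omega> x > r}"

definition v :: "'a::euclidean_space set \<Rightarrow> real \<Rightarrow> 'a \<Rightarrow> real" where
  "v \<Omega> r x = max 0 (1 - bdist \<Omega> x / r)"

definition r_star :: "'a::euclidean_space set \<Rightarrow> real" where
  "r_star \<Omega> = (THE r. 0 < r \<and> r < inradius \<Omega> \<and>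
     perimeter (inner_parallel \<Omega> r) / measure lebesgue (inner_parallel \<Omega> r) = 1 / r)"

text \<open>Meaningful for \<open>\<Lambda> \<ge> Lambda_inf \<Omega>\<close>.\<close>

definition r_Lambda :: "'a::euclidean_space set \<Rightarrow> real \<Rightarrow> real" where
  "r_Lambda \<Omega> \<Lambda> = (LEAST r. 0 < r \<and> r < inradius \<Omega> \<and>
     1 / (r\<^sup>2 * perimeter (inner_parallel \<Omega> r)) = \<Lambda>)"

definition cut_locus :: "'a::euclidean_space set \<Rightarrow> 'a set" where
  "cut_locus \<Omega> = closure {x\<in>\<Omega>. \<not> bdist \<Omega> differentiable (at x)}"

definition r_sing :: "'a::euclidean_space set \<Rightarrow> real" where
  "r_sing \<Omega> = setdist (cut_locus \<Omega>) (frontier \<Omega>)"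

text \<open>\<open>L\<close> is the image of \<open>r_sing \<Omega>\<close> under the inverse of the decreasing map \<open>r_Lambda \<Omega>\<close>,
  which takes \<open>{Lambda_inf \<Omega>..}\<close> onto \<open>{0<..r_star \<Omega>}\<close>. Outside that range the inverse is
  extended monotonically. At radius \<open>0\<close> (for example if \<open>\<Omega>\<close> is a polygon) its value is
  infinite. Beyond \<open>r_star \<Omega>\<close> there is no canonical value: the formula
  \<open>1 / (r\<^sup>2 * perimeter (inner_parallel \<Omega> r))\<close> need not decrease there. The predicate therefore
  accepts every value that does not exceed \<open>Lambda_inf \<Omega>\<close>.\<close>

definition is_Lambda_sing :: "'a::euclidean_space set \<Rightarrow> ereal \<Rightarrow> bool" where
  "is_Lambda_sing \<Omega> L \<longleftrightarrow>
     (r_sing \<Omega> = 0 \<longrightarrow> L = \<infinity>) \<and>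
     (0 < r_sing \<Omega> \<and> r_sing \<Omega> \<le> r_star \<Omega> \<longrightarrow>
        (\<exists>\<Lambda>\<ge>Lambda_inf \<Omega>. L = ereal \<Lambda> \<and> r_Lambda \<Omega> \<Lambda> = r_sing \<Omega>)) \<and>
     (r_star \<Omega> < r_sing \<Omega> \<longrightarrow> L \<le> ereal (Lambda_inf \<Omega>))"

end

theory Submission
  imports Defs "HOL-Probability.Probability"
begin

text \<open>
  Write \<open>d\<close> for the distance to the boundary, \<open>K r = {d \<ge> r}\<close> and \<open>V r\<close> for the volume of
  \<open>K r\<close>. An admissible \<open>u\<close> whose gradient has norm \<open>1/r\<close> is \<open>1/r\<close>-Lipschitz because the domain is
  convex, so \<open>u \<ge> v r\<close>, and its energy exceeds that of the constant \<open>1\<close> by at least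
  \<open>1/r - \<Lambda> * V r\<close>, with equality for \<open>v r\<close>. This leaves a minimization in the single variable \<open>r\<close>.
  By Brunn--Minkowski \<open>V\<close> is log-concave, and its derivative is minus the perimeter of the
  parallel set. Hence the minimum is positive for \<open>\<Lambda>\<close> below \<open>1/(r* V r*)\<close>, zero at this value, and
  above it is negative and attained only at \<open>r = r_Lambda\<close>.

  In the last case every minimizer vanishes on \<open>K r\<close> and is \<open>1/r\<close>-Lipschitz, so it lies between
  \<open>v r\<close> and \<open>w r = min 1 (dist(\<cdot>, K r)/r)\<close>, which is a minimizer itself. Uniqueness therefore means
  that \<open>dist(x, K r) = r - d x\<close> whenever \<open>d x < r\<close>. If this holds, then a point of \<open>K r\<close> nearest to
  \<open>x\<close> and a boundary point nearest to \<open>x\<close> yield smooth functions that enclose \<open>d\<close> and touch it at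
  \<open>x\<close>, so there is no cut point at depth less than \<open>r\<close>. Conversely, if \<open>d\<close> is differentiable at
  the point \<open>p\<close> of \<open>K r\<close> nearest to \<open>x\<close>, then the normal cone of \<open>K r\<close> at \<open>p\<close> is a single ray, and it
  leads from \<open>p\<close> through \<open>x\<close> to the boundary point nearest to \<open>p\<close>.
\<close>

subsection \<open>The Brunn--Minkowski inequality\<close>

text \<open>The perimeter is a Hausdorff measure, and only one relation to volume is extracted from
  it: at each radius the line of slope \<open>- P r\<close> supports \<open>V\<close> from below.
  This comes from polyhedra squeezed between parallel bodies. Facets are flat, and for flat sets the
  volume of a prism stands in for lower-dimensional measure; nearest-point projection carries the
  bounds back to the convex bodies. Supporting lines from below and log-concavity from above leave
  \<open>V\<close> no choice but to be differentiable. Brunn--Minkowski thus serves three times: in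
  the isodiametric estimate behind the lower bound for surfaces, for the regularity of
  \<open>V\<close>, and for the monotonicity of \<open>P / V\<close>.

  The second obstacle is the Sobolev class: a competitor needs a weak gradient before its energy can
  be estimated. Rademacher's theorem is avoided, because limits of coordinate difference quotients
  exist at every point of the domain: \<open>v\<close> is convex since \<open>d\<close> is concave,
  and \<open>w\<close> is a difference of two convex functions since \<open>K r\<close> is convex.
  Conversely, a bound on the weak gradient becomes a Lipschitz bound by carrying a bump function
  along a segment.\<close>

definition mix :: "real \<Rightarrow> 'a::real_vector set \<Rightarrow> 'a set \<Rightarrow> 'a set" where
  "mix t A B = {t *\<^sub>R x + (1 - t) *\<^sub>R y | x y. x \<in> A \<and> y \<in> B}"

lemma mixI: "x \<in> A \<Longrightarrow> y \<in> B \<Longrightarrow> t *\<^sub>R x + (1 - t) *\<^sub>R y \<in> mix t A B"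
  by (auto simp: mix_def)

lemma mix_commute: "mix t A B = mix (1 - t) B A"
  by (auto simp: mix_def add.commute)

lemma mix_mono: "A \<subseteq> A' \<Longrightarrow> B \<subseteq> B' \<Longrightarrow> mix t A B \<subseteq> mix t A' B'"
  by (auto simp: mix_def)

lemma mix_eq_image: "mix t A B = (\<lambda>p. t *\<^sub>R fst p + (1 - t) *\<^sub>R snd p) ` (A \<times> B)"
  by (force simp: mix_def)

lemma compact_mix:
  fixes A B :: "'a::real_normed_vector set"
  assumes "compact A" "compact B" shows "compact (mix t A B)"
  unfolding mix_eq_image
  by (intro compact_continuous_image compact_Times assms continuous_intros)

lemma bounded_mix:
  fixes A B :: "'a::euclidean_space set"
  assumes "bounded A" "bounded B" shows "bounded (mix t A B)"
proof -
  have "mix t A B \<subseteq> mix t (closure A) (closure B)"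
    by (intro mix_mono closure_subset)
  moreover have "compact (mix t (closure A) (closure B))"
    using assms by (intro compact_mix) auto
  ultimately show ?thesis
    using bounded_subset compact_imp_bounded by blast
qed

lemma open_mix:
  fixes A B :: "'a::real_normed_vector set"
  assumes "open A" "t \<noteq> 0" shows "open (mix t A B)"
proof -
  have "mix t A B = (\<Union>y\<in>B. (+) ((1 - t) *\<^sub>R y) ` ((\<lambda>x. t *\<^sub>R x) ` A))"
    by (auto simp: mix_def image_iff add.commute)
  then show ?thesis
    using assms by (auto intro!: open_translation open_scaling)
qed

text \<open>A point of the mixed box has a relative position \<open>s i\<close> between the
  endpoints in each coordinate \<open>i\<close>; the points of the two given boxes with these same
  relative positions combine to it.\<close>

lemma box_subset_mix:
  fixes a b c d :: "'a::euclidean_space"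
  assumes t: "0 < t" "t < 1" and ne: "box a b \<noteq> {}" "box c d \<noteq> {}"
  shows "box (t *\<^sub>R a + (1 - t) *\<^sub>R c) (t *\<^sub>R b + (1 - t) *\<^sub>R d) \<subseteq> mix t (box a b) (box c d)"
proof
  fix z assume z: "z \<in> box (t *\<^sub>R a + (1 - t) *\<^sub>R c) (t *\<^sub>R b + (1 - t) *\<^sub>R d)"
  define s where "s i = (z \<bullet> i - (t * (a \<bullet> i) + (1 - t) * (c \<bullet> i))) /
      (t * (b \<bullet> i - a \<bullet> i) + (1 - t) * (d \<bullet> i - c \<bullet> i))" for i
  define x where "x = (\<Sum>i\<in>Basis. (a \<bullet> i + s i * (b \<bullet> i - a \<bullet> i)) *\<^sub>R i)"
  define y where "y = (\<Sum>i\<in>Basis. (c \<bullet> i + s i * (d \<bullet> i - c \<bullet> i)) *\<^sub>R i)"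
  have lt: "a \<bullet> i < b \<bullet> i" "c \<bullet> i < d \<bullet> i" if "i \<in> Basis" for i
    using ne that by (auto simp: box_ne_empty)
  have pos: "0 < t * (b \<bullet> i - a \<bullet> i) + (1 - t) * (d \<bullet> i - c \<bullet> i)" if "i \<in> Basis" for i
    using lt[OF that] t by (intro add_pos_pos mult_pos_pos) auto
  have s: "0 < s i" "s i < 1" if "i \<in> Basis" for i
    using z pos[OF that] that unfolding s_def mem_box
    by (auto simp: inner_add_left divide_simps algebra_simps)
  have "x \<in> box a b" unfolding x_def mem_box
  proof safe
    fix i :: 'a assume i: "i \<in> Basis"
    have "s i * (b \<bullet> i - a \<bullet> i) < 1 * (b \<bullet> i - a \<bullet> i)"
      using lt[OF i] s[OF i] by (intro mult_strict_right_mono) auto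
    moreover have "0 < s i * (b \<bullet> i - a \<bullet> i)" using lt[OF i] s[OF i] by simp
    ultimately show "a \<bullet> i < (\<Sum>i\<in>Basis. (a \<bullet> i + s i * (b \<bullet> i - a \<bullet> i)) *\<^sub>R i) \<bullet> i"
      "(\<Sum>i\<in>Basis. (a \<bullet> i + s i * (b \<bullet> i - a \<bullet> i)) *\<^sub>R i) \<bullet> i < b \<bullet> i"
      using i by auto
  qed
  moreover have "y \<in> box c d" unfolding y_def mem_box
  proof safe
    fix i :: 'a assume i: "i \<in> Basis"
    have "s i * (d \<bullet> i - c \<bullet> i) < 1 * (d \<bullet> i - c \<bullet> i)"
      using lt[OF i] s[OF i] by (intro mult_strict_right_mono) auto
    moreover have "0 < s i * (d \<bullet> i - c \<bullet> i)" using lt[OF i] s[OF i] by simp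
    ultimately show "c \<bullet> i < (\<Sum>i\<in>Basis. (c \<bullet> i + s i * (d \<bullet> i - c \<bullet> i)) *\<^sub>R i) \<bullet> i"
      "(\<Sum>i\<in>Basis. (c \<bullet> i + s i * (d \<bullet> i - c \<bullet> i)) *\<^sub>R i) \<bullet> i < d \<bullet> i"
      using i by auto
  qed
  moreover have "z = t *\<^sub>R x + (1 - t) *\<^sub>R y"
  proof (rule euclidean_eqI)
    fix i :: 'a assume i: "i \<in> Basis"
    have "(t *\<^sub>R x + (1 - t) *\<^sub>R y) \<bullet> i = t * (a \<bullet> i) + (1 - t) * (c \<bullet> i) +
        s i * (t * (b \<bullet> i - a \<bullet> i) + (1 - t) * (d \<bullet> i - c \<bullet> i))"
      using i by (simp add: x_def y_def inner_add_left del: scaleR_left.add scaleR_left.diff) (simp add: algebra_simps)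
    also have "\<dots> = z \<bullet> i" using pos[OF i] by (simp add: s_def)
    finally show "z \<bullet> i = (t *\<^sub>R x + (1 - t) *\<^sub>R y) \<bullet> i" ..
  qed
  ultimately show "z \<in> mix t (box a b) (box c d)" by (auto simp: mix_def)
qed

text \<open>Volumes of boxes are products of edge lengths and the edges of the mixed box are
  weighted means, so weighted AM-GM in each coordinate suffices. The multiplicative form with
  exponents \<open>t\<close> and \<open>1 - t\<close> is the one that yields log-concavity
  later.\<close>

lemma box_Brunn_Minkowski:
  fixes a b c d :: "'a::euclidean_space"
  assumes t: "0 < t" "t < 1" and ne: "box a b \<noteq> {}" "box c d \<noteq> {}"
  shows "measure lebesgue (box a b) powr t * measure lebesgue (box c d) powr (1 - t)
    \<le> measure lebesgue (mix t (box a b) (box c d))"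
proof -
  have lt: "a \<bullet> i < b \<bullet> i" "c \<bullet> i < d \<bullet> i" if "i \<in> Basis" for i
    using ne that by (auto simp: box_ne_empty)
  have vol: "measure lebesgue (box p q) = (\<Prod>i\<in>Basis. q \<bullet> i - p \<bullet> i)"
    if "\<And>i. i \<in> Basis \<Longrightarrow> p \<bullet> i < q \<bullet> i" for p q :: 'a
    using that by (simp add: less_imp_le inner_diff_left)
  have "measure lebesgue (box a b) powr t * measure lebesgue (box c d) powr (1 - t)
     = (\<Prod>i\<in>Basis. (b \<bullet> i - a \<bullet> i) powr t * (d \<bullet> i - c \<bullet> i) powr (1 - t))"
    using lt by (simp add: vol prod_powr_distrib less_imp_le prod.distrib inner_diff_left)
  also have "\<dots> \<le> (\<Prod>i\<in>Basis. t * (b \<bullet> i - a \<bullet> i) + (1 - t) * (d \<bullet> i - c \<bullet> i))"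
    using lt t by (intro prod_mono conjI Youngs_inequality_0) (auto simp: less_imp_le)
  also have "\<dots> = measure lebesgue (box (t *\<^sub>R a + (1 - t) *\<^sub>R c) (t *\<^sub>R b + (1 - t) *\<^sub>R d))"
  proof (subst vol)
    fix i :: 'a assume i: "i \<in> Basis"
    have "t * (a \<bullet> i) + (1 - t) * (c \<bullet> i) < t * (b \<bullet> i) + (1 - t) * (d \<bullet> i)"
      using lt[OF i] t by (intro add_strict_mono mult_strict_left_mono) auto
    then show "(t *\<^sub>R a + (1 - t) *\<^sub>R c) \<bullet> i < (t *\<^sub>R b + (1 - t) *\<^sub>R d) \<bullet> i"
      by (simp add: inner_add_left)
  qed (auto simp: inner_add_left algebra_simps)
  also have "\<dots> \<le> measure lebesgue (mix t (box a b) (box c d))"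
    using t by (intro measure_mono_fmeasurable box_subset_mix t ne lmeasurable_open bounded_mix
        open_mix) auto
  finally show ?thesis .
qed

text \<open>The volume of \<open>E\<close> below a height is the distribution function of a
  push-forward measure on the line. It is continuous because hyperplanes are null, and it runs from
  0 to the full volume, so the intermediate value theorem gives the cut.\<close>

lemma exists_hyperplane_split:
  fixes E :: "'a::euclidean_space set"
  assumes E: "E \<in> lmeasurable" "E \<in> sets borel" and i: "i \<in> Basis" and \<rho>: "0 < \<rho>" "\<rho> < 1"
    and pos: "0 < measure lebesgue E"
  shows "\<exists>\<tau>. measure lebesgue (E \<inter> {x. x \<bullet> i < \<tau>}) = \<rho> * measure lebesgue E"
proof -
  let ?M = "distr (restrict_space lborel E) borel (\<lambda>x. x \<bullet> i)"
  have [measurable]: "(\<lambda>x. x \<bullet> i) \<in> borel_measurable (restrict_space lborel E)"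
    by (intro measurable_restrict_space1) auto
  have fin: "emeasure lborel E < \<infinity>"
    using E by (simp add: fmeasurable_def)
  interpret finite_borel_measure ?M
  proof (intro finite_borel_measure.intro finite_measureI finite_borel_measure_axioms.intro)
    show "emeasure ?M (space ?M) \<noteq> \<infinity>"
      using fin E by (subst emeasure_distr) (auto simp: emeasure_restrict_space space_restrict_space)
  qed auto
  have null: "E \<inter> {x. x \<bullet> i = \<tau>} \<in> null_sets lebesgue" for \<tau>
  proof -
    have "negligible {x. i \<bullet> x = \<tau>}" using i by (intro negligible_hyperplane) auto
    then show ?thesis
      by (metis (no_types, lifting) Collect_cong inf_le2 inner_commute negligible_iff_null_sets negligible_subset)
  qed
  have m: "measure ?M T = measure lebesgue (E \<inter> {x. x \<bullet> i \<in> T})" if T: "T \<in> sets borel" for T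
  proof -
    have "(\<lambda>x. x \<bullet> i) -` T \<inter> space borel \<in> sets borel"
      by (rule measurable_sets[OF _ T]) measurable
    then have B: "E \<inter> {x. x \<bullet> i \<in> T} \<in> sets borel"
      using E(2) by (auto simp: vimage_def)
    have "measure ?M T = measure (restrict_space lborel E) ((\<lambda>x. x \<bullet> i) -` T \<inter> E)"
      using T E by (subst measure_distr) (simp_all add: space_restrict_space)
    also have "\<dots> = measure lborel ((\<lambda>x. x \<bullet> i) -` T \<inter> E)"
      using E by (intro measure_restrict_space) auto
    also have "(\<lambda>x. x \<bullet> i) -` T \<inter> E = E \<inter> {x. x \<bullet> i \<in> T}" by auto
    also have "measure lborel \<dots> = measure lebesgue \<dots>"
      using B by (simp add: measure_completion)
    finally show ?thesis .
  qed
  have "isCont (cdf ?M) \<tau>" for \<tau>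
  proof (subst isCont_cdf)
    show "measure ?M {\<tau>} = 0" using null[of \<tau>] by (simp add: m measure_eq_0_null_sets)
  qed
  moreover have UN: "measure ?M (space ?M) = measure lebesgue E"
    by (simp add: m)
  have "eventually (\<lambda>\<tau>. cdf ?M \<tau> < \<rho> * measure lebesgue E) at_bot"
    using order_tendstoD(2)[OF cdf_lim_at_bot] \<rho> pos by simp
  then obtain l where l: "\<And>x. x \<le> l \<Longrightarrow> cdf ?M x < \<rho> * measure lebesgue E"
    by (auto simp: eventually_at_bot_linorder)
  have "eventually (\<lambda>\<tau>. cdf ?M \<tau> > \<rho> * measure lebesgue E) at_top"
    using order_tendstoD(1)[OF cdf_lim_at_top] \<rho> pos UN by simp
  then obtain u where u: "\<And>x. x \<ge> u \<Longrightarrow> cdf ?M x > \<rho> * measure lebesgue E"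
    by (auto simp: eventually_at_top_linorder)
  have "l \<le> u" using l u by (metis less_asym linear)
  ultimately obtain \<tau> where \<tau>: "cdf ?M \<tau> = \<rho> * measure lebesgue E"
    using IVT'[of "cdf ?M" l "\<rho> * measure lebesgue E" u] l[of l] u[of u]
    by (auto intro!: continuous_at_imp_continuous_on less_imp_le)
  have "measure lebesgue (E \<inter> {x. x \<bullet> i \<le> \<tau>}) = measure lebesgue (E \<inter> {x. x \<bullet> i < \<tau>})"
  proof -
    have "E \<inter> {x. x \<bullet> i \<le> \<tau>} = (E \<inter> {x. x \<bullet> i < \<tau>}) \<union> (E \<inter> {x. x \<bullet> i = \<tau>})" by auto
    then show ?thesis using null[of \<tau>] E
      by (simp add: measure_Un_null_set)
  qed
  with \<tau> m show ?thesis by (auto simp: cdf_def)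
qed

text \<open>The boxes are open because an open half-space cuts them into open boxes again; only a
  null set on the cutting hyperplane is lost.\<close>

definition box_family :: "'a::euclidean_space set set \<Rightarrow> bool" where
  "box_family D \<longleftrightarrow> finite D \<and> pairwise disjnt D \<and> (\<forall>X\<in>D. X \<noteq> {} \<and> (\<exists>a b. X = box a b))"

lemma box_Int_halfspace:
  fixes a b :: "'a::euclidean_space"
  assumes i: "i \<in> Basis"
  shows "\<exists>a' b'. box a b \<inter> {x. x \<bullet> i < c} = box a' b'" "\<exists>a' b'. box a b \<inter> {x. x \<bullet> i > c} = box a' b'"
proof -
  have "x \<in> box a b \<inter> {x. x \<bullet> i < c} \<longleftrightarrow> x \<in> box a (\<Sum>j\<in>Basis. (if j = i then min (b \<bullet> i) c else b \<bullet> j) *\<^sub>R j)"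
    for x
    using i by (simp add: mem_box) (metis (mono_tags, lifting) min_less_iff_conj)
  then show "\<exists>a' b'. box a b \<inter> {x. x \<bullet> i < c} = box a' b'" by blast
  have "x \<in> box a b \<inter> {x. x \<bullet> i > c} \<longleftrightarrow> x \<in> box (\<Sum>j\<in>Basis. (if j = i then max (a \<bullet> i) c else a \<bullet> j) *\<^sub>R j) b"
    for x
    using i by (simp add: mem_box) (metis (mono_tags, lifting) max_less_iff_conj)
  then show "\<exists>a' b'. box a b \<inter> {x. x \<bullet> i > c} = box a' b'" by blast
qed

text \<open>A box that \<open>H\<close> misses leaves the family. The strict decrease of the count
  in the last claim is what the induction on the number of boxes lives on.\<close>

lemma box_family_restrict:
  assumes D: "box_family D" and H: "\<And>a b. \<exists>a' b'. box a b \<inter> H = box a' b'"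
  shows "box_family ((\<lambda>X. X \<inter> H) ` D - {{}})" "card ((\<lambda>X. X \<inter> H) ` D - {{}}) \<le> card D"
    "\<Union>((\<lambda>X. X \<inter> H) ` D - {{}}) = \<Union>D \<inter> H"
    "X0 \<in> D \<Longrightarrow> X0 \<inter> H = {} \<Longrightarrow> card ((\<lambda>X. X \<inter> H) ` D - {{}}) < card D"
proof -
  have fin: "finite D" using D by (simp add: box_family_def)
  show "box_family ((\<lambda>X. X \<inter> H) ` D - {{}})"
    unfolding box_family_def
  proof (intro conjI ballI)
    show "finite ((\<lambda>X. X \<inter> H) ` D - {{}})" using fin by simp
    have "pairwise disjnt ((\<lambda>X. X \<inter> H) ` D)"
      using D unfolding box_family_def pairwise_def disjnt_def by (auto simp: disjoint_iff)
    then show "pairwise disjnt ((\<lambda>X. X \<inter> H) ` D - {{}})" by (rule pairwise_subset) auto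
    fix X assume "X \<in> (\<lambda>X. X \<inter> H) ` D - {{}}"
    then show "X \<noteq> {}" "\<exists>a b. X = box a b" using D H by (auto simp: box_family_def)
  qed
  show "card ((\<lambda>X. X \<inter> H) ` D - {{}}) \<le> card D"
    using fin by (meson card_Diff1_le card_image_le le_trans)
  show "\<Union>((\<lambda>X. X \<inter> H) ` D - {{}}) = \<Union>D \<inter> H" by auto
  assume X0: "X0 \<in> D" "X0 \<inter> H = {}"
  then have "(\<lambda>X. X \<inter> H) ` D - {{}} \<subseteq> (\<lambda>X. X \<inter> H) ` (D - {X0})" by auto
  then have "card ((\<lambda>X. X \<inter> H) ` D - {{}}) \<le> card (D - {X0})"
    by (meson card_image_le card_mono fin finite_Diff finite_imageI le_trans)
  also have "\<dots> < card D" using X0 fin by (metis card_Diff1_less)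
  finally show "card ((\<lambda>X. X \<inter> H) ` D - {{}}) < card D" .
qed

lemma open_box_family: "box_family D \<Longrightarrow> open (\<Union>D)"
  by (force simp: box_family_def)

lemma bounded_box_family: "box_family D \<Longrightarrow> bounded (\<Union>D)"
  by (intro bounded_Union) (auto simp: box_family_def)

lemma box_family_measure_pos:
  assumes "box_family D" "D \<noteq> {}" shows "0 < measure lebesgue (\<Union>D)"
proof -
  have "\<not> negligible (\<Union>D)"
    using assms open_box_family[OF assms(1)] by (intro open_not_negligible) (auto simp: box_family_def)
  then show ?thesis
    using assms lmeasurable_open[OF bounded_box_family open_box_family]
    by (metis negligible_iff_measure measure_nonneg order_le_less)
qed

lemma measure_disjoint_Un:
  assumes "A \<in> fmeasurable M" "B \<in> fmeasurable M" "A \<inter> B = {}"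
  shows "measure M (A \<union> B) = measure M A + measure M B"
proof -
  have "B - A = B" using assms(3) by auto
  then show ?thesis using measure_Un2[OF assms(1,2)] by simp
qed

lemma measure_hyperplane_split:
  fixes D :: "'a::euclidean_space set"
  assumes "D \<in> lmeasurable" and i: "i \<in> Basis"
  shows "measure lebesgue D = measure lebesgue (D \<inter> {x. x \<bullet> i < c}) + measure lebesgue (D \<inter> {x. x \<bullet> i > c})"
proof -
  have "negligible {x. i \<bullet> x = c}" using i by (intro negligible_hyperplane) auto
  then have n: "{x. x \<bullet> i = c} \<in> null_sets lebesgue"
    by (simp add: inner_commute negligible_iff_null_sets)
  have m: "{x. x \<bullet> i < c} \<in> sets lebesgue" "{x. x \<bullet> i > c} \<in> sets lebesgue"
    by (auto intro!: sets_completionI_sets)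
  have [simp]: "D \<inter> {x. x \<bullet> i < c} \<in> lmeasurable" "D \<inter> {x. x \<bullet> i > c} \<in> lmeasurable"
    using assms m by (auto intro: fmeasurable_Int_fmeasurable)
  have "measure lebesgue (D \<inter> {x. x \<bullet> i < c}) + measure lebesgue (D \<inter> {x. x \<bullet> i > c})
      = measure lebesgue (D \<inter> {x. x \<bullet> i < c} \<union> D \<inter> {x. x \<bullet> i > c})"
    by (rule measure_disjoint_Un[symmetric]) auto
  also have "\<dots> = measure lebesgue (D \<inter> {x. x \<bullet> i < c} \<union> D \<inter> {x. x \<bullet> i > c} \<union> {x. x \<bullet> i = c})"
    using n by (intro measure_Un_null_set[symmetric] sets.Un fmeasurableD) auto
  also have "\<dots> = measure lebesgue (D \<union> {x. x \<bullet> i = c})"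
    by (intro arg_cong[where f="measure lebesgue"]) auto
  also have "\<dots> = measure lebesgue D" using n assms by (subst measure_Un_null_set) auto
  finally show ?thesis ..
qed

text \<open>The Hadwiger--Ohmann argument: a hyperplane separates two boxes of the first family, and a
  parallel one cuts the second union in the same ratio.\<close>

lemma Brunn_Minkowski_step:
  fixes D E :: "'a::euclidean_space set set"
  assumes t: "0 < t" "t < 1" and D: "box_family D" "card D \<ge> 2" and E: "box_family E" "E \<noteq> {}"
    and IH: "\<And>D' E' :: 'a set set. \<lbrakk>box_family D'; box_family E'; D' \<noteq> {}; E' \<noteq> {}; card D' + card E' < card D + card E\<rbrakk>
      \<Longrightarrow> measure lebesgue (\<Union>D') powr t * measure lebesgue (\<Union>E') powr (1 - t)
           \<le> measure lebesgue (mix t (\<Union>D') (\<Union>E'))"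
  shows "measure lebesgue (\<Union>D) powr t * measure lebesgue (\<Union>E) powr (1 - t)
           \<le> measure lebesgue (mix t (\<Union>D) (\<Union>E))"
proof -
  let ?\<mu> = "measure lebesgue :: 'a set \<Rightarrow> real"
  obtain X Y where XY: "X \<in> D" "Y \<in> D" "X \<noteq> Y"
  proof -
    have "finite D" "\<not> card D \<le> Suc 0" using D by (auto simp: box_family_def)
    then show ?thesis using that by (auto simp: card_le_Suc0_iff_eq)
  qed
  obtain a b c d where abcd: "X = box a b" "Y = box c d" "box a b \<noteq> {}" "box c d \<noteq> {}"
  proof -
    have "\<exists>a b. X = box a b" "\<exists>c d. Y = box c d" "X \<noteq> {}" "Y \<noteq> {}"
      using XY D(1) by (auto simp: box_family_def)
    then show ?thesis using that by blast
  qed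
  have "box a b \<inter> box c d = {}"
    using XY D(1) abcd unfolding box_family_def pairwise_def disjnt_def by blast
  then obtain i where i: "i \<in> Basis" "b \<bullet> i \<le> a \<bullet> i \<or> d \<bullet> i \<le> c \<bullet> i \<or> b \<bullet> i \<le> c \<bullet> i \<or> d \<bullet> i \<le> a \<bullet> i"
    unfolding disjoint_interval by blast
  then have "b \<bullet> i \<le> c \<bullet> i \<or> d \<bullet> i \<le> a \<bullet> i"
    using abcd(3,4) by (auto simp: box_ne_empty not_le[symmetric])
  then have "\<exists>X\<in>D. \<exists>Y\<in>D. \<exists>e::real. X \<inter> {x. x \<bullet> i > e} = {} \<and> Y \<inter> {x. x \<bullet> i < e} = {}"
  proof
    assume "b \<bullet> i \<le> c \<bullet> i"
    then have "X \<inter> {x. x \<bullet> i > b \<bullet> i} = {} \<and> Y \<inter> {x. x \<bullet> i < b \<bullet> i} = {}"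
      using i(1) abcd by (force simp: mem_box)
    then show ?thesis using XY by blast
  next
    assume "d \<bullet> i \<le> a \<bullet> i"
    then have "Y \<inter> {x. x \<bullet> i > d \<bullet> i} = {} \<and> X \<inter> {x. x \<bullet> i < d \<bullet> i} = {}"
      using i(1) abcd by (force simp: mem_box)
    then show ?thesis using XY by blast
  qed
  then obtain X Y e where e: "X \<in> D" "Y \<in> D" "X \<inter> {x. x \<bullet> i > e} = {}" "Y \<inter> {x. x \<bullet> i < e} = {}"
    by blast
  define Dl where "Dl = (\<lambda>X. X \<inter> {x. x \<bullet> i < e}) ` D - {{}}"
  define Dr where "Dr = (\<lambda>X. X \<inter> {x. x \<bullet> i > e}) ` D - {{}}"
  note Dl = box_family_restrict[OF D(1) box_Int_halfspace(1)[OF i(1), where c="e"], folded Dl_def]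
  note Dr = box_family_restrict[OF D(1) box_Int_halfspace(2)[OF i(1), where c="e"], folded Dr_def]
  have ne: "X \<noteq> {}" "Y \<noteq> {}" using e D(1) by (auto simp: box_family_def)
  have opn: "X \<in> D \<Longrightarrow> open X" for X using D(1) by (auto simp: box_family_def)
  have "\<exists>x\<in>X. x \<bullet> i \<noteq> e" if "X \<in> D" "X \<noteq> {}" for X
  proof (rule ccontr)
    assume "\<not> (\<exists>x\<in>X. x \<bullet> i \<noteq> e)"
    then have "X \<subseteq> {x. i \<bullet> x = e}" by (auto simp: inner_commute)
    moreover have "negligible {x. i \<bullet> x = e}" using i(1) by (intro negligible_hyperplane) auto
    ultimately show False using open_not_negligible[OF opn[OF that(1)] that(2)] negligible_subset
      by blast
  qed
  then have "X \<inter> {x. x \<bullet> i < e} \<noteq> {}" "Y \<inter> {x. x \<bullet> i > e} \<noteq> {}"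
    using e ne by (force simp: neq_iff)+
  then have ne': "Dl \<noteq> {}" "Dr \<noteq> {}" using e(1,2) by (auto simp: Dl_def Dr_def)
  have Dm: "\<Union>D \<in> lmeasurable" "\<Union>E \<in> lmeasurable"
    using lmeasurable_open[OF bounded_box_family open_box_family] D E by auto
  define \<rho> where "\<rho> = ?\<mu> (\<Union>Dl) / ?\<mu> (\<Union>D)"
  have pos: "0 < ?\<mu> (\<Union>Dl)" "0 < ?\<mu> (\<Union>Dr)" "0 < ?\<mu> (\<Union>D)" "0 < ?\<mu> (\<Union>E)"
    using box_family_measure_pos Dl(1) Dr(1) ne' E XY(1) D(1) by blast+
  have split: "?\<mu> (\<Union>D) = ?\<mu> (\<Union>Dl) + ?\<mu> (\<Union>Dr)"
    unfolding Dl(3) Dr(3) by (rule measure_hyperplane_split[OF Dm(1) i(1)])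
  have \<rho>: "0 < \<rho>" "\<rho> < 1" using pos split by (auto simp: \<rho>_def)
  obtain \<tau> where \<tau>: "?\<mu> (\<Union>E \<inter> {x. x \<bullet> i < \<tau>}) = \<rho> * ?\<mu> (\<Union>E)"
    using exists_hyperplane_split[OF Dm(2) _ i(1) \<rho> pos(4)] open_box_family[OF E(1)] by auto
  define El where "El = (\<lambda>X. X \<inter> {x. x \<bullet> i < \<tau>}) ` E - {{}}"
  define Er where "Er = (\<lambda>X. X \<inter> {x. x \<bullet> i > \<tau>}) ` E - {{}}"
  note El = box_family_restrict[OF E(1) box_Int_halfspace(1)[OF i(1), where c="\<tau>"], folded El_def]
  note Er = box_family_restrict[OF E(1) box_Int_halfspace(2)[OF i(1), where c="\<tau>"], folded Er_def]
  have mEl: "?\<mu> (\<Union>El) = \<rho> * ?\<mu> (\<Union>E)" using \<tau> El(3) by simp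
  have mEr: "?\<mu> (\<Union>Er) = (1 - \<rho>) * ?\<mu> (\<Union>E)"
    using measure_hyperplane_split[OF Dm(2) i(1), of \<tau>] \<tau> Er(3) by (simp add: algebra_simps)
  have mDl: "?\<mu> (\<Union>Dl) = \<rho> * ?\<mu> (\<Union>D)" using pos by (simp add: \<rho>_def)
  have mDr: "?\<mu> (\<Union>Dr) = (1 - \<rho>) * ?\<mu> (\<Union>D)" using split mDl by (simp add: algebra_simps)
  have neE: "El \<noteq> {}" "Er \<noteq> {}" using mEl mEr \<rho> pos by auto
  \<comment> \<open>The geometric mean is homogeneous of degree one because the exponents add up to
    1, so the common ratio of the two cuts comes out as a factor.\<close>
  have pw: "(s * p) powr t * (s * q) powr (1 - t) = s * (p powr t * q powr (1 - t))"
    if "0 < s" "0 < p" "0 < q" for s p q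
  proof -
    have "s powr t * s powr (1 - t) = s" using that by (simp add: powr_add[symmetric])
    moreover have "(s * p) powr t * (s * q) powr (1 - t) = (s powr t * s powr (1 - t)) * (p powr t * q powr (1 - t))"
      using that by (simp add: powr_mult)
    ultimately show ?thesis by simp
  qed
  \<comment> \<open>Each half of \<open>D\<close> misses one of the separated boxes, so the total
    count drops even if the cut of \<open>E\<close> loses no box.\<close>
  have l: "\<rho> * (?\<mu> (\<Union>D) powr t * ?\<mu> (\<Union>E) powr (1 - t)) \<le> ?\<mu> (mix t (\<Union>Dl) (\<Union>El))"
    using IH[OF Dl(1) El(1) ne'(1) neE(1)] Dl(4)[OF e(2,4)] El(2) pw[OF \<rho>(1) pos(3,4)] mDl mEl by simp
  have r: "(1 - \<rho>) * (?\<mu> (\<Union>D) powr t * ?\<mu> (\<Union>E) powr (1 - t)) \<le> ?\<mu> (mix t (\<Union>Dr) (\<Union>Er))"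
    using IH[OF Dr(1) Er(1) ne'(2) neE(2)] Dr(4)[OF e(1,3)] Er(2) pw[of "1 - \<rho>", OF _ pos(3,4)] \<rho> mDr mEr
      by simp
  have mm: "mix t (\<Union>D') (\<Union>E') \<in> lmeasurable" if "box_family D'" "box_family E'"
    for D' E' :: "'a set set"
    using that t by (intro lmeasurable_open bounded_mix open_mix bounded_box_family open_box_family) auto
  \<comment> \<open>The mixed halves lie on opposite sides of the hyperplane at the mixed height, so
    they are disjoint; their volumes add and the factors \<rho> and \<open>1 - \<rho>\<close>
    recombine to 1.\<close>
  have sl: "mix t (\<Union>Dl) (\<Union>El) \<subseteq> {x. x \<bullet> i < t * e + (1 - t) * \<tau>}"
    unfolding Dl(3) El(3) using t
      by (auto simp: mix_def inner_add_left intro!: add_strict_mono mult_strict_left_mono)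
  have sr: "mix t (\<Union>Dr) (\<Union>Er) \<subseteq> {x. x \<bullet> i > t * e + (1 - t) * \<tau>}"
    unfolding Dr(3) Er(3) using t
      by (auto simp: mix_def inner_add_left intro!: add_strict_mono mult_strict_left_mono)
  have disj: "mix t (\<Union>Dl) (\<Union>El) \<inter> mix t (\<Union>Dr) (\<Union>Er) = {}"
    using sl sr by fastforce
  have sub: "mix t (\<Union>Dl) (\<Union>El) \<union> mix t (\<Union>Dr) (\<Union>Er) \<subseteq> mix t (\<Union>D) (\<Union>E)"
    unfolding Dl(3) El(3) Dr(3) Er(3) by (intro Un_least mix_mono) auto
  have "?\<mu> (\<Union>D) powr t * ?\<mu> (\<Union>E) powr (1 - t) \<le> ?\<mu> (mix t (\<Union>Dl) (\<Union>El)) + ?\<mu> (mix t (\<Union>Dr) (\<Union>Er))"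
    using l r by (simp add: algebra_simps)
  also have "\<dots> = ?\<mu> (mix t (\<Union>Dl) (\<Union>El) \<union> mix t (\<Union>Dr) (\<Union>Er))"
    using disj mm[OF Dl(1) El(1)] mm[OF Dr(1) Er(1)] by (intro measure_disjoint_Un[symmetric])
  also have "\<dots> \<le> ?\<mu> (mix t (\<Union>D) (\<Union>E))"
    using mm Dl(1) El(1) Dr(1) Er(1) D(1) E(1) by (intro measure_mono_fmeasurable sub) auto
  finally show ?thesis .
qed

text \<open>Induction on the total number of boxes, down to one box on each side. The cutting step
  needs two boxes in its first family; if only \<open>E\<close> has them, the families are exchanged
  together with the weights, which is why \<open>t\<close> is generalized in the induction.\<close>

lemma box_family_Brunn_Minkowski:
  fixes D E :: "'a::euclidean_space set set"
  assumes "0 < t" "t < 1" "box_family D" "box_family E" "D \<noteq> {}" "E \<noteq> {}"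
  shows "measure lebesgue (\<Union>D) powr t * measure lebesgue (\<Union>E) powr (1 - t)
           \<le> measure lebesgue (mix t (\<Union>D) (\<Union>E))"
  using assms
proof (induction "card D + card E" arbitrary: D E t rule: less_induct)
  case less
  have fin: "finite D" "finite E" using less.prems by (auto simp: box_family_def)
  then have "card D \<ge> 1" "card E \<ge> 1" using less.prems by (auto simp: Suc_le_eq card_gt_0_iff)
  then consider "card D \<ge> 2" | "card E \<ge> 2" | "card D = 1" "card E = 1" by linarith
  then show ?case
  proof cases
    case 1
    show ?thesis
    proof (rule Brunn_Minkowski_step[OF less.prems(1,2,3) 1 less.prems(4,6)])
      fix D' E' :: "'a set set"
      assume "box_family D'" "box_family E'" "D' \<noteq> {}" "E' \<noteq> {}" "card D' + card E' < card D + card E"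
      then show "measure lebesgue (\<Union>D') powr t * measure lebesgue (\<Union>E') powr (1 - t)
           \<le> measure lebesgue (mix t (\<Union>D') (\<Union>E'))"
        using less.prems(1,2) by (intro less.hyps) auto
    qed
  next
    case 2
    have "measure lebesgue (\<Union>E) powr (1 - t) * measure lebesgue (\<Union>D) powr (1 - (1 - t))
           \<le> measure lebesgue (mix (1 - t) (\<Union>E) (\<Union>D))"
    proof (rule Brunn_Minkowski_step[OF _ _ less.prems(4) 2 less.prems(3,5)])
      fix D' E' :: "'a set set"
      assume "box_family D'" "box_family E'" "D' \<noteq> {}" "E' \<noteq> {}" "card D' + card E' < card E + card D"
      then show "measure lebesgue (\<Union>D') powr (1 - t) * measure lebesgue (\<Union>E') powr (1 - (1 - t))
           \<le> measure lebesgue (mix (1 - t) (\<Union>D') (\<Union>E'))"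
        using less.prems(1,2) by (intro less.hyps) auto
    qed (use less.prems in auto)
    then show ?thesis by (simp add: mult.commute mix_commute[of t])
  next
    case 3
    then obtain X Y where XY: "D = {X}" "E = {Y}" by (metis card_1_singletonE)
    have "\<exists>a b. X = box a b" "\<exists>c d. Y = box c d" "X \<noteq> {}" "Y \<noteq> {}"
      using XY less.prems by (auto simp: box_family_def)
    then obtain a b c d where "X = box a b" "Y = box c d" "X \<noteq> {}" "Y \<noteq> {}" by blast
    then have "measure lebesgue X powr t * measure lebesgue Y powr (1 - t) \<le> measure lebesgue (mix t X Y)"
      using box_Brunn_Minkowski[OF less.prems(1,2)] by blast
    then show ?thesis using XY by simp
  qed
qed

section \<open>From families of boxes to compact sets, by grids\<close>

lemma finite_grid:
  fixes A :: "'a::euclidean_space set"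
  assumes "bounded A" "S \<subseteq> Basis"
  shows "finite ((\<lambda>x. \<Sum>i\<in>S. (\<eta> * of_int \<lfloor>x \<bullet> i / \<eta>\<rfloor>) *\<^sub>R i) ` A)"
proof -
  obtain B where B: "\<And>x. x \<in> A \<Longrightarrow> norm x \<le> B" using assms(1) by (auto simp: bounded_iff)
  have fin: "finite S" using assms(2) by (rule finite_subset) simp
  define N where "N = \<lceil>B / \<bar>\<eta>\<bar>\<rceil> + 1"
  have "(\<lambda>x. \<Sum>i\<in>S. (\<eta> * of_int \<lfloor>x \<bullet> i / \<eta>\<rfloor>) *\<^sub>R i) ` A
     \<subseteq> (\<lambda>f. \<Sum>i\<in>S. (\<eta> * of_int (f i)) *\<^sub>R i) ` (PiE S (\<lambda>_. {-N..N}))"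
  proof safe
    fix x assume x: "x \<in> A"
    have "restrict (\<lambda>i. \<lfloor>x \<bullet> i / \<eta>\<rfloor>) S \<in> PiE S (\<lambda>_. {-N..N})"
    proof (intro restrict_PiE_iff[THEN iffD2] ballI)
      fix i assume "i \<in> S"
      then have "\<bar>x \<bullet> i\<bar> \<le> B" using assms(2) B[OF x] Basis_le_norm[of i x] by auto
      then have "\<bar>x \<bullet> i / \<eta>\<bar> \<le> B / \<bar>\<eta>\<bar>" by (simp add: divide_right_mono)
      then show "\<lfloor>x \<bullet> i / \<eta>\<rfloor> \<in> {-N..N}" unfolding N_def atLeastAtMost_iff by linarith
    qed
    then show "(\<Sum>i\<in>S. (\<eta> * of_int \<lfloor>x \<bullet> i / \<eta>\<rfloor>) *\<^sub>R i)
      \<in> (\<lambda>f. \<Sum>i\<in>S. (\<eta> * of_int (f i)) *\<^sub>R i) ` (PiE S (\<lambda>_. {-N..N}))"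
      by (intro image_eqI[where x="restrict (\<lambda>i. \<lfloor>x \<bullet> i / \<eta>\<rfloor>) S"]) auto
  qed
  then show ?thesis
    by (rule finite_subset) (intro finite_imageI finite_PiE fin finite_atLeastAtMost_int)
qed

text \<open>Outer regularity gives an open set of nearly the same volume, and compactness gives a
  uniform margin \<open>e\<close> inside it.\<close>

lemma compact_nhd_measure:
  fixes X :: "'a::euclidean_space set"
  assumes "compact X" "0 < \<kappa>"
  shows "\<exists>e>0. \<forall>Y \<in> sets lebesgue. Y \<subseteq> (\<Union>x\<in>X. cball x e) \<longrightarrow> measure lebesgue Y \<le> measure lebesgue X + \<kappa>"
proof -
  have X: "X \<in> lmeasurable" using assms(1) by (rule lmeasurable_compact)
  obtain U where U: "open U" "X \<subseteq> U" "U - X \<in> lmeasurable" "emeasure lebesgue (U - X) < ennreal \<kappa>"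
    using sets_lebesgue_outer_open[OF fmeasurableD[OF X] assms(2)] by blast
  have UX: "U = X \<union> (U - X)" using U by auto
  have Um: "U \<in> lmeasurable" by (subst UX) (intro fmeasurable.Un X U)
  have less: "measure lebesgue (U - X) < \<kappa>"
    using U(3,4) assms(2) by (simp add: emeasure_eq_measure2 ennreal_less_iff)
  obtain e where e: "e > 0" "(\<Union>x\<in>X. cball x e) \<subseteq> U"
    using compact_subset_open_imp_cball_epsilon_subset[OF assms(1) U(1,2)] by blast
  have "measure lebesgue Y \<le> measure lebesgue X + \<kappa>" if "Y \<in> sets lebesgue" "Y \<subseteq> (\<Union>x\<in>X. cball x e)"
    for Y
  proof -
    have "measure lebesgue Y \<le> measure lebesgue U"
      using that e Um by (intro measure_mono_fmeasurable) auto
    also have "\<dots> = measure lebesgue X + measure lebesgue (U - X)"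
      using U Um X by (simp add: measurable_measure_Diff)
    finally show ?thesis using less by simp
  qed
  with e show ?thesis by blast
qed

text \<open>The boxes are the open grid cells that belong to points of \<open>A\<close>. Cells are
  disjoint and small, and what they miss of \<open>A\<close> lies on finitely many cell boundaries,
  which are null.\<close>

lemma box_family_approx:
  fixes A :: "'a::euclidean_space set"
  assumes A: "compact A" "A \<noteq> {}" and e: "0 < e"
  shows "\<exists>D. box_family D \<and> D \<noteq> {} \<and> \<Union>D \<subseteq> (\<Union>x\<in>A. cball x e) \<and> measure lebesgue A \<le> measure lebesgue (\<Union>D)"
proof -
  \<comment> \<open>With this mesh the sum of the coordinate differences of two points of a cell is
    at most \<open>e\<close>.\<close>
  define \<eta> where "\<eta> = e / DIM('a)"
  have \<eta>: "\<eta> > 0" using e by (simp add: \<eta>_def)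
  define cell where "cell x = (\<Sum>i\<in>Basis. (\<eta> * of_int \<lfloor>x \<bullet> i / \<eta>\<rfloor>) *\<^sub>R i)" for x :: 'a
  have cell: "cell x \<bullet> i = \<eta> * of_int \<lfloor>x \<bullet> i / \<eta>\<rfloor>" if "i \<in> Basis" for x i
    using that by (simp add: cell_def)
  have cell_le: "cell x \<bullet> i \<le> x \<bullet> i" "x \<bullet> i < cell x \<bullet> i + \<eta>" if "i \<in> Basis" for x i
  proof -
    have "(of_int \<lfloor>x \<bullet> i / \<eta>\<rfloor> :: real) \<le> x \<bullet> i / \<eta>" "x \<bullet> i / \<eta> < of_int \<lfloor>x \<bullet> i / \<eta>\<rfloor> + 1"
      by linarith+
    then have "of_int \<lfloor>x \<bullet> i / \<eta>\<rfloor> * \<eta> \<le> x \<bullet> i" "x \<bullet> i < (of_int \<lfloor>x \<bullet> i / \<eta>\<rfloor> + 1) * \<eta>"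
      using \<eta> by (simp_all only: pos_le_divide_eq pos_divide_less_eq)
    then show "cell x \<bullet> i \<le> x \<bullet> i" "x \<bullet> i < cell x \<bullet> i + \<eta>"
      by (simp_all add: cell[OF that] algebra_simps)
  qed
  let ?B = "\<lambda>p. box p (p + \<eta> *\<^sub>R One)"
  have cell_eq: "cell y = cell x" if "y \<in> ?B (cell x)" for x y
  proof (rule euclidean_eqI)
    fix i :: 'a assume i: "i \<in> Basis"
    have "cell x \<bullet> i < y \<bullet> i" "y \<bullet> i < cell x \<bullet> i + \<eta>"
      using that i by (auto simp: mem_box inner_add_left)
    then have "of_int \<lfloor>x \<bullet> i / \<eta>\<rfloor> \<le> y \<bullet> i / \<eta>" "y \<bullet> i / \<eta> < of_int \<lfloor>x \<bullet> i / \<eta>\<rfloor> + 1"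
      using \<eta> by (auto simp: cell[OF i] field_simps)
    then have "\<lfloor>y \<bullet> i / \<eta>\<rfloor> = \<lfloor>x \<bullet> i / \<eta>\<rfloor>" by (simp add: floor_unique)
    then show "cell y \<bullet> i = cell x \<bullet> i" by (simp add: cell[OF i])
  qed
  define D where "D = ?B ` (cell ` A)"
  have fin: "finite (cell ` A)"
    unfolding cell_def by (rule finite_grid) (use A compact_imp_bounded in auto)
  have "box_family D"
    unfolding box_family_def
  proof (intro conjI ballI)
    show "finite D" using fin by (simp add: D_def)
    show "pairwise disjnt D"
      unfolding pairwise_def
    proof (intro ballI impI)
      fix X Y assume XY: "X \<in> D" "Y \<in> D" "X \<noteq> Y"
      then obtain x y where xy: "X = ?B (cell x)" "Y = ?B (cell y)" by (auto simp: D_def)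
      have False if "z \<in> X" "z \<in> Y" for z
        using that cell_eq[of z x] cell_eq[of z y] xy XY(3) by simp
      then show "disjnt X Y" by (auto simp: disjnt_def)
    qed
    fix X assume "X \<in> D"
    then show "X \<noteq> {}" "\<exists>a b. X = box a b" using \<eta> by (auto simp: D_def box_eq_empty inner_add_left)
  qed
  moreover have "D \<noteq> {}" using A by (simp add: D_def)
  moreover have "\<Union>D \<subseteq> (\<Union>x\<in>A. cball x e)"
  proof
    fix y assume "y \<in> \<Union>D"
    then obtain x where x: "x \<in> A" "y \<in> ?B (cell x)" by (auto simp: D_def)
    have "norm (x - y) \<le> (\<Sum>i\<in>Basis. \<bar>(x - y) \<bullet> i\<bar>)" by (rule norm_le_l1)
    also have "\<dots> \<le> (\<Sum>i\<in>(Basis::'a set). \<eta>)"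
    proof (rule sum_mono)
      fix i :: 'a assume i: "i \<in> Basis"
      have "cell x \<bullet> i < y \<bullet> i" "y \<bullet> i < cell x \<bullet> i + \<eta>"
        using x i by (auto simp: mem_box inner_add_left)
      then show "\<bar>(x - y) \<bullet> i\<bar> \<le> \<eta>" using cell_le[OF i, of x] by (simp add: inner_diff_left)
    qed
    also have "\<dots> = e" by (simp add: \<eta>_def)
    finally show "y \<in> (\<Union>x\<in>A. cball x e)" using x by (auto simp: dist_norm)
  qed
  moreover have "measure lebesgue A \<le> measure lebesgue (\<Union>D)"
  proof -
    let ?F = "\<Union>p\<in>cell ` A. frontier (cbox p (p + \<eta> *\<^sub>R One))"
    have N: "negligible ?F"
      using fin by (intro negligible_Union) (auto intro: negligible_convex_frontier)
    have mD: "\<Union>D \<in> lmeasurable"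
      using \<open>box_family D\<close> by (intro lmeasurable_open bounded_box_family open_box_family)
    have "A \<subseteq> \<Union>D \<union> ?F"
    proof
      fix x assume x: "x \<in> A"
      have "x \<in> cbox (cell x) (cell x + \<eta> *\<^sub>R One)"
        using cell_le[of _ x] by (auto simp: mem_box inner_add_left less_imp_le)
      then show "x \<in> \<Union>D \<union> ?F" using x by (auto simp: D_def frontier_cbox)
    qed
    then have "measure lebesgue A \<le> measure lebesgue (\<Union>D \<union> ?F)"
      using mD N A lmeasurable_compact
      by (intro measure_mono_fmeasurable) (auto simp: negligible_imp_measurable fmeasurable.Un)
    also have "\<dots> = measure lebesgue (\<Union>D)"
      using mD N by (intro measure_Un_null_set) (auto simp: negligible_iff_null_sets)
    finally show ?thesis .
  qed
  ultimately show ?thesis by blast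
qed

text \<open>Both sets are replaced by box families inside their \<open>e\<close>-neighbourhoods that
  are at least as large. The mix of the two families stays in the \<open>e\<close>-neighbourhood of
  the compact set \<open>mix t A B\<close>, whose volume is nearly that of \<open>mix t A B\<close>
  itself.\<close>

theorem Brunn_Minkowski_compact:
  fixes A B :: "'a::euclidean_space set"
  assumes t: "0 < t" "t < 1" and A: "compact A" and B: "compact B"
  shows "measure lebesgue A powr t * measure lebesgue B powr (1 - t) \<le> measure lebesgue (mix t A B)"
proof (cases "A = {} \<or> B = {}")
  case True then show ?thesis by (auto simp: mix_def)
next
  case False
  show ?thesis
  proof (rule field_le_epsilon)
    fix \<kappa> :: real assume "\<kappa> > 0"
    then obtain e where e: "e > 0" "\<And>Y. Y \<in> sets lebesgue \<Longrightarrow> Y \<subseteq> (\<Union>x\<in>mix t A B. cball x e)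
      \<Longrightarrow> measure lebesgue Y \<le> measure lebesgue (mix t A B) + \<kappa>"
      using compact_nhd_measure[OF compact_mix[OF A B]] by metis
    obtain D where D: "box_family D" "D \<noteq> {}" "\<Union>D \<subseteq> (\<Union>x\<in>A. cball x e)" "measure lebesgue A \<le> measure lebesgue (\<Union>D)"
      using box_family_approx[OF A _ e(1)] False by blast
    obtain E where E: "box_family E" "E \<noteq> {}" "\<Union>E \<subseteq> (\<Union>x\<in>B. cball x e)" "measure lebesgue B \<le> measure lebesgue (\<Union>E)"
      using box_family_approx[OF B _ e(1)] False by blast
    have "mix t (\<Union>D) (\<Union>E) \<subseteq> (\<Union>x\<in>mix t A B. cball x e)"
    proof
      fix z assume "z \<in> mix t (\<Union>D) (\<Union>E)"
      then obtain x y where xy: "x \<in> \<Union>D" "y \<in> \<Union>E" "z = t *\<^sub>R x + (1 - t) *\<^sub>R y" unfolding mix_def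
        by blast
      then obtain x' y' where x'y': "x' \<in> A" "y' \<in> B" "norm (x' - x) \<le> e" "norm (y' - y) \<le> e"
      proof -
        have "x \<in> (\<Union>x\<in>A. cball x e)" "y \<in> (\<Union>x\<in>B. cball x e)" using xy D(3) E(3) by blast+
        then show ?thesis using that by (auto simp: dist_norm)
      qed
      have "norm (t *\<^sub>R x' + (1 - t) *\<^sub>R y' - z) = norm (t *\<^sub>R (x' - x) + (1 - t) *\<^sub>R (y' - y))"
        by (simp add: xy algebra_simps)
      also have "\<dots> \<le> t * norm (x' - x) + (1 - t) * norm (y' - y)"
        using t by (intro norm_triangle_le) auto
      also have "\<dots> \<le> t * e + (1 - t) * e"
        using t x'y' by (intro add_mono mult_left_mono) auto
      finally show "z \<in> (\<Union>x\<in>mix t A B. cball x e)"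
        using mixI[OF x'y'(1,2), of t]
        by (intro UN_I[of "t *\<^sub>R x' + (1 - t) *\<^sub>R y'"]) (auto simp: dist_norm left_diff_distrib)
    qed
    moreover have "mix t (\<Union>D) (\<Union>E) \<in> sets lebesgue"
      using t open_mix[OF open_box_family[OF D(1)]] by (intro sets_completionI_sets) auto
    ultimately have le: "measure lebesgue (mix t (\<Union>D) (\<Union>E)) \<le> measure lebesgue (mix t A B) + \<kappa>"
      by (intro e(2))
    have "measure lebesgue A powr t * measure lebesgue B powr (1 - t)
      \<le> measure lebesgue (\<Union>D) powr t * measure lebesgue (\<Union>E) powr (1 - t)"
      using t D E by (intro mult_mono powr_mono2) auto
    also have "\<dots> \<le> measure lebesgue (mix t (\<Union>D) (\<Union>E))"
      by (intro box_family_Brunn_Minkowski t D E)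
    finally show "measure lebesgue A powr t * measure lebesgue B powr (1 - t) \<le> measure lebesgue (mix t A B) + \<kappa>"
      using le by simp
  qed
qed

subsection \<open>The isodiametric inequality for flat sets\<close>

text \<open>By Vitali's covering theorem an open set is a disjoint union of balls up to a null set,
  and an orthogonal map takes balls to balls of the same radius and null sets to null sets. So it
  preserves the volume of open sets, hence of preimages of boxes, and these determine
  \<open>lborel\<close>.\<close>

lemma distr_lborel_orthogonal:
  fixes f :: "'a::euclidean_space \<Rightarrow> 'a"
  assumes f: "orthogonal_transformation f"
  shows "distr lborel borel f = lborel"
proof -
  have lin: "linear f" and nrm: "norm (f x) = norm x" for x
    using f by (auto simp: orthogonal_transformation)
  have cont: "continuous_on UNIV f"
    by (rule linear_continuous_on) (simp add: lin linear_conv_bounded_linear[symmetric])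
  have inj: "inj f" and surj: "surj f"
    using f orthogonal_transformation_inj orthogonal_transformation_surj by auto
  have [measurable]: "f \<in> borel_measurable borel"
    using cont by (rule borel_measurable_continuous_onI)
  have ball: "f ` cball x r = cball (f x) r" for x r
  proof
    show "f ` cball x r \<subseteq> cball (f x) r"
      using nrm by (auto simp: dist_norm linear_diff[OF lin, symmetric])
    show "cball (f x) r \<subseteq> f ` cball x r"
    proof
      fix y assume y: "y \<in> cball (f x) r"
      obtain z where "y = f z" using surj by blast
      with y show "y \<in> f ` cball x r"
        using nrm by (auto simp: dist_norm linear_diff[OF lin, symmetric])
    qed
  qed
  have opn: "emeasure lebesgue (f ` U) = emeasure lebesgue U" if U: "open U" for U
  proof -
    define K where "K = {(x, r). 0 < r \<and> cball x r \<subseteq> U}"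
    obtain C where C: "countable C" "C \<subseteq> K"
      "pairwise (\<lambda>i j. disjnt (cball (fst i) (snd i)) (cball (fst j) (snd j))) C"
      "negligible (U - (\<Union>i\<in>C. cball (fst i) (snd i)))"
    proof (rule Vitali_covering_theorem_cballs[of K snd U fst])
      fix x and d :: real assume "x \<in> U" "0 < d"
      obtain e where e: "e > 0" "cball x e \<subseteq> U" using U \<open>x \<in> U\<close> open_contains_cball by blast
      have "cball x (min e (d/2)) \<subseteq> U" using e by auto
      then show "\<exists>i. i \<in> K \<and> x \<in> cball (fst i) (snd i) \<and> snd i < d"
        using e \<open>0 < d\<close> by (intro exI[of _ "(x, min e (d/2))"]) (auto simp: K_def)
    qed (auto simp: K_def)
    let ?N = "U - (\<Union>i\<in>C. cball (fst i) (snd i))"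
    have sub: "(\<Union>i\<in>C. cball (fst i) (snd i)) \<subseteq> U" using C(2) unfolding K_def by fastforce
    have fN: "negligible (f ` ?N)"
      by (rule negligible_differentiable_image_negligible[OF order_refl C(4)])
        (simp add: lin linear_imp_differentiable_on)
    have dis1: "disjoint_family_on (\<lambda>i. cball (fst i) (snd i)) C"
      using C(3) by (auto simp: disjoint_family_on_def pairwise_def disjnt_def)
    have dis2: "disjoint_family_on (\<lambda>i. cball (f (fst i)) (snd i)) C"
      using dis1 unfolding disjoint_family_on_def ball[symmetric]
      by (metis image_Int[OF inj] image_empty)
    have eU: "U = (\<Union>i\<in>C. cball (fst i) (snd i)) \<union> ?N" using sub by auto
    have efU: "f ` U = (\<Union>i\<in>C. cball (f (fst i)) (snd i)) \<union> f ` ?N"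
      by (subst eU) (simp only: image_Un image_UN ball)
    have "emeasure lebesgue (f ` U) = emeasure lebesgue (\<Union>i\<in>C. cball (f (fst i)) (snd i))"
      unfolding efU using fN C(1)
      by (intro emeasure_Un_null_set sets.countable_UN') (auto simp: negligible_iff_null_sets)
    also have "\<dots> = (\<integral>\<^sup>+i. emeasure lebesgue (cball (f (fst i)) (snd i)) \<partial>count_space C)"
      using C(1) dis2 by (intro emeasure_UN_countable) auto
    also have "\<dots> = (\<integral>\<^sup>+i. emeasure lebesgue (cball (fst i) (snd i)) \<partial>count_space C)"
      using C(2) by (intro nn_integral_cong) (auto simp: K_def emeasure_cball)
    also have "\<dots> = emeasure lebesgue (\<Union>i\<in>C. cball (fst i) (snd i))"
      using C(1) dis1 by (intro emeasure_UN_countable[symmetric]) auto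
    also have "\<dots> = emeasure lebesgue ((\<Union>i\<in>C. cball (fst i) (snd i)) \<union> ?N)"
      using C(4) C(1)
        by (intro emeasure_Un_null_set[symmetric] sets.countable_UN') (auto simp: negligible_iff_null_sets)
    also have "\<dots> = emeasure lebesgue U" by (simp only: eU[symmetric])
    finally show ?thesis .
  qed
  show ?thesis
  proof (rule lborel_eqI[symmetric])
    fix l u :: 'a assume lu: "\<And>b. b \<in> Basis \<Longrightarrow> l \<bullet> b \<le> u \<bullet> b"
    have op: "open (f -` box l u)" using cont by (intro open_vimage) auto
    have "emeasure (distr lborel borel f) (box l u) = emeasure lborel (f -` box l u)"
      by (subst emeasure_distr) auto
    also have "\<dots> = emeasure lebesgue (f -` box l u)" using op by simp
    also have "\<dots> = emeasure lebesgue (f ` (f -` box l u))" using opn[OF op] by simp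
    also have "f ` (f -` box l u) = box l u" using surj by simp
    finally show "emeasure (distr lborel borel f) (box l u) = (\<Prod>b\<in>Basis. (u - l) \<bullet> b)"
      using lu by (simp add: emeasure_lborel_box)
  qed simp
qed

lemma measure_orthogonal_image_borel:
  fixes f :: "'a::euclidean_space \<Rightarrow> 'a"
  assumes f: "orthogonal_transformation f" and S: "S \<in> sets borel"
  shows "f ` S \<in> sets borel" "measure lebesgue (f ` S) = measure lebesgue S"
proof -
  have g: "orthogonal_transformation (inv f)"
    by (rule orthogonal_transformation_inv[OF f])
  have bij: "bij f" using f orthogonal_transformation_bij by blast
  have [measurable]: "inv f \<in> borel_measurable borel"
    using g by (intro borel_measurable_continuous_onI linear_continuous_on)
      (simp add: orthogonal_transformation_linear linear_conv_bounded_linear[symmetric])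
  have eq: "f ` S = inv f -` S" using bij 
    by (auto simp: inv_f_f[OF bij_is_inj[OF bij]]) (metis bij bij_inv_eq_iff imageI)
  show 1: "f ` S \<in> sets borel"
    unfolding eq using measurable_sets[of "inv f" borel borel S] S by simp
  have "emeasure lborel S = emeasure (distr lborel borel (inv f)) S"
    by (simp add: distr_lborel_orthogonal[OF g])
  also have "\<dots> = emeasure lborel (f ` S)"
    using S by (subst emeasure_distr) (auto simp: eq)
  finally show "measure lebesgue (f ` S) = measure lebesgue S"
    using 1 S by (simp add: measure_def)
qed

lemma orthogonal_transformation_unit_exists:
  fixes u w :: "'a::euclidean_space"
  assumes "norm u = 1" "norm w = 1"
  shows "\<exists>f. orthogonal_transformation f \<and> f u = w"
proof -
  define z where "z = u - w"
  \<comment> \<open>The reflection in the hyperplane orthogonal to \<open>u - w\<close>. For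
    \<open>u = w\<close> it degenerates to the identity, division by zero included.\<close>
  define f where "f x = x - (2 * (x \<bullet> z) / (z \<bullet> z)) *\<^sub>R z" for x
  have "linear f" unfolding f_def
    by (intro linearI) (auto simp: inner_add_left algebra_simps add_divide_distrib)
  moreover have "f x \<bullet> f y = x \<bullet> y" for x y
    by (cases "z = 0") (auto simp: f_def inner_diff_left inner_diff_right inner_commute field_simps)
  moreover have "f u = w"
  proof (cases "z = 0")
    case False
    have "u \<bullet> u = 1" "w \<bullet> w = 1" using assms by (simp_all add: dot_square_norm)
    then have "2 * (u \<bullet> z) = z \<bullet> z"
      by (simp add: z_def inner_diff_left inner_diff_right inner_commute)
    then have "2 * (u \<bullet> z) / (z \<bullet> z) = z \<bullet> z / (z \<bullet> z)" by (simp only:)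
    also have "\<dots> = 1" by (rule divide_self) (use False in simp)
    finally have "2 * (u \<bullet> z) / (z \<bullet> z) = 1" .
    then have "f u = u - z" by (simp only: f_def scaleR_one)
    then show ?thesis by (simp add: z_def)
  qed (simp add: f_def z_def)
  ultimately show ?thesis unfolding orthogonal_transformation_def by blast
qed

definition cylinder :: "'a::euclidean_space \<Rightarrow> real \<Rightarrow> real \<Rightarrow> real \<Rightarrow> 'a set" where
  "cylinder \<nu> \<rho> l u = {x. norm (x - (x \<bullet> \<nu>) *\<^sub>R \<nu>) \<le> \<rho> \<and> l \<le> x \<bullet> \<nu> \<and> x \<bullet> \<nu> \<le> u}"

lemma closed_cylinder: "closed (cylinder \<nu> \<rho> l u)"
  unfolding cylinder_def by (intro closed_Collect_conj closed_Collect_le continuous_intros)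

lemma bounded_cylinder: "bounded (cylinder \<nu> \<rho> l u)"
proof (rule boundedI)
  fix x assume x: "x \<in> cylinder \<nu> \<rho> l u"
  have "norm x = norm ((x - (x \<bullet> \<nu>) *\<^sub>R \<nu>) + (x \<bullet> \<nu>) *\<^sub>R \<nu>)" by simp
  also have "\<dots> \<le> norm (x - (x \<bullet> \<nu>) *\<^sub>R \<nu>) + \<bar>x \<bullet> \<nu>\<bar> * norm \<nu>" by (metis norm_scaleR norm_triangle_ineq)
  also have "\<dots> \<le> \<rho> + (\<bar>l\<bar> + \<bar>u\<bar>) * norm \<nu>"
    using x by (intro add_mono mult_right_mono) (auto simp: cylinder_def)
  finally show "norm x \<le> \<rho> + (\<bar>l\<bar> + \<bar>u\<bar>) * norm \<nu>" .
qed

lemma compact_cylinder: "compact (cylinder \<nu> \<rho> l u)"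
  by (simp add: compact_eq_bounded_closed closed_cylinder bounded_cylinder)

text \<open>For an axis along a coordinate, Fubini splits the cylinder into an interval and a ball
  in the product space over the remaining coordinates, where \<open>emeasure_cball_aux\<close> knows
  the volume for any finite index set.\<close>

lemma measure_cylinder_Basis:
  fixes b :: "'a::euclidean_space"
  assumes b: "b \<in> Basis" and \<rho>: "0 < \<rho>" and lu: "l \<le> u"
  shows "measure lebesgue (cylinder b \<rho> l u) = (u - l) * unit_ball_vol (real (DIM('a) - 1)) * \<rho> ^ (DIM('a) - 1)"
proof -
  let ?P = "\<lambda>A :: 'a set. Pi\<^sub>M A (\<lambda>_. lborel :: real measure)"
  interpret product_sigma_finite "\<lambda>_. lborel :: real measure" by standard
  let ?A = "Basis - {b}"
  have ins: "insert b ?A = Basis" using b by auto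
  have fA: "finite ?A" by simp
  let ?C = "{f. sqrt (\<Sum>i\<in>?A. (f i)\<^sup>2) \<le> \<rho>} \<inter> space (?P ?A)"
  have eq: "(\<Sum>i\<in>Basis. f i *\<^sub>R i) \<in> cylinder b \<rho> l u \<longleftrightarrow> sqrt (\<Sum>i\<in>?A. (f i)\<^sup>2) \<le> \<rho> \<and> l \<le> f b \<and> f b \<le> u"
    for f
  proof -
    have 1: "(\<Sum>i\<in>Basis. f i *\<^sub>R i) \<bullet> b = f b" using b by simp
    have "(\<Sum>i\<in>Basis. f i *\<^sub>R i) - f b *\<^sub>R b = (\<Sum>i\<in>Basis. (if i = b then 0 else f i) *\<^sub>R i)"
    proof (rule euclidean_eqI)
      fix i :: 'a assume "i \<in> Basis"
      then show "((\<Sum>i\<in>Basis. f i *\<^sub>R i) - f b *\<^sub>R b) \<bullet> i = (\<Sum>i\<in>Basis. (if i = b then 0 else f i) *\<^sub>R i) \<bullet> i"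
        using b by (auto simp: inner_diff_left inner_Basis)
    qed
    also have "norm \<dots> = sqrt (\<Sum>i\<in>Basis. (if i = b then 0 else f i)\<^sup>2)"
      by (subst euclidean_dist_l2[of _ 0, simplified]) (auto simp: L2_set_def)
    also have "(\<Sum>i\<in>Basis. (if i = b then 0 else f i)\<^sup>2) = (\<Sum>i\<in>?A. (f i)\<^sup>2)"
      by (subst ins[symmetric], subst sum.insert) auto
    finally show ?thesis using 1 by (simp add: cylinder_def)
  qed
  have "emeasure lborel (cylinder b \<rho> l u) = emeasure (?P Basis) ((\<lambda>f. \<Sum>i\<in>Basis. f i *\<^sub>R i) -` cylinder b \<rho> l u \<inter> space (?P Basis))"
    by (subst lborel_eq) (subst emeasure_distr, auto simp: borel_closed closed_cylinder)
  also have "\<dots> = (\<integral>\<^sup>+f. indicator (cylinder b \<rho> l u) (\<Sum>i\<in>Basis. f i *\<^sub>R i) \<partial>?P (insert b ?A))"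
    unfolding ins
  proof (subst nn_integral_indicator[symmetric])
    show "(\<lambda>f. \<Sum>i\<in>Basis. f i *\<^sub>R i) -` cylinder b \<rho> l u \<inter> space (?P Basis) \<in> sets (?P Basis)"
      by (rule measurable_sets[of _ _ borel]) (auto simp: borel_closed closed_cylinder)
  qed (auto intro!: nn_integral_cong simp: indicator_def)
  also have "\<dots> = (\<integral>\<^sup>+y. \<integral>\<^sup>+f. indicator (cylinder b \<rho> l u) (\<Sum>i\<in>Basis. (f(b := y)) i *\<^sub>R i) \<partial>?P ?A \<partial>lborel)"
  proof (rule product_nn_integral_insert_rev)
    show "(\<lambda>f. indicator (cylinder b \<rho> l u) (\<Sum>i\<in>Basis. f i *\<^sub>R i) :: ennreal) \<in> borel_measurable (?P (insert b ?A))"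
      unfolding ins
      by (rule measurable_compose[where N=borel and f="\<lambda>f. \<Sum>i\<in>Basis. f i *\<^sub>R i"])
        (auto simp: borel_closed closed_cylinder intro!: borel_measurable_indicator)
  qed (use fA in auto)
  also have "\<dots> = (\<integral>\<^sup>+y. \<integral>\<^sup>+f. indicator {l..u} y * indicator ?C f \<partial>?P ?A \<partial>lborel)"
  proof (intro nn_integral_cong)
    fix y :: real and f :: "'a \<Rightarrow> real" assume f: "f \<in> space (?P ?A)"
    have "(\<Sum>i\<in>?A. ((f(b := y)) i)\<^sup>2) = (\<Sum>i\<in>?A. (f i)\<^sup>2)" by (intro sum.cong) auto
    then have "(\<Sum>i\<in>Basis. (f(b := y)) i *\<^sub>R i) \<in> cylinder b \<rho> l u \<longleftrightarrow> y \<in> {l..u} \<and> f \<in> ?C"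
      unfolding eq using f by auto
    then show "indicator (cylinder b \<rho> l u) (\<Sum>i\<in>Basis. (f(b := y)) i *\<^sub>R i) = (indicator {l..u} y * indicator ?C f :: ennreal)"
      by (simp only: indicator_def) auto
  qed
  also have "\<dots> = (\<integral>\<^sup>+y. indicator {l..u} y * emeasure (?P ?A) ?C \<partial>lborel)"
    by (subst nn_integral_cmult) (auto simp: fA)
  also have "\<dots> = emeasure (?P ?A) ?C * emeasure lborel {l..u}"
    by (simp add: nn_integral_multc mult.commute)
  also have "emeasure (?P ?A) ?C = ennreal (unit_ball_vol (real (card ?A)) * \<rho> ^ card ?A)"
    by (rule emeasure_cball_aux[OF fA \<rho>])
  also have "card ?A = DIM('a) - 1" using b by simp
  finally have "emeasure lborel (cylinder b \<rho> l u) = ennreal (unit_ball_vol (real (DIM('a) - 1)) * \<rho> ^ (DIM('a) - 1) * (u - l))"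
    using lu \<rho> by (simp add: ennreal_mult'')
  then have "emeasure lebesgue (cylinder b \<rho> l u) = ennreal (unit_ball_vol (real (DIM('a) - 1)) * \<rho> ^ (DIM('a) - 1) * (u - l))"
    by (simp add: borel_closed closed_cylinder)
  then show ?thesis using lu \<rho> by (simp add: measure_def mult_ac)
qed

lemma cylinder_orthogonal_image:
  fixes f :: "'a::euclidean_space \<Rightarrow> 'a"
  assumes f: "orthogonal_transformation f"
  shows "f ` cylinder \<nu> \<rho> l u = cylinder (f \<nu>) \<rho> l u"
proof -
  have lin: "linear f" and nrm: "\<And>x. norm (f x) = norm x" and inn: "\<And>x y. f x \<bullet> f y = x \<bullet> y"
    using f orthogonal_transformation_norm[OF f] by (auto simp: orthogonal_transformation_def)
  have 1: "f x - (x \<bullet> \<nu>) *\<^sub>R f \<nu> = f (x - (x \<bullet> \<nu>) *\<^sub>R \<nu>)" for x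
    by (simp add: linear_diff[OF lin] linear_scale[OF lin])
  have "f x \<in> cylinder (f \<nu>) \<rho> l u \<longleftrightarrow> x \<in> cylinder \<nu> \<rho> l u" for x
    by (simp add: cylinder_def inn 1 nrm)
  moreover have "surj f" using f orthogonal_transformation_surj by blast
  ultimately show ?thesis by (auto simp: image_iff) (metis surjD)
qed

lemma measure_cylinder:
  fixes \<nu> :: "'a::euclidean_space"
  assumes \<nu>: "norm \<nu> = 1" and \<rho>: "0 < \<rho>" and lu: "l \<le> u"
  shows "measure lebesgue (cylinder \<nu> \<rho> l u) = (u - l) * unit_ball_vol (real (DIM('a) - 1)) * \<rho> ^ (DIM('a) - 1)"
proof -
  obtain b :: 'a where b: "b \<in> Basis" using nonempty_Basis by blast
  obtain f where f: "orthogonal_transformation f" "f \<nu> = b"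
    using orthogonal_transformation_unit_exists[OF \<nu>, of b] b by auto
  have "measure lebesgue (cylinder \<nu> \<rho> l u) = measure lebesgue (f ` cylinder \<nu> \<rho> l u)"
    by (rule measure_orthogonal_image_borel(2)[OF f(1), symmetric]) (simp add: borel_closed closed_cylinder)
  then show ?thesis
    by (simp add: cylinder_orthogonal_image[OF f(1)] f(2) measure_cylinder_Basis[OF b \<rho> lu])
qed

text \<open>For \<open>A\<close> in a hyperplane orthogonal to a unit vector \<nu>, the quotient
  \<open>measure lebesgue (prism A \<nu> h) / h\<close> plays the part of the surface area of
  \<open>A\<close>. This avoids a Euclidean type of one dimension less.\<close>

definition prism :: "'a::euclidean_space set \<Rightarrow> 'a \<Rightarrow> real \<Rightarrow> 'a set" where
  "prism A \<nu> h = {y + t *\<^sub>R \<nu> | y t. y \<in> A \<and> 0 \<le> t \<and> t \<le> h}"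

lemma compact_prism:
  assumes "compact A" shows "compact (prism A \<nu> h)"
proof -
  have "prism A \<nu> h = (\<lambda>p. fst p + snd p *\<^sub>R \<nu>) ` (A \<times> {0..h})" by (force simp: prism_def)
  then show ?thesis
    by (simp only:) (intro compact_continuous_image compact_Times assms continuous_intros compact_Icc)
qed

lemma lmeasurable_prism: "compact A \<Longrightarrow> prism A \<nu> h \<in> lmeasurable"
  by (simp add: compact_prism lmeasurable_compact)

lemma prism_orthogonal_image:
  assumes "linear f" shows "f ` prism A \<nu> h = prism (f ` A) (f \<nu>) h"
  using assms by (force simp: prism_def linear_add linear_scale)

text \<open>Isodiametric inequality for flat sets: apply Brunn--Minkowski to the prism over \<open>A\<close> and its
  reflection; their midpoints lie in a cylinder of radius \<open>diameter A / 2\<close>.\<close>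

lemma measure_prism_le_diameter:
  fixes A :: "'a::euclidean_space set"
  assumes A: "compact A" and \<nu>: "norm \<nu> = 1" and flat: "\<And>x. x \<in> A \<Longrightarrow> x \<bullet> \<nu> = c" and h: "0 \<le> h"
  shows "measure lebesgue (prism A \<nu> h)
    \<le> h * unit_ball_vol (real (DIM('a) - 1)) * (diameter A / 2) ^ (DIM('a) - 1)"
proof -
  let ?X = "prism A \<nu> h"
  have nn: "\<nu> \<bullet> \<nu> = 1" using \<nu> by (simp add: dot_square_norm)
  have D: "0 \<le> diameter A" using A compact_imp_bounded diameter_ge_0 by blast
  have neg: "measure lebesgue (uminus ` ?X) = measure lebesgue ?X"
  proof (rule measure_orthogonal_image_borel(2))
    show "orthogonal_transformation (uminus :: 'a \<Rightarrow> 'a)"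
      by (auto simp: orthogonal_transformation_def intro!: linearI)
    show "?X \<in> sets borel" using compact_prism[OF A] by (intro borel_closed compact_imp_closed)
  qed
  have cX: "compact ?X" "compact (uminus ` ?X)"
    using compact_prism[OF A] by (auto intro!: compact_continuous_image continuous_intros)
  \<comment> \<open>A radius strictly above \<open>diameter A / 2\<close> is positive even if
    \<open>A\<close> is a single point, so the cylinder formula applies; the radius is decreased to
    its limit at the end.\<close>
  have *: "measure lebesgue ?X \<le> h * unit_ball_vol (real (DIM('a) - 1)) * \<rho> ^ (DIM('a) - 1)"
    if \<rho>: "diameter A / 2 < \<rho>" for \<rho>
  proof -
    have "measure lebesgue ?X powr (1/2) * measure lebesgue (uminus ` ?X) powr (1 - 1/2)
        \<le> measure lebesgue (mix (1/2) ?X (uminus ` ?X))"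
      by (intro Brunn_Minkowski_compact cX) auto
    then have "measure lebesgue ?X \<le> measure lebesgue (mix (1/2) ?X (uminus ` ?X))"
      unfolding neg by (simp add: powr_half_sqrt)
    also have "\<dots> \<le> measure lebesgue (cylinder \<nu> \<rho> (-h/2) (h/2))"
    proof (intro measure_mono_fmeasurable fmeasurableD lmeasurable_compact compact_mix cX compact_cylinder subsetI)
      fix z assume "z \<in> mix (1/2) ?X (uminus ` ?X)"
      then obtain y t y' t' where y: "y \<in> A" "y' \<in> A" and t: "0 \<le> t" "t \<le> h" "0 \<le> t'" "t' \<le> h"
        and z: "z = (1/2) *\<^sub>R (y + t *\<^sub>R \<nu>) + (1 - 1/2) *\<^sub>R (- (y' + t' *\<^sub>R \<nu>))"
        by (auto simp: mix_def prism_def)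
      have z': "z = (1/2) *\<^sub>R (y - y') + ((t - t') / 2) *\<^sub>R \<nu>"
        unfolding z by (simp add: algebra_simps diff_divide_distrib)
      have zn: "z \<bullet> \<nu> = (t - t') / 2" unfolding z' using nn flat[OF y(1)] flat[OF y(2)]
        by (simp add: inner_add_left inner_diff_left)
      have "norm (z - (z \<bullet> \<nu>) *\<^sub>R \<nu>) = norm (y - y') / 2" unfolding zn unfolding z' by simp
      also have "\<dots> \<le> diameter A / 2"
        using diameter_bounded_bound[OF compact_imp_bounded[OF A] y] by (simp add: dist_norm)
      finally have "norm (z - (z \<bullet> \<nu>) *\<^sub>R \<nu>) \<le> \<rho>" using \<rho> by linarith
      moreover have "- h / 2 \<le> z \<bullet> \<nu>" "z \<bullet> \<nu> \<le> h / 2" using t zn by auto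
      ultimately show "z \<in> cylinder \<nu> \<rho> (-h/2) (h/2)" by (simp add: cylinder_def)
    qed
    also have "\<dots> = h * unit_ball_vol (real (DIM('a) - 1)) * \<rho> ^ (DIM('a) - 1)"
      using \<rho> D h by (subst measure_cylinder[OF \<nu>]) auto
    finally show ?thesis .
  qed
  show ?thesis
  proof (rule tendsto_lowerbound)
    show "((\<lambda>\<rho>. h * unit_ball_vol (real (DIM('a) - 1)) * \<rho> ^ (DIM('a) - 1)) \<longlongrightarrow>
      h * unit_ball_vol (real (DIM('a) - 1)) * (diameter A / 2) ^ (DIM('a) - 1)) (at_right (diameter A / 2))"
      by (intro tendsto_intros)
    show "\<forall>\<^sub>F \<rho> in at_right (diameter A / 2). measure lebesgue ?X \<le> h * unit_ball_vol (real (DIM('a) - 1)) * \<rho> ^ (DIM('a) - 1)"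
      using * by (auto simp: eventually_at_right_less intro: eventually_mono[OF eventually_at_right_less])
  qed simp
qed

subsection \<open>Hausdorff measure of flat sets\<close>

definition disc_weight :: "nat \<Rightarrow> 'a::euclidean_space set \<Rightarrow> ennreal" where
  "disc_weight s U = (if U = {} then 0 else ennreal (unit_ball_vol (real s) * (diameter U / 2) ^ s))"

definition fine_cover :: "real \<Rightarrow> 'a::euclidean_space set \<Rightarrow> (nat \<Rightarrow> 'a set) \<Rightarrow> bool" where
  "fine_cover \<delta> A U \<longleftrightarrow> A \<subseteq> (\<Union>i. U i) \<and> (\<forall>i. bounded (U i) \<and> diameter (U i) \<le> \<delta>)"

lemma hausdorff_content_altdef:
  "hausdorff_content s \<delta> A = (INF U \<in> {U. fine_cover \<delta> A U}. \<Sum>i. disc_weight s (U i))"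
  by (simp add: hausdorff_content_def fine_cover_def disc_weight_def)

lemma hausdorff_content_le_cover:
  "fine_cover \<delta> A U \<Longrightarrow> hausdorff_content s \<delta> A \<le> (\<Sum>i. disc_weight s (U i))"
  unfolding hausdorff_content_altdef by (rule INF_lower) simp

lemma hausdorff_content_le_measure:
  "0 < \<delta> \<Longrightarrow> hausdorff_content s \<delta> A \<le> hausdorff_measure s A"
  unfolding hausdorff_measure_def by (rule SUP_upper) simp

lemma hausdorff_measure_leI:
  "(\<And>\<delta>. 0 < \<delta> \<Longrightarrow> hausdorff_content s \<delta> A \<le> c) \<Longrightarrow> hausdorff_measure s A \<le> c"
  unfolding hausdorff_measure_def by (rule SUP_least) simp

lemma hausdorff_content_mono: "A \<subseteq> B \<Longrightarrow> hausdorff_content s \<delta> A \<le> hausdorff_content s \<delta> B"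
proof -
  assume "A \<subseteq> B"
  then have "{U. fine_cover \<delta> B U} \<subseteq> {U. fine_cover \<delta> A U}" unfolding fine_cover_def by blast
  then show ?thesis unfolding hausdorff_content_altdef by (rule INF_superset_mono) (rule order_refl)
qed

lemma hausdorff_measure_mono: "A \<subseteq> B \<Longrightarrow> hausdorff_measure s A \<le> hausdorff_measure s B"
  by (intro hausdorff_measure_leI order_trans[OF hausdorff_content_mono hausdorff_content_le_measure])

lemma hausdorff_content_empty:
  assumes "0 \<le> \<delta>" shows "hausdorff_content s \<delta> {} = 0"
proof -
  have "hausdorff_content s \<delta> ({}::'a set) \<le> (\<Sum>i. disc_weight s ({}::'a set))"
    using assms by (intro hausdorff_content_le_cover) (simp add: fine_cover_def)
  then show ?thesis by (simp add: disc_weight_def)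
qed

lemma hausdorff_content_single:
  assumes "bounded A" "diameter A \<le> \<delta>" "0 \<le> \<delta>"
  shows "hausdorff_content s \<delta> A \<le> disc_weight s A"
proof -
  let ?U = "\<lambda>i::nat. if i = 0 then A else {}"
  have "A \<subseteq> (\<Union>i. ?U i)"
  proof
    fix x assume "x \<in> A"
    then have "x \<in> ?U 0" by simp
    then show "x \<in> (\<Union>i. ?U i)" by blast
  qed
  then have "hausdorff_content s \<delta> A \<le> (\<Sum>i. disc_weight s (?U i))"
    using assms by (intro hausdorff_content_le_cover) (simp add: fine_cover_def)
  also have "\<dots> = (\<Sum>i\<in>{0}. disc_weight s (?U i))"
    by (intro suminf_finite) (auto simp: disc_weight_def)
  finally show ?thesis by simp
qed

lemma suminf_interleave_le:
  fixes f g :: "nat \<Rightarrow> ennreal"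
  shows "(\<Sum>i. if even i then f (i div 2) else g (i div 2)) \<le> (\<Sum>i. f i) + (\<Sum>i. g i)"
proof (rule suminf_le_const)
  fix n
  let ?w = "\<lambda>i. if even i then f (i div 2) else g (i div 2)"
  have "sum ?w {..<2 * n} = sum f {..<n} + sum g {..<n}"
    by (induction n) (auto simp: algebra_simps)
  moreover have "sum ?w {..<n} \<le> sum ?w {..<2 * n}"
    by (intro sum_mono2) auto
  moreover have "sum f {..<n} + sum g {..<n} \<le> (\<Sum>i. f i) + (\<Sum>i. g i)"
    by (intro add_mono sum_le_suminf summableI) auto
  ultimately show "sum ?w {..<n} \<le> (\<Sum>i. f i) + (\<Sum>i. g i)"
    by (metis (no_types, lifting) order_trans)
qed simp

text \<open>Near-optimal covers of the two sets are interleaved along the even and the odd indices;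
  they exist because only finite contents have to be considered.\<close>

lemma hausdorff_content_Un:
  "hausdorff_content s \<delta> (A \<union> B) \<le> hausdorff_content s \<delta> A + hausdorff_content s \<delta> B"
proof (rule ennreal_le_epsilon)
  have *: "hausdorff_content s \<delta> (A \<union> B) \<le> (\<Sum>i. disc_weight s (U i)) + (\<Sum>i. disc_weight s (V i))"
    if "fine_cover \<delta> A U" "fine_cover \<delta> B V" for U V
  proof -
    let ?W = "\<lambda>i::nat. if even i then U (i div 2) else V (i div 2)"
    have "\<Union>(range U) \<subseteq> (\<Union>i. ?W i)"
    proof
      fix x assume "x \<in> \<Union>(range U)"
      then obtain i where "x \<in> U i" by blast
      then have "x \<in> ?W (2 * i)" by simp
      then show "x \<in> (\<Union>i. ?W i)" by (rule UN_I[OF UNIV_I])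
    qed
    moreover have "\<Union>(range V) \<subseteq> (\<Union>i. ?W i)"
    proof
      fix x assume "x \<in> \<Union>(range V)"
      then obtain i where "x \<in> V i" by blast
      then have "x \<in> ?W (2 * i + 1)" by simp
      then show "x \<in> (\<Union>i. ?W i)" by (rule UN_I[OF UNIV_I])
    qed
    ultimately have "A \<union> B \<subseteq> (\<Union>i. ?W i)"
      using that unfolding fine_cover_def by (meson Un_least order_trans)
    then have "fine_cover \<delta> (A \<union> B) ?W"
      using that by (simp add: fine_cover_def)
    from hausdorff_content_le_cover[OF this]
    have "hausdorff_content s \<delta> (A \<union> B) \<le> (\<Sum>i. disc_weight s (?W i))" .
    also have "(\<lambda>i. disc_weight s (?W i)) = (\<lambda>i. if even i then disc_weight s (U (i div 2)) else disc_weight s (V (i div 2)))"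
      by auto
    also have "suminf \<dots> \<le> (\<Sum>i. disc_weight s (U i)) + (\<Sum>i. disc_weight s (V i))"
      by (rule suminf_interleave_le)
    finally show ?thesis .
  qed
  fix e :: real assume e: "0 < e" and fin: "hausdorff_content s \<delta> A + hausdorff_content s \<delta> B < top"
  have cov: "\<exists>U. fine_cover \<delta> C U \<and> (\<Sum>i. disc_weight s (U i)) < hausdorff_content s \<delta> C + ennreal (e / 2)"
    if "hausdorff_content s \<delta> C < top" for C
  proof -
    have "hausdorff_content s \<delta> C < hausdorff_content s \<delta> C + ennreal (e / 2)"
      using that e by (simp add: ennreal_add_left_cancel_less less_top[symmetric])
    then show ?thesis unfolding hausdorff_content_altdef[of s \<delta> C] INF_less_iff by blast
  qed
  have "hausdorff_content s \<delta> A < top" "hausdorff_content s \<delta> B < top"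
    using fin by (simp_all add: less_top[symmetric])
  from cov[OF this(1)] cov[OF this(2)] obtain U V where UV: "fine_cover \<delta> A U" "fine_cover \<delta> B V"
    "(\<Sum>i. disc_weight s (U i)) < hausdorff_content s \<delta> A + ennreal (e / 2)"
    "(\<Sum>i. disc_weight s (V i)) < hausdorff_content s \<delta> B + ennreal (e / 2)"
    by blast
  have "hausdorff_content s \<delta> (A \<union> B) \<le> (hausdorff_content s \<delta> A + ennreal (e / 2)) + (hausdorff_content s \<delta> B + ennreal (e / 2))"
    by (rule order_trans[OF *[OF UV(1,2)]]) (intro add_mono less_imp_le UV(3,4))
  also have "\<dots> = (hausdorff_content s \<delta> A + hausdorff_content s \<delta> B) + (ennreal (e / 2) + ennreal (e / 2))"
    by (simp only: ac_simps)
  also have "ennreal (e / 2) + ennreal (e / 2) = ennreal e"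
    using e by (simp add: ennreal_plus[symmetric] del: ennreal_plus)
  finally show "hausdorff_content s \<delta> (A \<union> B) \<le> hausdorff_content s \<delta> A + hausdorff_content s \<delta> B + ennreal e" .
qed

lemma hausdorff_content_UN:
  assumes "finite I" "0 \<le> \<delta>"
  shows "hausdorff_content s \<delta> (\<Union>i\<in>I. A i) \<le> (\<Sum>i\<in>I. hausdorff_content s \<delta> (A i))"
  using assms(1)
proof induction
  case empty then show ?case by (simp add: hausdorff_content_empty assms)
next
  case (insert i I)
  have "hausdorff_content s \<delta> (A i \<union> (\<Union>i\<in>I. A i)) \<le> hausdorff_content s \<delta> (A i) + hausdorff_content s \<delta> (\<Union>i\<in>I. A i)"
    by (rule hausdorff_content_Un)
  also have "\<dots> \<le> hausdorff_content s \<delta> (A i) + (\<Sum>i\<in>I. hausdorff_content s \<delta> (A i))"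
    by (intro add_left_mono insert)
  finally show ?case using insert(1,2) by simp
qed

lemma hausdorff_measure_UN:
  assumes "finite I"
  shows "hausdorff_measure s (\<Union>i\<in>I. A i) \<le> (\<Sum>i\<in>I. hausdorff_measure s (A i))"
proof (rule hausdorff_measure_leI)
  fix \<delta> :: real assume "0 < \<delta>"
  then have "hausdorff_content s \<delta> (\<Union>i\<in>I. A i) \<le> (\<Sum>i\<in>I. hausdorff_content s \<delta> (A i))"
    by (intro hausdorff_content_UN assms) auto
  also have "\<dots> \<le> (\<Sum>i\<in>I. hausdorff_measure s (A i))"
    using \<open>0 < \<delta>\<close> by (intro sum_mono hausdorff_content_le_measure)
  finally show "hausdorff_content s \<delta> (\<Union>i\<in>I. A i) \<le> (\<Sum>i\<in>I. hausdorff_measure s (A i))" .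
qed

lemma hausdorff_measure_nonexpansive_image:
  fixes f :: "'a::euclidean_space \<Rightarrow> 'a"
  assumes f: "\<And>x y. x \<in> A \<Longrightarrow> y \<in> A \<Longrightarrow> dist (f x) (f y) \<le> dist x y"
  shows "hausdorff_measure s (f ` A) \<le> hausdorff_measure s A"
proof (rule hausdorff_measure_leI)
  fix \<delta> :: real assume \<delta>: "0 < \<delta>"
  have "hausdorff_content s \<delta> (f ` A) \<le> hausdorff_content s \<delta> A"
    unfolding hausdorff_content_altdef[of s \<delta> A]
  proof (rule INF_greatest, simp)
    fix U assume U: "fine_cover \<delta> A U"
    \<comment> \<open>The covering sets are intersected with \<open>A\<close> before mapping,
      because \<open>f\<close> is nonexpansive only on \<open>A\<close>.\<close>
    let ?V = "\<lambda>i. f ` (U i \<inter> A)"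
    have V: "bounded (?V i) \<and> diameter (?V i) \<le> diameter (U i)" for i
    proof
      have b: "bounded (U i)" using U by (simp add: fine_cover_def)
      have d: "dist x y \<le> diameter (U i)" if "x \<in> ?V i" "y \<in> ?V i" for x y
      proof -
        obtain x' y' where *: "x = f x'" "y = f y'" "x' \<in> U i \<inter> A" "y' \<in> U i \<inter> A" using \<open>x \<in> _\<close> \<open>y \<in> _\<close>
          by blast
        then have "dist x y \<le> dist x' y'" using f by simp
        also have "\<dots> \<le> diameter (U i)" using * by (intro diameter_bounded_bound[OF b]) auto
        finally show ?thesis .
      qed
      show "bounded (?V i)"
      proof (cases "?V i = {}")
        case False
        then obtain x where "x \<in> ?V i" by blast
        then show ?thesis using d unfolding bounded_def by blast
      qed simp
      show "diameter (?V i) \<le> diameter (U i)"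
        using d diameter_ge_0[OF b] by (intro diameter_le) (auto simp: dist_norm[symmetric])
    qed
    have "fine_cover \<delta> (f ` A) ?V"
      unfolding fine_cover_def
    proof (intro conjI allI)
      show "f ` A \<subseteq> (\<Union>i. ?V i)" using U unfolding fine_cover_def by blast
      show "bounded (?V i)" for i using V by blast
      show "diameter (?V i) \<le> \<delta>" for i using V U unfolding fine_cover_def by (meson order_trans)
    qed
    from hausdorff_content_le_cover[OF this]
    have "hausdorff_content s \<delta> (f ` A) \<le> (\<Sum>i. disc_weight s (?V i))" .
    also have "\<dots> \<le> (\<Sum>i. disc_weight s (U i))"
    proof (intro suminf_le summableI)
      fix i
      have "0 \<le> diameter (?V i)" using V by (intro diameter_ge_0) blast
      then have "unit_ball_vol (real s) * (diameter (?V i) / 2) ^ s \<le> unit_ball_vol (real s) * (diameter (U i) / 2) ^ s"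
        using V by (intro mult_left_mono power_mono) auto
      then show "disc_weight s (?V i) \<le> disc_weight s (U i)"
        by (auto simp: disc_weight_def intro!: ennreal_leI)
    qed
    finally show "hausdorff_content s \<delta> (f ` A) \<le> (\<Sum>i. disc_weight s (U i))" .
  qed
  also have "\<dots> \<le> hausdorff_measure s A" using \<delta> by (rule hausdorff_content_le_measure)
  finally show "hausdorff_content s \<delta> (f ` A) \<le> hausdorff_measure s A" .
qed

section \<open>Grids of flat cubes and the sharp upper bound for flat sets\<close>

definition flat_cube :: "'a::euclidean_space \<Rightarrow> real \<Rightarrow> real \<Rightarrow> 'a \<Rightarrow> 'a set" where
  "flat_cube b c \<eta> p = {x. x \<bullet> b = c \<and> (\<forall>i\<in>Basis - {b}. p \<bullet> i \<le> x \<bullet> i \<and> x \<bullet> i \<le> p \<bullet> i + \<eta>)}"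

lemma flat_cube_eq_cbox:
  assumes b: "b \<in> Basis"
  shows "flat_cube b c \<eta> p = cbox (p + (c - p \<bullet> b) *\<^sub>R b) (p + \<eta> *\<^sub>R (One - b) + (c - p \<bullet> b) *\<^sub>R b)"
proof -
  have "x \<in> flat_cube b c \<eta> p \<longleftrightarrow> (\<forall>i\<in>Basis. (p + (c - p \<bullet> b) *\<^sub>R b) \<bullet> i \<le> x \<bullet> i \<and> x \<bullet> i \<le> (p + \<eta> *\<^sub>R (One - b) + (c - p \<bullet> b) *\<^sub>R b) \<bullet> i)"
    for x
    using b by (auto simp: flat_cube_def inner_add_left inner_diff_left inner_Basis)
  then show ?thesis by (auto simp: mem_box)
qed

lemma prism_flat_cube:
  assumes b: "b \<in> Basis" and h: "0 \<le> h"
  shows "prism (flat_cube b c \<eta> p) b h = cbox (p + (c - p \<bullet> b) *\<^sub>R b) (p + \<eta> *\<^sub>R (One - b) + (c + h - p \<bullet> b) *\<^sub>R b)"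
    (is "?L = cbox ?l ?u")
proof -
  have bb: "b \<bullet> b = 1" using b by simp
  have box: "x \<in> cbox ?l ?u \<longleftrightarrow> c \<le> x \<bullet> b \<and> x \<bullet> b \<le> c + h \<and> (\<forall>i\<in>Basis - {b}. p \<bullet> i \<le> x \<bullet> i \<and> x \<bullet> i \<le> p \<bullet> i + \<eta>)"
    for x
  proof -
    have "x \<in> cbox ?l ?u \<longleftrightarrow> (\<forall>i\<in>insert b (Basis - {b}). ?l \<bullet> i \<le> x \<bullet> i \<and> x \<bullet> i \<le> ?u \<bullet> i)"
      using b by (simp add: mem_box insert_absorb)
    also have "\<dots> \<longleftrightarrow> c \<le> x \<bullet> b \<and> x \<bullet> b \<le> c + h \<and> (\<forall>i\<in>Basis - {b}. p \<bullet> i \<le> x \<bullet> i \<and> x \<bullet> i \<le> p \<bullet> i + \<eta>)"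
      using b bb by (auto simp: inner_add_left inner_diff_left inner_Basis)
    finally show ?thesis .
  qed
  have ob: "(y + t *\<^sub>R b) \<bullet> i = y \<bullet> i" if "i \<in> Basis - {b}" for y t i
    using that b by (auto simp: inner_add_left inner_Basis)
  have "x \<in> ?L \<longleftrightarrow> x \<in> cbox ?l ?u" for x
  proof
    assume "x \<in> ?L"
    then obtain y t where "x = y + t *\<^sub>R b" "y \<in> flat_cube b c \<eta> p" "0 \<le> t" "t \<le> h"
      by (auto simp: prism_def)
    moreover have "x \<bullet> b = y \<bullet> b + t" "\<forall>i\<in>Basis - {b}. x \<bullet> i = y \<bullet> i"
      using ob[of _ y t] bb \<open>x = _\<close> by (auto simp: inner_add_left)
    ultimately show "x \<in> cbox ?l ?u" unfolding box flat_cube_def by auto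
  next
    assume x: "x \<in> cbox ?l ?u"
    let ?t = "x \<bullet> b - c"
    define y where "y = x - ?t *\<^sub>R b"
    have "y \<bullet> b = c" using bb by (simp add: y_def inner_diff_left)
    moreover have "\<forall>i\<in>Basis - {b}. y \<bullet> i = x \<bullet> i" using b
      by (auto simp: y_def inner_diff_left inner_Basis)
    ultimately have "y \<in> flat_cube b c \<eta> p" using x unfolding box flat_cube_def by simp
    moreover have "x = y + ?t *\<^sub>R b" by (simp add: y_def)
    moreover have "0 \<le> ?t" "?t \<le> h" using x unfolding box by auto
    ultimately show "x \<in> ?L" unfolding prism_def by blast
  qed
  then show ?thesis by blast
qed

lemma measure_prism_flat_cube:
  fixes b :: "'a::euclidean_space"
  assumes b: "b \<in> Basis" and h: "0 \<le> h" and \<eta>: "0 \<le> \<eta>"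
  shows "measure lebesgue (prism (flat_cube b c \<eta> p) b h) = \<eta> ^ (DIM('a) - 1) * h"
proof -
  let ?l = "p + (c - p \<bullet> b) *\<^sub>R b" and ?u = "p + \<eta> *\<^sub>R (One - b) + (c + h - p \<bullet> b) *\<^sub>R b"
  have ui: "(?u - ?l) \<bullet> i = (if i = b then h else \<eta>)" if "i \<in> Basis" for i
    using that b by (auto simp: inner_add_left inner_diff_left inner_Basis)
  have ui': "(\<Prod>i\<in>Basis. (?u - ?l) \<bullet> i) = (\<Prod>i\<in>insert b (Basis - {b}). if i = b then h else \<eta>)"
    by (rule prod.cong) (use b in blast, rule ui, use b in blast)
  have le: "?l \<bullet> i \<le> ?u \<bullet> i" if "i \<in> Basis" for i
  proof -
    have "0 \<le> (?u - ?l) \<bullet> i" unfolding ui[OF that] using h \<eta> by simp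
    then show ?thesis by (simp only: inner_diff_left diff_ge_0_iff_ge)
  qed
  have "measure lebesgue (cbox ?l ?u) = (\<Prod>i\<in>Basis. (?u - ?l) \<bullet> i)"
    using le by (simp add: inner_diff_left)
  also have "\<dots> = (\<Prod>i\<in>insert b (Basis - {b}). if i = b then h else \<eta>)"
    by (rule ui')
  also have "\<dots> = h * (\<Prod>i\<in>Basis - {b}. \<eta>)"
    by (subst prod.insert) (auto intro: prod.cong)
  finally show ?thesis using b by (simp add: prism_flat_cube[OF b h] mult.commute)
qed

lemma compact_flat_cube: "b \<in> Basis \<Longrightarrow> compact (flat_cube b c \<eta> p)"
  by (simp add: flat_cube_eq_cbox compact_cbox)

lemma flat_cube_diameter:
  fixes \<eta> :: real
  assumes b: "b \<in> Basis" and \<eta>: "0 \<le> \<eta>"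
  shows "diameter (flat_cube b c \<eta> p :: 'a::euclidean_space set) \<le> DIM('a) * \<eta>"
proof (rule diameter_le)
  fix x y assume xy: "x \<in> flat_cube b c \<eta> p" "y \<in> flat_cube b c \<eta> p"
  have "norm (x - y) \<le> (\<Sum>i\<in>Basis. \<bar>(x - y) \<bullet> i\<bar>)" by (rule norm_le_l1)
  also have "\<dots> \<le> (\<Sum>i\<in>(Basis::'a set). \<eta>)"
  proof (rule sum_mono)
    fix i :: 'a assume i: "i \<in> Basis"
    show "\<bar>(x - y) \<bullet> i\<bar> \<le> \<eta>"
    proof (cases "i = b")
      case True then show ?thesis using xy \<eta> by (simp add: flat_cube_def inner_diff_left)
    next
      case False
      then have "p \<bullet> i \<le> x \<bullet> i" "x \<bullet> i \<le> p \<bullet> i + \<eta>" "p \<bullet> i \<le> y \<bullet> i" "y \<bullet> i \<le> p \<bullet> i + \<eta>"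
        using xy i by (auto simp: flat_cube_def)
      then show ?thesis by (simp add: inner_diff_left)
    qed
  qed
  finally show "norm (x - y) \<le> DIM('a) * \<eta>" by simp
qed (use \<eta> in simp)

text \<open>The open prisms over the grid cells that belong to points of \<open>C\<close> are
  disjoint and stay close to the prism over \<open>C\<close>, so the volume of a neighbourhood of
  that prism bounds their number.\<close>

lemma flat_grid_cover:
  fixes C :: "'a::euclidean_space set"
  assumes b: "b \<in> Basis" and C: "compact C" and flat: "\<And>x. x \<in> C \<Longrightarrow> x \<bullet> b = c"
    and h: "0 < h" and \<delta>: "0 < \<delta>" and \<kappa>: "0 < \<kappa>"
  shows "\<exists>\<eta> G. 0 < \<eta> \<and> \<eta> \<le> \<delta> \<and> finite G \<and> C \<subseteq> (\<Union>p\<in>G. flat_cube b c \<eta> p) \<and>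
    real (card G) * (\<eta> ^ (DIM('a) - 1) * h) \<le> measure lebesgue (prism C b h) + \<kappa>"
proof -
  obtain e where e: "e > 0" "\<And>Y. Y \<in> sets lebesgue \<Longrightarrow> Y \<subseteq> (\<Union>x\<in>prism C b h. cball x e)
      \<Longrightarrow> measure lebesgue Y \<le> measure lebesgue (prism C b h) + \<kappa>"
    using compact_nhd_measure[OF compact_prism[OF C] \<kappa>] by metis
  define \<eta> where "\<eta> = min \<delta> (e / DIM('a))"
  have \<eta>: "0 < \<eta>" "\<eta> \<le> \<delta>" "DIM('a) * \<eta> \<le> e"
    using e \<delta> by (auto simp: \<eta>_def min_def field_simps)
  let ?A = "Basis - {b}"
  define cell where "cell x = (\<Sum>i\<in>?A. (\<eta> * of_int \<lfloor>x \<bullet> i / \<eta>\<rfloor>) *\<^sub>R i)" for x :: 'a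
  have cell: "cell x \<bullet> i = \<eta> * of_int \<lfloor>x \<bullet> i / \<eta>\<rfloor>" if i: "i \<in> ?A" for x i
  proof -
    have "cell x \<bullet> i = (\<Sum>j\<in>?A. if j = i then \<eta> * of_int \<lfloor>x \<bullet> j / \<eta>\<rfloor> else 0)"
      unfolding cell_def inner_sum_left using i by (intro sum.cong) (auto simp: inner_Basis)
    then show ?thesis using i by simp
  qed
  have cell_le: "cell x \<bullet> i \<le> x \<bullet> i" "x \<bullet> i < cell x \<bullet> i + \<eta>" if "i \<in> ?A" for x i
  proof -
    have "(of_int \<lfloor>x \<bullet> i / \<eta>\<rfloor> :: real) \<le> x \<bullet> i / \<eta>" "x \<bullet> i / \<eta> < of_int \<lfloor>x \<bullet> i / \<eta>\<rfloor> + 1"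
      by linarith+
    then have "of_int \<lfloor>x \<bullet> i / \<eta>\<rfloor> * \<eta> \<le> x \<bullet> i" "x \<bullet> i < (of_int \<lfloor>x \<bullet> i / \<eta>\<rfloor> + 1) * \<eta>"
      using \<eta> by (simp_all only: pos_le_divide_eq pos_divide_less_eq)
    then show "cell x \<bullet> i \<le> x \<bullet> i" "x \<bullet> i < cell x \<bullet> i + \<eta>"
      by (simp_all add: cell[OF that] algebra_simps)
  qed
  define G where "G = cell ` C"
  define l where "l p = p + (c - p \<bullet> b) *\<^sub>R b" for p
  define u where "u p = p + \<eta> *\<^sub>R (One - b) + (c + h - p \<bullet> b) *\<^sub>R b" for p
  have fin: "finite G" unfolding G_def cell_def
    by (rule finite_grid) (use C compact_imp_bounded in auto)
  have cover: "C \<subseteq> (\<Union>p\<in>G. flat_cube b c \<eta> p)"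
  proof
    fix x assume x: "x \<in> C"
    then have "x \<in> flat_cube b c \<eta> (cell x)"
      using flat cell_le[of _ x] by (auto simp: flat_cube_def less_imp_le)
    then show "x \<in> (\<Union>p\<in>G. flat_cube b c \<eta> p)" using x by (auto simp: G_def)
  qed
  have inbox: "p \<bullet> i < y \<bullet> i \<and> y \<bullet> i < p \<bullet> i + \<eta>" if "y \<in> box (l p) (u p)" "i \<in> ?A" for y p i
    using that b by (auto simp: mem_box l_def u_def inner_add_left inner_diff_left inner_Basis)
  have inbox_b: "c < y \<bullet> b \<and> y \<bullet> b < c + h" if "y \<in> box (l p) (u p)" for y p
    using that b by (auto simp: mem_box l_def u_def inner_add_left inner_diff_left inner_Basis)
  have cell_eq: "cell y = cell x" if "y \<in> box (l (cell x)) (u (cell x))" for x y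
  proof -
    have "\<lfloor>y \<bullet> i / \<eta>\<rfloor> = \<lfloor>x \<bullet> i / \<eta>\<rfloor>" if i: "i \<in> ?A" for i
    proof -
      have "of_int \<lfloor>x \<bullet> i / \<eta>\<rfloor> \<le> y \<bullet> i / \<eta>" "y \<bullet> i / \<eta> < of_int \<lfloor>x \<bullet> i / \<eta>\<rfloor> + 1"
        using \<eta> inbox[OF \<open>y \<in> _\<close> i] by (auto simp: cell[OF i] field_simps)
      then show ?thesis by (simp add: floor_unique)
    qed
    then show ?thesis unfolding cell_def by (intro sum.cong) auto
  qed
  have vol: "measure lebesgue (box (l p) (u p)) = \<eta> ^ (DIM('a) - 1) * h" for p
  proof -
    have "measure lebesgue (box (l p) (u p)) = measure lebesgue (cbox (l p) (u p))"
      by (simp add: measure_lborel_box_eq measure_lborel_cbox_eq) 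
    also have "\<dots> = \<eta> ^ (DIM('a) - 1) * h"
      using measure_prism_flat_cube[OF b, of h \<eta> c p] prism_flat_cube[OF b, of h c \<eta> p] h \<eta>
      by (simp add: l_def u_def)
    finally show ?thesis .
  qed
  have disj: "disjoint_family_on (\<lambda>p. box (l p) (u p)) G"
    unfolding disjoint_family_on_def
  proof (intro ballI impI)
    fix p q assume pq: "p \<in> G" "q \<in> G" "p \<noteq> q"
    then obtain x y where "p = cell x" "q = cell y" by (auto simp: G_def)
    then show "box (l p) (u p) \<inter> box (l q) (u q) = {}"
      using cell_eq pq(3) by (metis disjoint_iff)
  qed
  have "real (card G) * (\<eta> ^ (DIM('a) - 1) * h) = (\<Sum>p\<in>G. measure lebesgue (box (l p) (u p)))"
    by (simp only: vol sum_constant)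
  also have "\<dots> = measure lebesgue (\<Union>p\<in>G. box (l p) (u p))"
    using disj fin by (intro measure_finite_Union[symmetric]) (auto simp: emeasure_lborel_box_eq)
  also have "\<dots> \<le> measure lebesgue (prism C b h) + \<kappa>"
  proof (rule e(2))
    show "(\<Union>p\<in>G. box (l p) (u p)) \<in> sets lebesgue" using fin by auto
    show "(\<Union>p\<in>G. box (l p) (u p)) \<subseteq> (\<Union>x\<in>prism C b h. cball x e)"
    proof
      fix y assume "y \<in> (\<Union>p\<in>G. box (l p) (u p))"
      then obtain x where x: "x \<in> C" "y \<in> box (l (cell x)) (u (cell x))" by (auto simp: G_def)
      let ?x = "x + (y \<bullet> b - c) *\<^sub>R b"
      have "?x \<in> prism C b h" using x inbox_b[OF x(2)] by (force simp: prism_def)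
      moreover have "norm (?x - y) \<le> e"
      proof -
        have "norm (?x - y) \<le> (\<Sum>i\<in>Basis. \<bar>(?x - y) \<bullet> i\<bar>)" by (rule norm_le_l1)
        also have "\<dots> \<le> (\<Sum>i\<in>(Basis::'a set). \<eta>)"
        proof (rule sum_mono)
          fix i :: 'a assume i: "i \<in> Basis"
          show "\<bar>(?x - y) \<bullet> i\<bar> \<le> \<eta>"
          proof (cases "i = b")
            case True then show ?thesis using \<eta> flat[OF x(1)] b
              by (simp add: inner_diff_left inner_add_left)
          next
            case False
            then have iA: "i \<in> ?A" using i by simp
            have "(?x - y) \<bullet> i = x \<bullet> i - y \<bullet> i"
              using False i b by (simp add: inner_diff_left inner_add_left inner_Basis)
            then show ?thesis using cell_le[OF iA, of x] inbox[OF x(2) iA] by linarith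
          qed
        qed
        finally show ?thesis using \<eta>(3) by simp
      qed
      ultimately show "y \<in> (\<Union>x\<in>prism C b h. cball x e)" by (auto simp: dist_norm)
    qed
  qed
  finally show ?thesis using \<eta> fin cover by blast
qed

text \<open>Closed cylinders of smaller radius exhaust \<open>W\<close>. The strict inequality in
  the radius is wanted because a cube minus an open ball is compact.\<close>

lemma measure_open_cylinder_ge:
  fixes \<nu> :: "'a::euclidean_space"
  assumes \<nu>: "norm \<nu> = 1" and \<rho>: "0 < \<rho>" and lu: "l \<le> u"
  defines "W \<equiv> {x. norm (x - (x \<bullet> \<nu>) *\<^sub>R \<nu>) < \<rho> \<and> l \<le> x \<bullet> \<nu> \<and> x \<bullet> \<nu> \<le> u}"
  shows "W \<in> lmeasurable" "(u - l) * unit_ball_vol (real (DIM('a) - 1)) * \<rho> ^ (DIM('a) - 1) \<le> measure lebesgue W"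
proof -
  have "W \<in> sets borel" unfolding W_def by measurable
  moreover have "W \<subseteq> cylinder \<nu> \<rho> l u" by (auto simp: W_def cylinder_def)
  ultimately show W: "W \<in> lmeasurable"
    by (intro bounded_set_imp_lmeasurable bounded_subset[OF bounded_cylinder]) auto
  show "(u - l) * unit_ball_vol (real (DIM('a) - 1)) * \<rho> ^ (DIM('a) - 1) \<le> measure lebesgue W"
  proof (rule tendsto_upperbound)
    show "((\<lambda>\<sigma>. (u - l) * unit_ball_vol (real (DIM('a) - 1)) * \<sigma> ^ (DIM('a) - 1)) \<longlongrightarrow>
      (u - l) * unit_ball_vol (real (DIM('a) - 1)) * \<rho> ^ (DIM('a) - 1)) (at_left \<rho>)"
      by (intro tendsto_intros)
    have "(u - l) * unit_ball_vol (real (DIM('a) - 1)) * \<sigma> ^ (DIM('a) - 1) \<le> measure lebesgue W"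
      if "0 < \<sigma>" "\<sigma> < \<rho>" for \<sigma>
    proof -
      have "measure lebesgue (cylinder \<nu> \<sigma> l u) \<le> measure lebesgue W"
        using that W by (intro measure_mono_fmeasurable)
          (auto simp: W_def cylinder_def[symmetric] closed_cylinder borel_closed, auto simp: cylinder_def)
      then show ?thesis using measure_cylinder[OF \<nu> that(1) lu] by simp
    qed
    moreover have "\<forall>\<^sub>F \<sigma> in at_left \<rho>. 0 < \<sigma> \<and> \<sigma> < \<rho>"
      using \<rho> eventually_at_left_field by blast
    ultimately show "\<forall>\<^sub>F \<sigma> in at_left \<rho>. (u - l) * unit_ball_vol (real (DIM('a) - 1)) * \<sigma> ^ (DIM('a) - 1) \<le> measure lebesgue W"
      by (auto elim: eventually_mono)
  qed simp
qed

text \<open>\<open>D\<close> is the disc inscribed in the cube: its diameter is at most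
  \<open>\<eta>\<close>, so covering it by itself costs no more than its true area. The constant
  \<open>unit_ball_vol (real m) / 2 ^ m\<close> is the fraction of the cube that this disc fills,
  and \<open>R\<close> is the rest.\<close>

lemma flat_cube_disc:
  fixes b :: "'a::euclidean_space"
  assumes b: "b \<in> Basis" and h: "0 < h" and \<eta>: "0 < \<eta>" "\<eta> \<le> \<delta>"
  defines "m \<equiv> DIM('a) - 1"
  shows "\<exists>D R. flat_cube b c \<eta> p \<subseteq> D \<union> R \<and> compact R \<and> R \<subseteq> flat_cube b c \<eta> p \<and>
    hausdorff_content m \<delta> D \<le> ennreal (unit_ball_vol (real m) / 2 ^ m * \<eta> ^ m) \<and>
    measure lebesgue (prism R b h) / h \<le> (1 - unit_ball_vol (real m) / 2 ^ m) * \<eta> ^ m"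
proof -
  define z where "z = p + (\<eta> / 2) *\<^sub>R (One - b) + (c - p \<bullet> b) *\<^sub>R b"
  have bb: "b \<bullet> b = 1" using b by simp
  have zi: "z \<bullet> i = p \<bullet> i + \<eta> / 2" if "i \<in> Basis - {b}" for i
    using that b by (auto simp: z_def inner_add_left inner_diff_left inner_Basis)
  have zb: "z \<bullet> b = c" using b by (simp add: z_def inner_add_left inner_diff_left)
  let ?Q = "flat_cube b c \<eta> p"
  define D where "D = {x. x \<bullet> b = c \<and> norm (x - z) \<le> \<eta> / 2}"
  define R where "R = ?Q - ball z (\<eta> / 2)"
  define W where "W = {x. norm (x - (x \<bullet> b) *\<^sub>R b) < \<eta> / 2 \<and> 0 \<le> x \<bullet> b \<and> x \<bullet> b \<le> h}"
  have "?Q \<subseteq> D \<union> R" by (auto simp: D_def R_def flat_cube_def dist_norm norm_minus_commute)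
  moreover have cR: "compact R" unfolding R_def by (intro compact_diff compact_flat_cube b) auto
  moreover have "R \<subseteq> ?Q" by (auto simp: R_def)
  moreover have "hausdorff_content m \<delta> D \<le> ennreal (unit_ball_vol (real m) / 2 ^ m * \<eta> ^ m)"
  proof -
    have bd: "bounded D"
      by (rule bounded_subset[OF bounded_cball[of z "\<eta>/2"]]) (auto simp: D_def dist_norm norm_minus_commute)
    have dD: "diameter D \<le> \<eta>"
    proof (rule diameter_le)
      fix x y assume "x \<in> D" "y \<in> D"
      then have "norm (x - z) \<le> \<eta> / 2" "norm (y - z) \<le> \<eta> / 2" by (auto simp: D_def)
      then show "norm (x - y) \<le> \<eta>" using norm_triangle_ineq4[of "x - z" "y - z"] by simp
    qed (use \<eta> in simp)
    have "hausdorff_content m \<delta> D \<le> disc_weight m D"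
      using bd dD \<eta> by (intro hausdorff_content_single) auto
    also have "\<dots> \<le> ennreal (unit_ball_vol (real m) * (\<eta> / 2) ^ m)"
      using dD diameter_ge_0[OF bd]
      by (auto simp: disc_weight_def intro!: ennreal_leI mult_left_mono power_mono)
    finally show ?thesis by (simp add: power_divide)
  qed
  moreover have "measure lebesgue (prism R b h) / h \<le> (1 - unit_ball_vol (real m) / 2 ^ m) * \<eta> ^ m"
  proof -
    have nb: "norm b = 1" using b by simp
    have W: "W \<in> lmeasurable" "h * unit_ball_vol (real m) * (\<eta> / 2) ^ m \<le> measure lebesgue W"
      using measure_open_cylinder_ge[OF nb, of "\<eta>/2" 0 h] \<eta> h by (auto simp: W_def m_def)
    have zW: "(+) z ` W \<in> lmeasurable" "measure lebesgue ((+) z ` W) = measure lebesgue W"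
      using W by (simp_all add: measurable_translation measure_translation)
    have Wx: "norm ((x - (x \<bullet> b - c) *\<^sub>R b) - z) < \<eta> / 2 \<and> 0 \<le> x \<bullet> b - c \<and> x \<bullet> b - c \<le> h"
      if "x \<in> (+) z ` W" for x
    proof -
      obtain w where w: "x = z + w" "w \<in> W" using \<open>x \<in> (+) z ` W\<close> by blast
      have "x \<bullet> b - c = w \<bullet> b" using w zb by (simp add: inner_add_left)
      then show ?thesis using w by (simp add: W_def)
    qed
    have sub: "(+) z ` W \<subseteq> prism ?Q b h"
    proof
      fix x assume x: "x \<in> (+) z ` W"
      let ?y = "x - (x \<bullet> b - c) *\<^sub>R b"
      have "?y \<bullet> b = c" using bb by (simp add: inner_diff_left)
      moreover have "p \<bullet> i \<le> ?y \<bullet> i \<and> ?y \<bullet> i \<le> p \<bullet> i + \<eta>" if i: "i \<in> Basis - {b}" for i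
      proof -
        have "\<bar>(?y - z) \<bullet> i\<bar> \<le> norm (?y - z)" using i by (intro Basis_le_norm) auto
        then have "\<bar>(?y - z) \<bullet> i\<bar> < \<eta> / 2" using Wx[OF x] by linarith
        then have "\<bar>?y \<bullet> i - z \<bullet> i\<bar> < \<eta> / 2" by (simp only: inner_diff_left)
        then show ?thesis unfolding zi[OF i] by linarith
      qed
      ultimately have "?y \<in> ?Q" by (simp add: flat_cube_def)
      moreover have "x = ?y + (x \<bullet> b - c) *\<^sub>R b" by simp
      ultimately show "x \<in> prism ?Q b h" using Wx[OF x] unfolding prism_def by blast
    qed
    have sub2: "prism R b h \<subseteq> prism ?Q b h - (+) z ` W"
    proof
      fix x assume "x \<in> prism R b h"
      then obtain y t where y: "y \<in> R" "x = y + t *\<^sub>R b" "0 \<le> t" "t \<le> h" by (auto simp: prism_def)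
      have "y \<bullet> b = c" using y by (auto simp: R_def flat_cube_def)
      then have "x - (x \<bullet> b - c) *\<^sub>R b = y" using y bb by (simp add: inner_add_left)
      moreover have "\<not> norm (y - z) < \<eta> / 2" using y by (auto simp: R_def dist_norm norm_minus_commute)
      ultimately have "x \<notin> (+) z ` W" using Wx by metis
      moreover have "x \<in> prism ?Q b h" using y unfolding prism_def R_def by blast
      ultimately show "x \<in> prism ?Q b h - (+) z ` W" by blast
    qed
    have Qm: "prism ?Q b h \<in> lmeasurable" by (intro lmeasurable_prism compact_flat_cube b)
    have "measure lebesgue (prism R b h) \<le> measure lebesgue (prism ?Q b h - (+) z ` W)"
      using Qm zW lmeasurable_prism[OF cR, of b h]
      by (intro measure_mono_fmeasurable sub2) auto
    also have "\<dots> = \<eta> ^ m * h - measure lebesgue W"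
      using Qm zW sub measure_prism_flat_cube[OF b, of h \<eta> c p] h \<eta>
      by (subst measurable_measure_Diff) (auto simp: m_def)
    also have "\<dots> \<le> ((1 - unit_ball_vol (real m) / 2 ^ m) * \<eta> ^ m) * h"
      using W(2) by (simp add: power_divide algebra_simps)
    finally show ?thesis using h by (simp add: pos_divide_le_eq)
  qed
  ultimately show ?thesis by blast
qed

text \<open>The part of the unit cube outside its inscribed disc cannot have negative
  volume.\<close>

lemma disc_in_cube_ratio:
  "unit_ball_vol (real (DIM('a::euclidean_space) - 1)) / 2 ^ (DIM('a) - 1) \<le> 1"
proof -
  obtain b :: 'a where b: "b \<in> Basis" using nonempty_Basis by blast
  obtain R :: "'a set" where "measure lebesgue (prism R b 1) / 1
      \<le> (1 - unit_ball_vol (real (DIM('a) - 1)) / 2 ^ (DIM('a) - 1)) * 1 ^ (DIM('a) - 1)"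
    using flat_cube_disc[OF b zero_less_one zero_less_one order_refl, of 0 0] by auto
  moreover have "0 \<le> measure lebesgue (prism R b 1) / 1" by simp
  ultimately show ?thesis unfolding power_one mult_1_right by linarith
qed

text \<open>Every small cube contains a disc whose content is its exact area; only the rest of the cube
  is charged with the constant \<open>\<alpha>\<close> known so far. Iterating drives the constant to \<open>1\<close>.\<close>

lemma flat_hausdorff_measure_improve:
  fixes b :: "'a::euclidean_space"
  defines "m \<equiv> DIM('a) - 1"
  defines "c0 \<equiv> unit_ball_vol (real m) / 2 ^ m"
  assumes b: "b \<in> Basis" and h: "0 < h" and \<alpha>: "0 \<le> \<alpha>"
    and IH: "\<And>C. compact C \<Longrightarrow> (\<And>x. x \<in> C \<Longrightarrow> x \<bullet> b = c) \<Longrightarrow>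
      hausdorff_measure m C \<le> ennreal (\<alpha> * (measure lebesgue (prism C b h) / h))"
    and C: "compact C" "\<And>x. x \<in> C \<Longrightarrow> x \<bullet> b = c"
  shows "hausdorff_measure m C \<le> ennreal ((c0 + (1 - c0) * \<alpha>) * (measure lebesgue (prism C b h) / h))"
proof (rule hausdorff_measure_leI)
  fix \<delta> :: real assume \<delta>: "0 < \<delta>"
  define \<beta> where "\<beta> = c0 + (1 - c0) * \<alpha>"
  have c0: "0 < c0" by (simp add: c0_def)
  have c01: "c0 \<le> 1"
    unfolding c0_def m_def by (rule disc_in_cube_ratio)
  have \<beta>: "0 \<le> \<beta>" unfolding \<beta>_def using c0 c01 \<alpha> by (intro add_nonneg_nonneg mult_nonneg_nonneg) auto
  show "hausdorff_content m \<delta> C \<le> ennreal (\<beta> * (measure lebesgue (prism C b h) / h))"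
  proof (rule ennreal_le_epsilon)
    fix e :: real assume e: "0 < e"
    \<comment> \<open>Chosen so that the error of the grid count, which enters as
      \<open>\<beta> * \<kappa> / h\<close>, stays below \<open>e\<close>.\<close>
    define \<kappa> where "\<kappa> = e * h / (\<beta> + 1)"
    have \<kappa>: "0 < \<kappa>" unfolding \<kappa>_def using e h \<beta> by simp
    obtain \<eta> G where G: "0 < \<eta>" "\<eta> \<le> \<delta>" "finite G" "C \<subseteq> (\<Union>p\<in>G. flat_cube b c \<eta> p)"
      "real (card G) * (\<eta> ^ m * h) \<le> measure lebesgue (prism C b h) + \<kappa>"
      using flat_grid_cover[OF b C h \<delta> \<kappa>] unfolding m_def by blast
    have Q: "hausdorff_content m \<delta> (flat_cube b c \<eta> p) \<le> ennreal (\<beta> * \<eta> ^ m)" for p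
    proof -
      obtain D R where DR: "flat_cube b c \<eta> p \<subseteq> D \<union> R" "compact R" "R \<subseteq> flat_cube b c \<eta> p"
        "hausdorff_content m \<delta> D \<le> ennreal (c0 * \<eta> ^ m)"
        "measure lebesgue (prism R b h) / h \<le> (1 - c0) * \<eta> ^ m"
        using flat_cube_disc[OF b h G(1,2), of c p] unfolding m_def c0_def by blast
      have "hausdorff_content m \<delta> R \<le> hausdorff_measure m R"
        using \<delta> by (rule hausdorff_content_le_measure)
      also have "\<dots> \<le> ennreal (\<alpha> * (measure lebesgue (prism R b h) / h))"
        using DR by (intro IH) (auto simp: flat_cube_def)
      also have "\<dots> \<le> ennreal (\<alpha> * ((1 - c0) * \<eta> ^ m))"
        using DR \<alpha> by (intro ennreal_leI mult_left_mono)
      finally have R: "hausdorff_content m \<delta> R \<le> ennreal (\<alpha> * ((1 - c0) * \<eta> ^ m))" .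
      have "hausdorff_content m \<delta> D + hausdorff_content m \<delta> R \<le> ennreal (c0 * \<eta> ^ m) + ennreal (\<alpha> * ((1 - c0) * \<eta> ^ m))"
        by (rule add_mono[OF DR(4) R])
      also have "\<dots> = ennreal (c0 * \<eta> ^ m + \<alpha> * ((1 - c0) * \<eta> ^ m))"
        using c0 c01 \<alpha> G by (intro ennreal_plus[symmetric]) auto
      also have "c0 * \<eta> ^ m + \<alpha> * ((1 - c0) * \<eta> ^ m) = \<beta> * \<eta> ^ m" by (simp add: \<beta>_def algebra_simps)
      finally show ?thesis
        using hausdorff_content_mono[OF DR(1), of m \<delta>] hausdorff_content_Un[of m \<delta> D R] by order
    qed
    have "hausdorff_content m \<delta> C \<le> hausdorff_content m \<delta> (\<Union>p\<in>G. flat_cube b c \<eta> p)"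
      by (rule hausdorff_content_mono[OF G(4)])
    also have "\<dots> \<le> (\<Sum>p\<in>G. hausdorff_content m \<delta> (flat_cube b c \<eta> p))"
      using G \<delta> by (intro hausdorff_content_UN) auto
    also have "\<dots> \<le> (\<Sum>p\<in>G. ennreal (\<beta> * \<eta> ^ m))" by (intro sum_mono Q)
    also have "\<dots> = ennreal (\<Sum>p\<in>G. \<beta> * \<eta> ^ m)" using \<beta> G by (intro sum_ennreal) auto
    also have "(\<Sum>p\<in>G. \<beta> * \<eta> ^ m) = \<beta> * (real (card G) * (\<eta> ^ m * h) / h)" using h by simp
    also have "\<dots> \<le> \<beta> * ((measure lebesgue (prism C b h) + \<kappa>) / h)"
      using \<beta> h G by (intro mult_left_mono divide_right_mono) auto
    also have "\<dots> = \<beta> * (measure lebesgue (prism C b h) / h) + e * (\<beta> / (\<beta> + 1))"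
      using h \<beta> by (simp add: \<kappa>_def field_simps)
    also have "\<dots> \<le> \<beta> * (measure lebesgue (prism C b h) / h) + e * 1"
      using \<beta> e by (intro add_left_mono mult_left_mono) auto
    finally show "hausdorff_content m \<delta> C \<le> ennreal (\<beta> * (measure lebesgue (prism C b h) / h)) + ennreal e"
      using \<beta> h e by (simp add: ennreal_leI ennreal_plus[symmetric] del: ennreal_plus)
  qed
qed

text \<open>Each grid cube is covered by itself, and its diameter is at most \<open>DIM('a)\<close>
  times its edge. The resulting constant is far from sharp but finite, which is all that is asked of
  a starting point for the iterated improvement.\<close>

lemma flat_hausdorff_measure_crude:
  fixes b :: "'a::euclidean_space"
  defines "m \<equiv> DIM('a) - 1"
  assumes b: "b \<in> Basis" and h: "0 < h" and C: "compact C" "\<And>x. x \<in> C \<Longrightarrow> x \<bullet> b = c"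
  shows "hausdorff_measure m C \<le> ennreal (unit_ball_vol (real m) * (DIM('a) / 2) ^ m * (measure lebesgue (prism C b h) / h))"
proof (rule hausdorff_measure_leI)
  fix \<delta> :: real assume \<delta>: "0 < \<delta>"
  let ?\<beta> = "unit_ball_vol (real m) * (DIM('a) / 2) ^ m"
  have \<beta>: "0 \<le> ?\<beta>" by simp
  show "hausdorff_content m \<delta> C \<le> ennreal (?\<beta> * (measure lebesgue (prism C b h) / h))"
  proof (rule ennreal_le_epsilon)
    fix e :: real assume e: "0 < e"
    define \<kappa> where "\<kappa> = e * h / (?\<beta> + 1)"
    have \<kappa>: "0 < \<kappa>" unfolding \<kappa>_def using e h add_nonneg_pos[OF \<beta> zero_less_one]
      by (intro divide_pos_pos mult_pos_pos)
    have "0 < \<delta> / DIM('a)" using \<delta> by simp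
    then obtain \<eta> G where G: "0 < \<eta>" "\<eta> \<le> \<delta> / DIM('a)" "finite G" "C \<subseteq> (\<Union>p\<in>G. flat_cube b c \<eta> p)"
      "real (card G) * (\<eta> ^ m * h) \<le> measure lebesgue (prism C b h) + \<kappa>"
      using flat_grid_cover[OF b C h _ \<kappa>, of "\<delta> / DIM('a)"] unfolding m_def by blast
    have Q: "hausdorff_content m \<delta> (flat_cube b c \<eta> p) \<le> ennreal (?\<beta> * \<eta> ^ m)" for p
    proof -
      have bd: "bounded (flat_cube b c \<eta> p)" using compact_flat_cube[OF b] compact_imp_bounded by blast
      have d: "diameter (flat_cube b c \<eta> p) \<le> DIM('a) * \<eta>" using flat_cube_diameter[OF b] G by simp
      have "hausdorff_content m \<delta> (flat_cube b c \<eta> p) \<le> disc_weight m (flat_cube b c \<eta> p)"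
        using d G \<delta> by (intro hausdorff_content_single bd) (auto simp: field_simps)
      also have "\<dots> \<le> ennreal (unit_ball_vol (real m) * (DIM('a) * \<eta> / 2) ^ m)"
        using d diameter_ge_0[OF bd]
        by (auto simp: disc_weight_def intro!: ennreal_leI mult_left_mono power_mono)
      finally show ?thesis by (simp add: power_mult_distrib power_divide mult.assoc)
    qed
    have "hausdorff_content m \<delta> C \<le> hausdorff_content m \<delta> (\<Union>p\<in>G. flat_cube b c \<eta> p)"
      by (rule hausdorff_content_mono[OF G(4)])
    also have "\<dots> \<le> (\<Sum>p\<in>G. hausdorff_content m \<delta> (flat_cube b c \<eta> p))"
      using G \<delta> by (intro hausdorff_content_UN) auto
    also have "\<dots> \<le> (\<Sum>p\<in>G. ennreal (?\<beta> * \<eta> ^ m))" by (intro sum_mono Q)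
    also have "\<dots> = ennreal (\<Sum>p\<in>G. ?\<beta> * \<eta> ^ m)" using \<beta> G by (intro sum_ennreal) auto
    also have "(\<Sum>p\<in>G. ?\<beta> * \<eta> ^ m) = ?\<beta> * (real (card G) * (\<eta> ^ m * h) / h)" using h by simp
    also have "\<dots> \<le> ?\<beta> * ((measure lebesgue (prism C b h) + \<kappa>) / h)"
      using \<beta> h G by (intro mult_left_mono divide_right_mono) auto
    also have "\<dots> = ?\<beta> * (measure lebesgue (prism C b h) / h) + e * (?\<beta> / (?\<beta> + 1))"
      using h by (simp add: \<kappa>_def add_divide_distrib distrib_left)
    also have "\<dots> \<le> ?\<beta> * (measure lebesgue (prism C b h) / h) + e * 1"
      using \<beta> e by (intro add_left_mono mult_left_mono) (auto simp: add_pos_nonneg pos_divide_le_eq)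
    finally have "hausdorff_content m \<delta> C \<le> ennreal (?\<beta> * (measure lebesgue (prism C b h) / h) + e)"
      by (simp add: ennreal_leI)
    also have "\<dots> = ennreal (?\<beta> * (measure lebesgue (prism C b h) / h)) + ennreal e"
      using h e by (intro ennreal_plus) auto
    finally show "hausdorff_content m \<delta> C \<le> ennreal (?\<beta> * (measure lebesgue (prism C b h) / h)) + ennreal e" .
  qed
qed

lemma flat_hausdorff_measure_le_Basis:
  fixes b :: "'a::euclidean_space"
  assumes b: "b \<in> Basis" and h: "0 < h" and C: "compact C" "\<And>x. x \<in> C \<Longrightarrow> x \<bullet> b = c"
  shows "hausdorff_measure (DIM('a) - 1) C \<le> ennreal (measure lebesgue (prism C b h) / h)"
proof -
  define m where "m = DIM('a) - 1"
  define c0 where "c0 = unit_ball_vol (real m) / 2 ^ m"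
  define a0 where "a0 = unit_ball_vol (real m) * (DIM('a) / 2) ^ m"
  \<comment> \<open>The solution in closed form of the recursion that sends \<open>\<alpha>\<close>
    to \<open>c0 + (1 - c0) * \<alpha>\<close>, started at \<open>a0\<close>. It contracts with
    factor \<open>1 - c0\<close> towards its fixed point 1.\<close>
  define \<alpha> where "\<alpha> k = 1 + (1 - c0) ^ k * (a0 - 1)" for k :: nat
  have c0: "0 < c0" "c0 \<le> 1" using disc_in_cube_ratio[where 'a='a] by (simp_all add: c0_def m_def)
  have \<alpha>Suc: "\<alpha> (Suc k) = c0 + (1 - c0) * \<alpha> k" for k by (simp add: \<alpha>_def algebra_simps)
  have \<alpha>0: "0 \<le> \<alpha> k" for k
  proof (induction k)
    case 0 show ?case by (simp add: \<alpha>_def a0_def)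
  next
    case (Suc k) then show ?case unfolding \<alpha>Suc using c0
      by (intro add_nonneg_nonneg mult_nonneg_nonneg) auto
  qed
  have main: "compact D \<Longrightarrow> (\<And>x. x \<in> D \<Longrightarrow> x \<bullet> b = c) \<Longrightarrow>
      hausdorff_measure m D \<le> ennreal (\<alpha> k * (measure lebesgue (prism D b h) / h))" for k D
  proof (induction k arbitrary: D)
    case 0
    then show ?case using flat_hausdorff_measure_crude[OF b h, of D c] by (simp add: \<alpha>_def a0_def m_def)
  next
    case (Suc k)
    show ?case unfolding \<alpha>Suc c0_def m_def
      using Suc.IH Suc.prems \<alpha>0[of k] unfolding m_def
      by (intro flat_hausdorff_measure_improve[OF b h]) blast+
  qed
  have "(\<lambda>k. ennreal (\<alpha> k * (measure lebesgue (prism C b h) / h))) \<longlonglongrightarrow> ennreal ((1 + 0 * (a0 - 1)) * (measure lebesgue (prism C b h) / h))"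
    unfolding \<alpha>_def using c0
    by (intro tendsto_ennrealI tendsto_mult tendsto_add tendsto_const LIMSEQ_power_zero) auto
  then show ?thesis unfolding m_def[symmetric]
    using main[OF C]
      by (intro LIMSEQ_le_const[where X="\<lambda>k. ennreal (\<alpha> k * (measure lebesgue (prism C b h) / h))"]) auto
qed

lemma flat_hausdorff_measure_le:
  fixes \<nu> :: "'a::euclidean_space"
  assumes \<nu>: "norm \<nu> = 1" and h: "0 < h" and C: "compact C" "\<And>x. x \<in> C \<Longrightarrow> x \<bullet> \<nu> = c"
  shows "hausdorff_measure (DIM('a) - 1) C \<le> ennreal (measure lebesgue (prism C \<nu> h) / h)"
proof -
  obtain b :: 'a where b: "b \<in> Basis" using nonempty_Basis by blast
  obtain f where f: "orthogonal_transformation f" "f \<nu> = b"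
    using orthogonal_transformation_unit_exists[OF \<nu>, of b] b by auto
  have lin: "linear f" and lin': "linear (inv f)"
    using f orthogonal_transformation_linear orthogonal_transformation_inv by auto
  have inj: "inj f" using f orthogonal_transformation_inj by blast
  have eq: "inv f ` (f ` C) = C" using inj by (simp add: image_image)
  have "hausdorff_measure (DIM('a) - 1) C = hausdorff_measure (DIM('a) - 1) (inv f ` (f ` C))"
    by (simp only: eq)
  also have "\<dots> \<le> hausdorff_measure (DIM('a) - 1) (f ` C)"
  proof (rule hausdorff_measure_nonexpansive_image)
    fix x y
    have "dist (inv f x) (inv f y) = norm (inv f (x - y))" by (simp add: dist_norm linear_diff[OF lin'])
    also have "\<dots> = norm (x - y)"
      by (rule orthogonal_transformation_norm[OF orthogonal_transformation_inv[OF f(1)]])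
    finally show "dist (inv f x) (inv f y) \<le> dist x y" by (simp add: dist_norm)
  qed
  also have "\<dots> \<le> ennreal (measure lebesgue (prism (f ` C) b h) / h)"
  proof (rule flat_hausdorff_measure_le_Basis[OF b h])
    show "compact (f ` C)"
      using C(1) by (intro compact_continuous_image linear_continuous_on) (simp_all add: lin linear_conv_bounded_linear[symmetric])
    fix x assume "x \<in> f ` C"
    then show "x \<bullet> b = c" using C(2) f by (auto simp: orthogonal_transformation_def)
  qed
  also have "prism (f ` C) b h = f ` prism C \<nu> h" by (simp add: prism_orthogonal_image[OF lin] f(2))
  also have "measure lebesgue \<dots> = measure lebesgue (prism C \<nu> h)"
    by (intro measure_orthogonal_image_borel f) (simp add: borel_closed compact_imp_closed compact_prism[OF C(1)])
  finally show ?thesis .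
qed

subsection \<open>The surface of a polyhedron\<close>

definition polyhedron_of :: "('a::euclidean_space \<times> real) set \<Rightarrow> 'a set" where
  "polyhedron_of I = {x. \<forall>(a, \<beta>)\<in>I. a \<bullet> x \<le> \<beta>}"

text \<open>For a unit normal this is the signed distance to the bounding hyperplane, positive on
  the inner side.\<close>

definition slack :: "'a::euclidean_space \<times> real \<Rightarrow> 'a \<Rightarrow> real" where
  "slack i x = snd i - fst i \<bullet> x"

lemma polyhedron_of_slack: "polyhedron_of I = {x. \<forall>i\<in>I. 0 \<le> slack i x}"
  by (auto simp: polyhedron_of_def slack_def)

lemma continuous_slack [continuous_intros]:
  fixes i :: "'a::euclidean_space \<times> real"
  shows "continuous_on S (slack i)"
  unfolding slack_def by (intro continuous_intros)

lemma slack_add: "slack i (x + t *\<^sub>R w) = slack i x - t * (fst i \<bullet> w)"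
  by (simp add: slack_def inner_add_right)

lemma closed_polyhedron_of: "closed (polyhedron_of I)"
proof -
  have "polyhedron_of I = (\<Inter>i\<in>I. {x. 0 \<le> slack i x})" by (auto simp: polyhedron_of_slack)
  then show ?thesis
    by (simp only:) (intro closed_INT ballI closed_Collect_le continuous_intros)
qed

lemma convex_polyhedron_of: "convex (polyhedron_of I)"
proof -
  have "polyhedron_of I = (\<Inter>i\<in>I. {x. fst i \<bullet> x \<le> snd i})" by (force simp: polyhedron_of_def)
  then show ?thesis by (simp only:) (intro convex_INT convex_halfspace_le)
qed

definition facet :: "('a::euclidean_space \<times> real) set \<Rightarrow> 'a \<times> real \<Rightarrow> 'a set" where
  "facet I i = {x \<in> polyhedron_of I. slack i x = 0}"

lemma frontier_polyhedron_subset: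
  fixes I :: "('a::euclidean_space \<times> real) set"
  assumes fin: "finite I"
  shows "frontier (polyhedron_of I) \<subseteq> (\<Union>i\<in>I. facet I i)"
proof
  fix x assume x: "x \<in> frontier (polyhedron_of I)"
  then have xP: "x \<in> polyhedron_of I" "x \<notin> interior (polyhedron_of I)"
    using closed_polyhedron_of[of I] by (auto simp: frontier_def)
  have "\<exists>i\<in>I. slack i x \<le> 0"
  proof (rule ccontr)
    assume "\<not> (\<exists>i\<in>I. slack i x \<le> 0)"
    then have "x \<in> (\<Inter>i\<in>I. {x. 0 < slack i x})" by auto
    moreover have "open (\<Inter>i\<in>I. {x. 0 < slack i x})"
      using fin by (intro open_INT ballI open_Collect_less continuous_intros)
    moreover have "(\<Inter>i\<in>I. {x. 0 < slack i x}) \<subseteq> polyhedron_of I"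
      by (auto simp: polyhedron_of_slack less_imp_le)
    ultimately show False using xP interiorI by blast
  qed
  then show "x \<in> (\<Union>i\<in>I. facet I i)" using xP by (force simp: facet_def polyhedron_of_slack)
qed

lemma facet_subset_frontier:
  assumes i: "i \<in> I" "norm (fst i) = 1"
  shows "facet I i \<subseteq> frontier (polyhedron_of I)"
proof
  fix x assume x: "x \<in> facet I i"
  have "x \<notin> interior (polyhedron_of I)"
  proof
    assume "x \<in> interior (polyhedron_of I)"
    then obtain e where e: "e > 0" "cball x e \<subseteq> polyhedron_of I" by (auto simp: mem_interior_cball)
    have "x + e *\<^sub>R fst i \<in> cball x e" using e i by (simp add: dist_norm)
    then have "0 \<le> slack i (x + e *\<^sub>R fst i)" using e i(1) by (auto simp: polyhedron_of_slack)
    then show False using x e i by (simp add: slack_add facet_def dot_square_norm)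
  qed
  moreover have "x \<in> polyhedron_of I" using x by (simp add: facet_def)
  ultimately show "x \<in> frontier (polyhedron_of I)"
    using closure_subset by (auto simp: frontier_def)
qed

lemma compact_facet: "bounded (polyhedron_of I) \<Longrightarrow> compact (facet I i)"
  unfolding facet_def compact_eq_bounded_closed
  by (intro conjI closed_Collect_conj[of "\<lambda>x. x \<in> polyhedron_of I", simplified] closed_polyhedron_of
      closed_Collect_eq continuous_intros) (auto intro: bounded_subset)

text \<open>Outer normals are monotone: the two facet inequalities give \<open>(s *\<^sub>R fst i -
  t *\<^sub>R fst j) \<bullet> (y - x) \<le> 0\<close>. On rays that meet, the left factor equals
  \<open>y - x\<close>, so the base points coincide, and then the unit normals and the offsets do
  too.\<close>

lemma outward_rays_disjoint:
  assumes i: "i \<in> I" "norm (fst i) = 1" and j: "j \<in> I" "norm (fst j) = 1"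
    and x: "x \<in> facet I i" and y: "y \<in> facet I j" and s: "0 < s" and t: "0 < t"
    and eq: "x + s *\<^sub>R fst i = y + t *\<^sub>R fst j"
  shows "i = j"
proof -
  have ix: "fst i \<bullet> x = snd i" "fst j \<bullet> y = snd j" using x y by (auto simp: facet_def slack_def)
  have "fst i \<bullet> y \<le> snd i" "fst j \<bullet> x \<le> snd j"
    using x y i j by (auto simp: facet_def polyhedron_of_def)
  then have "fst i \<bullet> (y - x) \<le> 0" "fst j \<bullet> (x - y) \<le> 0" using ix by (auto simp: inner_diff_right)
  then have "s * (fst i \<bullet> (y - x)) + t * (fst j \<bullet> (x - y)) \<le> 0"
    using s t by (intro add_nonpos_nonpos mult_nonneg_nonpos) auto
  moreover have "s * (fst i \<bullet> (y - x)) + t * (fst j \<bullet> (x - y)) = (s *\<^sub>R fst i - t *\<^sub>R fst j) \<bullet> (y - x)"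
    by (simp add: inner_diff_left inner_diff_right algebra_simps)
  moreover have "s *\<^sub>R fst i - t *\<^sub>R fst j = y - x" using eq by (simp add: algebra_simps)
  ultimately have "(y - x) \<bullet> (y - x) \<le> 0" by simp
  then have "y - x = 0" by (metis inner_gt_zero_iff not_less)
  then have xy: "x = y" by simp
  then have st: "s *\<^sub>R fst i = t *\<^sub>R fst j" using eq by simp
  then have "norm (s *\<^sub>R fst i) = norm (t *\<^sub>R fst j)" by simp
  then have "s = t" using s t i j by simp
  then have "fst i = fst j" using st s by simp
  then show ?thesis using ix xy by (simp add: prod_eq_iff)
qed

text \<open>The prisms of height \<epsilon> erected outwards over the facets do not overlap, and
  they fit between \<open>P\<close> and \<open>Y\<close>. Each has at least \<epsilon> times the
  Hausdorff measure of its facet as volume, and the facets cover the frontier.\<close>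

lemma hausdorff_frontier_polyhedron_le:
  fixes I :: "('a::euclidean_space \<times> real) set"
  defines "P \<equiv> polyhedron_of I"
  assumes fin: "finite I" and unit: "\<And>i. i \<in> I \<Longrightarrow> norm (fst i) = 1" and bd: "bounded P"
    and \<epsilon>: "0 < \<epsilon>" and Y: "Y \<in> lmeasurable" "(\<Union>x\<in>P. cball x \<epsilon>) \<subseteq> Y"
  shows "hausdorff_measure (DIM('a) - 1) (frontier P) \<le> ennreal ((measure lebesgue Y - measure lebesgue P) / \<epsilon>)"
proof -
  let ?pr = "\<lambda>i. prism (facet I i) (fst i) \<epsilon>"
  have cF: "compact (facet I i)" for i using bd compact_facet by (simp add: P_def)
  \<comment> \<open>Removing the base, a null set, leaves only points at positive height, as the
    disjointness of outward rays requires.\<close>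
  define T where "T i = ?pr i - {x. fst i \<bullet> x = snd i}" for i
  have negl: "negligible {x. fst i \<bullet> x = snd i}" if "i \<in> I" for i
    using unit[OF that] by (intro negligible_hyperplane) auto
  have T: "T i \<in> lmeasurable" "measure lebesgue (T i) = measure lebesgue (?pr i)" if "i \<in> I" for i
  proof -
    have N: "{x. fst i \<bullet> x = snd i} \<in> null_sets lebesgue"
      using negl[OF that] by (simp only: negligible_iff_null_sets)
    show "T i \<in> lmeasurable" unfolding T_def
      by (rule fmeasurable_Diff[OF lmeasurable_prism[OF cF] null_setsD2[OF N]])
    show "measure lebesgue (T i) = measure lebesgue (?pr i)" unfolding T_def
      by (rule measure_Diff_null_set[OF fmeasurableD[OF lmeasurable_prism[OF cF]] N])
  qed
  have Tray: "\<exists>y s. y \<in> facet I i \<and> 0 < s \<and> s \<le> \<epsilon> \<and> x = y + s *\<^sub>R fst i" if x: "x \<in> T i" for x i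
  proof -
    have "x \<in> ?pr i" and neq: "fst i \<bullet> x \<noteq> snd i" using x by (simp_all add: T_def)
    then obtain y s where ys: "y \<in> facet I i" "0 \<le> s" "s \<le> \<epsilon>" "x = y + s *\<^sub>R fst i"
      unfolding prism_def by blast
    have "s \<noteq> 0"
    proof
      assume "s = 0"
      then have "slack i x = 0" using ys by (simp add: facet_def)
      then show False using neq by (simp add: slack_def)
    qed
    then have "0 < s" using ys(2) by simp
    then show ?thesis using ys by blast
  qed
  have disj: "disjoint_family_on T I"
    unfolding disjoint_family_on_def
  proof (intro ballI impI, rule ccontr)
    fix i j assume ij: "i \<in> I" "j \<in> I" "i \<noteq> j" "T i \<inter> T j \<noteq> {}"
    then obtain z where "z \<in> T i" "z \<in> T j" by blast
    obtain x s where xs: "x \<in> facet I i" "0 < s" "z = x + s *\<^sub>R fst i" using Tray[OF \<open>z \<in> T i\<close>] by blast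
    obtain y t where yt: "y \<in> facet I j" "0 < t" "z = y + t *\<^sub>R fst j" using Tray[OF \<open>z \<in> T j\<close>] by blast
    have "x + s *\<^sub>R fst i = y + t *\<^sub>R fst j" using xs(3) yt(3) by simp
    then have "i = j"
      by (rule outward_rays_disjoint[OF ij(1) unit[OF ij(1)] ij(2) unit[OF ij(2)] xs(1) yt(1) xs(2) yt(2)])
    then show False using ij(3) by simp
  qed
  have PY: "P \<subseteq> Y" using Y(2) \<epsilon> by (force simp: subset_iff)
  have Pm: "P \<in> lmeasurable" using bd closed_polyhedron_of[of I] unfolding P_def
    by (intro lmeasurable_compact) (simp add: compact_eq_bounded_closed)
  have sub: "(\<Union>i\<in>I. T i) \<subseteq> Y - P"
  proof safe
    fix i x assume i: "i \<in> I" and x: "x \<in> T i"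
    obtain y s where ys: "y \<in> facet I i" "0 < s" "s \<le> \<epsilon>" "x = y + s *\<^sub>R fst i" using Tray[OF x] by blast
    have "x \<in> cball y \<epsilon>" using ys unit[OF i] by (simp add: dist_norm)
    moreover have "y \<in> P" using ys by (simp add: facet_def P_def)
    ultimately show "x \<in> Y" using Y(2) by blast
    assume "x \<in> P"
    then have "0 \<le> slack i x" using i by (simp add: P_def polyhedron_of_slack)
    then show False using ys unit[OF i] by (simp add: slack_add facet_def dot_square_norm)
  qed
  have Ts: "T ` I \<subseteq> sets lebesgue" using T(1) by (simp add: image_subset_iff fmeasurableD)
  have Tf: "\<And>i. i \<in> I \<Longrightarrow> emeasure lebesgue (T i) \<noteq> \<infinity>"
    unfolding infinity_ennreal_def by (rule fmeasurableD2[OF T(1)])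
  have "hausdorff_measure (DIM('a) - 1) (frontier P) \<le> hausdorff_measure (DIM('a) - 1) (\<Union>i\<in>I. facet I i)"
    unfolding P_def by (intro hausdorff_measure_mono frontier_polyhedron_subset fin)
  also have "\<dots> \<le> (\<Sum>i\<in>I. hausdorff_measure (DIM('a) - 1) (facet I i))"
    by (rule hausdorff_measure_UN[OF fin])
  also have "\<dots> \<le> (\<Sum>i\<in>I. ennreal (measure lebesgue (?pr i) / \<epsilon>))"
  proof (rule sum_mono)
    fix i assume i: "i \<in> I"
    show "hausdorff_measure (DIM('a) - 1) (facet I i) \<le> ennreal (measure lebesgue (?pr i) / \<epsilon>)"
      by (rule flat_hausdorff_measure_le[OF unit[OF i] \<epsilon> cF, where c="snd i"])
        (simp add: facet_def slack_def inner_commute)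
  qed
  also have "\<dots> = ennreal (\<Sum>i\<in>I. measure lebesgue (?pr i) / \<epsilon>)" using \<epsilon> by (intro sum_ennreal) auto
  also have "(\<Sum>i\<in>I. measure lebesgue (?pr i) / \<epsilon>) = (\<Sum>i\<in>I. measure lebesgue (T i)) / \<epsilon>"
    by (simp add: T(2) sum_divide_distrib)
  also have "(\<Sum>i\<in>I. measure lebesgue (T i)) = measure lebesgue (\<Union>i\<in>I. T i)"
    by (rule measure_finite_Union[OF fin Ts disj Tf, symmetric])
  also have "\<dots> \<le> measure lebesgue (Y - P)"
    by (rule measure_mono_fmeasurable[OF sub sets.finite_UN[OF fin fmeasurableD[OF T(1)]]
          fmeasurable_Diff[OF Y(1) fmeasurableD[OF Pm]]])
  also have "measure lebesgue (Y - P) = measure lebesgue Y - measure lebesgue P"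
    by (rule measurable_measure_Diff[OF Y(1) fmeasurableD[OF Pm] PY])
  finally show ?thesis using \<epsilon> by (simp add: divide_right_mono ennreal_leI)
qed

text \<open>Below, \<open>T\<close> consists of points whose nearest facet is nearest with a margin \<open>\<eta>\<close>. Their feet
  lie on shrunk facets at mutual distance at least \<open>\<eta>\<close>, so a set of small diameter meets only one of
  them.\<close>

lemma hausdorff_frontier_polyhedron_ge_margin:
  fixes I :: "('a::euclidean_space \<times> real) set"
  defines "P \<equiv> polyhedron_of I"
  assumes fin: "finite I" and unit: "\<And>i. i \<in> I \<Longrightarrow> norm (fst i) = 1" and bd: "bounded P"
    and \<epsilon>: "0 < \<epsilon>" and \<eta>: "0 < \<eta>" and T: "T \<in> lmeasurable" "T \<subseteq> P"
    and margin: "\<And>x. x \<in> T \<Longrightarrow> \<exists>i\<in>I. slack i x \<le> \<epsilon> \<and> (\<forall>j\<in>I - {i}. slack i x + \<eta> \<le> slack j x)"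
  shows "ennreal (measure lebesgue T) \<le> ennreal \<epsilon> * hausdorff_measure (DIM('a) - 1) (frontier P)"
proof -
  let ?m = "DIM('a) - 1"
  define F where "F i = {y \<in> facet I i. \<forall>j\<in>I - {i}. \<eta> \<le> slack j y}" for i
  have "compact (F i)" for i
  proof -
    have "F i = facet I i \<inter> (\<Inter>j\<in>I - {i}. {y. \<eta> \<le> slack j y})" by (auto simp: F_def)
    moreover have "closed (\<Inter>j\<in>I - {i}. {y. \<eta> \<le> slack j y})"
      by (intro closed_INT ballI closed_Collect_le continuous_intros)
    ultimately show ?thesis
      using compact_Int_closed[OF compact_facet[of I i]] bd unfolding P_def by metis
  qed note cF = this
  have foot: "\<exists>i\<in>I. \<exists>y\<in>F i. \<exists>t. 0 \<le> t \<and> t \<le> \<epsilon> \<and> x = y + t *\<^sub>R (- fst i)" if x: "x \<in> T" for x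
  proof -
    obtain i where i: "i \<in> I" "slack i x \<le> \<epsilon>" "\<And>j. j \<in> I - {i} \<Longrightarrow> slack i x + \<eta> \<le> slack j x"
      using margin[OF x] by blast
    let ?t = "slack i x" and ?y = "x + slack i x *\<^sub>R fst i"
    have t0: "0 \<le> ?t" using x T(2) i by (auto simp: P_def polyhedron_of_slack)
    have si: "slack i ?y = 0" using unit[OF i(1)] by (simp add: slack_add dot_square_norm)
    \<comment> \<open>On the way to the foot the slack of constraint \<open>i\<close> falls at rate
      1 and every other slack at rate at most 1, so the margin \<eta> survives.\<close>
    have sj: "\<eta> \<le> slack j ?y" if j: "j \<in> I - {i}" for j
    proof -
      have "fst j \<bullet> fst i \<le> norm (fst j) * norm (fst i)" by (rule norm_cauchy_schwarz)
      then have "?t * (fst j \<bullet> fst i) \<le> ?t * 1" using unit i j t0 by (intro mult_left_mono) auto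
      then show ?thesis using i(3)[OF j] by (simp add: slack_add)
    qed
    have "0 \<le> slack j ?y" if "j \<in> I" for j using si sj[of j] \<eta> that by (cases "j = i") auto
    then have "?y \<in> F i" using si sj by (auto simp: F_def facet_def polyhedron_of_slack)
    moreover have "x = ?y + ?t *\<^sub>R (- fst i)" by simp
    ultimately show ?thesis using i t0 by blast
  qed
  have sep: "\<eta> \<le> dist y z" if yz: "y \<in> F i" "z \<in> F j" and ij: "i \<in> I" "j \<in> I" "i \<noteq> j" for y z i j
  proof -
    have "\<eta> \<le> slack j y" "slack j z = 0" using yz ij by (auto simp: F_def facet_def)
    then have "\<eta> \<le> fst j \<bullet> (z - y)" by (simp add: slack_def inner_diff_right)
    also have "\<dots> \<le> norm (fst j) * norm (z - y)" by (rule norm_cauchy_schwarz)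
    also have "\<dots> = dist y z" using unit ij by (simp add: dist_norm norm_minus_commute)
    finally show ?thesis .
  qed
  have "ennreal (measure lebesgue T) \<le> ennreal \<epsilon> * hausdorff_content ?m (\<eta> / 2) (frontier P)"
  proof -
    have main: "ennreal (measure lebesgue T) \<le> ennreal \<epsilon> * (\<Sum>n. disc_weight ?m (U n))"
      if U: "fine_cover (\<eta> / 2) (frontier P) U" for U
    proof -
      have bU: "bounded (U n)" "diameter (U n) \<le> \<eta> / 2" for n using U by (auto simp: fine_cover_def)
      \<comment> \<open>Taking closures makes the pieces compact without changing the diameters of
        the covering sets.\<close>
      define A where "A n i = closure (U n) \<inter> F i" for n i
      define B where "B n = (\<Union>i\<in>I. prism (A n i) (- fst i) \<epsilon>)" for n
      have cA: "compact (A n i)" for n i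
        unfolding A_def by (intro closed_Int_compact cF closed_closure)
      have Bm: "B n \<in> lmeasurable" for n unfolding B_def
        using fin cA by (intro fmeasurable.finite_UN lmeasurable_prism) auto
      have TB: "T \<subseteq> (\<Union>n. B n)"
      proof
        fix x assume "x \<in> T"
        then obtain i y t where *: "i \<in> I" "y \<in> F i" "0 \<le> t" "t \<le> \<epsilon>" "x = y + t *\<^sub>R (- fst i)"
          using foot by blast
        have "y \<in> frontier P" using * facet_subset_frontier[OF *(1) unit[OF *(1)]]
          by (auto simp: F_def P_def)
        then obtain n where "y \<in> U n" using U by (auto simp: fine_cover_def)
        then have "y \<in> A n i" using * closure_subset by (auto simp: A_def)
        then have "x \<in> prism (A n i) (- fst i) \<epsilon>" using * unfolding prism_def by blast
        then show "x \<in> (\<Union>n. B n)" using * unfolding B_def by blast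
      qed
      have Bn: "emeasure lebesgue (B n) \<le> ennreal \<epsilon> * disc_weight ?m (U n)" for n
      proof (cases "\<exists>i\<in>I. A n i \<noteq> {}")
        case False
        then have "B n = {}" by (auto simp: B_def prism_def)
        then show ?thesis by simp
      next
        case True
        then obtain i y where i: "i \<in> I" "y \<in> A n i" by blast
        have "A n j = {}" if "j \<in> I" "j \<noteq> i" for j
        proof (rule ccontr)
          assume "A n j \<noteq> {}"
          then obtain z where z: "z \<in> A n j" by blast
          have "\<eta> \<le> dist y z" using sep[of y i z j] i z that by (auto simp: A_def)
          also have "\<dots> \<le> diameter (closure (U n))"
            using i z bU by (intro diameter_bounded_bound) (auto simp: A_def)
          also have "\<dots> \<le> \<eta> / 2" using bU by (simp add: diameter_closure)
          finally show False using \<eta> by simp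
        qed
        then have "prism (A n j) (- fst j) \<epsilon> \<subseteq> prism (A n i) (- fst i) \<epsilon>" if "j \<in> I" for j
          using that by (cases "j = i") (auto simp: prism_def)
        then have "B n = prism (A n i) (- fst i) \<epsilon>"
          using i(1) unfolding B_def by blast
        then have "measure lebesgue (B n) \<le> \<epsilon> * unit_ball_vol (real ?m) * (diameter (A n i) / 2) ^ ?m"
          using \<epsilon> unit[OF i(1)]
          by (simp only:) (rule measure_prism_le_diameter[OF cA, where c="- snd i"],
              auto simp: A_def F_def facet_def slack_def inner_commute)
        also have "\<dots> = \<epsilon> * (unit_ball_vol (real ?m) * (diameter (A n i) / 2) ^ ?m)" by simp
        also have "\<dots> \<le> \<epsilon> * (unit_ball_vol (real ?m) * (diameter (U n) / 2) ^ ?m)"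
        proof (intro mult_left_mono power_mono divide_right_mono)
          have "diameter (A n i) \<le> diameter (closure (U n))"
            using bU by (intro diameter_subset) (auto simp: A_def)
          then show "diameter (A n i) \<le> diameter (U n)" using bU by (simp add: diameter_closure)
          show "0 \<le> diameter (A n i) / 2" using diameter_ge_0[OF compact_imp_bounded[OF cA]] by simp
        qed (use \<epsilon> in auto)
        finally have "ennreal (measure lebesgue (B n)) \<le> ennreal (\<epsilon> * (unit_ball_vol (real ?m) * (diameter (U n) / 2) ^ ?m))"
          by (rule ennreal_leI)
        moreover have "U n \<noteq> {}" using i by (auto simp: A_def)
        moreover have "0 \<le> diameter (U n)" using bU by (intro diameter_ge_0)
        then have "ennreal (\<epsilon> * (unit_ball_vol (real ?m) * (diameter (U n) / 2) ^ ?m))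
            = ennreal \<epsilon> * ennreal (unit_ball_vol (real ?m) * (diameter (U n) / 2) ^ ?m)"
          using \<epsilon> by (intro ennreal_mult) auto
        ultimately show ?thesis
          using Bm by (simp only: disc_weight_def emeasure_eq_measure2 if_False)
      qed
      have "ennreal (measure lebesgue T) = emeasure lebesgue T" using T(1)
        by (simp add: emeasure_eq_measure2)
      also have "\<dots> \<le> emeasure lebesgue (\<Union>n. B n)"
        using TB Bm by (intro emeasure_mono) auto
      also have "\<dots> \<le> (\<Sum>n. emeasure lebesgue (B n))"
        using Bm by (intro emeasure_subadditive_countably) auto
      also have "\<dots> \<le> (\<Sum>n. ennreal \<epsilon> * disc_weight ?m (U n))"
        by (intro suminf_le Bn summableI)
      also have "\<dots> = ennreal \<epsilon> * (\<Sum>n. disc_weight ?m (U n))" by simp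
      finally show ?thesis .
    qed
    have "ennreal (measure lebesgue T / \<epsilon>) \<le> hausdorff_content ?m (\<eta> / 2) (frontier P)"
      unfolding hausdorff_content_altdef
    proof (rule INF_greatest)
      fix U assume "U \<in> {U. fine_cover (\<eta> / 2) (frontier P) U}"
      then have le: "ennreal (measure lebesgue T) \<le> ennreal \<epsilon> * (\<Sum>n. disc_weight ?m (U n))"
        by (intro main) simp
      show "ennreal (measure lebesgue T / \<epsilon>) \<le> (\<Sum>n. disc_weight ?m (U n))"
      proof (cases "\<Sum>n. disc_weight ?m (U n)")
        case (real \<sigma>)
        then have "ennreal (measure lebesgue T) \<le> ennreal (\<epsilon> * \<sigma>)"
          using le \<epsilon> by (simp only: ennreal_mult)
        then have "measure lebesgue T \<le> \<epsilon> * \<sigma>" using \<epsilon> real by (subst (asm) ennreal_le_iff) auto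
        then have "measure lebesgue T / \<epsilon> \<le> \<sigma>" using \<epsilon> by (simp add: pos_divide_le_eq mult.commute)
        then show ?thesis unfolding real by (rule ennreal_leI)
      next
        case top
        show ?thesis unfolding top by (rule top_greatest)
      qed
    qed
    then have "ennreal \<epsilon> * ennreal (measure lebesgue T / \<epsilon>) \<le> ennreal \<epsilon> * hausdorff_content ?m (\<eta> / 2) (frontier P)"
      by (rule mult_left_mono) simp
    moreover have "ennreal \<epsilon> * ennreal (measure lebesgue T / \<epsilon>) = ennreal (\<epsilon> * (measure lebesgue T / \<epsilon>))"
      using \<epsilon> by (intro ennreal_mult[symmetric]) auto
    ultimately show ?thesis using \<epsilon> by simp
  qed
  also have "\<dots> \<le> ennreal \<epsilon> * hausdorff_measure ?m (frontier P)"
    using \<eta> by (intro mult_left_mono hausdorff_content_le_measure) auto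
  finally show ?thesis .
qed

text \<open>A point whose \<epsilon>-ball leaves \<open>P\<close> has smallest slack at most
  \<epsilon>. If this minimum is attained once, the point has some margin
  \<open>1 / real (Suc k)\<close> and lies in \<open>T k\<close>; points with ties lie on finitely
  many hyperplanes, collected in \<open>N\<close>. The margin version then passes to the limit along
  the increasing sets \<open>T k\<close>.\<close>

lemma hausdorff_frontier_polyhedron_ge:
  fixes I :: "('a::euclidean_space \<times> real) set"
  defines "P \<equiv> polyhedron_of I"
  assumes fin: "finite I" and unit: "\<And>i. i \<in> I \<Longrightarrow> norm (fst i) = 1" and bd: "bounded P"
    and \<epsilon>: "0 < \<epsilon>" and E: "E \<in> lmeasurable" "E \<subseteq> P" "\<And>x. x \<in> E \<Longrightarrow> \<not> cball x \<epsilon> \<subseteq> P"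
  shows "ennreal (measure lebesgue E) \<le> ennreal \<epsilon> * hausdorff_measure (DIM('a) - 1) (frontier P)"
proof -
  define T where "T k = {x \<in> E. \<exists>i\<in>I. slack i x \<le> \<epsilon> \<and> (\<forall>j\<in>I - {i}. slack i x + 1 / real (Suc k) \<le> slack j x)}"
    for k
  define N where "N = (\<Union>i\<in>I. \<Union>j\<in>I - {i}. {x. (fst i - fst j) \<bullet> x = snd i - snd j})"
  have "closed {x. \<exists>i\<in>I. slack i x \<le> \<epsilon> \<and> (\<forall>j\<in>I - {i}. slack i x + 1 / real (Suc k) \<le> slack j x)}" for k
  proof -
    have "{x. \<exists>i\<in>I. slack i x \<le> \<epsilon> \<and> (\<forall>j\<in>I - {i}. slack i x + 1 / real (Suc k) \<le> slack j x)}
      = (\<Union>i\<in>I. {x. slack i x \<le> \<epsilon>} \<inter> (\<Inter>j\<in>I - {i}. {x. slack i x + 1 / real (Suc k) \<le> slack j x}))" by auto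
    then show ?thesis using fin
      by (simp only:) (intro closed_UN closed_Int closed_INT ballI closed_Collect_le continuous_intros)
  qed
  then have Tm: "T k \<in> lmeasurable" for k
    unfolding T_def Collect_conj_eq Collect_mem_eq using E(1)
      by (intro fmeasurable_Int_fmeasurable) auto
  have hyp: "negligible {x. (fst i - fst j) \<bullet> x = snd i - snd j}" if "i \<noteq> j" for i j :: "'a \<times> real"
  proof (cases "fst i = fst j")
    case True
    then have "{x. (fst i - fst j) \<bullet> x = snd i - snd j} = {}" using that by (auto simp: prod_eq_iff)
    then show ?thesis by simp
  qed (intro negligible_hyperplane, auto)
  have "negligible (\<Union>j\<in>I - {i}. {x. (fst i - fst j) \<bullet> x = snd i - snd j})" for i
    using fin by (intro negligible_Union) (auto intro!: hyp simp del: prod.collapse split_paired_All)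
  then have N: "negligible N" unfolding N_def using fin by (intro negligible_Union) auto
  have inc: "incseq T"
  proof (rule incseq_SucI, rule subsetI)
    fix k x assume "x \<in> T k"
    then obtain i where i: "x \<in> E" "i \<in> I" "slack i x \<le> \<epsilon>" "\<forall>j\<in>I - {i}. slack i x + 1 / real (Suc k) \<le> slack j x"
      by (auto simp: T_def)
    have "1 / real (Suc (Suc k)) \<le> 1 / real (Suc k)" by (intro divide_left_mono) auto
    then have "\<forall>j\<in>I - {i}. slack i x + 1 / real (Suc (Suc k)) \<le> slack j x"
      using i(4) by (meson add_left_mono order_trans)
    with i(1-3) show "x \<in> T (Suc k)" unfolding T_def by blast
  qed
  have cover: "E \<subseteq> (\<Union>k. T k) \<union> N"
  proof
    fix x assume x: "x \<in> E"
    have Ine: "I \<noteq> {}" using E(3)[OF x] by (auto simp: P_def polyhedron_of_def)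
    obtain i where i: "i \<in> I" "\<And>j. j \<in> I \<Longrightarrow> slack i x \<le> slack j x"
      using arg_min_if_finite[OF fin Ine, of "\<lambda>i. slack i x"] by (metis not_le)
    have sle: "slack i x \<le> \<epsilon>"
    proof (rule ccontr)
      assume big: "\<not> slack i x \<le> \<epsilon>"
      have "cball x \<epsilon> \<subseteq> P"
      proof
        fix z assume z: "z \<in> cball x \<epsilon>"
        have "0 \<le> slack j z" if j: "j \<in> I" for j
        proof -
          have "fst j \<bullet> (z - x) \<le> norm (fst j) * norm (z - x)" by (rule norm_cauchy_schwarz)
          also have "\<dots> \<le> \<epsilon>" using unit[OF j] z by (simp add: dist_norm norm_minus_commute)
          also have "\<dots> \<le> slack j x" using big i(2)[OF j] by simp
          finally show ?thesis by (simp add: slack_def inner_diff_right)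
        qed
        then show "z \<in> P" by (simp add: P_def polyhedron_of_slack)
      qed
      then show False using E(3)[OF x] by simp
    qed
    show "x \<in> (\<Union>k. T k) \<union> N"
    proof (cases "\<exists>j\<in>I - {i}. slack j x = slack i x")
      case True
      then obtain j where "j \<in> I - {i}" "slack j x = slack i x" by blast
      then have "x \<in> N" unfolding N_def
        by (intro UN_I[OF i(1)] UN_I[of j]) (simp_all add: slack_def inner_diff_left)
      then show ?thesis by simp
    next
      case False
      then have pos: "0 < slack j x - slack i x" if "j \<in> I - {i}" for j
      proof -
        have "slack i x \<le> slack j x" "slack j x \<noteq> slack i x" using i(2) that False by auto
        then show ?thesis by simp
      qed
      obtain k where k: "\<forall>j\<in>I - {i}. 1 / real (Suc k) \<le> slack j x - slack i x"
      proof (cases "I - {i} = {}")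
        case True then show ?thesis using that by blast
      next
        case False
        define g where "g = Min ((\<lambda>j. slack j x - slack i x) ` (I - {i}))"
        have "0 < g" unfolding g_def using False fin pos by (subst Min_gr_iff) auto
        then obtain k where "inverse (real (Suc k)) < g" using reals_Archimedean by blast
        moreover have "g \<le> slack j x - slack i x" if "j \<in> I - {i}" for j
          unfolding g_def using fin that by (intro Min_le) auto
        ultimately have "\<forall>j\<in>I - {i}. 1 / real (Suc k) \<le> slack j x - slack i x"
          unfolding inverse_eq_divide by (meson less_le_trans less_imp_le)
        then show ?thesis by (rule that)
      qed
      then have "\<forall>j\<in>I - {i}. slack i x + 1 / real (Suc k) \<le> slack j x"
        by (simp add: le_diff_eq add.commute)
      then have "x \<in> T k" using x i(1) sle unfolding T_def by blast
      then show ?thesis by blast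
    qed
  qed
  have le: "ennreal (measure lebesgue (T k)) \<le> ennreal \<epsilon> * hausdorff_measure (DIM('a) - 1) (frontier P)"
    for k
    unfolding P_def
  proof (rule hausdorff_frontier_polyhedron_ge_margin[OF fin unit _ \<epsilon>, of "1 / real (Suc k)"])
    show "bounded (polyhedron_of I)" using bd by (simp add: P_def)
    show "T k \<subseteq> polyhedron_of I" using E(2) by (auto simp: T_def P_def)
  qed (use Tm in \<open>auto simp: T_def\<close>)
  have "emeasure lebesgue E \<le> emeasure lebesgue ((\<Union>k. T k) \<union> N)"
    using cover Tm N by (intro emeasure_mono) (auto simp: negligible_imp_sets)
  also have "\<dots> = emeasure lebesgue (\<Union>k. T k)"
    using Tm N by (intro emeasure_Un_null_set) (auto simp: negligible_iff_null_sets)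
  also have "\<dots> = (SUP k. emeasure lebesgue (T k))"
    using Tm inc by (intro SUP_emeasure_incseq[symmetric]) auto
  also have "\<dots> \<le> ennreal \<epsilon> * hausdorff_measure (DIM('a) - 1) (frontier P)"
    using le Tm by (intro SUP_least) (simp add: emeasure_eq_measure2)
  finally show ?thesis using E(1) by (simp add: emeasure_eq_measure2)
qed

text \<open>Projection to the nearest point of \<open>K\<close> is nonexpansive and maps the
  frontier of \<open>L\<close> onto at least the frontier of \<open>K\<close>: from a frontier point
  of \<open>K\<close>, follow an outer normal until it leaves \<open>L\<close>; the exit point
  projects back.\<close>

lemma hausdorff_measure_frontier_mono:
  fixes K L :: "'a::euclidean_space set"
  assumes K: "convex K" "closed K" "interior K \<noteq> {}" and L: "closed L" "bounded L" and sub: "K \<subseteq> L"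
  shows "hausdorff_measure s (frontier K) \<le> hausdorff_measure s (frontier L)"
proof -
  have ne: "K \<noteq> {}" using K interior_subset by blast
  have "frontier K \<subseteq> closest_point K ` frontier L"
  proof
    fix y assume y: "y \<in> frontier K"
    then have yK: "y \<in> K" "y \<notin> interior K" using K by (auto simp: frontier_def)
    then have "y \<notin> rel_interior K" using K by (simp add: rel_interior_nonempty_interior)
    then obtain a where a: "a \<noteq> 0" "\<And>z. z \<in> K \<Longrightarrow> a \<bullet> y \<le> a \<bullet> z"
      using supporting_hyperplane_rel_boundary[OF K(1) yK(1)] by metis
    \<comment> \<open>The vector \<open>a\<close> supports \<open>K\<close> from inside, so
      \<open>- a\<close> is an outer normal at \<open>y\<close>. The largest parameter in
      \<open>S\<close> gives the last point of \<open>L\<close> on this ray.\<close>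
    define S where "S = {t. 0 \<le> t \<and> y - t *\<^sub>R a \<in> L}"
    have S0: "0 \<in> S" using yK sub by (auto simp: S_def)
    obtain B where B: "\<And>x. x \<in> L \<Longrightarrow> norm x \<le> B" using L(2) by (auto simp: bounded_iff)
    have "closed ((\<lambda>t. y - t *\<^sub>R a) -` L)"
      by (intro closed_vimage L continuous_intros)
    moreover have "S = {0..} \<inter> (\<lambda>t. y - t *\<^sub>R a) -` L" by (auto simp: S_def)
    ultimately have "closed S" by (simp add: closed_Int)
    moreover have "t \<le> (B + norm y) / norm a" if "t \<in> S" for t
    proof -
      have "t * norm a = norm (y - (y - t *\<^sub>R a))" using that by (simp add: S_def)
      also have "\<dots> \<le> norm y + norm (y - t *\<^sub>R a)" by (rule norm_triangle_ineq4)
      also have "\<dots> \<le> norm y + B" using that B by (simp add: S_def)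
      finally show ?thesis using a(1) by (simp add: field_simps)
    qed
    then have bdd: "bdd_above S" by (auto simp: bdd_above_def)
    ultimately have max: "Sup S \<in> S" using S0 closed_contains_Sup by blast
    define z where "z = y - Sup S *\<^sub>R a"
    have t0: "0 \<le> Sup S" and zL: "z \<in> L" using max by (auto simp: S_def z_def)
    have "z \<notin> interior L"
    proof
      assume "z \<in> interior L"
      then obtain e where e: "e > 0" "cball z e \<subseteq> L" by (auto simp: mem_interior_cball)
      have "z - (e / norm a) *\<^sub>R a \<in> cball z e" using e a by (simp add: dist_norm)
      then have "y - (Sup S + e / norm a) *\<^sub>R a \<in> L" using e by (auto simp: z_def algebra_simps)
      then have "Sup S + e / norm a \<in> S" using t0 e by (simp add: S_def)
      then have "Sup S + e / norm a \<le> Sup S" using bdd by (rule cSup_upper)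
      then show False using e a by (simp add: field_simps)
    qed
    then have zf: "z \<in> frontier L" using zL L by (simp add: frontier_def)
    have "y = closest_point K z"
    proof (rule closest_point_unique[OF K(1,2) yK(1)], rule ballI)
      fix w assume w: "w \<in> K"
      have "0 \<le> Sup S * (a \<bullet> (w - y))" using a(2)[OF w] t0 by (simp add: inner_diff_right)
      then have "(z - y) \<bullet> (w - y) \<le> 0" by (simp add: z_def)
      then have "(z - y) \<bullet> (z - y) \<le> (z - y) \<bullet> (z - w)" by (simp add: inner_diff_right)
      also have "\<dots> \<le> norm (z - y) * norm (z - w)" by (rule norm_cauchy_schwarz)
      finally have "norm (z - y) * norm (z - y) \<le> norm (z - y) * norm (z - w)"
        by (simp add: dot_square_norm power2_eq_square)
      then show "dist z y \<le> dist z w" by (cases "z = y") (auto simp: dist_norm)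
    qed
    then show "y \<in> closest_point K ` frontier L" using zf by blast
  qed
  then have "hausdorff_measure s (frontier K) \<le> hausdorff_measure s (closest_point K ` frontier L)"
    by (rule hausdorff_measure_mono)
  also have "\<dots> \<le> hausdorff_measure s (frontier L)"
    using K ne by (intro hausdorff_measure_nonexpansive_image closest_point_lipschitz)
  finally show ?thesis .
qed

text \<open>Each frontier point of \<open>U\<close> is strictly separated from \<open>K\<close>, and
  by compactness finitely many of these half-spaces cut off the whole frontier. Being connected,
  their intersection cannot leave \<open>U\<close> without meeting that frontier.\<close>

lemma polyhedron_between:
  fixes K :: "'a::euclidean_space set"
  assumes K: "compact K" "convex K" "K \<noteq> {}" and U: "open U" "bounded U" "K \<subseteq> U"
  shows "\<exists>I. finite I \<and> (\<forall>i\<in>I. norm (fst i) = 1) \<and> K \<subseteq> polyhedron_of I \<and> polyhedron_of I \<subseteq> U"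
proof -
  have "\<exists>i. norm (fst i) = 1 \<and> slack i x < 0 \<and> (\<forall>z\<in>K. 0 \<le> slack i z)" if x: "x \<in> frontier U" for x
  proof -
    have "x \<notin> K" using x U by (auto simp: frontier_def interior_open)
    then obtain a c where ac: "a \<bullet> x < c" "\<And>z. z \<in> K \<Longrightarrow> c < a \<bullet> z"
      using separating_hyperplane_closed_point[OF K(2) compact_imp_closed[OF K(1)]] by metis
    have a0: "a \<noteq> 0" using ac K(3) by force
    let ?i = "(- a /\<^sub>R norm a, - c / norm a)"
    have s: "slack ?i z = (a \<bullet> z - c) / norm a" for z
      by (simp add: slack_def diff_divide_distrib inverse_eq_divide)
    have "norm (fst ?i) = 1" using a0 by simp
    moreover have "slack ?i x < 0" unfolding s using ac a0 by (simp add: divide_neg_pos)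
    moreover have "\<forall>z\<in>K. 0 \<le> slack ?i z" unfolding s using ac a0
      by (auto intro!: divide_nonneg_nonneg less_imp_le)
    ultimately show ?thesis by blast
  qed
  then obtain i where i: "\<And>x. x \<in> frontier U \<Longrightarrow> norm (fst (i x)) = 1 \<and> slack (i x) x < 0 \<and> (\<forall>z\<in>K. 0 \<le> slack (i x) z)"
    by metis
  have "compact (frontier U)" using U by (simp add: compact_frontier_bounded)
  moreover have "open {z. slack (i x) z < 0}" for x by (intro open_Collect_less continuous_intros)
  moreover have "frontier U \<subseteq> (\<Union>x\<in>frontier U. {z. slack (i x) z < 0})" using i by blast
  ultimately obtain X where X: "X \<subseteq> frontier U" "finite X" "frontier U \<subseteq> (\<Union>x\<in>X. {z. slack (i x) z < 0})"
    by (rule compactE_image[of "frontier U" "frontier U" "\<lambda>x. {z. slack (i x) z < 0}"]) auto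
  let ?P = "polyhedron_of (i ` X)"
  have KP: "K \<subseteq> ?P" using X i by (auto simp: polyhedron_of_slack)
  have disj: "?P \<inter> frontier U = {}" using X(3) by (force simp: polyhedron_of_slack)
  have "?P \<subseteq> U"
  proof (rule ccontr)
    assume "\<not> ?P \<subseteq> U"
    moreover have "?P \<inter> U \<noteq> {}" using KP U K by blast
    ultimately have "?P \<inter> frontier U \<noteq> {}"
      by (intro connected_Int_frontier convex_connected convex_polyhedron_of) auto
    then show False using disj by simp
  qed
  then show ?thesis using KP X i by (intro exI[of _ "i ` X"]) auto
qed

subsection \<open>Parallel bodies of a convex domain\<close>

locale convex_domain =
  fixes \<Omega> :: "'a::euclidean_space set"
  assumes open_dom: "open \<Omega>" and bounded_dom: "bounded \<Omega>" and convex_dom: "convex \<Omega>"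
    and nonempty_dom: "\<Omega> \<noteq> {}"
begin

abbreviation d :: "'a \<Rightarrow> real" where "d \<equiv> bdist \<Omega>"

abbreviation R :: real where "R \<equiv> inradius \<Omega>"

lemma frontier_dom_nonempty: "frontier \<Omega> \<noteq> {}"
  using nonempty_dom bounded_dom not_bounded_UNIV by (auto simp: frontier_eq_empty)

lemma frontier_dom_disjoint: "x \<in> frontier \<Omega> \<Longrightarrow> x \<notin> \<Omega>"
  using open_dom by (auto simp: frontier_def interior_open)

lemma bdist_nonneg: "0 \<le> d x"
  by (simp add: bdist_def infdist_nonneg)

lemma bdist_triangle: "d x \<le> d y + dist x y"
  by (simp add: bdist_def infdist_triangle)

lemma bdist_le: "y \<in> frontier \<Omega> \<Longrightarrow> d x \<le> dist x y"
  by (simp add: bdist_def infdist_le)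

lemma continuous_bdist: "continuous_on S d"
  unfolding bdist_def by (intro continuous_intros)

lemma bdist_frontier: "x \<in> frontier \<Omega> \<Longrightarrow> d x = 0"
  by (simp add: bdist_def)

lemma bdist_pos: "x \<in> \<Omega> \<Longrightarrow> 0 < d x"
  unfolding bdist_def using frontier_dom_disjoint frontier_dom_nonempty
  by (intro infdist_pos_not_in_closed) auto

lemma bdist_foot:
  obtains y where "y \<in> frontier \<Omega>" "d x = dist x y"
  unfolding bdist_def using infdist_attains_inf[OF frontier_closed frontier_dom_nonempty] by metis

lemma ball_bdist_subset: 
  assumes "x \<in> \<Omega>" shows "ball x (d x) \<subseteq> \<Omega>"
proof (rule ccontr)
  assume "\<not> ball x (d x) \<subseteq> \<Omega>"
  then have "ball x (d x) - \<Omega> \<noteq> {}" by blast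
  moreover have "x \<in> ball x (d x) \<inter> \<Omega>" using assms bdist_pos by simp
  then have "ball x (d x) \<inter> \<Omega> \<noteq> {}" by blast
  ultimately have "ball x (d x) \<inter> frontier \<Omega> \<noteq> {}"
    by (intro connected_Int_frontier connected_ball)
  then obtain y where "dist x y < d x" "y \<in> frontier \<Omega>" by auto
  then show False using bdist_le[of y x] by linarith
qed

lemma ball_subset_imp_le_bdist:
  assumes "ball x r \<subseteq> \<Omega>" shows "r \<le> d x"
proof -
  obtain y where y: "y \<in> frontier \<Omega>" "d x = dist x y" by (rule bdist_foot)
  then have "y \<notin> ball x r" using assms frontier_dom_disjoint by blast
  then show ?thesis using y by simp
qed

text \<open>The balls of radius \<open>d x\<close> and \<open>d y\<close> lie in the convex domain,
  and the convex combination of two balls is the ball with averaged centre and radius.\<close>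

lemma bdist_concave:
  assumes x: "x \<in> \<Omega>" and y: "y \<in> \<Omega>" and t: "0 \<le> t" "t \<le> 1"
  shows "t * d x + (1 - t) * d y \<le> d (t *\<^sub>R x + (1 - t) *\<^sub>R y)"
proof (rule ball_subset_imp_le_bdist)
  let ?\<rho> = "t * d x + (1 - t) * d y" and ?z = "t *\<^sub>R x + (1 - t) *\<^sub>R y"
  have \<rho>: "0 < ?\<rho>"
    using t bdist_pos[OF x] bdist_pos[OF y] by (cases "t = 0") (auto intro: add_pos_nonneg)
  show "ball ?z ?\<rho> \<subseteq> \<Omega>"
  proof
    fix w assume w: "w \<in> ball ?z ?\<rho>"
    let ?u = "w - ?z"
    have u: "norm ?u / ?\<rho> < 1" using w \<rho> by (simp add: dist_norm norm_minus_commute)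
    have "p + (d p / ?\<rho>) *\<^sub>R ?u \<in> \<Omega>" if p: "p \<in> \<Omega>" for p
    proof -
      have "norm ((d p / ?\<rho>) *\<^sub>R ?u) = d p * (norm ?u / ?\<rho>)"
        using bdist_nonneg[of p] \<rho> by simp
      also have "\<dots> < d p * 1" using bdist_pos[OF p] u by (intro mult_strict_left_mono)
      finally show ?thesis using ball_bdist_subset[OF p] by (auto simp: dist_norm)
    qed
    from this[OF x] this[OF y]
    have "t *\<^sub>R (x + (d x / ?\<rho>) *\<^sub>R ?u) + (1 - t) *\<^sub>R (y + (d y / ?\<rho>) *\<^sub>R ?u) \<in> \<Omega>"
      using convexD[OF convex_dom, of _ _ t "1 - t"] t by simp
    also have "t *\<^sub>R (x + (d x / ?\<rho>) *\<^sub>R ?u) + (1 - t) *\<^sub>R (y + (d y / ?\<rho>) *\<^sub>R ?u)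
        = ?z + ((t * d x + (1 - t) * d y) / ?\<rho>) *\<^sub>R ?u"
      by (simp only: scaleR_add_right scaleR_scaleR add_divide_distrib scaleR_add_left times_divide_eq_right) (simp only: ac_simps)
    also have "\<dots> = w" using \<rho> by simp
    finally show "w \<in> \<Omega>" .
  qed
qed

text \<open>The supremum in \<open>inradius\<close> also runs over empty balls of radius at most 0.
  They do not matter, since the maximum of \<open>d\<close> over the compact closure is positive and
  hence attained inside.\<close>

lemma inradius_attained: obtains x0 where "x0 \<in> \<Omega>" "d x0 = R"
proof -
  have "compact (closure \<Omega>)" "closure \<Omega> \<noteq> {}" using bounded_dom nonempty_dom by auto
  then obtain x0 where x0: "x0 \<in> closure \<Omega>" "\<And>y. y \<in> closure \<Omega> \<Longrightarrow> d y \<le> d x0"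
    using continuous_attains_sup[OF _ _ continuous_bdist] by metis
  obtain z where z: "z \<in> \<Omega>" using nonempty_dom by blast
  have "0 < d x0" using x0(2)[of z] bdist_pos[OF z] z closure_subset by force
  then have "x0 \<notin> frontier \<Omega>" using bdist_frontier by force
  then have x0\<Omega>: "x0 \<in> \<Omega>" using x0(1) interior_subset by (auto simp: frontier_def)
  have "R = d x0" unfolding inradius_def
  proof (rule cSup_eq_maximum)
    show "d x0 \<in> {r. \<exists>x. ball x r \<subseteq> \<Omega>}" using ball_bdist_subset[OF x0\<Omega>] by blast
    fix r assume "r \<in> {r. \<exists>x. ball x r \<subseteq> \<Omega>}"
    then obtain x where x: "ball x r \<subseteq> \<Omega>" by blast
    show "r \<le> d x0"
    proof (cases "0 < r")
      case True
      then have "x \<in> closure \<Omega>" using x closure_subset[of \<Omega>] by (meson centre_in_ball subsetD)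
      then show ?thesis using ball_subset_imp_le_bdist[OF x] x0(2) by force
    next
      case False then show ?thesis using bdist_nonneg[of x0] by simp
    qed
  qed
  then show thesis using that x0\<Omega> by simp
qed

lemma inradius_pos: "0 < R"
  using inradius_attained bdist_pos by metis

lemma bdist_le_inradius:
  assumes "x \<in> \<Omega>" shows "d x \<le> R"
  unfolding inradius_def
proof (rule cSup_upper)
  show "d x \<in> {r. \<exists>x. ball x r \<subseteq> \<Omega>}" using ball_bdist_subset[OF assms] by blast
  obtain B where B: "\<And>x. x \<in> \<Omega> \<Longrightarrow> norm x \<le> B" using bounded_dom by (auto simp: bounded_iff)
  have fr: "\<And>y. y \<in> frontier \<Omega> \<Longrightarrow> norm y \<le> B"
  proof -
    have "closure \<Omega> \<subseteq> cball 0 B" using B by (intro closure_minimal) auto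
    then show "\<And>y. y \<in> frontier \<Omega> \<Longrightarrow> norm y \<le> B" by (auto simp: frontier_def)
  qed
  show "bdd_above {r. \<exists>x. ball x r \<subseteq> \<Omega>}"
  proof (rule bdd_aboveI)
    fix r assume "r \<in> {r. \<exists>x. ball x r \<subseteq> \<Omega>}"
    then obtain x where x: "ball x r \<subseteq> \<Omega>" by blast
    obtain y where y: "y \<in> frontier \<Omega>" using frontier_dom_nonempty by blast
    show "r \<le> max 0 (2 * B)"
    proof (cases "0 < r")
      case True
      then have "x \<in> \<Omega>" using x by auto
      have "r \<le> dist x y" using ball_subset_imp_le_bdist[OF x] bdist_le[OF y, of x] by linarith
      also have "\<dots> \<le> norm x + norm y" by (simp add: dist_norm norm_triangle_ineq4)
      also have "\<dots> \<le> 2 * B" using B[OF \<open>x \<in> \<Omega>\<close>] fr[OF y] by simp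
      finally show ?thesis by simp
    qed auto
  qed
qed

text \<open>The closed counterpart of \<open>inner_parallel\<close>: compact for positive
  \<open>r\<close>, so that Brunn--Minkowski applies, and with the same frontier and the same volume
  as the open set when \<open>0 < r < R\<close>.\<close>

definition K :: "real \<Rightarrow> 'a set" where
  "K r = {x \<in> \<Omega>. r \<le> d x}"

definition V :: "real \<Rightarrow> real" where
  "V r = measure lebesgue (K r)"

definition P :: "real \<Rightarrow> real" where
  "P r = perimeter (inner_parallel \<Omega> r)"

lemma inner_parallel_eq: "inner_parallel \<Omega> r = {x \<in> \<Omega>. r < d x}"
  by (simp add: inner_parallel_def)

lemma K_antimono: "r \<le> s \<Longrightarrow> K s \<subseteq> K r"
  by (auto simp: K_def)

lemma compact_K:
  assumes "0 < r" shows "compact (K r)"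
proof -
  have "K r = closure \<Omega> \<inter> {x. r \<le> d x}"
  proof
    show "K r \<subseteq> closure \<Omega> \<inter> {x. r \<le> d x}" using closure_subset by (auto simp: K_def)
    show "closure \<Omega> \<inter> {x. r \<le> d x} \<subseteq> K r"
    proof
      fix x assume x: "x \<in> closure \<Omega> \<inter> {x. r \<le> d x}"
      then have "x \<notin> frontier \<Omega>" using bdist_frontier assms by force
      then show "x \<in> K r" using x interior_subset by (auto simp: K_def frontier_def)
    qed
  qed
  moreover have "closed {x. r \<le> d x}"
    by (intro closed_Collect_le continuous_bdist continuous_intros)
  ultimately show ?thesis using bounded_dom by (simp add: compact_Int_closed)
qed

lemma mix_K: 
  assumes "0 \<le> t" "t \<le> 1" shows "mix t (K r) (K s) \<subseteq> K (t * r + (1 - t) * s)"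
proof
  fix z assume "z \<in> mix t (K r) (K s)"
  then obtain x y where xy: "x \<in> K r" "y \<in> K s" "z = t *\<^sub>R x + (1 - t) *\<^sub>R y" by (auto simp: mix_def)
  have "t * r + (1 - t) * s \<le> t * d x + (1 - t) * d y"
    using xy assms by (intro add_mono mult_left_mono) (auto simp: K_def)
  also have "\<dots> \<le> d z" using xy assms by (auto simp: K_def intro: bdist_concave)
  finally have "t * r + (1 - t) * s \<le> d z" .
  moreover have "z \<in> \<Omega>" using xy convexD[OF convex_dom, of x y t "1 - t"] assms by (simp add: K_def)
  ultimately show "z \<in> K (t * r + (1 - t) * s)" by (simp add: K_def)
qed

lemma convex_K: "convex (K r)"
proof (rule convexI)
  fix x y and s t :: real assume "x \<in> K r" "y \<in> K r" "0 \<le> s" "0 \<le> t" "s + t = 1"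
  moreover have "t = 1 - s" using \<open>s + t = 1\<close> by simp
  moreover have "s * r + (1 - s) * r = r" by (simp add: algebra_simps)
  ultimately show "s *\<^sub>R x + t *\<^sub>R y \<in> K r"
    using mix_K[of s r r] mixI[of x "K r" y "K r" s] by (simp add: subset_iff)
qed

lemma open_inner_parallel: "open (inner_parallel \<Omega> r)"
proof -
  have "inner_parallel \<Omega> r = \<Omega> \<inter> {x. r < d x}" by (auto simp: inner_parallel_eq)
  then show ?thesis
    by (simp only:) (intro open_Int open_dom open_Collect_less continuous_bdist continuous_intros)
qed

lemma inner_parallel_nonempty:
  assumes "r < R" shows "inner_parallel \<Omega> r \<noteq> {}"
proof -
  obtain x0 where "x0 \<in> \<Omega>" "d x0 = R" by (rule inradius_attained)
  then have "x0 \<in> inner_parallel \<Omega> r" using assms by (simp add: inner_parallel_eq)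
  then show ?thesis by blast
qed

lemma inner_parallel_subset_K: "inner_parallel \<Omega> r \<subseteq> K r"
  by (auto simp: inner_parallel_eq K_def)

lemma convex_inner_parallel: "convex (inner_parallel \<Omega> r)"
proof (rule convexI)
  fix x y and s t :: real assume xy: "x \<in> inner_parallel \<Omega> r" "y \<in> inner_parallel \<Omega> r"
    and st: "0 \<le> s" "0 \<le> t" "s + t = 1"
  let ?m = "min (d x) (d y)"
  have "x \<in> K ?m" "y \<in> K ?m" using xy by (auto simp: inner_parallel_eq K_def)
  then have "s *\<^sub>R x + t *\<^sub>R y \<in> K ?m" using convexD[OF convex_K] st by blast
  then show "s *\<^sub>R x + t *\<^sub>R y \<in> inner_parallel \<Omega> r" using xy by (auto simp: inner_parallel_eq K_def)
qed

text \<open>By concavity of \<open>d\<close>, moving a point of \<open>K r\<close> slightly towards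
  a point of maximal depth makes its depth exceed \<open>r\<close>.\<close>

lemma closure_inner_parallel:
  assumes r: "0 < r" "r < R" shows "closure (inner_parallel \<Omega> r) = K r"
proof
  show "closure (inner_parallel \<Omega> r) \<subseteq> K r"
    using compact_K[OF r(1)] inner_parallel_subset_K by (intro closure_minimal compact_imp_closed)
  show "K r \<subseteq> closure (inner_parallel \<Omega> r)"
  proof
    fix x assume x: "x \<in> K r"
    obtain x0 where x0: "x0 \<in> \<Omega>" "d x0 = R" by (rule inradius_attained)
    define f where "f n = (1 / real (Suc n)) *\<^sub>R x0 + (1 - 1 / real (Suc n)) *\<^sub>R x" for n
    have "f n \<in> inner_parallel \<Omega> r" for n
    proof -
      let ?t = "1 / real (Suc n)"
      have t: "0 < ?t" "?t \<le> 1" by auto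
      have "r = ?t * r + (1 - ?t) * r" by (simp add: algebra_simps)
      also have "\<dots> < ?t * d x0 + (1 - ?t) * d x"
        using r x x0 t
          by (intro add_less_le_mono mult_strict_left_mono mult_left_mono) (auto simp: K_def)
      also have "\<dots> \<le> d (f n)" unfolding f_def using x x0 t by (intro bdist_concave) (auto simp: K_def)
      finally have "r < d (f n)" .
      moreover have "f n \<in> \<Omega>" unfolding f_def
        using convexD[OF convex_dom x0(1), of x ?t "1 - ?t"] x t by (simp add: K_def)
      ultimately show ?thesis by (simp add: inner_parallel_eq)
    qed
    moreover have "f \<longlonglongrightarrow> 0 *\<^sub>R x0 + (1 - 0) *\<^sub>R x"
      unfolding f_def by (intro tendsto_intros lim_1_over_n[THEN LIMSEQ_Suc])
    then have "f \<longlonglongrightarrow> x" by simp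
    ultimately show "x \<in> closure (inner_parallel \<Omega> r)" unfolding closure_sequential by blast
  qed
qed

lemma frontier_inner_parallel:
  assumes r: "0 < r" "r < R" shows "frontier (inner_parallel \<Omega> r) = frontier (K r)"
  using convex_interior_closure[OF convex_inner_parallel, of r] closure_inner_parallel[OF r]
    compact_imp_closed[OF compact_K[OF r(1)]]
  by (simp add: frontier_def)

lemma interior_K_nonempty: "r < R \<Longrightarrow> interior (K r) \<noteq> {}"
  using inner_parallel_nonempty interior_maximal[OF inner_parallel_subset_K open_inner_parallel]
    by blast

section \<open>Volume and surface of the parallel bodies\<close>

lemma lmeasurable_K: "0 < r \<Longrightarrow> K r \<in> lmeasurable"
  by (intro lmeasurable_compact compact_K)

lemma lmeasurable_inner_parallel: "inner_parallel \<Omega> r \<in> lmeasurable"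
  by (intro lmeasurable_open open_inner_parallel bounded_subset[OF bounded_dom]) (auto simp: inner_parallel_eq)

lemma measure_inner_parallel:
  assumes r: "0 < r" "r < R" shows "measure lebesgue (inner_parallel \<Omega> r) = V r"
proof -
  have "negligible (frontier (inner_parallel \<Omega> r))"
    by (rule negligible_convex_frontier[OF convex_inner_parallel])
  moreover have "K r = inner_parallel \<Omega> r \<union> frontier (inner_parallel \<Omega> r)"
    using closure_inner_parallel[OF r] inner_parallel_subset_K[of r] open_inner_parallel
    by (auto simp: frontier_def interior_open)
  ultimately show ?thesis unfolding V_def
    using lmeasurable_inner_parallel
      by (simp add: measure_Un_null_set negligible_iff_null_sets fmeasurableD)
qed

lemma V_pos:
  assumes "0 < r" "r < R" shows "0 < V r"
proof -
  have "\<not> negligible (inner_parallel \<Omega> r)"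
    using open_not_negligible[OF open_inner_parallel inner_parallel_nonempty] assms by blast
  then show ?thesis using measure_inner_parallel[OF assms] lmeasurable_inner_parallel
    by (metis negligible_iff_measure measure_nonneg order_le_less)
qed

lemma V_antimono: "0 < r \<Longrightarrow> r \<le> s \<Longrightarrow> V s \<le> V r"
  unfolding V_def using lmeasurable_K
  by (intro measure_mono_fmeasurable K_antimono) (auto simp: fmeasurableD)

lemma V_le_dom: "0 < r \<Longrightarrow> V r \<le> measure lebesgue \<Omega>"
  unfolding V_def using lmeasurable_K lmeasurable_open[OF bounded_dom open_dom]
  by (intro measure_mono_fmeasurable) (auto simp: fmeasurableD K_def)

lemma V_log_concave:
  assumes r: "0 < r" "r < R" and s: "0 < s" "s < R" and t: "0 < t" "t < 1"
  shows "t * ln (V r) + (1 - t) * ln (V s) \<le> ln (V (t * r + (1 - t) * s))"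
proof -
  have q: "0 < t * r + (1 - t) * s" "t * r + (1 - t) * s < R"
  proof -
    show "0 < t * r + (1 - t) * s" using r s t by (intro add_pos_pos mult_pos_pos) auto
    have "t * r + (1 - t) * s < t * R + (1 - t) * R"
      using r s t by (intro add_strict_mono mult_strict_left_mono) auto
    then show "t * r + (1 - t) * s < R" by (simp add: algebra_simps)
  qed
  have "V r powr t * V s powr (1 - t) \<le> measure lebesgue (mix t (K r) (K s))"
    unfolding V_def using r s t by (intro Brunn_Minkowski_compact compact_K)
  also have "\<dots> \<le> V (t * r + (1 - t) * s)"
    unfolding V_def using r s t q
    by (intro measure_mono_fmeasurable mix_K lmeasurable_K fmeasurableD lmeasurable_compact compact_mix compact_K) auto
  finally have "ln (V r powr t * V s powr (1 - t)) \<le> ln (V (t * r + (1 - t) * s))"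
    using V_pos[OF r] V_pos[OF s] by (intro ln_mono) auto
  then show ?thesis using V_pos[OF r] V_pos[OF s] by (simp add: ln_mult ln_powr)
qed

text \<open>For \<epsilon> strictly below \<open>r - s\<close> there is room for a polyhedron
  between \<open>K r\<close> and the points deeper than \<open>s + \<epsilon>\<close>. Its surface
  dominates that of \<open>K r\<close> and its \<epsilon>-neighbourhood stays in \<open>K s\<close>;
  finally \<epsilon> tends to \<open>r - s\<close>.\<close>

lemma hausdorff_frontier_K_le:
  assumes s: "0 < s" "s < r" and r: "r < R"
  shows "hausdorff_measure (DIM('a) - 1) (frontier (K r)) \<le> ennreal ((V s - V r) / (r - s))"
proof -
  let ?H = "hausdorff_measure (DIM('a) - 1) (frontier (K r))"
  have *: "?H \<le> ennreal ((V s - V r) / \<epsilon>)" if \<epsilon>: "0 < \<epsilon>" "\<epsilon> < r - s" for \<epsilon>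
  proof -
    have sub: "K r \<subseteq> inner_parallel \<Omega> (s + \<epsilon>)" using \<epsilon> by (auto simp: K_def inner_parallel_eq)
    have ne: "K r \<noteq> {}" using interior_K_nonempty[OF r] interior_subset by blast
    have bU: "bounded (inner_parallel \<Omega> (s + \<epsilon>))"
      by (rule bounded_subset[OF bounded_dom]) (auto simp: inner_parallel_eq)
    have "0 < r" using s by simp
    then obtain I where I: "finite I" "\<And>i. i \<in> I \<Longrightarrow> norm (fst i) = 1" "K r \<subseteq> polyhedron_of I"
      "polyhedron_of I \<subseteq> inner_parallel \<Omega> (s + \<epsilon>)"
      using polyhedron_between[OF compact_K convex_K ne open_inner_parallel bU sub] by blast
    let ?P = "polyhedron_of I"
    have bP: "bounded ?P" using I(4) bU bounded_subset by blast
    have "?H \<le> hausdorff_measure (DIM('a) - 1) (frontier ?P)"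
      using s r I(3) bP by (intro hausdorff_measure_frontier_mono convex_K compact_imp_closed compact_K
          interior_K_nonempty closed_polyhedron_of) auto
    also have "\<dots> \<le> ennreal ((measure lebesgue (K s) - measure lebesgue ?P) / \<epsilon>)"
    proof (rule hausdorff_frontier_polyhedron_le[OF I(1,2) bP \<epsilon>(1)])
      show "K s \<in> lmeasurable" by (rule lmeasurable_K[OF s(1)])
      show "(\<Union>x\<in>?P. cball x \<epsilon>) \<subseteq> K s"
      proof (rule UN_least, rule subsetI)
        fix x z assume x: "x \<in> ?P" and z: "z \<in> cball x \<epsilon>"
        have dx: "x \<in> \<Omega>" "s + \<epsilon> < d x" using x I(4) by (auto simp: inner_parallel_eq)
        have "z \<in> ball x (d x)" using z dx s by auto
        then have "z \<in> \<Omega>" using ball_bdist_subset[OF dx(1)] by blast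
        moreover have "s \<le> d z" using bdist_triangle[of x z] z dx by simp
        ultimately show "z \<in> K s" by (simp add: K_def)
      qed
    qed
    also have "\<dots> \<le> ennreal ((V s - V r) / \<epsilon>)"
    proof (intro ennreal_leI divide_right_mono diff_mono)
      show "V r \<le> measure lebesgue ?P" unfolding V_def using I(3) bP s closed_polyhedron_of
        by (intro measure_mono_fmeasurable fmeasurableD lmeasurable_K lmeasurable_compact)
          (auto simp: compact_eq_bounded_closed)
    qed (use \<epsilon> in \<open>auto simp: V_def\<close>)
    finally show ?thesis .
  qed
  show ?thesis
  proof (rule tendsto_lowerbound)
    show "((\<lambda>\<epsilon>. ennreal ((V s - V r) / \<epsilon>)) \<longlongrightarrow> ennreal ((V s - V r) / (r - s))) (at_left (r - s))"
      using s by (intro tendsto_ennrealI tendsto_intros) auto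
    have "\<forall>\<^sub>F \<epsilon> in at_left (r - s). 0 < \<epsilon> \<and> \<epsilon> < r - s"
      unfolding eventually_at_left_field using s by (intro exI[of _ 0]) auto
    then show "\<forall>\<^sub>F \<epsilon> in at_left (r - s). ?H \<le> ennreal ((V s - V r) / \<epsilon>)"
      by eventually_elim (use * in auto)
  qed simp
qed

text \<open>A polyhedron is placed between \<open>K q\<close>, with \<open>q\<close> slightly above
  \<open>r\<close>, and the points deeper than \<open>r\<close>. Its surface is at most that of
  \<open>K r\<close>, and every point of depth between \<open>q\<close> and \<open>s\<close> is
  within \<open>s - r\<close> of its complement. The claim follows as \<open>q\<close> decreases to
  \<open>r\<close>.\<close>

lemma hausdorff_frontier_K_ge:
  assumes r: "0 < r" "r < s" and s: "s < R"
  shows "ennreal (V r - V s) \<le> ennreal (s - r) * hausdorff_measure (DIM('a) - 1) (frontier (K r))"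
proof -
  let ?H = "hausdorff_measure (DIM('a) - 1) (frontier (K r))"
  let ?\<epsilon> = "s - r"
  have *: "ennreal (V q - V s) \<le> ennreal ?\<epsilon> * ?H" if q: "r < q" "q < s" for q
  proof -
    let ?U = "inner_parallel \<Omega> r"
    have sub: "K q \<subseteq> ?U" using q by (auto simp: K_def inner_parallel_eq)
    have "q < R" using q s by simp
    then have ne: "K q \<noteq> {}" using interior_K_nonempty interior_subset by blast
    have bU: "bounded ?U"
      by (rule bounded_subset[OF bounded_dom]) (auto simp: inner_parallel_eq)
    have "0 < q" using q r by simp
    then obtain I where I: "finite I" "\<And>i. i \<in> I \<Longrightarrow> norm (fst i) = 1" "K q \<subseteq> polyhedron_of I"
      "polyhedron_of I \<subseteq> ?U"
      using polyhedron_between[OF compact_K convex_K ne open_inner_parallel bU sub] by blast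
    let ?P = "polyhedron_of I"
    have bP: "bounded ?P" using I(4) bU bounded_subset by blast
    have "measure lebesgue (K q - K s) = V q - V s"
      unfolding V_def using r q lmeasurable_K K_antimono[of q s]
      by (intro measurable_measure_Diff) (auto simp: fmeasurableD)
    then have "ennreal (V q - V s) = ennreal (measure lebesgue (K q - K s))" by simp
    also have "\<dots> \<le> ennreal ?\<epsilon> * hausdorff_measure (DIM('a) - 1) (frontier ?P)"
    proof (rule hausdorff_frontier_polyhedron_ge[OF I(1,2) bP])
      show "0 < ?\<epsilon>" using r by simp
      show "K q - K s \<in> lmeasurable" using r q
        by (intro fmeasurable_Diff fmeasurableD lmeasurable_K) auto
      show "K q - K s \<subseteq> ?P" using I(3) by blast
      fix x assume x: "x \<in> K q - K s"
      show "\<not> cball x ?\<epsilon> \<subseteq> ?P"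
      proof
        assume sub: "cball x ?\<epsilon> \<subseteq> ?P"
        obtain y where y: "y \<in> frontier \<Omega>" "d x = dist x y" by (rule bdist_foot)
        have "y \<notin> ?U" using frontier_dom_disjoint[OF y(1)] by (auto simp: inner_parallel_eq)
        then have "y \<notin> cball x ?\<epsilon>" using sub I(4) by blast
        then have far: "?\<epsilon> < d x" using y(2) by simp
        have dpos: "0 < d x" using far r by simp
        \<comment> \<open>The point at distance \<open>s - r\<close> on the way to the nearest
          boundary point: its depth is at most \<open>d x - (s - r)\<close>, which is below
          \<open>r\<close>.\<close>
        define z where "z = x + (?\<epsilon> / d x) *\<^sub>R (y - x)"
        have "dist x z = ?\<epsilon>" using dpos r y(2) by (simp add: z_def dist_norm norm_minus_commute)
        then have "z \<in> ?P" using sub by auto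
        then have "r < d z" using I(4) by (auto simp: inner_parallel_eq)
        also have "d z \<le> dist z y" by (rule bdist_le[OF y(1)])
        also have "z - y = (1 - ?\<epsilon> / d x) *\<^sub>R (x - y)" by (simp add: z_def algebra_simps)
        then have "dist z y = \<bar>1 - ?\<epsilon> / d x\<bar> * dist x y" by (simp add: dist_norm)
        also have "\<dots> = d x - ?\<epsilon>" using far dpos y(2) by (simp add: field_simps)
        finally show False using x by (auto simp: K_def)
      qed
    qed
    also have "\<dots> \<le> ennreal ?\<epsilon> * ?H"
    proof (intro mult_left_mono hausdorff_measure_frontier_mono convex_polyhedron_of closed_polyhedron_of)
      show "interior ?P \<noteq> {}" using interior_mono[OF I(3)] interior_K_nonempty[of q] q s by auto
      show "closed (K r)" "bounded (K r)" using compact_K[OF r(1)]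
        by (auto simp: compact_imp_closed compact_imp_bounded)
      show "?P \<subseteq> K r" using I(4) inner_parallel_subset_K by blast
    qed auto
    finally show ?thesis .
  qed
  \<comment> \<open>A sequence decreasing to \<open>r\<close>; the denominator starts at 2 so that
    already the first term is below \<open>s\<close>.\<close>
  define q where "q n = r + (s - r) / real (Suc (Suc n))" for n
  have q: "r < q n" "q n < s" for n
  proof -
    have "(s - r) / real (Suc (Suc n)) < (s - r) / 1" using r by (intro divide_strict_left_mono) auto
    then show "r < q n" "q n < s" using r by (auto simp: q_def)
  qed
  have Km: "K (q n) \<in> lmeasurable" for n by (rule lmeasurable_K) (use q(1)[of n] r in linarith)
  have "(\<Union>n. K (q n)) = inner_parallel \<Omega> r"
  proof
    show "(\<Union>n. K (q n)) \<subseteq> inner_parallel \<Omega> r"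
    proof (rule UN_least, rule subsetI)
      fix n x assume "x \<in> K (q n)"
      then show "x \<in> inner_parallel \<Omega> r" using q(1)[of n] by (simp add: K_def inner_parallel_eq)
    qed
    show "inner_parallel \<Omega> r \<subseteq> (\<Union>n. K (q n))"
    proof
      fix x assume x: "x \<in> inner_parallel \<Omega> r"
      have "(\<lambda>n. (s - r) / real n) \<longlonglongrightarrow> 0" by (rule lim_const_over_n)
      then have "(\<lambda>n. r + (s - r) / real (n + 2)) \<longlonglongrightarrow> r + 0"
        by (intro tendsto_intros LIMSEQ_ignore_initial_segment)
      then have "q \<longlonglongrightarrow> r" unfolding q_def by simp
      then have "\<forall>\<^sub>F n in sequentially. q n < d x"
        using x by (intro order_tendstoD) (auto simp: inner_parallel_eq)
      then obtain n where "q n < d x" by (auto simp: eventually_sequentially)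
      then show "x \<in> (\<Union>n. K (q n))" using x by (auto simp: K_def inner_parallel_eq intro!: exI[of _ n])
    qed
  qed
  moreover have "incseq (\<lambda>n. K (q n))"
  proof (rule incseq_SucI, rule K_antimono)
    fix n show "q (Suc n) \<le> q n" unfolding q_def using r by (intro add_left_mono divide_left_mono) auto
  qed
  then have "(\<lambda>n. measure lebesgue (K (q n))) \<longlonglongrightarrow> measure lebesgue (\<Union>n. K (q n))"
    using Km calculation fmeasurableD2[OF lmeasurable_inner_parallel[of r]]
    by (intro Lim_measure_incseq) (simp_all add: image_subset_iff fmeasurableD)
  ultimately have "(\<lambda>n. V (q n)) \<longlonglongrightarrow> V r"
    using measure_inner_parallel[of r] r s by (simp add: V_def)
  then have "(\<lambda>n. ennreal (V (q n) - V s)) \<longlonglongrightarrow> ennreal (V r - V s)"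
    by (intro tendsto_ennrealI tendsto_intros)
  then show ?thesis by (rule LIMSEQ_le_const2) (use * q in auto)
qed

text \<open>The rest of the argument uses no other property of Hausdorff measure.\<close>

lemma V_subgradient:
  assumes r: "0 < r" "r < R" and s: "0 < s" "s < R"
  shows "V r - P r * (s - r) \<le> V s"
proof -
  let ?H = "hausdorff_measure (DIM('a) - 1) (frontier (K r))"
  have Pr: "P r = enn2real ?H" by (simp add: P_def perimeter_def frontier_inner_parallel[OF r])
  \<comment> \<open>Finiteness matters because \<open>enn2real\<close> in the definition of
    \<open>perimeter\<close> would turn an infinite measure into 0.\<close>
  have "?H \<le> ennreal ((V (r/2) - V r) / (r - r/2))" using r by (intro hausdorff_frontier_K_le) auto
  then have "?H < top" using ennreal_less_top by (rule le_less_trans)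
  then have fin: "?H = ennreal (P r)" unfolding Pr by (rule ennreal_enn2real[symmetric])
  have P0: "0 \<le> P r" by (simp add: Pr)
  consider "s < r" | "s = r" | "r < s" by linarith
  then show ?thesis
  proof cases
    case 1
    then have "ennreal (P r) \<le> ennreal ((V s - V r) / (r - s))"
      using hausdorff_frontier_K_le[OF s(1) 1 r(2)] fin by simp
    then have "P r \<le> (V s - V r) / (r - s)"
      using V_antimono[OF s(1), of r] 1 by (subst (asm) ennreal_le_iff) auto
    then show ?thesis using 1 by (simp add: field_simps)
  next
    case 3
    then have "ennreal (V r - V s) \<le> ennreal (s - r) * ennreal (P r)"
      using hausdorff_frontier_K_ge[OF r(1) 3 s(2)] fin by simp
    also have "\<dots> = ennreal ((s - r) * P r)" using 3 P0 by (simp add: ennreal_mult)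
    finally have "V r - V s \<le> (s - r) * P r"
      using 3 P0 by (subst (asm) ennreal_le_iff) auto
    then show ?thesis by (simp add: algebra_simps)
  qed simp
qed

text \<open>A ball inside \<open>K R\<close> is impossible, as depth drops strictly on the way from
  its centre to the nearest boundary point; and a convex set without interior is null.\<close>

lemma measure_K_inradius: "measure lebesgue (K R) = 0"
proof -
  have "interior (K R) = {}"
  proof (rule ccontr)
    assume "interior (K R) \<noteq> {}"
    then obtain x e where e: "e > 0" "cball x e \<subseteq> K R" by (auto simp: mem_interior_cball)
    have "x \<in> cball x e" using e(1) by simp
    then have "x \<in> K R" using e(2) by (rule subsetD[rotated])
    then have x: "x \<in> \<Omega>" by (simp add: K_def)
    obtain y where y: "y \<in> frontier \<Omega>" "d x = dist x y" by (rule bdist_foot)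
    define t where "t = min 1 (e / d x)"
    have t: "0 < t" "t \<le> 1" "t * d x \<le> e"
      using e bdist_pos[OF x] by (auto simp: t_def min_def field_simps)
    define z where "z = x + t *\<^sub>R (y - x)"
    have "dist x z \<le> e" using t y(2) by (simp add: z_def dist_norm norm_minus_commute)
    then have "R \<le> d z" using e by (auto simp: K_def)
    also have "d z \<le> dist z y" by (rule bdist_le[OF y(1)])
    also have "z - y = (1 - t) *\<^sub>R (x - y)" by (simp add: z_def algebra_simps)
    then have "dist z y = (1 - t) * d x" using t y(2) by (simp add: dist_norm)
    also have "\<dots> < 1 * d x" using t bdist_pos[OF x] by (intro mult_strict_right_mono) auto
    finally show False using bdist_le_inradius[OF x] by simp
  qed
  then show ?thesis using negligible_convex_interior[OF convex_K]
    by (simp add: negligible_iff_null_sets measure_eq_0_null_sets)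
qed

lemma V_tendsto_0:
  assumes "0 < \<kappa>" shows "\<exists>s. 0 < s \<and> s < R \<and> V s < \<kappa>"
proof -
  define q where "q n = R - R / real (Suc (Suc n))" for n
  have q: "0 < q n" "q n < R" for n
  proof -
    have "R / real (Suc (Suc n)) < R / 1" using inradius_pos by (intro divide_strict_left_mono) auto
    then show "0 < q n" "q n < R" using inradius_pos by (auto simp: q_def)
  qed
  have "(\<Inter>n. K (q n)) = K R"
  proof
    show "K R \<subseteq> (\<Inter>n. K (q n))" using q K_antimono by (metis INT_greatest less_imp_le)
    show "(\<Inter>n. K (q n)) \<subseteq> K R"
    proof
      fix x assume x: "x \<in> (\<Inter>n. K (q n))"
      have "(\<lambda>n. R / real n) \<longlonglongrightarrow> 0" by (rule lim_const_over_n)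
      then have "(\<lambda>n. R - R / real (n + 2)) \<longlonglongrightarrow> R - 0"
        by (intro tendsto_intros LIMSEQ_ignore_initial_segment)
      then have "q \<longlonglongrightarrow> R" unfolding q_def by simp
      then have "R \<le> d x" by (rule LIMSEQ_le_const2) (use x in \<open>auto simp: K_def\<close>)
      then show "x \<in> K R" using x by (auto simp: K_def)
    qed
  qed
  moreover have "decseq (\<lambda>n. K (q n))"
    unfolding decseq_Suc_iff
  proof (intro allI K_antimono)
    fix n show "q n \<le> q (Suc n)" unfolding q_def using inradius_pos
      by (intro diff_left_mono divide_left_mono) auto
  qed
  then have "(\<lambda>n. measure lebesgue (K (q n))) \<longlonglongrightarrow> measure lebesgue (\<Inter>n. K (q n))"
    using fmeasurableD[OF lmeasurable_K[OF q(1)]] fmeasurableD2[OF lmeasurable_K[OF q(1)]]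
    by (intro Lim_measure_decseq) (simp_all add: image_subset_iff)
  ultimately have "(\<lambda>n. V (q n)) \<longlonglongrightarrow> 0" by (simp add: measure_K_inradius V_def)
  then have "\<forall>\<^sub>F n in sequentially. V (q n) < \<kappa>" using assms by (intro order_tendstoD)
  then show ?thesis using q by (auto simp: eventually_sequentially)
qed

subsection \<open>The radii and the reduced energy\<close>

text \<open>\<open>V_subgradient\<close> bounds \<open>V (r + h)\<close> and
  \<open>V (r - h)\<close> from below. Log-concavity bounds their product by the square of
  \<open>V r\<close>, which turns the lower bound on one side into an upper bound on the other. The
  deviation from the tangent is then of second order in \<open>h\<close>.\<close>

lemma V_has_derivative:
  assumes r: "0 < r" "r < R"
  shows "(V has_real_derivative - P r) (at r)"
proof -
  \<comment> \<open>The last term makes \<open>\<bar>P r * h\<bar>\<close> at most half of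
    \<open>V r\<close>, so that \<open>V r + P r * h\<close> may be used as a divisor.\<close>
  define \<epsilon> where "\<epsilon> = min (min r (R - r)) (V r / (\<bar>P r\<bar> + 1) / 2)"
  have \<epsilon>: "0 < \<epsilon>" using r V_pos[OF r] by (simp add: \<epsilon>_def)
  have bnd: "norm ((V (r + h) - V r) / h - (- P r)) \<le> 2 * (P r)\<^sup>2 / V r * \<bar>h\<bar>" if h: "h \<noteq> 0" "\<bar>h\<bar> < \<epsilon>"
    for h
  proof -
    have rh: "0 < r + h" "r + h < R" "0 < r - h" "r - h < R" using h unfolding \<epsilon>_def by auto
    have lo: "V r - P r * h \<le> V (r + h)" "V r + P r * h \<le> V (r - h)"
      using V_subgradient[OF r rh(1,2)] V_subgradient[OF r rh(3,4)] by auto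
    have Ph: "\<bar>P r * h\<bar> \<le> V r / 2"
    proof -
      have "\<bar>h\<bar> \<le> V r / (\<bar>P r\<bar> + 1) / 2" using h unfolding \<epsilon>_def by auto
      then have "\<bar>h\<bar> * (\<bar>P r\<bar> + 1) \<le> V r / 2" by (simp add: field_simps)
      moreover have "\<bar>P r * h\<bar> \<le> \<bar>h\<bar> * (\<bar>P r\<bar> + 1)" by (simp add: abs_mult algebra_simps)
      ultimately show ?thesis by linarith
    qed
    have pos: "0 < V r" "0 < V (r + h)" "0 < V (r - h)" using V_pos r rh by blast+
    have "(1/2) * ln (V (r + h)) + (1 - 1/2) * ln (V (r - h)) \<le> ln (V ((1/2) * (r + h) + (1 - 1/2) * (r - h)))"
      using rh by (intro V_log_concave) auto
    then have "ln (V (r + h)) + ln (V (r - h)) \<le> 2 * ln (V r)" by (simp add: field_simps)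
    then have "ln (V (r + h) * V (r - h)) \<le> ln (V r * V r)" using pos by (simp add: ln_mult)
    then have "V (r + h) * V (r - h) \<le> V r * V r" using pos by (subst (asm) ln_le_cancel_iff) auto
    moreover have "V (r + h) * (V r + P r * h) \<le> V (r + h) * V (r - h)"
      using lo pos by (intro mult_left_mono) auto
    ultimately have up: "V (r + h) * (V r + P r * h) \<le> V r * V r" by linarith
    define e where "e = V (r + h) - V r + P r * h"
    have e0: "0 \<le> e" using lo by (simp add: e_def)
    have "e * (V r + P r * h) \<le> (P r * h)\<^sup>2"
      using up by (simp add: e_def algebra_simps power2_eq_square)
    moreover have "e * (V r / 2) \<le> e * (V r + P r * h)" using Ph e0 by (intro mult_left_mono) auto
    ultimately have "e * (V r / 2) \<le> (P r * h)\<^sup>2" by linarith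
    then have e1: "e \<le> 2 * (P r * h)\<^sup>2 / V r" using pos by (simp add: field_simps)
    have "norm ((V (r + h) - V r) / h - (- P r)) = e / \<bar>h\<bar>"
    proof -
      have "(V (r + h) - V r) / h - (- P r) = e / h" using h by (simp add: e_def field_simps)
      then show ?thesis using e0 by simp
    qed
    also have "\<dots> \<le> (2 * (P r * h)\<^sup>2 / V r) / \<bar>h\<bar>" using e1 by (intro divide_right_mono) auto
    also have "\<dots> = 2 * (P r)\<^sup>2 / V r * \<bar>h\<bar>"
      using h by (simp add: power_mult_distrib power2_eq_square field_simps) (simp add: abs_if)
    finally show ?thesis .
  qed
  have "(\<lambda>h. (V (r + h) - V r) / h - (- P r)) \<midarrow>0\<rightarrow> 0"
  proof (rule Lim_null_comparison)
    show "\<forall>\<^sub>F h in at 0. norm ((V (r + h) - V r) / h - (- P r)) \<le> 2 * (P r)\<^sup>2 / V r * \<bar>h\<bar>"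
      using \<epsilon> bnd by (auto simp: eventually_at dist_real_def intro!: exI[of _ \<epsilon>])
    show "(\<lambda>h. 2 * (P r)\<^sup>2 / V r * \<bar>h\<bar>) \<midarrow>0\<rightarrow> 0" using V_pos[OF r] by (auto intro!: tendsto_eq_intros)
  qed
  then show ?thesis unfolding DERIV_def by (rule LIM_zero_cancel)
qed

lemma isCont_V: "0 < r \<Longrightarrow> r < R \<Longrightarrow> isCont V r"
  using V_has_derivative DERIV_isCont by blast

section \<open>Monotonicity and continuity of the perimeter\<close>

lemma P_pos:
  assumes r: "0 < r" "r < R" shows "0 < P r"
proof -
  obtain s where s: "0 < s" "s < R" "V s < V r" using V_tendsto_0[OF V_pos[OF r]] by blast
  then have rs: "r < s" using V_antimono[of s r] by force
  have "0 < P r * (s - r)" using V_subgradient[OF r s(1,2)] s by linarith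
  then show ?thesis using rs by (simp add: zero_less_mult_iff)
qed

text \<open>The supporting line at \<open>r\<close>, followed up to the inradius, where the volume
  tends to 0.\<close>

lemma V_le_P:
  assumes r: "0 < r" "r < R" shows "V r \<le> (R - r) * P r"
proof (rule field_le_epsilon)
  fix \<kappa> :: real assume "0 < \<kappa>"
  then obtain s where s: "0 < s" "s < R" "V s < \<kappa>" using V_tendsto_0 by blast
  have "P r * (s - r) \<le> P r * (R - r)" using s P_pos[OF r] by (intro mult_left_mono) auto
  then show "V r \<le> (R - r) * P r + \<kappa>" using V_subgradient[OF r s(1,2)] s by (simp add: mult.commute)
qed

lemma P_antimono:
  assumes s: "0 < s" "s \<le> r" and r: "r < R" shows "P r \<le> P s"
proof (cases "s = r")
  case False
  have "V s - P s * (r - s) \<le> V r" "V r - P r * (s - r) \<le> V s"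
    using assms by (auto intro!: V_subgradient)
  then have "P r * (r - s) \<le> P s * (r - s)" by (simp add: algebra_simps)
  then show ?thesis using False s by simp
qed simp

text \<open>The quotient is the derivative of \<open>- ln (V r)\<close>, which is convex by
  Brunn--Minkowski; adding its tangent inequalities at \<open>s\<close> and at \<open>r\<close>
  gives the claim.\<close>

lemma P_over_V_mono:
  assumes s: "0 < s" "s \<le> r" and r: "r < R" shows "P s / V s \<le> P r / V r"
proof (cases "s = r")
  case False
  let ?f = "\<lambda>x. - ln (V x)"
  have cvx: "convex_on {0<..<R} ?f"
  proof (rule convex_onI)
    fix t x y :: real assume "0 < t" "t < 1" "x \<in> {0<..<R}" "y \<in> {0<..<R}"
    then show "?f ((1 - t) *\<^sub>R x + t *\<^sub>R y) \<le> (1 - t) * ?f x + t * ?f y"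
      using V_log_concave[of x y "1 - t"] by simp
  qed simp
  have D: "(?f has_real_derivative P c / V c) (at c)" if "c \<in> {0<..<R}" for c
    using that V_pos[of c] by (auto intro!: derivative_eq_intros V_has_derivative)
  have tan: "?f x - ?f c \<ge> P c / V c * (x - c)" if "c \<in> {0<..<R}" "x \<in> {0<..<R}" for c x
    using that D[of c]
      by (intro convex_on_imp_above_tangent[OF cvx]) (auto intro: has_field_derivative_at_within)
  have "?f r - ?f s \<ge> P s / V s * (r - s)" "?f s - ?f r \<ge> P r / V r * (s - r)"
    using assms by - (rule tan; simp)+
  moreover have "P r / V r * (s - r) = - (P r / V r * (r - s))"
    by (metis minus_diff_eq mult_minus_right)
  ultimately have "P s / V s * (r - s) \<le> P r / V r * (r - s)" by linarith
  moreover have "0 < r - s" using False s by simp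
  ultimately show ?thesis by (simp only: mult_le_cancel_right_pos)
qed simp

text \<open>As \<open>P\<close> decreases while \<open>P / V\<close> increases, \<open>P s\<close>
  is pinned between \<open>P r\<close> and \<open>P r / V r * V s\<close>, and the continuity of
  \<open>V\<close> closes the gap.\<close>

lemma isCont_P:
  assumes r: "0 < r" "r < R" shows "isCont P r"
proof -
  have bnd: "norm (P s - P r) \<le> P r / V r * \<bar>V s - V r\<bar>" if s: "0 < s" "s < R" for s
  proof -
    note pos = V_pos[OF r] V_pos[OF s] P_pos[OF r] P_pos[OF s]
    show ?thesis
    proof (cases "s \<le> r")
      case True
      have "P r \<le> P s" "V r \<le> V s" using P_antimono V_antimono True s r by auto
      moreover have "P s \<le> P r / V r * V s" using P_over_V_mono[OF s(1) True r(2)] pos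
        by (simp add: field_simps)
      ultimately show ?thesis using pos by (simp add: diff_divide_distrib right_diff_distrib)
    next
      case False
      then have "P s \<le> P r" "V s \<le> V r" using P_antimono[of r s] V_antimono[of r s] s r by auto
      moreover have "P r / V r * V s \<le> P s" using P_over_V_mono[of r s] False pos s r
        by (simp add: field_simps)
      ultimately show ?thesis using pos by (simp add: diff_divide_distrib right_diff_distrib)
    qed
  qed
  have "(\<lambda>s. P s - P r) \<midarrow>r\<rightarrow> 0"
  proof (rule Lim_null_comparison)
    have "\<forall>\<^sub>F s in at r. s \<in> {0<..<R}" using r by (intro eventually_at_in_open') auto
    then show "\<forall>\<^sub>F s in at r. norm (P s - P r) \<le> P r / V r * \<bar>V s - V r\<bar>"
      by eventually_elim (use bnd in auto)
    have "(V \<longlongrightarrow> V r) (at r)" using isCont_V[OF r] by (simp add: isCont_def)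
    then show "(\<lambda>s. P r / V r * \<bar>V s - V r\<bar>) \<midarrow>r\<rightarrow> 0" using V_pos[OF r]
      by (auto intro!: tendsto_eq_intros)
  qed
  then show ?thesis by (simp add: isCont_def LIM_zero_cancel)
qed

text \<open>The value 1 encodes the equation that defines \<open>r_star\<close>, and the sign of
  \<open>1 - \<phi> r\<close> is that of the derivative of \<open>r * V r\<close>.\<close>

definition \<phi> :: "real \<Rightarrow> real" where "\<phi> r = r * (P r / V r)"

lemma phi_strict_mono:
  assumes "0 < s" "s < r" "r < R" shows "\<phi> s < \<phi> r"
proof -
  have "\<phi> s \<le> s * (P r / V r)" unfolding \<phi>_def using assms by (intro mult_left_mono P_over_V_mono) auto
  also have "\<dots> < \<phi> r" unfolding \<phi>_def using assms P_pos[of r] V_pos[of r]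
    by (intro mult_strict_right_mono) auto
  finally show ?thesis .
qed

lemma phi_root_exists: "\<exists>r. 0 < r \<and> r < R \<and> \<phi> r = 1"
proof -
  \<comment> \<open>At half the inradius the bound \<open>V_le_P\<close> reads
    \<open>V r \<le> r * P r\<close>, which says that \<phi> is at least 1 there.\<close>
  let ?b = "R / 2"
  have b: "0 < ?b" "?b < R" using inradius_pos by auto
  define m where "m = P ?b / V ?b"
  have m: "0 < m" unfolding m_def using P_pos[OF b] V_pos[OF b] by simp
  \<comment> \<open>Below \<open>R / 2\<close> the quotient \<open>P / V\<close> is at most
    \<open>m\<close>, so \<phi> is at most \<open>a * m\<close>, hence at most 1.\<close>
  define a where "a = min ?b (1 / m)"
  have a: "0 < a" "a \<le> ?b" using b m by (auto simp: a_def)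
  have "\<phi> a \<le> a * m" unfolding \<phi>_def m_def using a b by (intro mult_left_mono P_over_V_mono) auto
  also have "\<dots> \<le> 1 / m * m" using m by (intro mult_right_mono) (auto simp: a_def)
  finally have fa: "\<phi> a \<le> 1" using m by simp
  have "V ?b \<le> ?b * P ?b" using V_le_P[OF b] by simp
  then have fb: "1 \<le> \<phi> ?b" unfolding \<phi>_def using V_pos[OF b] by (simp add: field_simps)
  have "isCont \<phi> x" if "a \<le> x" "x \<le> ?b" for x
    unfolding \<phi>_def using that a b V_pos[of x] by (intro continuous_intros isCont_P isCont_V) auto
  then obtain r where "a \<le> r" "r \<le> ?b" "\<phi> r = 1"
    using IVT[of \<phi> a 1 ?b] fa fb a by blast
  then show ?thesis using a b by (intro exI[of _ r]) auto
qed

lemma phi_eq_1_iff: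
  assumes "0 < r" "r < R"
  shows "\<phi> r = 1 \<longleftrightarrow> perimeter (inner_parallel \<Omega> r) / measure lebesgue (inner_parallel \<Omega> r) = 1 / r"
  using assms V_pos[OF assms] by (simp add: measure_inner_parallel P_def[symmetric] \<phi>_def field_simps)

lemma r_star: "0 < r_star \<Omega>" "r_star \<Omega> < R" "\<phi> (r_star \<Omega>) = 1"
proof -
  let ?Q = "\<lambda>r. 0 < r \<and> r < R \<and> perimeter (inner_parallel \<Omega> r) / measure lebesgue (inner_parallel \<Omega> r) = 1 / r"
  obtain r where r: "0 < r" "r < R" "\<phi> r = 1" using phi_root_exists by blast
  have "?Q (THE r. ?Q r)"
  proof (rule theI[of ?Q r])
    show "?Q r" using r phi_eq_1_iff by blast
    fix s assume "?Q s"
    then have "0 < s" "s < R" "\<phi> s = 1" using phi_eq_1_iff by blast+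
    then show "s = r" using phi_strict_mono[of s r] phi_strict_mono[of r s] r
      by (cases s r rule: linorder_cases) auto
  qed
  then show "0 < r_star \<Omega>" "r_star \<Omega> < R" "\<phi> (r_star \<Omega>) = 1"
    unfolding r_star_def using phi_eq_1_iff by blast+
qed

abbreviation rs :: real where "rs \<equiv> r_star \<Omega>"

lemma phi_le_1: "0 < r \<Longrightarrow> r \<le> rs \<Longrightarrow> \<phi> r \<le> 1"
  using phi_strict_mono[of r rs] r_star by (cases "r = rs") auto

lemma P_rs: "rs * P rs = V rs"
  using r_star V_pos[OF r_star(1,2)] by (simp add: \<phi>_def field_simps)

section \<open>The maximum of \<open>r * V r\<close>, the radius \<open>r_Lambda\<close> and the
  reduced energy\<close>

lemma has_derivative_rV:
  assumes "0 < r" "r < R"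
  shows "((\<lambda>r. r * V r) has_real_derivative V r * (1 - \<phi> r)) (at r)"
proof -
  have "V r * (1 - \<phi> r) = V r - r * P r" using V_pos[OF assms] by (simp add: \<phi>_def field_simps)
  then show ?thesis using assms by (auto intro!: derivative_eq_intros V_has_derivative)
qed

lemma rV_strict_mono:
  assumes "0 < s" "s < r" "r \<le> rs" shows "s * V s < r * V r"
proof (rule DERIV_pos_imp_increasing_open[OF assms(2), of "\<lambda>r. r * V r"])
  fix x assume x: "s < x" "x < r"
  have "\<phi> x < 1" using phi_strict_mono[of x rs] r_star x assms by auto
  then have "0 < V x * (1 - \<phi> x)" using V_pos[of x] x assms r_star by auto
  then show "\<exists>y. ((\<lambda>r. r * V r) has_real_derivative y) (at x) \<and> 0 < y"
    using has_derivative_rV[of x] x assms r_star by auto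
next
  show "continuous_on {s..r} (\<lambda>r. r * V r)"
    using assms r_star by (intro continuous_at_imp_continuous_on ballI continuous_intros isCont_V) auto
qed

lemma rV_strict_antimono:
  assumes "rs \<le> s" "s < r" "r < R" shows "r * V r < s * V s"
proof (rule DERIV_neg_imp_decreasing_open[OF assms(2), of "\<lambda>r. r * V r"])
  fix x assume x: "s < x" "x < r"
  have "1 < \<phi> x" using phi_strict_mono[of rs x] r_star x assms by auto
  then have "V x * (1 - \<phi> x) < 0" using V_pos[of x] x assms r_star by (auto simp: mult_pos_neg)
  then show "\<exists>y. ((\<lambda>r. r * V r) has_real_derivative y) (at x) \<and> y < 0"
    using has_derivative_rV[of x] x assms r_star by auto
next
  show "continuous_on {s..r} (\<lambda>r. r * V r)"
    using assms r_star by (intro continuous_at_imp_continuous_on ballI continuous_intros isCont_V) auto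
qed

lemma rV_less_max:
  assumes "0 < r" "r < R" "r \<noteq> rs" shows "r * V r < rs * V rs"
  using rV_strict_mono[of r rs] rV_strict_antimono[of rs r] assms
    by (cases r rs rule: linorder_cases) auto

text \<open>The reciprocal of the expression in \<open>r_Lambda\<close>, so that the equation for
  the radius reads \<open>h r = 1 / \<Lambda>\<close>.\<close>

definition h :: "real \<Rightarrow> real" where "h r = r\<^sup>2 * P r"

text \<open>Log-concavity of the volume (through the monotonicity of \<open>P / V\<close>) limits the decay of the
  perimeter enough to make \<open>h\<close> increase up to \<open>rs\<close>.\<close>

lemma h_strict_mono:
  assumes s: "0 < s" "s < r" and r: "r \<le> rs" shows "h s < h r"
proof -
  have rR: "r < R" "s < R" using r s r_star by auto
  note pos = V_pos[OF s(1) rR(2)] V_pos[OF _ rR(1)] P_pos[OF s(1) rR(2)]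
  have "s\<^sup>2 * P s < r * (s * P s)"
    using s pos by (simp add: power2_eq_square)
  also have "\<dots> = r * ((s * V s) * (P s / V s))" using pos by simp
  also have "\<dots> \<le> r * ((r * V r) * (P r / V r))"
  proof (rule mult_left_mono)
    show "(s * V s) * (P s / V s) \<le> (r * V r) * (P r / V r)"
      using s r rR pos rV_strict_mono[OF s r] P_over_V_mono[OF s(1), of r] by - (rule mult_mono, auto)
  qed (use s in simp)
  also have "\<dots> = r\<^sup>2 * P r" using pos(2) s by (simp add: power2_eq_square)
  finally show ?thesis by (simp add: h_def)
qed

text \<open>The reciprocal of the maximum of \<open>r * V r\<close>; \<open>Lambda_inf_eq\<close>
  identifies it with \<open>Lambda_inf \<Omega>\<close>.\<close>

definition \<Lambda>0 :: real where "\<Lambda>0 = 1 / (rs * V rs)"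

lemma Lambda0_pos: "0 < \<Lambda>0"
  unfolding \<Lambda>0_def using r_star V_pos by simp

lemma h_rs: "h rs = 1 / \<Lambda>0"
  using P_rs by (simp add: h_def \<Lambda>0_def power2_eq_square)

lemma isCont_h: "0 < r \<Longrightarrow> r < R \<Longrightarrow> isCont h r"
  unfolding h_def by (intro continuous_intros isCont_P)

lemma h_root_exists:
  assumes "\<Lambda>0 \<le> \<Lambda>" shows "\<exists>r. 0 < r \<and> r \<le> rs \<and> h r = 1 / \<Lambda>"
proof -
  have \<Lambda>: "0 < \<Lambda>" using assms Lambda0_pos by simp
  let ?M = "measure lebesgue \<Omega>"
  have M: "0 < ?M" using V_le_dom[OF r_star(1)] V_pos[OF r_star(1,2)] by simp
  \<comment> \<open>Since \<open>h r = r * \<phi> r * V r\<close> with \<phi> at most 1 up to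
    \<open>rs\<close>, this radius makes \<open>h\<close> at most
    \<open>1 / \<Lambda>\<close>.\<close>
  define a where "a = min rs (1 / (\<Lambda> * ?M))"
  have a: "0 < a" "a \<le> rs" using r_star \<Lambda> M by (auto simp: a_def)
  have aR: "a < R" using a r_star by simp
  have "h a = a * (\<phi> a * V a)" using V_pos[OF a(1) aR] by (simp add: h_def \<phi>_def power2_eq_square)
  also have "\<dots> \<le> (1 / (\<Lambda> * ?M)) * (1 * ?M)"
    using a phi_le_1[OF a] V_le_dom[OF a(1)] V_pos[OF a(1) aR] P_pos[OF a(1) aR] \<Lambda> M
    by (intro mult_mono) (auto simp: \<phi>_def a_def)
  also have "\<dots> = 1 / \<Lambda>" using M by simp
  finally have ha: "h a \<le> 1 / \<Lambda>" .
  have hb: "1 / \<Lambda> \<le> h rs" unfolding h_rs using assms Lambda0_pos by (simp add: frac_le)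
  have "isCont h x" if "a \<le> x" "x \<le> rs" for x using that a r_star by (intro isCont_h) auto
  then obtain r where "a \<le> r" "r \<le> rs" "h r = 1 / \<Lambda>" using IVT[of h a "1 / \<Lambda>" rs] ha hb a by blast
  then show ?thesis using a by (intro exI[of _ r]) auto
qed

text \<open>Strict monotonicity of \<open>h\<close> up to \<open>rs\<close> puts the root found
  there below every other root, so the \<open>LEAST\<close> in the definition is attained at
  it.\<close>

lemma r_Lambda:
  assumes "\<Lambda>0 \<le> \<Lambda>"
  shows "0 < r_Lambda \<Omega> \<Lambda>" "r_Lambda \<Omega> \<Lambda> \<le> rs" "h (r_Lambda \<Omega> \<Lambda>) = 1 / \<Lambda>"
proof -
  have \<Lambda>: "0 < \<Lambda>" using assms Lambda0_pos by simp
  obtain \<rho> where \<rho>: "0 < \<rho>" "\<rho> \<le> rs" "h \<rho> = 1 / \<Lambda>" using h_root_exists[OF assms] by blast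
  have "r_Lambda \<Omega> \<Lambda> = \<rho>" unfolding r_Lambda_def
  proof (rule Least_equality)
    show "0 < \<rho> \<and> \<rho> < R \<and> 1 / (\<rho>\<^sup>2 * perimeter (inner_parallel \<Omega> \<rho>)) = \<Lambda>"
      using \<rho> r_star \<Lambda> by (simp add: h_def P_def)
    fix s assume s: "0 < s \<and> s < R \<and> 1 / (s\<^sup>2 * perimeter (inner_parallel \<Omega> s)) = \<Lambda>"
    then have "h s = 1 / \<Lambda>" using \<Lambda> by (auto simp: h_def P_def)
    then show "\<rho> \<le> s" using h_strict_mono[of s \<rho>] s \<rho> by (metis less_irrefl not_le)
  qed
  then show "0 < r_Lambda \<Omega> \<Lambda>" "r_Lambda \<Omega> \<Lambda> \<le> rs" "h (r_Lambda \<Omega> \<Lambda>) = 1 / \<Lambda>" using \<rho> by auto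
qed

lemma r_Lambda_Lambda0: "r_Lambda \<Omega> \<Lambda>0 = rs"
  using r_Lambda[OF order_refl] h_rs h_strict_mono[of "r_Lambda \<Omega> \<Lambda>0" rs] by force

lemma r_Lambda_strict_antimono:
  assumes "\<Lambda>0 \<le> \<Lambda>" "\<Lambda> < \<Lambda>'" shows "r_Lambda \<Omega> \<Lambda>' < r_Lambda \<Omega> \<Lambda>"
proof (rule ccontr)
  assume "\<not> ?thesis"
  then have le: "r_Lambda \<Omega> \<Lambda> \<le> r_Lambda \<Omega> \<Lambda>'" by simp
  have "h (r_Lambda \<Omega> \<Lambda>) \<le> h (r_Lambda \<Omega> \<Lambda>')"
    using le h_strict_mono[of "r_Lambda \<Omega> \<Lambda>" "r_Lambda \<Omega> \<Lambda>'"] r_Lambda[OF assms(1)] r_Lambda[of \<Lambda>'] assms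
    by (cases "r_Lambda \<Omega> \<Lambda> = r_Lambda \<Omega> \<Lambda>'") auto
  then have "1 / \<Lambda> \<le> 1 / \<Lambda>'" using r_Lambda(3) assms by simp
  then show False using assms Lambda0_pos by (simp add: field_simps)
qed

text \<open>The expression has the sign of \<open>1 - \<Lambda> * (r * V r)\<close>, and
  \<open>r * V r\<close> is largest at \<open>rs\<close>, where its value is
  \<open>1 / \<Lambda>0\<close>.\<close>

lemma energy_nonneg:
  assumes "0 < \<Lambda>" "\<Lambda> \<le> \<Lambda>0" "0 < r" "r < R" shows "0 \<le> 1 / r - \<Lambda> * V r" "\<Lambda> < \<Lambda>0 \<Longrightarrow> 0 < 1 / r - \<Lambda> * V r"
proof -
  have rV: "r * V r \<le> rs * V rs" using rV_less_max[OF assms(3,4)] by (cases "r = rs") auto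
  have eq: "1 / r - \<Lambda> * V r = (1 - \<Lambda> * (r * V r)) / r" using assms by (simp add: field_simps)
  have le: "\<Lambda> * (r * V r) \<le> \<Lambda> * (rs * V rs)" using rV assms by (intro mult_left_mono) auto
  have max: "\<Lambda>0 * (rs * V rs) = 1" using r_star(1) V_pos[OF r_star(1,2)] by (simp add: \<Lambda>0_def)
  have "\<Lambda> * (rs * V rs) \<le> \<Lambda>0 * (rs * V rs)" using assms r_star V_pos[OF r_star(1,2)]
    by (intro mult_right_mono) auto
  then have "\<Lambda> * (r * V r) \<le> 1" using le max by linarith
  then show "0 \<le> 1 / r - \<Lambda> * V r" unfolding eq using assms by (intro divide_nonneg_nonneg) auto
  assume "\<Lambda> < \<Lambda>0"
  then have "\<Lambda> * (rs * V rs) < \<Lambda>0 * (rs * V rs)" using r_star V_pos[OF r_star(1,2)]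
    by (intro mult_strict_right_mono) auto
  then have "\<Lambda> * (r * V r) < 1" using le max by linarith
  then show "0 < 1 / r - \<Lambda> * V r" unfolding eq using assms by (intro divide_pos_pos) auto
qed

lemma energy_rs: "1 / rs - \<Lambda>0 * V rs = 0"
  unfolding \<Lambda>0_def using r_star(1) V_pos[OF r_star(1,2)] by simp

text \<open>The derivative of the reduced energy is a positive multiple of
  \<open>h r - 1 / \<Lambda>\<close>, so up to \<open>rs\<close> it changes sign exactly at \<rho>.
  Negativity comes from the comparison with \<open>rs\<close>, where the energy vanishes for
  \<Lambda>0 already.\<close>

lemma energy_minimizer:
  assumes \<Lambda>: "\<Lambda>0 < \<Lambda>"
  defines "\<rho> \<equiv> r_Lambda \<Omega> \<Lambda>"
  shows "1 / \<rho> - \<Lambda> * V \<rho> < 0"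
    and "\<And>r. \<lbrakk>0 < r; r < R; r \<noteq> \<rho>\<rbrakk> \<Longrightarrow> 1 / \<rho> - \<Lambda> * V \<rho> < 1 / r - \<Lambda> * V r"
proof -
  let ?f = "\<lambda>r. 1 / r - \<Lambda> * V r"
  have \<Lambda>p: "0 < \<Lambda>" using \<Lambda> Lambda0_pos by simp
  have \<rho>: "0 < \<rho>" "\<rho> \<le> rs" "h \<rho> = 1 / \<Lambda>" unfolding \<rho>_def using r_Lambda[of \<Lambda>] \<Lambda> by auto
  have D: "(?f has_real_derivative \<Lambda> / r\<^sup>2 * (h r - 1 / \<Lambda>)) (at r)" if "0 < r" "r < R" for r
  proof -
    have "\<Lambda> / r\<^sup>2 * (h r - 1 / \<Lambda>) = - (1 / r\<^sup>2) + \<Lambda> * P r"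
      using that \<Lambda>p by (simp add: h_def field_simps)
    then show ?thesis using that V_has_derivative[OF that]
      by (auto intro!: derivative_eq_intros simp: power2_eq_square)
  qed
  have cont: "continuous_on {a..b} ?f" if "0 < a" "b < R" for a b
    using that by (intro continuous_at_imp_continuous_on ballI continuous_intros isCont_V) auto
  have below: "?f \<rho> < ?f r" if r: "0 < r" "r < \<rho>" for r
  proof (rule DERIV_neg_imp_decreasing_open[OF r(2)])
    fix x assume x: "r < x" "x < \<rho>"
    have "h x < 1 / \<Lambda>" using h_strict_mono[of x \<rho>] x r \<rho> by auto
    then have "\<Lambda> / x\<^sup>2 * (h x - 1 / \<Lambda>) < 0" using x r \<Lambda>p by (intro mult_pos_neg) auto
    then show "\<exists>y. (?f has_real_derivative y) (at x) \<and> y < 0" using D[of x] x r \<rho> r_star by auto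
  qed (use r \<rho> r_star in \<open>auto intro!: cont\<close>)
  have above: "?f \<rho> < ?f r" if r: "\<rho> < r" "r \<le> rs" for r
  proof (rule DERIV_pos_imp_increasing_open[OF r(1)])
    fix x assume x: "\<rho> < x" "x < r"
    have "1 / \<Lambda> < h x" using h_strict_mono[of \<rho> x] x r \<rho> by auto
    then have "0 < \<Lambda> / x\<^sup>2 * (h x - 1 / \<Lambda>)" using x \<rho> \<Lambda>p by (intro mult_pos_pos) auto
    then show "\<exists>y. (?f has_real_derivative y) (at x) \<and> 0 < y" using D[of x] x r \<rho> r_star by auto
  qed (use r \<rho> r_star in \<open>auto intro!: cont\<close>)
  have rs_neg: "?f rs < 0"
  proof -
    have "\<Lambda>0 * V rs < \<Lambda> * V rs" using \<Lambda> V_pos[OF r_star(1,2)] by simp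
    then show ?thesis using energy_rs by linarith
  qed
  have rs_le: "?f \<rho> \<le> ?f rs" using above[of rs] \<rho> by (cases "\<rho> = rs") auto
  show "?f \<rho> < 0" using rs_neg rs_le by linarith
  \<comment> \<open>Beyond \<open>rs\<close> nothing is known about the monotonicity of
    \<open>h\<close>. Instead the energy is written as
    \<open>(1 - \<Lambda> * (r * V r)) / r\<close>: the numerator is negative at \<open>rs\<close>
    and larger at \<open>r\<close>, and dividing a negative number by the larger \<open>r\<close>
    increases it as well.\<close>
  have beyond: "?f rs < ?f r" if r: "rs < r" "r < R" for r
  proof -
    have r0: "0 < r" using r r_star by simp
    have eq: "?f q = (1 - \<Lambda> * (q * V q)) / q" if "0 < q" for q using that by (simp add: field_simps)
    have B: "1 - \<Lambda> * (rs * V rs) < 0" using rs_neg r_star unfolding eq[OF r_star(1)]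
      by (simp add: divide_less_0_iff)
    have "\<Lambda> * (r * V r) < \<Lambda> * (rs * V rs)" using rV_less_max[of r] r r0 \<Lambda>p
      by (intro mult_strict_left_mono) auto
    then have "(1 - \<Lambda> * (rs * V rs)) / r < (1 - \<Lambda> * (r * V r)) / r" using r0
      by (intro divide_strict_right_mono) auto
    moreover have "(1 - \<Lambda> * (rs * V rs)) / rs \<le> (1 - \<Lambda> * (rs * V rs)) / r"
      using B r r_star by (intro divide_left_mono_neg) auto
    ultimately show ?thesis unfolding eq[OF r0] eq[OF r_star(1)] by linarith
  qed
  fix r assume "0 < r" "r < R" "r \<noteq> \<rho>"
  then show "?f \<rho> < ?f r"
    using below[of r] above[of r] beyond[of r] rs_le by (cases "r < \<rho>"; cases "r \<le> rs") auto
qed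

end

subsection \<open>Test functions\<close>

text \<open>The flat exponential together with the inverse powers that differentiation produces; the
  index \<open>j\<close> makes the family closed under derivatives up to linear
  combinations.\<close>

definition \<psi> :: "nat \<Rightarrow> real \<Rightarrow> real" where
  "\<psi> j t = (if t \<le> 0 then 0 else exp (- inverse t) * inverse t ^ j)"

lemma psi_tendsto_0: "(\<psi> j \<longlongrightarrow> 0) (at_right 0)"
proof -
  have "((\<lambda>t. inverse t ^ j / exp (inverse t)) \<longlongrightarrow> (0::real)) (at_right 0)"
    by (rule filterlim_compose[OF tendsto_power_div_exp_0 filterlim_inverse_at_top_right])
  moreover have "\<forall>\<^sub>F t in at_right 0. inverse t ^ j / exp (inverse t) = \<psi> j t"
    using eventually_at_right_less[of 0] by eventually_elim (simp add: \<psi>_def exp_minus field_simps)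
  ultimately show ?thesis by (rule Lim_transform_eventually)
qed

lemma psi_has_derivative:
  "(\<psi> j has_real_derivative \<psi> (j + 2) t - j * \<psi> (j + 1) t) (at t)"
proof (cases t "0 :: real" rule: linorder_cases)
  case less
  have "((\<lambda>t. 0) has_real_derivative 0) (at t)" by simp
  moreover have "\<forall>\<^sub>F s in nhds t. 0 = \<psi> j s"
    using eventually_nhds_in_open[of "{..<0}" t] less by (auto elim!: eventually_mono simp: \<psi>_def)
  ultimately have "(\<psi> j has_real_derivative 0) (at t)"
    by (rule DERIV_cong_ev[THEN iffD1, OF refl _ refl, rotated])
  then show ?thesis using less by (simp add: \<psi>_def)
next
  case greater
  have "((\<lambda>t. exp (- inverse t) * inverse t ^ j) has_real_derivative \<psi> (j + 2) t - j * \<psi> (j + 1) t) (at t)"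
    using greater
    by (auto intro!: derivative_eq_intros simp: \<psi>_def power2_eq_square power_add algebra_simps)
      (cases j; simp add: power_add algebra_simps)
  moreover have "\<forall>\<^sub>F s in nhds t. exp (- inverse s) * inverse s ^ j = \<psi> j s"
    using eventually_nhds_in_open[of "{0<..}" t] greater by (auto elim!: eventually_mono simp: \<psi>_def)
  ultimately show ?thesis by (rule DERIV_cong_ev[THEN iffD1, OF refl _ refl, rotated])
next
  case equal
  have "((\<lambda>h. (\<psi> j (0 + h) - \<psi> j 0) / h) \<longlongrightarrow> 0) (at_left 0)"
  proof (rule Lim_transform_eventually[OF tendsto_const])
    show "\<forall>\<^sub>F h in at_left 0. 0 = (\<psi> j (0 + h) - \<psi> j 0) / h"
      unfolding eventually_at_left_field by (intro exI[of _ "-1"]) (auto simp: \<psi>_def)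
  qed
  \<comment> \<open>From the right the difference quotient of \<open>\<psi> j\<close> at 0 is
    \<open>\<psi> (Suc j)\<close>, which tends to 0 as well.\<close>
  moreover have "((\<lambda>h. (\<psi> j (0 + h) - \<psi> j 0) / h) \<longlongrightarrow> 0) (at_right 0)"
  proof (rule Lim_transform_eventually[OF psi_tendsto_0[of "Suc j"]])
    show "\<forall>\<^sub>F h in at_right 0. \<psi> (Suc j) h = (\<psi> j (0 + h) - \<psi> j 0) / h"
      using eventually_at_right_less[of 0] by eventually_elim (simp add: \<psi>_def divide_inverse)
  qed
  ultimately have "((\<lambda>h. (\<psi> j (0 + h) - \<psi> j 0) / h) \<longlongrightarrow> 0) (at 0)"
    using filterlim_split_at by blast
  then show ?thesis using equal unfolding DERIV_def by (simp add: \<psi>_def)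
qed

text \<open>Generated by just enough operations to contain the bumps and all their directional
  derivatives; membership then gives \<open>Ck k\<close> for every \<open>k\<close> by induction on
  \<open>k\<close>.\<close>

inductive_set smooth :: "('a::euclidean_space \<Rightarrow> real) set" where
  const: "(\<lambda>x. c) \<in> smooth"
| linear: "(\<lambda>x. x \<bullet> a) \<in> smooth"
| square: "(\<lambda>x. x \<bullet> x) \<in> smooth"
| add: "f \<in> smooth \<Longrightarrow> g \<in> smooth \<Longrightarrow> (\<lambda>x. f x + g x) \<in> smooth"
| mult: "f \<in> smooth \<Longrightarrow> g \<in> smooth \<Longrightarrow> (\<lambda>x. f x * g x) \<in> smooth"
| psi: "f \<in> smooth \<Longrightarrow> (\<lambda>x. \<psi> j (f x)) \<in> smooth"

lemma smooth_has_derivative: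
  "f \<in> smooth \<Longrightarrow> \<exists>D. (\<forall>x. (f has_derivative D x) (at x)) \<and> (\<forall>e. (\<lambda>x. D x e) \<in> smooth)"
proof (induction rule: smooth.induct)
  case (const c)
  then show ?case by (intro exI[of _ "\<lambda>x e. 0"]) (auto intro: smooth.const)
next
  case (linear a)
  show ?case
    by (intro exI[of _ "\<lambda>x e. e \<bullet> a"]) (auto intro!: derivative_eq_intros smooth.const)
next
  case square
  have "((\<lambda>x. x \<bullet> x) has_derivative (\<lambda>e. x \<bullet> e + x \<bullet> e)) (at x)" for x :: 'a
    by (auto intro!: derivative_eq_intros simp: inner_commute)
  moreover have "(\<lambda>x. x \<bullet> e + x \<bullet> e) \<in> smooth" for e :: 'a by (intro smooth.add smooth.linear)
  ultimately show ?case by (intro exI[of _ "\<lambda>x e. x \<bullet> e + x \<bullet> e"]) auto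
next
  case (add f g)
  then obtain Df Dg where D: "\<And>x. (f has_derivative Df x) (at x)" "\<And>e. (\<lambda>x. Df x e) \<in> smooth"
    "\<And>x. (g has_derivative Dg x) (at x)" "\<And>e. (\<lambda>x. Dg x e) \<in> smooth" by auto
  show ?case
    by (intro exI[of _ "\<lambda>x e. Df x e + Dg x e"]) (auto intro!: derivative_eq_intros D smooth.add)
next
  case (mult f g)
  then obtain Df Dg where D: "\<And>x. (f has_derivative Df x) (at x)" "\<And>e. (\<lambda>x. Df x e) \<in> smooth"
    "\<And>x. (g has_derivative Dg x) (at x)" "\<And>e. (\<lambda>x. Dg x e) \<in> smooth" by auto
  have "((\<lambda>x. f x * g x) has_derivative (\<lambda>e. f x * Dg x e + Df x e * g x)) (at x)" for x
    by (rule has_derivative_mult[OF D(1,3)])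
  moreover have "(\<lambda>x. f x * Dg x e + Df x e * g x) \<in> smooth" for e
    by (intro smooth.add smooth.mult mult.hyps D)
  ultimately show ?case by (intro exI[of _ "\<lambda>x e. f x * Dg x e + Df x e * g x"]) auto
next
  case (psi f j)
  then obtain Df where D: "\<And>x. (f has_derivative Df x) (at x)" "\<And>e. (\<lambda>x. Df x e) \<in> smooth" by auto
  let ?D = "\<lambda>x e. (\<psi> (j + 2) (f x) + (- real j) * \<psi> (j + 1) (f x)) * Df x e"
  have "((\<lambda>x. \<psi> j (f x)) has_derivative ?D x) (at x)" for x
    using has_derivative_compose[OF D(1) psi_has_derivative[of j "f x", unfolded has_field_derivative_def]]
    by (simp add: mult.commute)
  moreover have "(\<lambda>x. ?D x e) \<in> smooth" for e
    by (intro smooth.mult smooth.add smooth.psi smooth.const psi.hyps D)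
  ultimately show ?case by (intro exI[of _ ?D]) auto
qed

lemma smooth_Ck: "f \<in> smooth \<Longrightarrow> Ck k f"
proof (induction k arbitrary: f)
  case 0
  then obtain D where "\<And>x. (f has_derivative D x) (at x)" using smooth_has_derivative by blast
  then show ?case by (auto intro!: continuous_at_imp_continuous_on has_derivative_continuous)
next
  case (Suc k)
  then obtain D where D: "\<And>x. (f has_derivative D x) (at x)" "\<And>e. (\<lambda>x. D x e) \<in> smooth"
    using smooth_has_derivative by blast
  have "frechet_derivative f (at x) = D x" for x using frechet_derivative_at[OF D(1)] by simp
  then show ?case using Suc.IH D
    by (auto simp: differentiable_on_def intro: differentiableI differentiable_at_withinI)
qed

text \<open>The factor \<open>k\<close> sharpens the profile: as it grows, the bumps stay between 0
  and 1 and converge to the indicator of the ball.\<close>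

definition bump :: "real \<Rightarrow> 'a::euclidean_space \<Rightarrow> real \<Rightarrow> 'a \<Rightarrow> real" where
  "bump k c r x = \<psi> 0 (k * (r\<^sup>2 - (x - c) \<bullet> (x - c)))"

lemma bump_smooth: "bump k c r \<in> smooth"
proof -
  have "bump k c r = (\<lambda>x. \<psi> 0 (k * (((- 1) * (x \<bullet> x) + x \<bullet> (2 *\<^sub>R c)) + (r\<^sup>2 - c \<bullet> c))))"
    by (auto simp: bump_def inner_diff_left inner_diff_right inner_commute algebra_simps)
  then show ?thesis by (simp only:) (intro smooth.intros)
qed

lemma bump_pos_iff:
  assumes "0 < k" "0 < r" shows "bump k c r x > 0 \<longleftrightarrow> x \<in> ball c r"
proof -
  have "(x - c) \<bullet> (x - c) < r\<^sup>2 \<longleftrightarrow> norm (x - c) < r"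
    using assms by (simp add: norm_lt_square)
  then show ?thesis using assms
    by (auto simp: bump_def \<psi>_def zero_less_mult_iff mult_le_0_iff not_le dist_norm norm_minus_commute)
qed

lemma psi_0_bounds: "0 \<le> \<psi> 0 t" "\<psi> 0 t \<le> 1"
  by (auto simp: \<psi>_def)

lemma bump_nonneg: "0 \<le> bump k c r x" and bump_le_1: "bump k c r x \<le> 1"
  by (simp_all add: bump_def psi_0_bounds)

lemma bump_zero_iff:
  assumes "0 < k" "0 < r" shows "bump k c r x = 0 \<longleftrightarrow> x \<notin> ball c r"
  using bump_pos_iff[OF assms, of c x] bump_nonneg[of k c r x] by linarith

lemma bump_translate: "bump k c r (y + s) = bump k (c - s) r y"
  by (simp add: bump_def algebra_simps)

lemma bump_test_function:
  assumes "0 < k" "0 < r" "cball c r \<subseteq> \<Omega>" shows "bump k c r \<in> test_functions \<Omega>"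
proof -
  have "{x. bump k c r x \<noteq> 0} = ball c r" by (simp add: set_eq_iff bump_zero_iff[OF assms(1,2)])
  moreover have "Ck j (bump k c r)" for j by (rule smooth_Ck[OF bump_smooth])
  ultimately show ?thesis using assms by (simp add: test_functions_def)
qed

lemma bump_tendsto_indicator:
  assumes "0 < r" shows "(\<lambda>n. bump (real (Suc n)) c r x) \<longlonglongrightarrow> indicator (ball c r) x"
proof (cases "x \<in> ball c r")
  case True
  let ?t = "r\<^sup>2 - (x - c) \<bullet> (x - c)"
  have t: "0 < ?t" using bump_pos_iff[of 1 r c x] True assms
    by (auto simp: bump_def \<psi>_def split: if_splits)
  have "(\<lambda>n. exp (- (inverse (real (Suc n)) * inverse ?t))) \<longlonglongrightarrow> exp (- (0 * inverse ?t))"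
    by (intro tendsto_intros LIMSEQ_inverse_real_of_nat)
  moreover have "bump (real (Suc n)) c r x = exp (- (inverse (real (Suc n)) * inverse ?t))" for n
  proof -
    have "0 < real (Suc n) * ?t" using t by simp
    then show ?thesis by (simp add: bump_def \<psi>_def not_le inverse_mult_distrib del: of_nat_Suc)
  qed
  ultimately show ?thesis using True by simp
next
  case False
  then show ?thesis using bump_zero_iff[of "real (Suc n)" r c x for n] assms by simp
qed

text \<open>What the integral estimates use of a test function: a compact set \<open>S\<close> off
  which it vanishes, and a derivative \<open>D\<close> that is continuous in each direction.\<close>

definition C1c :: "'a::euclidean_space set \<Rightarrow> ('a \<Rightarrow> real) \<Rightarrow> ('a \<Rightarrow> 'a \<Rightarrow> real) \<Rightarrow> bool" where
  "C1c S f D \<longleftrightarrow> compact S \<and> (\<forall>x. (f has_derivative D x) (at x)) \<and> (\<forall>e. continuous_on UNIV (\<lambda>x. D x e))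
     \<and> (\<forall>x. x \<notin> S \<longrightarrow> f x = 0)"

lemma C1c_test_function:
  assumes "\<phi> \<in> test_functions \<Omega>"
  shows "C1c (closure {x. \<phi> x \<noteq> 0}) \<phi> (\<lambda>x. frechet_derivative \<phi> (at x))"
proof -
  have Ck: "Ck (Suc 0) \<phi>" and cpt: "compact (closure {x. \<phi> x \<noteq> 0})" using assms
    by (auto simp: test_functions_def)
  have D: "(\<phi> has_derivative frechet_derivative \<phi> (at x)) (at x)" for x
    using Ck by (auto simp: differentiable_on_def frechet_derivative_works[symmetric])
  have "continuous_on UNIV (\<lambda>x. frechet_derivative \<phi> (at x) e)" for e
  proof -
    have "frechet_derivative \<phi> (at x) e = (\<Sum>b\<in>Basis. (e \<bullet> b) * frechet_derivative \<phi> (at x) b)" for x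
    proof -
      have lin: "linear (frechet_derivative \<phi> (at x))" using D has_derivative_linear by blast
      have "frechet_derivative \<phi> (at x) e = frechet_derivative \<phi> (at x) (\<Sum>b\<in>Basis. (e \<bullet> b) *\<^sub>R b)"
        by (simp add: euclidean_representation)
      also have "\<dots> = (\<Sum>b\<in>Basis. (e \<bullet> b) * frechet_derivative \<phi> (at x) b)"
        by (simp add: linear_sum[OF lin] linear_scale[OF lin])
      finally show ?thesis .
    qed
    then have "(\<lambda>x. frechet_derivative \<phi> (at x) e) = (\<lambda>x. \<Sum>b\<in>Basis. (e \<bullet> b) * frechet_derivative \<phi> (at x) b)"
      by (rule ext)
    moreover have "continuous_on UNIV (\<lambda>x. frechet_derivative \<phi> (at x) b)" if "b \<in> Basis" for b
      using Ck that by simp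
    ultimately show ?thesis by (simp only:) (intro continuous_intros)
  qed
  moreover have "\<phi> x = 0" if "x \<notin> closure {x. \<phi> x \<noteq> 0}" for x
  proof (rule ccontr)
    assume "\<phi> x \<noteq> 0"
    then have "x \<in> {x. \<phi> x \<noteq> 0}" by simp
    then show False using closure_subset that by (meson subsetD)
  qed
  ultimately show ?thesis unfolding C1c_def using D cpt by blast
qed

lemma C1c_derivative_zero:
  assumes "C1c S f D" "x \<notin> S" shows "D x e = 0"
proof -
  have "open (- S)" using assms by (auto simp: C1c_def compact_imp_closed open_Compl)
  moreover have "(f has_derivative D x) (at x)" using assms by (simp add: C1c_def)
  moreover have "\<And>y. y \<in> - S \<Longrightarrow> f y = 0" using assms by (simp add: C1c_def)
  ultimately have "((\<lambda>y. 0) has_derivative D x) (at x)"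
    using assms(2) has_derivative_transform_within_open[of f "D x" x UNIV "- S" "\<lambda>y. 0"] by auto
  then have "D x = (\<lambda>_. 0)" by (rule has_derivative_unique) (rule has_derivative_const)
  then show ?thesis by simp
qed

lemma C1c_continuous: "C1c S f D \<Longrightarrow> continuous_on A f"
  unfolding C1c_def by (meson continuous_at_imp_continuous_on has_derivative_continuous)

section \<open>Integrals of continuous functions with compact support\<close>

lemma integrable_compact_support:
  fixes f :: "'a::euclidean_space \<Rightarrow> real"
  assumes f: "continuous_on UNIV f" and S: "compact S" and z: "\<And>x. x \<notin> S \<Longrightarrow> f x = 0"
  shows "integrable lborel f" "integrable lebesgue f"
proof -
  have "integrable lborel (\<lambda>x. indicator S x *\<^sub>R f x)"
    using borel_integrable_compact[OF S continuous_on_subset[OF f]] by simp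
  moreover have "(\<lambda>x. indicator S x *\<^sub>R f x) = f" using z by (auto simp: indicator_def fun_eq_iff)
  ultimately show I: "integrable lborel f" by simp
  show "integrable lebesgue f" using I f
    by (subst integrable_completion) (simp_all add: borel_measurable_continuous_onI)
qed

lemma integral_cbox_compact_support:
  fixes f :: "'a::euclidean_space \<Rightarrow> real"
  assumes f: "continuous_on UNIV f" and S: "compact S" "S \<subseteq> cbox a b" and z: "\<And>x. x \<notin> S \<Longrightarrow> f x = 0"
  shows "integral (cbox a b) f = (LINT x|lborel. f x)"
proof -
  have "(f has_integral (LINT x|lborel. f x)) UNIV"
    using integrable_compact_support(1)[OF f S(1) z] by (rule has_integral_integral_lborel)
  moreover have "(\<lambda>x. if x \<in> cbox a b then f x else 0) = f" using z S(2) by (auto simp: fun_eq_iff)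
  ultimately have "(f has_integral (LINT x|lborel. f x)) (cbox a b)"
    by (subst has_integral_restrict_UNIV[symmetric]) (simp only:)
  then show ?thesis by (rule integral_unique)
qed

lemma integral_lebesgue_on_compact_support:
  fixes f :: "'a::euclidean_space \<Rightarrow> real"
  assumes f: "continuous_on UNIV f" and \<Omega>: "\<Omega> \<in> sets lebesgue" and z: "\<And>x. x \<notin> \<Omega> \<Longrightarrow> f x = 0"
  shows "(LINT x|lebesgue_on \<Omega>. f x) = (LINT x|lborel. f x)"
proof -
  have "(LINT x|lebesgue_on \<Omega>. f x) = (LINT x|lebesgue. indicator \<Omega> x *\<^sub>R f x)"
    using \<Omega> by (subst integral_restrict_space) auto
  also have "(\<lambda>x. indicator \<Omega> x *\<^sub>R f x) = f" using z by (auto simp: indicator_def fun_eq_iff)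
  also have "(LINT x|lebesgue. f x) = (LINT x|lborel. f x)"
    using f by (intro integral_completion) (simp add: borel_measurable_continuous_onI)
  finally show ?thesis .
qed

lemma integral_translate:
  fixes f :: "'a::euclidean_space \<Rightarrow> real"
  assumes "f \<in> borel_measurable borel"
  shows "(LINT x|lborel. f (x + a)) = (LINT x|lborel. f x)"
proof -
  have "(LINT x|lborel. f x) = (LINT x|distr lborel borel ((+) a). f x)"
    by (simp add: lborel_distr_plus)
  also have "\<dots> = (LINT x|lborel. f (a + x))" using assms by (subst integral_distr) auto
  finally show ?thesis by (simp add: add.commute)
qed

text \<open>Differentiation under the integral sign. The translation acts on the smooth factor,
  since \<open>u\<close> is merely continuous.\<close>

lemma translate_integral_derivative:
  fixes u :: "'a::euclidean_space \<Rightarrow> real"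
  assumes u: "continuous_on UNIV u" and f: "C1c S f D"
  shows "((\<lambda>s. LINT y|lborel. u y * f (y + s *\<^sub>R e)) has_real_derivative (LINT y|lborel. u y * D (y + s *\<^sub>R e) e)) (at s)"
proof -
  have S: "compact S" using f by (simp add: C1c_def)
  have Dc: "continuous_on UNIV (\<lambda>x. D x e)" using f by (simp add: C1c_def)
  \<comment> \<open>A compact set that contains the supports of all translates with parameter within
    1 of \<open>s\<close>, so that one box serves them all.\<close>
  define T where "T = (\<lambda>p. fst p - snd p *\<^sub>R e) ` (S \<times> {s - 1..s + 1})"
  have T: "compact T" unfolding T_def
    by (intro compact_continuous_image compact_Times S continuous_intros) auto
  obtain a where a: "T \<subseteq> cbox (- a) a" using bounded_subset_cbox_symmetric[OF compact_imp_bounded[OF T]]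
    by blast
  have inT: "y \<in> T" if "\<bar>q - s\<bar> \<le> 1" "y + q *\<^sub>R e \<in> S" for y q
    unfolding T_def using that by (intro image_eqI[of _ _ "(y + q *\<^sub>R e, q)"]) auto
  have fc: "continuous_on UNIV f" using C1c_continuous[OF f] .
  have e1: "integral (cbox (- a) a) (\<lambda>y. u y * f (y + q *\<^sub>R e)) = (LINT y|lborel. u y * f (y + q *\<^sub>R e))"
    if q: "\<bar>q - s\<bar> \<le> 1" for q
    by (rule integral_cbox_compact_support[OF _ T a])
      (use inT[OF q] f in \<open>auto intro!: continuous_intros u continuous_on_compose2[OF fc] simp: C1c_def\<close>)
  have e2: "integral (cbox (- a) a) (\<lambda>y. u y * D (y + s *\<^sub>R e) e) = (LINT y|lborel. u y * D (y + s *\<^sub>R e) e)"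
    by (rule integral_cbox_compact_support[OF _ T a])
      (use inT[of s] C1c_derivative_zero[OF f] in \<open>auto intro!: continuous_intros u continuous_on_compose2[OF Dc]\<close>)
  have "((\<lambda>q. integral (cbox (- a) a) (\<lambda>y. u y * f (y + q *\<^sub>R e))) has_field_derivative
      integral (cbox (- a) a) (\<lambda>y. u y * D (y + s *\<^sub>R e) e)) (at s within UNIV)"
  proof (rule leibniz_rule_field_derivative)
    fix q :: real and y :: 'a
    have "(f has_derivative D (y + q *\<^sub>R e)) (at (y + q *\<^sub>R e))" using f by (simp add: C1c_def)
    moreover have "((\<lambda>q. y + q *\<^sub>R e) has_derivative (\<lambda>q. q *\<^sub>R e)) (at q)"
      by (auto intro!: derivative_eq_intros)
    ultimately have "((\<lambda>q. f (y + q *\<^sub>R e)) has_derivative (\<lambda>h. D (y + q *\<^sub>R e) (h *\<^sub>R e))) (at q)"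
      by (rule has_derivative_compose[rotated])
    moreover have "linear (D (y + q *\<^sub>R e))" using f has_derivative_linear by (auto simp: C1c_def)
    ultimately have "((\<lambda>q. f (y + q *\<^sub>R e)) has_field_derivative D (y + q *\<^sub>R e) e) (at q)"
      by (simp add: has_field_derivative_def linear_scale mult_commute_abs)
    then show "((\<lambda>q. u y * f (y + q *\<^sub>R e)) has_field_derivative u y * D (y + q *\<^sub>R e) e) (at q within UNIV)"
      by (intro DERIV_cmult) simp
    show "(\<lambda>y. u y * f (y + q *\<^sub>R e)) integrable_on cbox (- a) a"
      by (intro integrable_continuous continuous_intros continuous_on_subset[OF u] continuous_on_compose2[OF fc]) auto
  next
    show "continuous_on (UNIV \<times> cbox (- a) a) (\<lambda>(q, y). u y * D (y + q *\<^sub>R e) e)"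
      unfolding split_beta
        by (intro continuous_intros continuous_on_compose2[OF u] continuous_on_compose2[OF Dc]) auto
  qed auto
  then have "((\<lambda>q. integral (cbox (- a) a) (\<lambda>y. u y * f (y + q *\<^sub>R e))) has_field_derivative
      (LINT y|lborel. u y * D (y + s *\<^sub>R e) e)) (at s)" by (simp add: e2)
  moreover have "\<forall>\<^sub>F q in nhds s. integral (cbox (- a) a) (\<lambda>y. u y * f (y + q *\<^sub>R e)) = (LINT y|lborel. u y * f (y + q *\<^sub>R e))"
    using eventually_nhds_in_open[of "ball s 1" s]
      by (auto elim!: eventually_mono intro!: e1 simp: dist_real_def)
  ultimately show ?thesis by (rule DERIV_cong_ev[THEN iffD1, OF refl _ refl, rotated])
qed

subsection \<open>Weak gradients and Lipschitz constants\<close>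

lemma compact_support_bounded:
  fixes f :: "'a::euclidean_space \<Rightarrow> real"
  assumes f: "continuous_on UNIV f" and S: "compact S" and z: "\<And>x. x \<notin> S \<Longrightarrow> f x = 0"
  shows "\<exists>B\<ge>0. \<forall>x. \<bar>f x\<bar> \<le> B"
proof -
  have "compact (f ` S)" using S continuous_on_subset[OF f] by (intro compact_continuous_image) auto
  then obtain B where "\<forall>y\<in>f ` S. norm y \<le> B" using compact_imp_bounded bounded_iff by blast
  then have B: "\<And>x. x \<in> S \<Longrightarrow> \<bar>f x\<bar> \<le> B" by simp
  then have "\<bar>f x\<bar> \<le> max 0 B" for x using z[of x] by (cases "x \<in> S") (auto simp: le_max_iff_disj)
  then show ?thesis by (intro exI[of _ "max 0 B"]) auto
qed

lemma integrable_Linf_inner: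
  fixes \<phi> :: "'a::euclidean_space \<Rightarrow> real"
  assumes g: "g \<in> Linf \<Omega>" and \<Omega>: "\<Omega> \<in> lmeasurable"
    and \<phi>: "\<phi> \<in> borel_measurable (lebesgue_on \<Omega>)" "\<And>x. \<bar>\<phi> x\<bar> \<le> B"
  shows "integrable (lebesgue_on \<Omega>) (\<lambda>x. (g x \<bullet> e) * \<phi> x)"
proof -
  interpret finite_measure "lebesgue_on \<Omega>" by (rule finite_measure_lebesgue_on[OF \<Omega>])
  obtain C where gm: "g \<in> borel_measurable (lebesgue_on \<Omega>)"
    and C: "AE x in lebesgue_on \<Omega>. norm (g x) \<le> C"
    using g by (auto simp: Linf_def)
  show ?thesis
  proof (rule integrable_const_bound[where B="C * norm e * B"])
    show "AE x in lebesgue_on \<Omega>. norm ((g x \<bullet> e) * \<phi> x) \<le> C * norm e * B"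
      using C
    proof eventually_elim
      case (elim x)
      have "\<bar>g x \<bullet> e\<bar> \<le> norm (g x) * norm e" by (rule Cauchy_Schwarz_ineq2)
      also have "\<dots> \<le> C * norm e" using elim by (intro mult_right_mono) auto
      finally have "\<bar>g x \<bullet> e\<bar> * \<bar>\<phi> x\<bar> \<le> (C * norm e) * B"
        using \<phi>(2)[of x] by (intro mult_mono) (auto intro: order_trans[OF abs_ge_zero])
      then show ?case by (simp add: abs_mult)
    qed
    show "(\<lambda>x. (g x \<bullet> e) * \<phi> x) \<in> borel_measurable (lebesgue_on \<Omega>)"
      using gm \<phi>(1) by measurable
  qed
qed

lemma continuous_imp_measurable_lebesgue_on:
  fixes f :: "'a::euclidean_space \<Rightarrow> real"
  assumes "continuous_on UNIV f" shows "f \<in> borel_measurable (lebesgue_on \<Omega>)"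
  using borel_measurable_continuous_onI[OF assms]
  by (intro measurable_restrict_space1) (simp add: measurable_completion)

lemma integrable_lebesgue_on_continuous:
  fixes f :: "'a::euclidean_space \<Rightarrow> real"
  assumes "continuous_on UNIV f" "integrable lborel f" "\<Omega> \<in> sets lebesgue"
  shows "integrable (lebesgue_on \<Omega>) f"
proof -
  have "integrable lebesgue f" using assms
    by (subst integrable_completion) (simp_all add: borel_measurable_continuous_onI)
  from integrable_mult_indicator[OF assms(3) this] show ?thesis using assms(3)
    by (subst integrable_restrict_space) auto
qed

text \<open>The definition tests coordinate directions only; linearity extends it to every
  \<open>e\<close>. The continuous function \<open>U\<close> on the whole space allows integrals
  over \<open>lborel\<close>, where translations are available.\<close>

lemma weak_gradient_direction:
  fixes \<Omega> :: "'a::euclidean_space set"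
  assumes \<Omega>: "\<Omega> \<in> lmeasurable" and U: "continuous_on UNIV U" and uU: "\<And>x. x \<in> \<Omega> \<Longrightarrow> U x = u x"
    and g: "g \<in> Linf \<Omega>" "has_weak_gradient \<Omega> u g" and \<phi>: "\<phi> \<in> test_functions \<Omega>"
  shows "(LINT x|lborel. U x * frechet_derivative \<phi> (at x) e) = - (LINT x|lebesgue_on \<Omega>. (g x \<bullet> e) * \<phi> x)"
proof -
  let ?D = "\<lambda>x. frechet_derivative \<phi> (at x)"
  let ?S = "closure {x. \<phi> x \<noteq> 0}"
  have C: "C1c ?S \<phi> ?D" by (rule C1c_test_function[OF \<phi>])
  have S: "compact ?S" "?S \<subseteq> \<Omega>" using \<phi> by (auto simp: test_functions_def)
  have D: "continuous_on UNIV (\<lambda>x. U x * ?D x e)" "\<And>x. x \<notin> ?S \<Longrightarrow> U x * ?D x e = 0" for e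
  proof -
    have "continuous_on UNIV (\<lambda>x. ?D x e)" using C unfolding C1c_def by blast
    then show "continuous_on UNIV (\<lambda>x. U x * ?D x e)" by (intro continuous_intros U)
    show "U x * ?D x e = 0" if "x \<notin> ?S" for x
      by (simp only: C1c_derivative_zero[OF C that] mult_zero_right)
  qed
  have cont: "continuous_on UNIV \<phi>" by (rule C1c_continuous[OF C])
  have "\<And>x. x \<notin> ?S \<Longrightarrow> \<phi> x = 0" using C unfolding C1c_def by blast
  then obtain B where B: "\<And>x. \<bar>\<phi> x\<bar> \<le> B"
    using compact_support_bounded[OF cont S(1)] by blast
  have I: "integrable (lebesgue_on \<Omega>) (\<lambda>x. (g x \<bullet> e) * \<phi> x)" for e
    by (rule integrable_Linf_inner[OF g(1) \<Omega> continuous_imp_measurable_lebesgue_on[OF cont] B])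
  have b: "(LINT x|lborel. U x * ?D x b) = - (LINT x|lebesgue_on \<Omega>. (g x \<bullet> b) * \<phi> x)" if "b \<in> Basis"
    for b
  proof -
    have "(LINT x|lborel. U x * ?D x b) = (LINT x|lebesgue_on \<Omega>. U x * ?D x b)"
      using D(2) S \<Omega>
        by (intro integral_lebesgue_on_compact_support[symmetric] D) (auto simp: fmeasurableD subset_iff)
    also have "\<dots> = (LINT x|lebesgue_on \<Omega>. u x * ?D x b)"
      by (intro Bochner_Integration.integral_cong) (auto simp: uU)
    also have "\<dots> = - (LINT x|lebesgue_on \<Omega>. (g x \<bullet> b) * \<phi> x)"
      using g(2) \<phi> that by (simp add: has_weak_gradient_def)
    finally show ?thesis .
  qed
  have De: "?D x e = (\<Sum>b\<in>Basis. (e \<bullet> b) * ?D x b)" for x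
  proof -
    have lin: "linear (?D x)" using C has_derivative_linear by (auto simp: C1c_def)
    have "?D x e = ?D x (\<Sum>b\<in>Basis. (e \<bullet> b) *\<^sub>R b)" by (simp add: euclidean_representation)
    also have "\<dots> = (\<Sum>b\<in>Basis. (e \<bullet> b) * ?D x b)"
      by (simp add: linear_sum[OF lin] linear_scale[OF lin])
    finally show ?thesis .
  qed
  have "(LINT x|lborel. U x * ?D x e) = (LINT x|lborel. (\<Sum>b\<in>Basis. (e \<bullet> b) * (U x * ?D x b)))"
    by (simp only: De sum_distrib_left mult_ac)
  also have "\<dots> = (\<Sum>b\<in>Basis. (e \<bullet> b) * (LINT x|lborel. U x * ?D x b))"
    using integrable_compact_support(1)[OF D(1) S(1) D(2)]
    by (subst Bochner_Integration.integral_sum) auto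
  also have "\<dots> = (\<Sum>b\<in>Basis. (e \<bullet> b) * (- (LINT x|lebesgue_on \<Omega>. (g x \<bullet> b) * \<phi> x)))"
    by (intro sum.cong) (simp_all add: b)
  also have "\<dots> = - (\<Sum>b\<in>Basis. (e \<bullet> b) * (LINT x|lebesgue_on \<Omega>. (g x \<bullet> b) * \<phi> x))"
    by (simp add: sum_negf)
  also have "(\<Sum>b\<in>Basis. (e \<bullet> b) * (LINT x|lebesgue_on \<Omega>. (g x \<bullet> b) * \<phi> x))
      = (LINT x|lebesgue_on \<Omega>. (\<Sum>b\<in>Basis. (e \<bullet> b) * ((g x \<bullet> b) * \<phi> x)))"
    using I by (subst Bochner_Integration.integral_sum) auto
  also have "(\<lambda>x. \<Sum>b\<in>Basis. (e \<bullet> b) * ((g x \<bullet> b) * \<phi> x)) = (\<lambda>x. (g x \<bullet> e) * \<phi> x)"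
  proof
    fix x
    show "(\<Sum>b\<in>Basis. (e \<bullet> b) * ((g x \<bullet> b) * \<phi> x)) = (g x \<bullet> e) * \<phi> x"
      by (simp add: euclidean_inner[of "g x" e] sum_distrib_left mult_ac)
  qed
  finally show ?thesis .
qed

lemma bump_support:
  assumes "0 < k" "0 < r"
  shows "continuous_on UNIV (bump k c r)" "\<And>x. x \<notin> cball c r \<Longrightarrow> bump k c r x = 0"
proof -
  have "\<phi> \<in> smooth \<Longrightarrow> continuous_on UNIV \<phi>" for \<phi> :: "'a \<Rightarrow> real"
    using smooth_Ck[of \<phi> 0] by simp
  then show "continuous_on UNIV (bump k c r)" using bump_smooth by blast
  show "bump k c r x = 0" if "x \<notin> cball c r" for x
    unfolding bump_zero_iff[OF assms] using that ball_subset_cball by blast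
qed

lemma bump_integrable:
  assumes "0 < k" "0 < r" shows "integrable lborel (bump k c r)"
  by (rule integrable_compact_support(1)[OF bump_support(1)[OF assms] compact_cball bump_support(2)[OF assms]])

lemma bump_integral_pos:
  assumes "0 < k" "0 < r" shows "0 < (LINT x|lborel. bump k c r x)"
proof (rule ccontr)
  assume "\<not> ?thesis"
  moreover have "0 \<le> (LINT x|lborel. bump k c r x)" by (simp add: bump_nonneg)
  ultimately have "(LINT x|lborel. bump k c r x) = 0" by simp
  then have "AE x in lborel. bump k c r x = 0"
    by (subst (asm) integral_nonneg_eq_0_iff_AE[OF bump_integrable[OF assms]]) (simp_all add: bump_nonneg)
  then have "AE x in lborel. x \<notin> ball c r" by (simp only: bump_zero_iff[OF assms])
  then have "ball c r \<in> null_sets lborel" using AE_iff_null_sets[of "ball c r" lborel] by simp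
  then have "negligible (ball c r)" by (simp add: negligible_iff_null_sets null_sets_completionI)
  then show False using assms open_not_negligible[of "ball c r"] by auto
qed

lemma bump_integral_translate:
  assumes "0 < k" "0 < r" shows "(LINT x|lborel. bump k (c - s) r x) = (LINT x|lborel. bump k c r x)"
proof -
  have "(LINT x|lborel. bump k c r (x + s)) = (LINT x|lborel. bump k c r x)"
    using bump_support(1)[OF assms] by (intro integral_translate borel_measurable_continuous_onI)
  then show ?thesis by (simp add: bump_translate)
qed

lemma bump_average:
  fixes U :: "'a::euclidean_space \<Rightarrow> real"
  assumes kr: "0 < k" "0 < r" and U: "continuous_on UNIV U" and \<kappa>: "\<And>y. y \<in> ball c r \<Longrightarrow> \<bar>U y - a\<bar> \<le> \<kappa>"
  shows "\<bar>(LINT x|lborel. U x * bump k c r x) - a * (LINT x|lborel. bump k c r x)\<bar> \<le> \<kappa> * (LINT x|lborel. bump k c r x)"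
proof -
  have I: "integrable lborel (\<lambda>x. U x * bump k c r x)"
  proof (rule integrable_compact_support(1)[OF _ compact_cball])
    show "continuous_on UNIV (\<lambda>x. U x * bump k c r x)"
      by (intro continuous_intros U bump_support(1)[OF kr])
    show "U x * bump k c r x = 0" if "x \<notin> cball c r" for x
      using bump_support(2)[OF kr that] by simp
  qed
  note I2 = bump_integrable[OF kr, of c]
  have "(LINT x|lborel. U x * bump k c r x) - a * (LINT x|lborel. bump k c r x)
      = (LINT x|lborel. (U x - a) * bump k c r x)"
    using I I2 by (simp add: left_diff_distrib)
  also have "\<bar>\<dots>\<bar> \<le> (LINT x|lborel. \<kappa> * bump k c r x)"
  proof (rule integral_abs_bound_integral)
    show "integrable lborel (\<lambda>x. (U x - a) * bump k c r x)" using I I2 by (simp add: left_diff_distrib)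
    show "integrable lborel (\<lambda>x. \<kappa> * bump k c r x)" using I2 by simp
    fix x
    show "\<bar>(U x - a) * bump k c r x\<bar> \<le> \<kappa> * bump k c r x"
    proof (cases "x \<in> ball c r")
      case True
      then show ?thesis using \<kappa>[OF True] bump_nonneg[of k c r x] by (simp add: abs_mult mult_right_mono)
    next
      case False
      then show ?thesis using bump_zero_iff[OF kr, of c x] by simp
    qed
  qed
  finally show ?thesis by simp
qed

section \<open>From a bound on the weak gradient to a Lipschitz bound\<close>

context convex_domain
begin

lemma lmeasurable_dom: "\<Omega> \<in> lmeasurable"
  by (rule lmeasurable_open[OF bounded_dom open_dom])

lemma extension_exists:
  fixes u :: "'a \<Rightarrow> real"
  assumes "continuous_on (closure \<Omega>) u"
  obtains U where "continuous_on UNIV U" "\<And>x. x \<in> closure \<Omega> \<Longrightarrow> U x = u x"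
  using Tietze_unbounded[OF assms, of UNIV] by (metis closed_closedin closed_closure subtopology_UNIV)

text \<open>A small bump is carried along the segment from \<open>x\<close> to \<open>z\<close>. The
  derivative of the weighted integral of \<open>U\<close> against it is tested by the weak gradient
  and is at most \<open>L * norm e\<close> times the mass of the bump; the mean value theorem
  compares the two ends, where the averages are close to \<open>u x\<close> and
  \<open>u z\<close>.\<close>

lemma weak_gradient_lipschitz:
  assumes u: "continuous_on (closure \<Omega>) u" and g: "g \<in> Linf \<Omega>" "has_weak_gradient \<Omega> u g"
    and L: "AE x in lebesgue_on \<Omega>. norm (g x) \<le> L" and x: "x \<in> \<Omega>" and z: "z \<in> \<Omega>"
  shows "\<bar>u x - u z\<bar> \<le> L * dist x z"
proof (rule field_le_epsilon)
  fix \<kappa> :: real assume \<kappa>: "0 < \<kappa>"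
  obtain U where U: "continuous_on UNIV U" "\<And>x. x \<in> closure \<Omega> \<Longrightarrow> U x = u x"
    using extension_exists[OF u] by blast
  have uU: "\<And>x. x \<in> \<Omega> \<Longrightarrow> U x = u x" using U(2) closure_subset by blast
  have seg: "closed_segment x z \<subseteq> \<Omega>" using x z convex_dom by (rule closed_segment_subset)
  obtain \<delta>0 where \<delta>0: "\<delta>0 > 0" "(\<Union>w\<in>closed_segment x z. cball w \<delta>0) \<subseteq> \<Omega>"
    using compact_subset_open_imp_cball_epsilon_subset[OF compact_segment open_dom seg] by blast
  have "\<exists>d>0. \<forall>y. dist y w < d \<longrightarrow> dist (U y) (U w) < \<kappa> / 2" for w
    using U(1) \<kappa> unfolding continuous_on_iff by (metis UNIV_I half_gt_zero)
  then obtain \<delta>1 \<delta>2 where \<delta>: "\<delta>1 > 0" "\<And>y. dist y x < \<delta>1 \<Longrightarrow> dist (U y) (U x) < \<kappa> / 2"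
      "\<delta>2 > 0" "\<And>y. dist y z < \<delta>2 \<Longrightarrow> dist (U y) (U z) < \<kappa> / 2"
    by metis
  define r where "r = min \<delta>0 (min \<delta>1 \<delta>2)"
  have r: "0 < r" "r \<le> \<delta>0" "r \<le> \<delta>1" "r \<le> \<delta>2" using \<delta>0 \<delta> by (auto simp: r_def)
  \<comment> \<open>With this sign the function \<open>\<phi> (y + s *\<^sub>R e)\<close> of
    \<open>y\<close> is the bump centred at \<open>x - s *\<^sub>R e\<close>, which runs from
    \<open>x\<close> to \<open>z\<close>.\<close>
  define e where "e = x - z"
  define \<phi> where "\<phi> = bump 1 x r"
  define m where "m = (LINT y|lborel. \<phi> y)"
  have m: "0 < m" unfolding m_def \<phi>_def using r by (intro bump_integral_pos) auto
  have test: "bump 1 (x - s *\<^sub>R e) r \<in> test_functions \<Omega>" if s: "0 \<le> s" "s \<le> 1" for s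
  proof (rule bump_test_function)
    have "x - s *\<^sub>R e = (1 - s) *\<^sub>R x + s *\<^sub>R z" by (simp add: e_def algebra_simps)
    then have "x - s *\<^sub>R e \<in> closed_segment x z" unfolding closed_segment_def using s by blast
    then have "cball (x - s *\<^sub>R e) \<delta>0 \<subseteq> \<Omega>" using \<delta>0(2) by blast
    then show "cball (x - s *\<^sub>R e) r \<subseteq> \<Omega>" using r(2) subset_cball by blast
  qed (use r in auto)
  have \<phi>: "\<phi> \<in> test_functions \<Omega>" using test[of 0] by (simp add: \<phi>_def)
  let ?D = "\<lambda>y. frechet_derivative \<phi> (at y)"
  have C: "C1c (closure {x. \<phi> x \<noteq> 0}) \<phi> ?D" by (rule C1c_test_function[OF \<phi>])
  let ?F = "\<lambda>s. LINT y|lborel. U y * \<phi> (y + s *\<^sub>R e)"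
  let ?F' = "\<lambda>s. LINT y|lborel. U y * ?D (y + s *\<^sub>R e) e"
  have DF: "(?F has_real_derivative ?F' s) (at s)" for s
    by (rule translate_integral_derivative[OF U(1) C])
  have bnd: "\<bar>?F' s\<bar> \<le> L * norm e * m" if s: "0 \<le> s" "s \<le> 1" for s
  proof -
    let ?\<psi> = "bump 1 (x - s *\<^sub>R e) r"
    have \<psi>: "?\<psi> = (\<lambda>y. \<phi> (y + s *\<^sub>R e))" by (simp add: \<phi>_def bump_translate)
    have eqD: "frechet_derivative ?\<psi> (at y) = ?D (y + s *\<^sub>R e)" for y
    proof (rule frechet_derivative_at[symmetric])
      have "((\<lambda>y. y + s *\<^sub>R e) has_derivative (\<lambda>h. h)) (at y)" by (auto intro!: derivative_eq_intros)
      moreover have "(\<phi> has_derivative ?D (y + s *\<^sub>R e)) (at (y + s *\<^sub>R e))" using C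
        by (simp add: C1c_def)
      ultimately show "(?\<psi> has_derivative ?D (y + s *\<^sub>R e)) (at y)"
        unfolding \<psi> by (rule has_derivative_compose)
    qed
    have "?F' s = (LINT y|lborel. U y * frechet_derivative ?\<psi> (at y) e)" by (simp only: eqD)
    also have "\<dots> = - (LINT y|lebesgue_on \<Omega>. (g y \<bullet> e) * ?\<psi> y)"
      by (rule weak_gradient_direction[OF lmeasurable_dom U(1) uU g test[OF s]])
    also have "\<bar>\<dots>\<bar> \<le> (LINT y|lebesgue_on \<Omega>. (L * norm e) * ?\<psi> y)"
    proof -
      have sup: "continuous_on UNIV ?\<psi>" "\<And>y. \<bar>?\<psi> y\<bar> \<le> 1"
        using bump_support(1)[of 1 r] r by (simp_all add: bump_nonneg bump_le_1)
      have I1: "integrable (lebesgue_on \<Omega>) (\<lambda>y. (g y \<bullet> e) * ?\<psi> y)"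
        by (rule integrable_Linf_inner[OF g(1) lmeasurable_dom continuous_imp_measurable_lebesgue_on[OF sup(1)] sup(2)])
      have I2: "integrable (lebesgue_on \<Omega>) ?\<psi>"
        using r bump_integrable[of 1 r "x - s *\<^sub>R e"] fmeasurableD[OF lmeasurable_dom]
        by (intro integrable_lebesgue_on_continuous sup) auto
      have "\<bar>LINT y|lebesgue_on \<Omega>. (g y \<bullet> e) * ?\<psi> y\<bar> \<le> (LINT y|lebesgue_on \<Omega>. \<bar>(g y \<bullet> e) * ?\<psi> y\<bar>)"
        by (rule integral_abs_bound)
      also have "\<dots> \<le> (LINT y|lebesgue_on \<Omega>. (L * norm e) * ?\<psi> y)"
      proof (rule integral_mono_AE)
        show "AE y in lebesgue_on \<Omega>. \<bar>(g y \<bullet> e) * ?\<psi> y\<bar> \<le> (L * norm e) * ?\<psi> y"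
          using L
        proof eventually_elim
          case (elim y)
          have "\<bar>g y \<bullet> e\<bar> \<le> norm (g y) * norm e" by (rule Cauchy_Schwarz_ineq2)
          also have "\<dots> \<le> L * norm e" using elim by (intro mult_right_mono) auto
          finally show ?case using bump_nonneg[of 1 _ r y] by (simp add: abs_mult mult_right_mono)
        qed
      qed (use I1 I2 in auto)
      finally show ?thesis by simp
    qed
    also have "\<dots> = L * norm e * (LINT y|lebesgue_on \<Omega>. ?\<psi> y)" by simp
    also have "(LINT y|lebesgue_on \<Omega>. ?\<psi> y) = (LINT y|lborel. ?\<psi> y)"
    proof (rule integral_lebesgue_on_compact_support)
      show "continuous_on UNIV ?\<psi>" using bump_support(1)[of 1 r] r by simp
      show "\<Omega> \<in> sets lebesgue" using lmeasurable_dom by (rule fmeasurableD)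
      fix y assume y: "y \<notin> \<Omega>"
      have "closure {x. ?\<psi> x \<noteq> 0} \<subseteq> \<Omega>" using test[OF s] by (simp add: test_functions_def)
      then show "?\<psi> y = 0" using y closure_subset[of "{x. ?\<psi> x \<noteq> 0}"] by (meson mem_Collect_eq subsetD)
    qed
    also have "\<dots> = m" unfolding m_def \<phi>_def using r by (intro bump_integral_translate) auto
    finally show ?thesis .
  qed
  obtain s where "0 < s" "s < 1" "?F 1 - ?F 0 = (1 - 0) * ?F' s"
    using MVT2[of 0 1 ?F ?F'] DF by auto
  then have F: "\<bar>?F 1 - ?F 0\<bar> \<le> L * norm e * m" using bnd[of s] by simp
  have "\<bar>?F 0 - U x * m\<bar> \<le> \<kappa> / 2 * m"
  proof -
    have "\<bar>(LINT y|lborel. U y * bump 1 x r y) - U x * (LINT y|lborel. bump 1 x r y)\<bar>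
        \<le> \<kappa> / 2 * (LINT y|lborel. bump 1 x r y)"
    proof (rule bump_average[OF zero_less_one r(1) U(1)])
      fix y assume "y \<in> ball x r"
      then have "dist y x < \<delta>1" using r(3) by (simp add: dist_commute)
      then show "\<bar>U y - U x\<bar> \<le> \<kappa> / 2" using \<delta>(2)[of y] by (simp add: dist_real_def)
    qed
    then show ?thesis by (simp add: m_def \<phi>_def)
  qed
  moreover have "\<bar>?F 1 - U z * m\<bar> \<le> \<kappa> / 2 * m"
  proof -
    have eq: "\<phi> (y + 1 *\<^sub>R e) = bump 1 z r y" for y by (simp add: \<phi>_def bump_translate e_def)
    have mz: "m = (LINT y|lborel. bump 1 z r y)"
      using bump_integral_translate[of 1 r x e] r by (simp add: m_def \<phi>_def e_def)
    show ?thesis unfolding eq mz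
    proof (rule bump_average[OF zero_less_one r(1) U(1)])
      fix y assume "y \<in> ball z r"
      then have "dist y z < \<delta>2" using r(4) by (simp add: dist_commute)
      then show "\<bar>U y - U z\<bar> \<le> \<kappa> / 2" using \<delta>(4)[of y] by (simp add: dist_real_def)
    qed
  qed
  ultimately have "\<bar>U x * m - U z * m\<bar> \<le> L * norm e * m + \<kappa> * m" using F by linarith
  moreover have "\<bar>U x * m - U z * m\<bar> = \<bar>U x - U z\<bar> * m" using m
    by (simp add: left_diff_distrib[symmetric] abs_mult)
  ultimately have "\<bar>U x - U z\<bar> * m \<le> (L * norm e + \<kappa>) * m" by (simp add: distrib_right)
  then have "\<bar>U x - U z\<bar> \<le> L * norm e + \<kappa>" using m by simp
  then show "\<bar>u x - u z\<bar> \<le> L * dist x z + \<kappa>" using uU x z by (simp add: e_def dist_norm)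
qed

end

text \<open>If \<open>w\<close> exceeds \<open>k + \<delta>\<close> on a set \<open>A\<close> of
  volume \<open>a\<close>, disjoint balls inside an open set barely larger than \<open>A\<close>
  cover almost all of \<open>A\<close>. Adding up the averages gives
  \<open>(k + \<delta>) * a \<le> k * (a + \<epsilon>)\<close> for every positive \<epsilon>, which
  forces \<open>a = 0\<close>.\<close>

lemma AE_le_of_ball_averages:
  fixes \<Omega> :: "'a::euclidean_space set" and w :: "'a \<Rightarrow> ennreal"
  assumes \<Omega>: "open \<Omega>" "bounded \<Omega>" and w: "w \<in> borel_measurable (lebesgue_on \<Omega>)" and k: "0 \<le> k"
    and av: "\<And>c r. 0 < r \<Longrightarrow> cball c r \<subseteq> \<Omega> \<Longrightarrow>
      (\<integral>\<^sup>+x. w x * indicator (ball c r) x \<partial>lebesgue_on \<Omega>) \<le> ennreal k * emeasure lebesgue (ball c r)"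
  shows "AE x in lebesgue_on \<Omega>. w x \<le> ennreal k"
proof -
  let ?N = "lebesgue_on \<Omega>"
  have \<Omega>m: "\<Omega> \<in> lmeasurable" using \<Omega> by (intro lmeasurable_open)
  have setN: "A \<in> sets ?N \<longleftrightarrow> A \<in> sets lebesgue \<and> A \<subseteq> \<Omega>" for A
    using \<Omega>m by (auto simp: sets_restrict_space_iff fmeasurableD)
  have emN: "emeasure ?N A = emeasure lebesgue A" if "A \<subseteq> \<Omega>" for A
    using \<Omega>m that by (simp add: emeasure_restrict_space fmeasurableD)
  have null: "{x \<in> \<Omega>. ennreal (k + \<delta>) < w x} \<in> null_sets ?N" if \<delta>: "0 < \<delta>" for \<delta>
  proof -
    define A where "A = {x \<in> \<Omega>. ennreal (k + \<delta>) < w x}"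
    have "{x \<in> space ?N. ennreal (k + \<delta>) < w x} \<in> sets ?N" using w by measurable
    then have AN: "A \<in> sets ?N" using \<Omega>m by (simp add: A_def space_restrict_space)
    then have A: "A \<in> sets lebesgue" "A \<subseteq> \<Omega>" using setN by auto
    have Am: "A \<in> lmeasurable" using A \<Omega>m by (meson fmeasurableI2)
    define a where "a = measure lebesgue A"
    have ea: "emeasure lebesgue A = ennreal a" using Am by (simp add: a_def emeasure_eq_measure2)
    have a0: "0 \<le> a" by (simp add: a_def)
    have main: "(k + \<delta>) * a \<le> k * (a + \<epsilon>)" if \<epsilon>: "0 < \<epsilon>" for \<epsilon>
    proof -
      obtain T where T: "open T" "A \<subseteq> T" "T - A \<in> lmeasurable" "emeasure lebesgue (T - A) < ennreal \<epsilon>"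
        using sets_lebesgue_outer_open[OF A(1) \<epsilon>] by blast
      define K where "K = {(c, r). 0 < r \<and> cball c r \<subseteq> T \<inter> \<Omega>}"
      obtain C where C: "countable C" "C \<subseteq> K"
        "pairwise (\<lambda>i j. disjnt (ball (fst i) (snd i)) (ball (fst j) (snd j))) C"
        "negligible (A - (\<Union>i\<in>C. ball (fst i) (snd i)))"
      proof (rule Vitali_covering_theorem_balls[of A K fst snd])
        fix x and d :: real assume x: "x \<in> A" "0 < d"
        have "open (T \<inter> \<Omega>)" "x \<in> T \<inter> \<Omega>" using T \<Omega> x A by auto
        then obtain e where e: "e > 0" "cball x e \<subseteq> T \<inter> \<Omega>" using open_contains_cball by metis
        have "cball x (min e (d/2)) \<subseteq> T \<inter> \<Omega>" using e by auto
        then show "\<exists>i. i \<in> K \<and> x \<in> ball (fst i) (snd i) \<and> snd i < d"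
          using e x by (intro exI[of _ "(x, min e (d/2))"]) (auto simp: K_def)
      qed auto
      let ?B = "\<lambda>i. ball (fst i) (snd i)"
      let ?S = "\<Union>i\<in>C. ?B i"
      have K: "0 < snd i" "cball (fst i) (snd i) \<subseteq> T \<inter> \<Omega>" if "i \<in> C" for i
      proof -
        have "i \<in> K" using C(2) that by blast
        then show "0 < snd i" "cball (fst i) (snd i) \<subseteq> T \<inter> \<Omega>" by (cases i; simp add: K_def)+
      qed
      have Bsub: "?B i \<subseteq> T \<inter> \<Omega>" if "i \<in> C" for i using K[OF that] ball_subset_cball by blast
      have disj: "disjoint_family_on ?B C"
        using C(3) by (auto simp: disjoint_family_on_def pairwise_def disjnt_def)
      have BN: "?B i \<in> sets ?N" if "i \<in> C" for i using Bsub[OF that] setN by auto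
      have Sleb: "?S \<in> sets lebesgue" using C(1) by (intro sets.countable_UN') auto
      have "ennreal ((k + \<delta>) * a) = (\<integral>\<^sup>+x. ennreal (k + \<delta>) * indicator A x \<partial>?N)"
        using AN k \<delta> a0 ea emN[OF A(2)] by (subst nn_integral_cmult_indicator) (auto simp: ennreal_mult)
      also have "\<dots> \<le> (\<integral>\<^sup>+x. w x * indicator ?S x \<partial>?N)"
      proof (rule nn_integral_mono_AE)
        have "A - ?S \<in> null_sets lebesgue" using C(4) by (simp add: negligible_iff_null_sets)
        then have "A - ?S \<in> null_sets ?N"
          using A by (auto simp: null_sets_def setN emN Diff_subset[THEN subset_trans])
        then have "AE x in ?N. x \<notin> A - ?S" by (rule AE_not_in)
        then show "AE x in ?N. ennreal (k + \<delta>) * indicator A x \<le> w x * indicator ?S x"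
          by eventually_elim (auto simp: A_def indicator_def intro: less_imp_le)
      qed
      also have "\<dots> = emeasure (density ?N w) ?S"
        using w C(1) BN by (subst emeasure_density) (auto intro!: sets.countable_UN')
      also have "\<dots> = (\<integral>\<^sup>+i. emeasure (density ?N w) (?B i) \<partial>count_space C)"
        using C(1) BN disj by (intro emeasure_UN_countable) auto
      also have "\<dots> \<le> (\<integral>\<^sup>+i. ennreal k * emeasure lebesgue (?B i) \<partial>count_space C)"
      proof (rule nn_integral_mono)
        fix i assume "i \<in> space (count_space C)"
        then have i: "i \<in> C" by simp
        have "emeasure (density ?N w) (?B i) = (\<integral>\<^sup>+x. w x * indicator (?B i) x \<partial>?N)"
          by (rule emeasure_density[OF w BN[OF i]])
        also have "\<dots> \<le> ennreal k * emeasure lebesgue (?B i)" using K[OF i] by (intro av) auto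
        finally show "emeasure (density ?N w) (?B i) \<le> ennreal k * emeasure lebesgue (?B i)" .
      qed
      also have "\<dots> = ennreal k * (\<integral>\<^sup>+i. emeasure lebesgue (?B i) \<partial>count_space C)"
        by (rule nn_integral_cmult) simp
      also have "(\<integral>\<^sup>+i. emeasure lebesgue (?B i) \<partial>count_space C) = emeasure lebesgue ?S"
        using C(1) disj by (intro emeasure_UN_countable[symmetric]) auto
      also have "emeasure lebesgue ?S \<le> emeasure lebesgue (A \<union> (T - A))"
      proof (rule emeasure_mono)
        show "?S \<subseteq> A \<union> (T - A)" using Bsub by blast
        show "A \<union> (T - A) \<in> sets lebesgue" by (intro sets.Un A(1) fmeasurableD[OF T(3)])
      qed
      also have "\<dots> \<le> emeasure lebesgue A + emeasure lebesgue (T - A)"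
        using A(1) T(3) by (intro emeasure_subadditive) (auto simp: fmeasurableD)
      also have "\<dots> \<le> ennreal a + ennreal \<epsilon>" using T(4) ea by (intro add_mono) auto
      also have "\<dots> = ennreal (a + \<epsilon>)" using a0 \<epsilon> by simp
      finally have "ennreal ((k + \<delta>) * a) \<le> ennreal k * ennreal (a + \<epsilon>)" by (simp add: mult_left_mono)
      also have "\<dots> = ennreal (k * (a + \<epsilon>))" using k a0 \<epsilon> by (simp add: ennreal_mult)
      finally show ?thesis using k a0 \<epsilon> by (subst (asm) ennreal_le_iff) auto
    qed
    have "a = 0"
    proof (rule ccontr)
      assume "a \<noteq> 0"
      then have ap: "0 < a" using a0 by simp
      \<comment> \<open>This choice of \<epsilon> leaves
        \<open>\<delta> * a \<le> \<delta> * a * (k / (k + 1))\<close>, which is absurd.\<close>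
      have "0 < \<delta> * a / (k + 1)" using ap \<delta> k by simp
      from main[OF this] have "\<delta> * a \<le> \<delta> * a * (k / (k + 1))" by (simp add: algebra_simps)
      moreover have "k / (k + 1) < 1" using k by simp
      then have "\<delta> * a * (k / (k + 1)) < \<delta> * a * 1" using ap \<delta> by (intro mult_strict_left_mono) auto
      ultimately show False by simp
    qed
    then show ?thesis using AN ea emN[OF A(2)] by (auto simp: A_def null_sets_def)
  qed
  have "AE x in ?N. \<forall>n. x \<notin> {x \<in> \<Omega>. ennreal (k + 1 / real (Suc n)) < w x}"
    unfolding AE_all_countable using null by (intro allI AE_not_in) auto
  then show ?thesis
  proof (rule AE_mp, intro AE_I2 impI)
    fix x assume "x \<in> space ?N" and n: "\<forall>n. x \<notin> {x \<in> \<Omega>. ennreal (k + 1 / real (Suc n)) < w x}"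
    then have le: "w x \<le> ennreal (k + 1 / real (Suc n))" for n using \<Omega>m
      by (auto simp: space_restrict_space not_less)
    have "(\<lambda>n. ennreal (k + 1 / real (Suc n))) \<longlonglongrightarrow> ennreal (k + 0)"
      by (intro tendsto_ennrealI tendsto_intros lim_1_over_n[THEN LIMSEQ_Suc])
    then have "w x \<le> ennreal (k + 0)" by (rule LIMSEQ_le_const) (use le in auto)
    then show "w x \<le> ennreal k" by simp
  qed
qed

section \<open>From a Lipschitz bound to existence and size of the weak gradient\<close>

context convex_domain
begin

text \<open>The change of variables moves the translation from the bump to \<open>U\<close>, whose
  increments the Lipschitz bound controls near the support; the derivative of the integral inherits
  the bound.\<close>

lemma weak_gradient_test_bound:
  assumes U: "continuous_on UNIV U" and lip: "\<And>x y. x \<in> \<Omega> \<Longrightarrow> y \<in> \<Omega> \<Longrightarrow> \<bar>U x - U y\<bar> \<le> L * dist x y"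
    and g: "g \<in> Linf \<Omega>" "has_weak_gradient \<Omega> U g" and k: "0 < k" and r: "0 < r" and sub: "cball c r \<subseteq> \<Omega>"
  shows "\<bar>LINT x|lebesgue_on \<Omega>. (g x \<bullet> e) * bump k c r x\<bar> \<le> L * norm e * (LINT x|lborel. bump k c r x)"
proof -
  define \<phi> where "\<phi> = bump k c r"
  define m where "m = (LINT x|lborel. \<phi> x)"
  have \<phi>: "\<phi> \<in> test_functions \<Omega>" unfolding \<phi>_def by (rule bump_test_function[OF k r sub])
  have \<phi>c: "continuous_on UNIV \<phi>" and \<phi>0: "\<And>x. x \<notin> cball c r \<Longrightarrow> \<phi> x = 0"
    and \<phi>z: "\<And>x. x \<notin> ball c r \<Longrightarrow> \<phi> x = 0"
    unfolding \<phi>_def using bump_support[OF k r] bump_zero_iff[OF k r, of c] by blast+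
  have \<phi>n: "0 \<le> \<phi> x" for x by (simp add: \<phi>_def bump_nonneg)
  let ?D = "\<lambda>y. frechet_derivative \<phi> (at y)"
  have C: "C1c (closure {x. \<phi> x \<noteq> 0}) \<phi> ?D" by (rule C1c_test_function[OF \<phi>])
  let ?F = "\<lambda>s. LINT y|lborel. U y * \<phi> (y + s *\<^sub>R e)"
  have DF: "(?F has_real_derivative (LINT y|lborel. U y * ?D (y + 0 *\<^sub>R e) e)) (at 0)"
    by (rule translate_integral_derivative[OF U C])
  obtain \<delta> where \<delta>: "\<delta> > 0" "(\<Union>w\<in>cball c r. cball w \<delta>) \<subseteq> \<Omega>"
    using compact_subset_open_imp_cball_epsilon_subset[OF compact_cball open_dom sub] by blast
  have shift: "?F s = (LINT y|lborel. U (y - s *\<^sub>R e) * \<phi> y)" for s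
  proof -
    have "continuous_on UNIV (\<lambda>y. U (y - s *\<^sub>R e) * \<phi> y)"
      by (intro continuous_intros continuous_on_compose2[OF U] \<phi>c) auto
    from integral_translate[OF borel_measurable_continuous_onI[OF this], of "s *\<^sub>R e"] show ?thesis
      by simp
  qed
  have I: "integrable lborel (\<lambda>y. U (y - s *\<^sub>R e) * \<phi> y)" for s
  proof (rule integrable_compact_support(1)[OF _ compact_cball])
    show "continuous_on UNIV (\<lambda>y. U (y - s *\<^sub>R e) * \<phi> y)"
      by (intro continuous_intros continuous_on_compose2[OF U] \<phi>c) auto
    show "U (y - s *\<^sub>R e) * \<phi> y = 0" if "y \<notin> cball c r" for y using \<phi>0[OF that] by simp
  qed
  have bnd: "\<bar>?F s - ?F 0\<bar> \<le> L * norm e * m * \<bar>s\<bar>" if s: "\<bar>s\<bar> * norm e \<le> \<delta>" for s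
  proof -
    have "?F s - ?F 0 = (LINT y|lborel. (U (y - s *\<^sub>R e) - U y) * \<phi> y)"
      unfolding shift using I[of s] I[of 0] by (simp add: left_diff_distrib)
    also have "\<bar>\<dots>\<bar> \<le> (LINT y|lborel. (L * norm e * \<bar>s\<bar>) * \<phi> y)"
    proof (rule integral_abs_bound_integral)
      show "integrable lborel (\<lambda>y. (U (y - s *\<^sub>R e) - U y) * \<phi> y)"
        using I[of s] I[of 0] by (simp add: left_diff_distrib)
      show "integrable lborel (\<lambda>y. (L * norm e * \<bar>s\<bar>) * \<phi> y)"
        using bump_integrable[OF k r, of c] by (simp add: \<phi>_def)
      fix y
      show "\<bar>(U (y - s *\<^sub>R e) - U y) * \<phi> y\<bar> \<le> (L * norm e * \<bar>s\<bar>) * \<phi> y"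
      proof (cases "y \<in> ball c r")
        case True
        then have y: "y \<in> cball c r" using ball_subset_cball by blast
        then have "cball y \<delta> \<subseteq> \<Omega>" using \<delta>(2) by blast
        moreover have "y - s *\<^sub>R e \<in> cball y \<delta>" using s by (simp add: dist_norm)
        ultimately have "\<bar>U (y - s *\<^sub>R e) - U y\<bar> \<le> L * dist (y - s *\<^sub>R e) y"
          using sub y by (intro lip) blast+
        also have "\<dots> = L * norm e * \<bar>s\<bar>" by (simp add: dist_norm)
        finally show ?thesis using \<phi>n[of y] by (simp add: abs_mult mult_right_mono)
      next
        case False
        then show ?thesis using \<phi>z[of y] by simp
      qed
    qed
    finally show ?thesis by (simp add: m_def mult_ac)
  qed
  have "((\<lambda>s. (?F s - ?F 0) / (s - 0)) \<longlongrightarrow> (LINT y|lborel. U y * ?D (y + 0 *\<^sub>R e) e)) (at 0)"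
    using DF by (simp only: has_field_derivative_iff)
  then have "norm (LINT y|lborel. U y * ?D (y + 0 *\<^sub>R e) e) \<le> L * norm e * m"
  proof (rule Lim_norm_ubound[rotated])
    define \<eta> where "\<eta> = \<delta> / (norm e + 1)"
    have \<eta>: "0 < \<eta>" unfolding \<eta>_def using \<delta>(1) by (simp add: add_nonneg_pos)
    have "norm ((?F s - ?F 0) / (s - 0)) \<le> L * norm e * m" if s: "s \<noteq> 0" "dist s 0 < \<eta>" for s
    proof -
      have "\<bar>s\<bar> * (norm e + 1) \<le> \<delta>"
        using s(2) by (simp add: \<eta>_def dist_real_def pos_less_divide_eq add_nonneg_pos less_imp_le)
      then have "\<bar>s\<bar> * norm e \<le> \<delta>" by (simp add: distrib_left)
      from bnd[OF this] show ?thesis using s(1) by (simp add: abs_divide pos_divide_le_eq)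
    qed
    then show "\<forall>\<^sub>F s in at 0. norm ((?F s - ?F 0) / (s - 0)) \<le> L * norm e * m"
      unfolding eventually_at using \<eta> by blast
  qed simp
  moreover have "(LINT y|lborel. U y * ?D (y + 0 *\<^sub>R e) e) = - (LINT x|lebesgue_on \<Omega>. (g x \<bullet> e) * \<phi> x)"
    using weak_gradient_direction[OF lmeasurable_dom U refl g \<phi>, of e] by simp
  ultimately show ?thesis by (simp add: \<phi>_def m_def)
qed

text \<open>Sharpened bumps converge to the indicator of a ball, so the bound on tested integrals
  becomes a bound on ball averages.\<close>

lemma weak_gradient_directional_le:
  assumes U: "continuous_on UNIV U" and lip: "\<And>x y. x \<in> \<Omega> \<Longrightarrow> y \<in> \<Omega> \<Longrightarrow> \<bar>U x - U y\<bar> \<le> L * dist x y"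
    and L: "0 \<le> L" and g: "g \<in> Linf \<Omega>" "has_weak_gradient \<Omega> U g"
  shows "AE x in lebesgue_on \<Omega>. g x \<bullet> e \<le> L * norm e"
proof -
  let ?N = "lebesgue_on \<Omega>"
  interpret N: finite_measure ?N by (rule finite_measure_lebesgue_on[OF lmeasurable_dom])
  obtain C where gm: "g \<in> borel_measurable ?N" and C: "AE x in ?N. norm (g x) \<le> C"
    using g(1) by (auto simp: Linf_def)
  \<comment> \<open>Besides bounding \<open>g x \<bullet> e\<close>, this number serves as a shift
    that makes \<open>g x \<bullet> e + M\<close> nonnegative almost everywhere, so the conversion
    to \<open>ennreal\<close> loses nothing.\<close>
  define M where "M = \<bar>C\<bar> * norm e"
  have gM: "AE x in ?N. \<bar>g x \<bullet> e\<bar> \<le> M"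
    using C
  proof eventually_elim
    case (elim x)
    have "\<bar>g x \<bullet> e\<bar> \<le> norm (g x) * norm e" by (rule Cauchy_Schwarz_ineq2)
    also have "\<dots> \<le> M" unfolding M_def using elim by (intro mult_right_mono) auto
    finally show ?case .
  qed
  have wm: "(\<lambda>x. ennreal (g x \<bullet> e + M)) \<in> borel_measurable ?N" using gm by measurable
  have "AE x in ?N. ennreal (g x \<bullet> e + M) \<le> ennreal (L * norm e + M)"
  proof (rule AE_le_of_ball_averages[OF open_dom bounded_dom wm])
    show "0 \<le> L * norm e + M" using L by (simp add: M_def)
    fix c r assume r: "0 < (r::real)" and sub: "cball c r \<subseteq> \<Omega>"
    let ?b = "\<lambda>n. bump (real (Suc n)) c r"
    have bsub: "ball c r \<subseteq> \<Omega>" using sub ball_subset_cball by blast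
    have bc: "continuous_on UNIV (?b n)" for n using bump_support(1)[of "real (Suc n)" r c] r by simp
    have bm: "?b n \<in> borel_measurable ?N" for n by (rule continuous_imp_measurable_lebesgue_on[OF bc])
    have Im: "indicator (ball c r) \<in> borel_measurable ?N"
      by (intro borel_measurable_indicator) (use bsub lmeasurable_dom in \<open>auto simp: sets_restrict_space_iff fmeasurableD\<close>)
    have Ib: "integrable ?N (\<lambda>x. (g x \<bullet> e) * indicator (ball c r) x)"
      by (rule integrable_Linf_inner[OF g(1) lmeasurable_dom Im, of 1]) (simp add: indicator_def)
    have lim1: "(\<lambda>n. LINT x|?N. (g x \<bullet> e) * ?b n x) \<longlonglongrightarrow> (LINT x|?N. (g x \<bullet> e) * indicator (ball c r) x)"
    proof (rule integral_dominated_convergence[where w="\<lambda>x. M"])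
      show "(\<lambda>x. (g x \<bullet> e) * indicator (ball c r) x) \<in> borel_measurable ?N" using Ib by simp
      show "(\<lambda>x. (g x \<bullet> e) * ?b n x) \<in> borel_measurable ?N" for n using gm bm by measurable
      show "AE x in ?N. (\<lambda>n. (g x \<bullet> e) * ?b n x) \<longlonglongrightarrow> (g x \<bullet> e) * indicator (ball c r) x"
        by (intro AE_I2 tendsto_intros bump_tendsto_indicator r)
      show "AE x in ?N. norm ((g x \<bullet> e) * ?b n x) \<le> M" for n
        using gM
      proof eventually_elim
        case (elim x)
        have "\<bar>g x \<bullet> e\<bar> * \<bar>?b n x\<bar> \<le> M * 1"
          using elim bump_nonneg[of "real (Suc n)" c r x] bump_le_1[of "real (Suc n)" c r x]
            by (intro mult_mono) auto
        then show ?case by (simp add: abs_mult)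
      qed
    qed simp
    have lim2: "(\<lambda>n. LINT x|lborel. ?b n x) \<longlonglongrightarrow> (LINT x|lborel. indicator (ball c r) x)"
    proof (rule integral_dominated_convergence[where w="indicator (ball c r)"])
      show "integrable lborel (indicator (ball c r) :: 'a \<Rightarrow> real)"
        by (intro integrable_real_indicator) (use r in \<open>simp_all add: emeasure_ball\<close>)
      show "?b n \<in> borel_measurable lborel" for n using borel_measurable_continuous_onI[OF bc] by simp
      show "AE x in lborel. (\<lambda>n. ?b n x) \<longlonglongrightarrow> indicator (ball c r) x"
        by (intro AE_I2 bump_tendsto_indicator r)
      show "AE x in lborel. norm (?b n x) \<le> indicator (ball c r) x" for n
      proof (rule AE_I2)
        fix x
        show "norm (?b n x) \<le> indicator (ball c r) x"
        proof (cases "x \<in> ball c r")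
          case True
          then show ?thesis
            using bump_nonneg[of "real (Suc n)" c r x] bump_le_1[of "real (Suc n)" c r x] by simp
        next
          case False
          then have "?b n x = 0" using bump_zero_iff[of "real (Suc n)" r c x] r by simp
          then show ?thesis by simp
        qed
      qed
      show "indicator (ball c r) \<in> borel_measurable (lborel :: 'a measure)"
        by (rule borel_measurable_indicator) simp
    qed
    have le: "(LINT x|?N. (g x \<bullet> e) * ?b n x) \<le> L * norm e * (LINT x|lborel. ?b n x)" for n
      using weak_gradient_test_bound[OF U lip g _ r sub, of "real (Suc n)" e] by simp
    have "(LINT x|?N. (g x \<bullet> e) * indicator (ball c r) x) \<le> L * norm e * (LINT x|lborel. indicator (ball c r) x)"
      by (rule LIMSEQ_le[OF lim1 tendsto_mult_left[OF lim2]]) (use le in auto)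
    then have ball: "(LINT x|?N. (g x \<bullet> e) * indicator (ball c r) x) \<le> L * norm e * measure lebesgue (ball c r)"
      by simp
    have Ib2: "integrable ?N (indicator (ball c r) :: 'a \<Rightarrow> real)"
      using Im by (rule N.integrable_const_bound[where B=1, rotated]) (simp add: indicator_def)
    have mb: "(LINT x|?N. indicator (ball c r) x) = measure lebesgue (ball c r)"
    proof -
      have "measure ?N (ball c r) = measure lebesgue (ball c r)"
        using lmeasurable_dom bsub by (intro measure_restrict_space) (auto simp: fmeasurableD)
      moreover have "ball c r \<inter> \<Omega> = ball c r" using bsub by blast
      ultimately show ?thesis by simp
    qed
    have "(\<integral>\<^sup>+x. ennreal (g x \<bullet> e + M) * indicator (ball c r) x \<partial>?N)
        = (\<integral>\<^sup>+x. ennreal ((g x \<bullet> e) * indicator (ball c r) x + M * indicator (ball c r) x) \<partial>?N)"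
      by (intro nn_integral_cong) (auto simp: indicator_def)
    also have "\<dots> = ennreal (LINT x|?N. (g x \<bullet> e) * indicator (ball c r) x + M * indicator (ball c r) x)"
    proof (rule nn_integral_eq_integral)
      show "integrable ?N (\<lambda>x. (g x \<bullet> e) * indicator (ball c r) x + M * indicator (ball c r) x)"
        using Ib Ib2 by simp
      show "AE x in ?N. 0 \<le> (g x \<bullet> e) * indicator (ball c r) x + M * indicator (ball c r) x"
        using gM by eventually_elim (auto simp: indicator_def)
    qed
    also have "(LINT x|?N. (g x \<bullet> e) * indicator (ball c r) x + M * indicator (ball c r) x)
        = (LINT x|?N. (g x \<bullet> e) * indicator (ball c r) x) + M * measure lebesgue (ball c r)"
      using Ib Ib2 mb by (subst Bochner_Integration.integral_add) auto
    also have "\<dots> \<le> (L * norm e + M) * measure lebesgue (ball c r)" using ball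
      by (simp add: distrib_right)
    finally have "(\<integral>\<^sup>+x. ennreal (g x \<bullet> e + M) * indicator (ball c r) x \<partial>?N)
        \<le> ennreal ((L * norm e + M) * measure lebesgue (ball c r))" by (simp add: ennreal_leI)
    also have "\<dots> = ennreal (L * norm e + M) * emeasure lebesgue (ball c r)"
    proof -
      have "ball c r \<in> lmeasurable" by simp
      then have "emeasure lebesgue (ball c r) = ennreal (measure lebesgue (ball c r))"
        by (rule emeasure_eq_measure2)
      moreover have "0 \<le> L * norm e + M" using L by (simp add: M_def)
      ultimately show ?thesis by (simp only: ennreal_mult[OF _ measure_nonneg])
    qed
    finally show "(\<integral>\<^sup>+x. ennreal (g x \<bullet> e + M) * indicator (ball c r) x \<partial>?N)
        \<le> ennreal (L * norm e + M) * emeasure lebesgue (ball c r)" .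
  qed
  then show ?thesis
  proof eventually_elim
    case (elim x)
    have "0 \<le> L * norm e + M" using L by (simp add: M_def)
    then show ?case using elim by (simp add: ennreal_le_iff)
  qed
qed

text \<open>The exceptional null set depends on the direction, so only a countable dense set of
  directions is used. Were the norm too large at some point, directions close to \<open>g x\<close>
  itself would violate the directional bound.\<close>

lemma weak_gradient_norm_le:
  assumes U: "continuous_on UNIV U" and lip: "\<And>x y. x \<in> \<Omega> \<Longrightarrow> y \<in> \<Omega> \<Longrightarrow> \<bar>U x - U y\<bar> \<le> L * dist x y"
    and L: "0 \<le> L" and g: "g \<in> Linf \<Omega>" "has_weak_gradient \<Omega> U g"
  shows "AE x in lebesgue_on \<Omega>. norm (g x) \<le> L"
proof -
  obtain E :: "'a set" where E: "countable E" "\<And>X. open X \<Longrightarrow> X \<noteq> {} \<Longrightarrow> \<exists>d\<in>E. d \<in> X"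
    using countable_dense_exists by metis
  have "AE x in lebesgue_on \<Omega>. \<forall>e\<in>E. g x \<bullet> e \<le> L * norm e"
    unfolding AE_ball_countable[OF E(1)] using weak_gradient_directional_le[OF U lip L g] by blast
  then show ?thesis
  proof eventually_elim
    case (elim x)
    have "g x \<bullet> g x \<le> L * norm (g x)"
    proof (rule ccontr)
      assume "\<not> g x \<bullet> g x \<le> L * norm (g x)"
      then have "g x \<in> {e. L * norm e < g x \<bullet> e}" by (simp add: not_le)
      then have "{e. L * norm e < g x \<bullet> e} \<noteq> {}" by blast
      moreover have "open {e. L * norm e < g x \<bullet> e}" by (intro open_Collect_less continuous_intros)
      ultimately obtain e where "e \<in> E" "L * norm e < g x \<bullet> e" using E(2) by blast
      then show False using elim by force
    qed
    then have "norm (g x) * norm (g x) \<le> L * norm (g x)" by (simp add: dot_square_norm power2_eq_square)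
    then show ?case using L by (cases "g x = 0") auto
  qed
qed

text \<open>The gradient is the pointwise limit of forward difference quotients in the coordinate
  directions, and \<open>conv\<close> takes the place of almost everywhere differentiability.
  Dominated convergence passes to the limit in a discrete integration by parts.\<close>

lemma weak_gradient_exists:
  assumes U: "continuous_on UNIV U" and lip: "\<And>x y. x \<in> \<Omega> \<Longrightarrow> y \<in> \<Omega> \<Longrightarrow> \<bar>U x - U y\<bar> \<le> L * dist x y"
    and conv: "\<And>x b. x \<in> \<Omega> \<Longrightarrow> b \<in> Basis \<Longrightarrow> convergent (\<lambda>n. real (Suc n) * (U (x + (1 / real (Suc n)) *\<^sub>R b) - U x))"
    and L: "0 \<le> L"
  shows "\<exists>g\<in>Linf \<Omega>. has_weak_gradient \<Omega> U g"
proof -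
  let ?N = "lebesgue_on \<Omega>"
  interpret N: finite_measure ?N by (rule finite_measure_lebesgue_on[OF lmeasurable_dom])
  have spN: "space ?N = \<Omega>" by (simp add: space_restrict_space)
  define q where "q n b x = real (Suc n) * (U (x + (1 / real (Suc n)) *\<^sub>R b) - U x)" for n b x
  have qc: "continuous_on UNIV (q n b)" for n b
    unfolding q_def by (intro continuous_intros continuous_on_compose2[OF U]) auto
  define G where "G b x = lim (\<lambda>n. q n b x)" for b x
  have qG: "(\<lambda>n. q n b x) \<longlonglongrightarrow> G b x" if "x \<in> \<Omega>" "b \<in> Basis" for x b
    using conv[OF that] unfolding G_def q_def convergent_LIMSEQ_iff by simp
  have qL: "\<bar>q n b x\<bar> \<le> L" if b: "b \<in> Basis" and x: "x \<in> \<Omega>" "cball x \<delta> \<subseteq> \<Omega>"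
    and n: "1 / real (Suc n) \<le> \<delta>" for n b x \<delta>
  proof -
    have "x + (1 / real (Suc n)) *\<^sub>R b \<in> cball x \<delta>" using n b by (simp add: dist_norm)
    then have "\<bar>U (x + (1 / real (Suc n)) *\<^sub>R b) - U x\<bar> \<le> L * dist (x + (1 / real (Suc n)) *\<^sub>R b) x"
      using x by (intro lip) auto
    also have "\<dots> = L * (1 / real (Suc n))" using b by (simp add: dist_norm)
    finally have "real (Suc n) * \<bar>U (x + (1 / real (Suc n)) *\<^sub>R b) - U x\<bar> \<le> real (Suc n) * (L * (1 / real (Suc n)))"
      by (rule mult_left_mono) simp
    then show ?thesis by (simp add: q_def abs_mult)
  qed
  have small: "\<exists>n0. \<forall>n\<ge>n0. 1 / real (Suc n) \<le> \<delta>" if "0 < \<delta>" for \<delta>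
  proof -
    have "(\<lambda>n. 1 / real (Suc n)) \<longlonglongrightarrow> 0" by (rule lim_1_over_n[THEN LIMSEQ_Suc])
    then have "\<forall>\<^sub>F n in sequentially. 1 / real (Suc n) < \<delta>" using that by (rule order_tendstoD)
    then obtain n0 where "\<forall>n\<ge>n0. 1 / real (Suc n) < \<delta>" unfolding eventually_sequentially by blast
    then have "\<forall>n\<ge>n0. 1 / real (Suc n) \<le> \<delta>" using less_imp_le by blast
    then show ?thesis by (rule exI)
  qed
  have GL: "\<bar>G b x\<bar> \<le> L" if x: "x \<in> \<Omega>" and b: "b \<in> Basis" for x b
  proof -
    obtain \<delta> where \<delta>: "\<delta> > 0" "cball x \<delta> \<subseteq> \<Omega>"
      using open_contains_cball[THEN iffD1, OF open_dom] x by blast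
    obtain n0 where n0: "\<forall>n\<ge>n0. 1 / real (Suc n) \<le> \<delta>" using small[OF \<delta>(1)] by blast
    have "(\<lambda>n. \<bar>q n b x\<bar>) \<longlonglongrightarrow> \<bar>G b x\<bar>" by (intro tendsto_intros qG x b)
    then show ?thesis
    proof (rule LIMSEQ_le_const2)
      show "\<exists>N. \<forall>n\<ge>N. \<bar>q n b x\<bar> \<le> L" using qL[OF b x \<delta>(2)] n0 by blast
    qed
  qed
  have qm: "q n b \<in> borel_measurable ?N" for n b by (rule continuous_imp_measurable_lebesgue_on[OF qc])
  have Gm: "G b \<in> borel_measurable ?N" if "b \<in> Basis" for b
    by (rule borel_measurable_LIMSEQ_real[OF _ qm]) (use qG that spN in auto)
  define g where "g x = (\<Sum>b\<in>Basis. G b x *\<^sub>R b)" for x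
  have gb: "g x \<bullet> b = G b x" if "b \<in> Basis" for x b using that by (simp add: g_def)
  have gm: "g \<in> borel_measurable ?N" unfolding g_def
    using Gm by (intro borel_measurable_sum borel_measurable_scaleR) auto
  have gn: "norm (g x) \<le> DIM('a) * L" if "x \<in> \<Omega>" for x
  proof -
    have "norm (g x) \<le> (\<Sum>b\<in>Basis. \<bar>g x \<bullet> b\<bar>)" by (rule norm_le_l1)
    also have "\<dots> \<le> (\<Sum>b\<in>(Basis::'a set). L)" using gb GL[OF that] by (intro sum_mono) auto
    finally show ?thesis by simp
  qed
  have "g \<in> Linf \<Omega>" unfolding Linf_def using gm gn spN by (auto intro!: exI[of _ "DIM('a) * L"])
  moreover have "has_weak_gradient \<Omega> U g"
    unfolding has_weak_gradient_def
  proof (intro ballI)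
    fix \<phi> and b :: 'a assume \<phi>: "\<phi> \<in> test_functions \<Omega>" and b: "b \<in> Basis"
    let ?S = "closure {x. \<phi> x \<noteq> 0}"
    let ?D = "\<lambda>x. frechet_derivative \<phi> (at x)"
    have C: "C1c ?S \<phi> ?D" by (rule C1c_test_function[OF \<phi>])
    have S: "compact ?S" "?S \<subseteq> \<Omega>" using \<phi> by (simp_all add: test_functions_def)
    have \<phi>0: "\<And>x. x \<notin> ?S \<Longrightarrow> \<phi> x = 0" using C unfolding C1c_def by blast
    have \<phi>c: "continuous_on UNIV \<phi>" by (rule C1c_continuous[OF C])
    have Dc: "continuous_on UNIV (\<lambda>x. ?D x b)" using C unfolding C1c_def by blast
    let ?F = "\<lambda>s. LINT y|lborel. U y * \<phi> (y + s *\<^sub>R b)"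
    have DF: "(?F has_real_derivative (LINT y|lborel. U y * ?D (y + 0 *\<^sub>R b) b)) (at 0)"
      by (rule translate_integral_derivative[OF U C])
    have shift: "?F s = (LINT y|lborel. U (y - s *\<^sub>R b) * \<phi> y)" for s
    proof -
      have "continuous_on UNIV (\<lambda>y. U (y - s *\<^sub>R b) * \<phi> y)"
        by (intro continuous_intros continuous_on_compose2[OF U] \<phi>c) auto
      from integral_translate[OF borel_measurable_continuous_onI[OF this], of "s *\<^sub>R b"] show ?thesis
        by simp
    qed
    have I: "integrable lborel (\<lambda>y. U (y - s *\<^sub>R b) * \<phi> y)" for s
    proof (rule integrable_compact_support(1)[OF _ S(1)])
      show "continuous_on UNIV (\<lambda>y. U (y - s *\<^sub>R b) * \<phi> y)"
        by (intro continuous_intros continuous_on_compose2[OF U] \<phi>c) auto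
      show "U (y - s *\<^sub>R b) * \<phi> y = 0" if "y \<notin> ?S" for y using \<phi>0[OF that] by simp
    qed
    \<comment> \<open>Discrete integration by parts: a forward difference of \<open>U\<close> turns
      into a backward difference of \<phi>, whence the negative step.\<close>
    have qF: "(LINT x|?N. q n b x * \<phi> x) = - ((?F (- (1 / real (Suc n))) - ?F 0) / (- (1 / real (Suc n)) - 0))"
      for n
    proof -
      have "(LINT x|?N. q n b x * \<phi> x) = (LINT x|lborel. q n b x * \<phi> x)"
      proof (rule integral_lebesgue_on_compact_support)
        show "continuous_on UNIV (\<lambda>x. q n b x * \<phi> x)" by (intro continuous_intros qc \<phi>c)
        show "\<Omega> \<in> sets lebesgue" by (rule fmeasurableD[OF lmeasurable_dom])
        fix x assume "x \<notin> \<Omega>"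
        then have "x \<notin> ?S" using S(2) by blast
        from \<phi>0[OF this] show "q n b x * \<phi> x = 0" by simp
      qed
      also have "\<dots> = (LINT x|lborel. real (Suc n) * (U (x - (- (1 / real (Suc n))) *\<^sub>R b) * \<phi> x - U (x - 0 *\<^sub>R b) * \<phi> x))"
        by (intro Bochner_Integration.integral_cong refl) (simp add: q_def algebra_simps)
      also have "\<dots> = real (Suc n) * (?F (- (1 / real (Suc n))) - ?F 0)"
        unfolding shift
          by (subst integral_mult_right_zero, subst Bochner_Integration.integral_diff[OF I I]) (rule refl)
      finally show ?thesis by simp
    qed
    have F: "((\<lambda>s. (?F s - ?F 0) / (s - 0)) \<longlongrightarrow> (LINT y|lborel. U y * ?D (y + 0 *\<^sub>R b) b)) (at 0)"
      using DF by (simp only: has_field_derivative_iff)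
    have seq: "filterlim (\<lambda>n. - (1 / real (Suc n))) (at 0) sequentially"
      unfolding filterlim_at
    proof
      have "(\<lambda>n. - (1 / real (Suc n))) \<longlonglongrightarrow> - 0" by (intro tendsto_intros lim_1_over_n[THEN LIMSEQ_Suc])
      then show "(\<lambda>n. - (1 / real (Suc n))) \<longlonglongrightarrow> 0" by simp
    qed auto
    have lim1: "(\<lambda>n. LINT x|?N. q n b x * \<phi> x) \<longlonglongrightarrow> - (LINT y|lborel. U y * ?D (y + 0 *\<^sub>R b) b)"
      unfolding qF by (rule tendsto_minus[OF filterlim_compose[OF F seq]])
    obtain \<delta> where \<delta>: "\<delta> > 0" "(\<Union>w\<in>?S. cball w \<delta>) \<subseteq> \<Omega>"
      using compact_subset_open_imp_cball_epsilon_subset[OF S(1) open_dom S(2)] by blast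
    obtain n0 where n0: "\<forall>n\<ge>n0. 1 / real (Suc n) \<le> \<delta>" using small[OF \<delta>(1)] by blast
    \<comment> \<open>Only from \<open>n0\<close> on do the shifted points stay in the domain for
      every \<open>x\<close> in the support, so that \<open>L\<close> bounds the quotients.\<close>
    have lim2: "(\<lambda>n. LINT x|?N. q (n + n0) b x * \<phi> x) \<longlonglongrightarrow> (LINT x|?N. G b x * \<phi> x)"
    proof (rule integral_dominated_convergence[where w="\<lambda>x. L * \<bar>\<phi> x\<bar>"])
      have \<phi>m: "\<phi> \<in> borel_measurable ?N" by (rule continuous_imp_measurable_lebesgue_on[OF \<phi>c])
      show "(\<lambda>x. G b x * \<phi> x) \<in> borel_measurable ?N" using Gm[OF b] \<phi>m by measurable
      show "(\<lambda>x. q (n + n0) b x * \<phi> x) \<in> borel_measurable ?N" for n using qm \<phi>m by measurable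
      have "integrable ?N \<phi>"
        using integrable_compact_support(1)[OF \<phi>c S(1) \<phi>0] fmeasurableD[OF lmeasurable_dom]
        by (intro integrable_lebesgue_on_continuous \<phi>c)
      then show "integrable ?N (\<lambda>x. L * \<bar>\<phi> x\<bar>)" by simp
      show "AE x in ?N. (\<lambda>n. q (n + n0) b x * \<phi> x) \<longlonglongrightarrow> G b x * \<phi> x"
        using qG b spN by (intro AE_I2 tendsto_intros LIMSEQ_ignore_initial_segment) auto
      show "AE x in ?N. norm (q (n + n0) b x * \<phi> x) \<le> L * \<bar>\<phi> x\<bar>" for n
      proof (rule AE_I2)
        fix x assume "x \<in> space ?N"
        show "norm (q (n + n0) b x * \<phi> x) \<le> L * \<bar>\<phi> x\<bar>"
        proof (cases "x \<in> ?S")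
          case True
          then have "cball x \<delta> \<subseteq> \<Omega>" "x \<in> \<Omega>" using \<delta>(2) S(2) by blast+
          moreover have "1 / real (Suc (n + n0)) \<le> \<delta>" using n0 le_add2 by blast
          ultimately have "\<bar>q (n + n0) b x\<bar> \<le> L" by (intro qL[OF b, of x \<delta>])
          then show ?thesis by (simp add: abs_mult mult_right_mono)
        next
          case False
          then show ?thesis using \<phi>0[OF False] by simp
        qed
      qed
    qed
    have "(LINT x|?N. G b x * \<phi> x) = - (LINT y|lborel. U y * ?D (y + 0 *\<^sub>R b) b)"
      using lim2 LIMSEQ_ignore_initial_segment[OF lim1, of n0] by (rule LIMSEQ_unique)
    moreover have "(LINT x|?N. U x * ?D x b) = (LINT y|lborel. U y * ?D y b)"
    proof (rule integral_lebesgue_on_compact_support)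
      show "continuous_on UNIV (\<lambda>x. U x * ?D x b)" by (intro continuous_intros U Dc)
      show "\<Omega> \<in> sets lebesgue" by (rule fmeasurableD[OF lmeasurable_dom])
      fix x assume "x \<notin> \<Omega>"
      then have "x \<notin> ?S" using S(2) by blast
      from C1c_derivative_zero[OF C this] show "U x * ?D x b = 0" by (simp only: mult_zero_right)
    qed
    ultimately show "(LINT x|?N. U x * ?D x b) = - (LINT x|?N. (g x \<bullet> b) * \<phi> x)"
      by (simp add: gb[OF b])
  qed
  ultimately show ?thesis by blast
qed

text \<open>\<open>Linf_norm\<close> converts an extended real, so the essential supremum has to be
  finite for the conversion to mean anything. That it is not negative rests on the domain having
  positive volume.\<close>

lemma Linf_norm_facts:
  fixes g :: "'a \<Rightarrow> 'a"
  assumes "g \<in> Linf \<Omega>"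
  shows "AE x in lebesgue_on \<Omega>. norm (g x) \<le> Linf_norm \<Omega> g" "0 \<le> Linf_norm \<Omega> g"
    "\<And>L. (AE x in lebesgue_on \<Omega>. norm (g x) \<le> L) \<Longrightarrow> Linf_norm \<Omega> g \<le> L"
proof -
  let ?N = "lebesgue_on \<Omega>"
  let ?f = "\<lambda>x. ereal (norm (g x))"
  obtain C where gm: "g \<in> borel_measurable ?N" and C: "AE x in ?N. norm (g x) \<le> C"
    using assms by (auto simp: Linf_def)
  have fm: "?f \<in> borel_measurable ?N" using gm by measurable
  have ae: "AE x in ?N. ?f x \<le> esssup ?N ?f" by (rule esssup_AE)
  have ub: "esssup ?N ?f \<le> ereal M" if "AE x in ?N. norm (g x) \<le> M" for M
    using that by (intro esssup_I[OF fm]) simp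
  have lb: "0 \<le> esssup ?N ?f"
  proof (rule ccontr)
    assume "\<not> 0 \<le> esssup ?N ?f"
    then have "AE x in ?N. False" using ae
      by (auto elim!: eventually_mono) (meson ereal_less_eq(5) norm_ge_zero not_le order_trans)
    then have "emeasure ?N (space ?N) = 0" 
      by (subst (asm) AE_iff_measurable[of "space ?N"]) auto
    then have "emeasure lebesgue \<Omega> = 0"
      using lmeasurable_dom by (simp add: emeasure_restrict_space space_restrict_space fmeasurableD)
    then have "negligible \<Omega>"
      using lmeasurable_dom by (simp add: negligible_iff_null_sets null_sets_def fmeasurableD)
    then show False using open_not_negligible[OF open_dom nonempty_dom] by simp
  qed
  obtain e where e: "esssup ?N ?f = ereal e"
    using lb ub[OF C] by (cases "esssup ?N ?f") auto
  have n: "Linf_norm \<Omega> g = e" by (simp add: Linf_norm_def e)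
  show "AE x in ?N. norm (g x) \<le> Linf_norm \<Omega> g" using ae unfolding e n by simp
  show "0 \<le> Linf_norm \<Omega> g" using lb unfolding e n by simp
  show "Linf_norm \<Omega> g \<le> L" if "AE x in ?N. norm (g x) \<le> L" for L using ub[OF that] unfolding e n by simp
qed

abbreviation lipnorm :: "('a \<Rightarrow> real) \<Rightarrow> real" where
  "lipnorm u \<equiv> Linf_norm \<Omega> (weak_gradient \<Omega> u)"

lemma weak_gradient_spec:
  assumes "u \<in> W1inf \<Omega>"
  shows "weak_gradient \<Omega> u \<in> Linf \<Omega>" "has_weak_gradient \<Omega> u (weak_gradient \<Omega> u)"
proof -
  have "\<exists>g. g \<in> Linf \<Omega> \<and> has_weak_gradient \<Omega> u g" using assms by (auto simp: W1inf_def)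
  then have "weak_gradient \<Omega> u \<in> Linf \<Omega> \<and> has_weak_gradient \<Omega> u (weak_gradient \<Omega> u)"
    unfolding weak_gradient_def by (rule someI_ex)
  then show "weak_gradient \<Omega> u \<in> Linf \<Omega>" "has_weak_gradient \<Omega> u (weak_gradient \<Omega> u)" by auto
qed

text \<open>The bound is carried to the closure by continuity, since it is to be applied between
  interior points and boundary points, where \<open>u\<close> equals 1.\<close>

lemma Lip1_lipschitz:
  assumes u: "u \<in> Lip1 \<Omega>"
  shows "0 \<le> lipnorm u" and "\<And>x y. x \<in> closure \<Omega> \<Longrightarrow> y \<in> closure \<Omega> \<Longrightarrow> \<bar>u x - u y\<bar> \<le> lipnorm u * dist x y"
proof -
  have uW: "u \<in> W1inf \<Omega>" and uc: "continuous_on (closure \<Omega>) u" using u by (auto simp: Lip1_def)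
  note g = weak_gradient_spec[OF uW]
  show "0 \<le> lipnorm u" by (rule Linf_norm_facts(2)[OF g(1)])
  have *: "\<bar>u x - u y\<bar> \<le> lipnorm u * dist x y" if "x \<in> \<Omega>" "y \<in> \<Omega>" for x y
    by (rule weak_gradient_lipschitz[OF uc g Linf_norm_facts(1)[OF g(1)] that])
  fix x y assume "x \<in> closure \<Omega>" "y \<in> closure \<Omega>"
  then obtain X Y where XY: "\<And>n. X n \<in> \<Omega>" "X \<longlonglongrightarrow> x" "\<And>n. Y n \<in> \<Omega>" "Y \<longlonglongrightarrow> y"
    unfolding closure_sequential by blast
  have "(\<lambda>n. u (X n)) \<longlonglongrightarrow> u x" "(\<lambda>n. u (Y n)) \<longlonglongrightarrow> u y"
    using XY closure_subset \<open>x \<in> closure \<Omega>\<close> \<open>y \<in> closure \<Omega>\<close>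
    by (auto intro!: continuous_on_tendsto_compose[OF uc] always_eventually)
  then have "(\<lambda>n. \<bar>u (X n) - u (Y n)\<bar>) \<longlonglongrightarrow> \<bar>u x - u y\<bar>" by (intro tendsto_intros)
  moreover have "(\<lambda>n. lipnorm u * dist (X n) (Y n)) \<longlonglongrightarrow> lipnorm u * dist x y"
    by (intro tendsto_intros XY)
  ultimately show "\<bar>u x - u y\<bar> \<le> lipnorm u * dist x y"
    by (rule LIMSEQ_le) (use * XY in auto)
qed

lemma Lip1I:
  assumes lip: "\<And>x y. \<bar>u x - u y\<bar> \<le> L * dist x y" and L: "0 \<le> L"
    and u0: "\<And>x. x \<in> \<Omega> \<Longrightarrow> 0 \<le> u x" and u1: "\<And>x. x \<in> frontier \<Omega> \<Longrightarrow> u x = 1"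
    and conv: "\<And>x b. x \<in> \<Omega> \<Longrightarrow> b \<in> Basis \<Longrightarrow> convergent (\<lambda>n. real (Suc n) * (u (x + (1 / real (Suc n)) *\<^sub>R b) - u x))"
  shows "u \<in> Lip1 \<Omega>" "lipnorm u \<le> L"
proof -
  have U: "continuous_on UNIV u"
    unfolding continuous_on_iff
  proof (intro ballI allI impI)
    fix x :: 'a and e :: real assume e: "0 < e"
    have "dist (u y) (u x) < e" if "dist y x < e / (L + 1)" for y
    proof -
      have "dist y x * (L + 1) < e" using that L by (simp add: field_simps)
      moreover have "L * dist y x \<le> dist y x * (L + 1)" by (simp add: algebra_simps)
      ultimately show ?thesis using lip[of y x] by (simp add: dist_real_def)
    qed
    then show "\<exists>d>0. \<forall>y\<in>UNIV. dist y x < d \<longrightarrow> dist (u y) (u x) < e"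
      using e L by (intro exI[of _ "e / (L + 1)"]) auto
  qed
  obtain g where g: "g \<in> Linf \<Omega>" "has_weak_gradient \<Omega> u g"
    using weak_gradient_exists[OF U lip conv L] by blast
  have "u \<in> Linf \<Omega>"
  proof -
    have "compact (u ` closure \<Omega>)"
      using bounded_dom continuous_on_subset[OF U] by (intro compact_continuous_image) auto
    then obtain B where "\<forall>y\<in>u ` closure \<Omega>. norm y \<le> B" using compact_imp_bounded bounded_iff by blast
    then have "norm (u x) \<le> B" if "x \<in> \<Omega>" for x using that closure_subset by blast
    then have "AE x in lebesgue_on \<Omega>. norm (u x) \<le> B"
      by (intro AE_I2) (auto simp: space_restrict_space)
    then show ?thesis using continuous_imp_measurable_lebesgue_on[OF U] by (auto simp: Linf_def)
  qed
  then have uW: "u \<in> W1inf \<Omega>" using g by (auto simp: W1inf_def)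
  then show "u \<in> Lip1 \<Omega>" using u0 u1 continuous_on_subset[OF U] by (auto simp: Lip1_def)
  note wg = weak_gradient_spec[OF uW]
  show "lipnorm u \<le> L"
    by (rule Linf_norm_facts(3)[OF wg(1) weak_gradient_norm_le[OF U lip L wg]])
qed

subsection \<open>Competitors and minimizers\<close>

text \<open>The slopes of a convex function decrease as the step shrinks, and the Lipschitz constant
  bounds them from below.\<close>

lemma convergent_quotients_of_convex:
  assumes conv: "\<And>x y t. \<lbrakk>x \<in> \<Omega>; y \<in> \<Omega>; 0 \<le> t; t \<le> 1\<rbrakk> \<Longrightarrow> f (t *\<^sub>R x + (1 - t) *\<^sub>R y) \<le> t * f x + (1 - t) * f y"
    and lip: "\<And>x y. \<bar>f x - f y\<bar> \<le> L * dist x y"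
    and x: "x \<in> \<Omega>" and b: "b \<in> Basis"
  shows "convergent (\<lambda>n. real (Suc n) * (f (x + (1 / real (Suc n)) *\<^sub>R b) - f x))"
proof -
  define g where "g n = real (Suc n) * (f (x + (1 / real (Suc n)) *\<^sub>R b) - f x)" for n
  obtain e where e: "0 < e" "ball x e \<subseteq> \<Omega>" using open_dom x open_contains_ball by blast
  \<comment> \<open>Convexity is available only inside the domain, hence only for small steps; the
    finitely many earlier quotients do not affect convergence.\<close>
  obtain N where N: "1 / real (Suc N) < e" using e(1) by (metis inverse_eq_divide reals_Archimedean)
  have inO: "x + (1 / real (Suc n)) *\<^sub>R b \<in> \<Omega>" if n: "N \<le> n" for n
  proof -
    have "1 / real (Suc n) \<le> 1 / real (Suc N)" using n by (intro divide_left_mono) auto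
    then have "dist x (x + (1 / real (Suc n)) *\<^sub>R b) < e" using N b by (simp add: dist_norm)
    then show ?thesis using e(2) by auto
  qed
  have dec: "g (Suc n) \<le> g n" if n: "N \<le> n" for n
  proof -
    let ?t = "real (Suc n) / real (Suc (Suc n))" and ?y = "x + (1 / real (Suc n)) *\<^sub>R b"
    have "?t *\<^sub>R ?y + (1 - ?t) *\<^sub>R x = x + (?t * (1 / real (Suc n))) *\<^sub>R b"
      by (simp add: algebra_simps)
    also have "?t * (1 / real (Suc n)) = 1 / real (Suc (Suc n))" by (simp add: field_simps)
    finally have eq: "?t *\<^sub>R ?y + (1 - ?t) *\<^sub>R x = x + (1 / real (Suc (Suc n))) *\<^sub>R b" .
    have "f (x + (1 / real (Suc (Suc n))) *\<^sub>R b) \<le> ?t * f ?y + (1 - ?t) * f x"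
      using conv[OF inO[OF n] x, of ?t] unfolding eq by simp
    then have "f (x + (1 / real (Suc (Suc n))) *\<^sub>R b) - f x \<le> ?t * (f ?y - f x)"
      by (simp add: algebra_simps)
    then have "g (Suc n) \<le> real (Suc (Suc n)) * (?t * (f ?y - f x))"
      unfolding g_def by (intro mult_left_mono) auto
    also have "\<dots> = g n" unfolding g_def by (simp add: field_simps)
    finally show ?thesis .
  qed
  have "- L \<le> g n" for n
  proof -
    have "\<bar>f (x + (1 / real (Suc n)) *\<^sub>R b) - f x\<bar> \<le> L * (1 / real (Suc n))"
      using lip[of "x + (1 / real (Suc n)) *\<^sub>R b" x] b by (simp add: dist_norm)
    then have "real (Suc n) * \<bar>f (x + (1 / real (Suc n)) *\<^sub>R b) - f x\<bar> \<le> real (Suc n) * (L * (1 / real (Suc n)))"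
      by (intro mult_left_mono) auto
    also have "\<dots> = L" by simp
    finally have "\<bar>g n\<bar> \<le> L" unfolding g_def by (simp add: abs_mult)
    then show ?thesis by linarith
  qed
  moreover have "decseq (\<lambda>n. g (n + N))" by (rule decseq_SucI) (use dec in simp)
  ultimately obtain l where "(\<lambda>n. g (n + N)) \<longlonglongrightarrow> l" using decseq_convergent[of "\<lambda>n. g (n + N)" "- L"]
    by blast
  then have "g \<longlonglongrightarrow> l" by (rule LIMSEQ_offset)
  then show ?thesis unfolding g_def convergent_def by blast
qed

lemma bdist_lipschitz: "\<bar>d x - d y\<bar> \<le> dist x y"
  using bdist_triangle[of x y] bdist_triangle[of y x] by (simp add: dist_commute abs_le_iff)

lemma v_Lip1:
  assumes r: "0 < r" shows "v \<Omega> r \<in> Lip1 \<Omega>" "lipnorm (v \<Omega> r) \<le> 1 / r"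
proof -
  have lip: "\<bar>v \<Omega> r x - v \<Omega> r y\<bar> \<le> 1 / r * dist x y" for x y
  proof -
    have "\<bar>d y - d x\<bar> / r \<le> dist x y / r" using bdist_lipschitz[of y x] r
      by (simp add: divide_right_mono dist_commute)
    moreover have "\<bar>d y - d x\<bar> / r = \<bar>d y / r - d x / r\<bar>" using r
      by (simp add: diff_divide_distrib[symmetric])
    ultimately show ?thesis unfolding v_def by (auto simp: max_def abs_le_iff)
  qed
  have conv: "v \<Omega> r (t *\<^sub>R x + (1 - t) *\<^sub>R y) \<le> t * v \<Omega> r x + (1 - t) * v \<Omega> r y"
    if xy: "x \<in> \<Omega>" "y \<in> \<Omega>" and t: "0 \<le> t" "t \<le> 1" for x y t
  proof -
    have "(t * d x + (1 - t) * d y) / r \<le> d (t *\<^sub>R x + (1 - t) *\<^sub>R y) / r"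
      using bdist_concave[OF xy t] r by (simp add: divide_right_mono)
    then have "1 - d (t *\<^sub>R x + (1 - t) *\<^sub>R y) / r \<le> t * (1 - d x / r) + (1 - t) * (1 - d y / r)"
      by (simp add: algebra_simps add_divide_distrib diff_divide_distrib)
    also have "\<dots> \<le> t * v \<Omega> r x + (1 - t) * v \<Omega> r y"
      unfolding v_def using t by (intro add_mono mult_left_mono) auto
    finally show ?thesis using t by (auto simp: v_def intro!: add_nonneg_nonneg)
  qed
  have v0: "0 \<le> v \<Omega> r x" for x by (simp add: v_def)
  have v1: "v \<Omega> r x = 1" if "x \<in> frontier \<Omega>" for x using bdist_frontier[OF that] by (simp add: v_def)
  show "v \<Omega> r \<in> Lip1 \<Omega>" "lipnorm (v \<Omega> r) \<le> 1 / r"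
    using Lip1I[OF lip _ v0 v1 convergent_quotients_of_convex[OF conv lip]] r by auto
qed

lemma one_Lip1: "(\<lambda>x. 1) \<in> Lip1 \<Omega>" "lipnorm (\<lambda>x. 1) = 0"
proof -
  have *: "(\<lambda>x. 1) \<in> Lip1 \<Omega>" "lipnorm (\<lambda>x. 1) \<le> 0"
    using Lip1I[of "\<lambda>x. 1" 0] by (simp_all add: convergent_const)
  then show "(\<lambda>x. 1) \<in> Lip1 \<Omega>" "lipnorm (\<lambda>x. 1) = 0"
    using Lip1_lipschitz(1)[OF *(1)] by auto
qed

definition w :: "real \<Rightarrow> 'a \<Rightarrow> real" where
  "w r x = min 1 (infdist x (K r) / r)"

lemma K_nonempty: "r \<le> R \<Longrightarrow> K r \<noteq> {}"
proof -
  assume r: "r \<le> R"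
  obtain x0 where "x0 \<in> \<Omega>" "d x0 = R" by (rule inradius_attained)
  then have "x0 \<in> K r" using r by (simp add: K_def)
  then show "K r \<noteq> {}" by blast
qed

lemma infdist_K_ge: "r \<le> R \<Longrightarrow> r - d x \<le> infdist x (K r)"
  unfolding infdist_notempty[OF K_nonempty]
proof (rule cINF_greatest)
  fix p assume "p \<in> K r"
  then show "r - d x \<le> dist x p" using bdist_triangle[of p x] by (simp add: K_def dist_commute)
qed (use K_nonempty in auto)

lemma infdist_K_convex:
  assumes r: "0 < r" "r \<le> R" and t: "0 \<le> t" "t \<le> 1"
  shows "infdist (t *\<^sub>R x + (1 - t) *\<^sub>R y) (K r) \<le> t * infdist x (K r) + (1 - t) * infdist y (K r)"
proof -
  have cl: "closed (K r)" using compact_K r compact_imp_closed by blast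
  obtain p where p: "p \<in> K r" "infdist x (K r) = dist x p"
    using infdist_attains_inf[OF cl K_nonempty[OF r(2)]] by blast
  obtain q where q: "q \<in> K r" "infdist y (K r) = dist y q"
    using infdist_attains_inf[OF cl K_nonempty[OF r(2)]] by blast
  have "t *\<^sub>R p + (1 - t) *\<^sub>R q \<in> K r" using convex_K p q t by (intro convexD) auto
  then have "infdist (t *\<^sub>R x + (1 - t) *\<^sub>R y) (K r) \<le> dist (t *\<^sub>R x + (1 - t) *\<^sub>R y) (t *\<^sub>R p + (1 - t) *\<^sub>R q)"
    by (rule infdist_le)
  also have "\<dots> = norm (t *\<^sub>R (x - p) + (1 - t) *\<^sub>R (y - q))" by (simp add: dist_norm algebra_simps)
  also have "\<dots> \<le> t * dist x p + (1 - t) * dist y q"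
    using t by (intro order_trans[OF norm_triangle_ineq]) (simp add: dist_norm)
  finally show ?thesis using p q by simp
qed

lemma w_Lip1:
  assumes r: "0 < r" "r \<le> R" shows "w r \<in> Lip1 \<Omega>" "lipnorm (w r) \<le> 1 / r"
proof -
  define i where "i x = infdist x (K r) / r" for x
  have lipi: "\<bar>i x - i y\<bar> \<le> 1 / r * dist x y" for x y
  proof -
    have "\<bar>i x - i y\<bar> = \<bar>infdist x (K r) - infdist y (K r)\<bar> / r"
      unfolding i_def using r by (simp add: diff_divide_distrib[symmetric])
    also have "\<dots> \<le> dist x y / r" using r infdist_triangle_abs by (intro divide_right_mono) auto
    finally show ?thesis by simp
  qed
  have lipm: "\<bar>max 1 (i x) - max 1 (i y)\<bar> \<le> 1 / r * dist x y" for x y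
    using lipi[of x y] by (auto simp: max_def abs_le_iff)
  have lip: "\<bar>w r x - w r y\<bar> \<le> 1 / r * dist x y" for x y
    using lipi[of x y] by (auto simp: w_def i_def min_def abs_le_iff)
  have convi: "i (t *\<^sub>R x + (1 - t) *\<^sub>R y) \<le> t * i x + (1 - t) * i y" if t: "0 \<le> t" "t \<le> 1" for x y t
  proof -
    have "i (t *\<^sub>R x + (1 - t) *\<^sub>R y) \<le> (t * infdist x (K r) + (1 - t) * infdist y (K r)) / r"
      unfolding i_def using infdist_K_convex[OF r t] r by (simp add: divide_right_mono)
    then show ?thesis by (simp add: i_def add_divide_distrib)
  qed
  have convm: "max 1 (i (t *\<^sub>R x + (1 - t) *\<^sub>R y)) \<le> t * max 1 (i x) + (1 - t) * max 1 (i y)"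
    if t: "0 \<le> t" "t \<le> 1" for x y t
  proof -
    have "t * i x + (1 - t) * i y \<le> t * max 1 (i x) + (1 - t) * max 1 (i y)"
      using t by (intro add_mono mult_left_mono) auto
    moreover have "t * 1 + (1 - t) * 1 \<le> t * max 1 (i x) + (1 - t) * max 1 (i y)"
      using t by (intro add_mono mult_left_mono) auto
    ultimately show ?thesis using convi[OF t, of x y] by auto
  qed
  have conv: "convergent (\<lambda>n. real (Suc n) * (w r (x + (1 / real (Suc n)) *\<^sub>R b) - w r x))"
    if xb: "x \<in> \<Omega>" "b \<in> Basis" for x b
  proof -
    let ?y = "\<lambda>n. x + (1 / real (Suc n)) *\<^sub>R b"
    \<comment> \<open>A minimum with a constant destroys convexity, but \<open>w r\<close> is a
      difference of two convex Lipschitz functions, and the quotients of each converge.\<close>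
    have weq: "w r z = i z + 1 - max 1 (i z)" for z by (auto simp: w_def i_def)
    have "real (Suc n) * (w r (?y n) - w r x)
        = real (Suc n) * (i (?y n) - i x) - real (Suc n) * (max 1 (i (?y n)) - max 1 (i x))" for n
      unfolding weq by (simp only: right_diff_distrib distrib_left)
    then show ?thesis
      using convergent_diff[OF convergent_quotients_of_convex[OF convi lipi xb]
          convergent_quotients_of_convex[OF convm lipm xb]] by simp
  qed
  have w1: "w r x = 1" if x: "x \<in> frontier \<Omega>" for x
  proof -
    have "r \<le> infdist x (K r)" using infdist_K_ge[OF r(2), of x] bdist_frontier[OF x] by simp
    then show ?thesis using r by (simp add: w_def)
  qed
  have w0: "0 \<le> w r x" for x using r infdist_nonneg[of x "K r"] by (simp add: w_def)
  show "w r \<in> Lip1 \<Omega>" "lipnorm (w r) \<le> 1 / r"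
    using Lip1I[OF lip _ w0 w1 conv] r by auto
qed

lemma measure_diff_K:
  assumes "0 < r" shows "\<Omega> - K r \<in> lmeasurable" "measure lebesgue (\<Omega> - K r) = measure lebesgue \<Omega> - V r"
proof -
  have K: "K r \<in> lmeasurable" "K r \<subseteq> \<Omega>" using lmeasurable_K[OF assms] by (auto simp: K_def)
  show "\<Omega> - K r \<in> lmeasurable" by (rule fmeasurable.Diff[OF lmeasurable_dom K(1)])
  show "measure lebesgue (\<Omega> - K r) = measure lebesgue \<Omega> - V r"
    unfolding V_def by (rule measurable_measure_Diff[OF lmeasurable_dom fmeasurableD[OF K(1)] K(2)])
qed

lemma positivity_set:
  assumes r: "0 < r"
  shows "{x \<in> \<Omega>. v \<Omega> r x > 0} = \<Omega> - K r"
    and "r \<le> R \<Longrightarrow> {x \<in> \<Omega>. w r x > 0} = \<Omega> - K r"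
proof -
  have pos: "0 < v \<Omega> r x \<longleftrightarrow> x \<notin> K r" if "x \<in> \<Omega>" for x
    using r that by (simp add: v_def K_def less_max_iff_disj not_le)
  show "{x \<in> \<Omega>. v \<Omega> r x > 0} = \<Omega> - K r" using pos by blast
  assume R: "r \<le> R"
  have "0 < infdist x (K r) \<longleftrightarrow> x \<notin> K r" for x
    using in_closed_iff_infdist_zero[OF compact_imp_closed[OF compact_K[OF r]] K_nonempty[OF R], of x]
      infdist_nonneg[of x "K r"] by (metis less_irrefl order_le_less)
  then have "0 < w r x \<longleftrightarrow> x \<notin> K r" for x
    using r by (simp add: w_def zero_less_divide_iff)
  then show "{x \<in> \<Omega>. w r x > 0} = \<Omega> - K r" by blast
qed

text \<open>Inequalities suffice for \<open>v\<close> and \<open>w\<close>, because the lower bounds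
  valid for every admissible function meet them.\<close>

lemma J_competitors:
  assumes r: "0 < r"
  shows "J \<Omega> \<Lambda> (v \<Omega> r) \<le> measure lebesgue \<Omega> * \<Lambda> + (1 / r - \<Lambda> * V r)"
    and "r \<le> R \<Longrightarrow> J \<Omega> \<Lambda> (w r) \<le> measure lebesgue \<Omega> * \<Lambda> + (1 / r - \<Lambda> * V r)"
    and "J \<Omega> \<Lambda> (\<lambda>x. 1) = measure lebesgue \<Omega> * \<Lambda>"
  using v_Lip1[OF r] w_Lip1[OF r] one_Lip1
  by (simp_all add: J_def positivity_set[OF r] measure_diff_K[OF r] algebra_simps)

section \<open>Lower bounds for the energy and the minimizers\<close>

lemma open_positivity_set: "u \<in> Lip1 \<Omega> \<Longrightarrow> open {x \<in> \<Omega>. u x > 0}"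
proof -
  assume "u \<in> Lip1 \<Omega>"
  then have "continuous_on \<Omega> u"
    by (auto simp: Lip1_def intro: continuous_on_subset[OF _ closure_subset])
  then have "open (\<Omega> \<inter> u -` {0<..})" using open_dom by (rule continuous_open_preimage) auto
  moreover have "\<Omega> \<inter> u -` {0<..} = {x \<in> \<Omega>. u x > 0}" by auto
  ultimately show ?thesis by simp
qed

lemma lmeasurable_positivity_set: "u \<in> Lip1 \<Omega> \<Longrightarrow> {x \<in> \<Omega>. u x > 0} \<in> lmeasurable"
  using open_positivity_set by (intro lmeasurable_open bounded_subset[OF bounded_dom]) auto

lemma Lip1_lower_bound:
  assumes u: "u \<in> Lip1 \<Omega>" and x: "x \<in> \<Omega>" shows "1 - lipnorm u * d x \<le> u x"
proof -
  obtain y where y: "y \<in> frontier \<Omega>" "d x = dist x y" by (rule bdist_foot)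
  have "u y = 1" using u y by (simp add: Lip1_def)
  moreover have "\<bar>u x - u y\<bar> \<le> lipnorm u * dist x y"
    using Lip1_lipschitz(2)[OF u, of x y] x y closure_subset by (auto simp: frontier_def)
  ultimately show ?thesis using y by simp
qed

text \<open>An alternative on the steepness of \<open>u\<close>. If
  \<open>lipnorm u * R < 1\<close>, the boundary value 1 keeps \<open>u\<close> positive on the
  whole domain and nothing is gained in volume. Otherwise \<open>1 / lipnorm u\<close> is a radius
  up to the inradius, and \<open>u\<close> can vanish only on the parallel body of that
  depth.\<close>

lemma J_lower_bound:
  assumes u: "u \<in> Lip1 \<Omega>" and \<Lambda>: "0 < \<Lambda>"
  obtains "J \<Omega> \<Lambda> u = measure lebesgue \<Omega> * \<Lambda> + lipnorm u"
  | r where "r = 1 / lipnorm u" "0 < r" "r \<le> R" "{x \<in> \<Omega>. u x > 0} \<supseteq> \<Omega> - K r"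
      "measure lebesgue \<Omega> * \<Lambda> + (1 / r - \<Lambda> * V r) \<le> J \<Omega> \<Lambda> u"
proof (cases "lipnorm u * R < 1")
  case True
  have "{x \<in> \<Omega>. u x > 0} = \<Omega>"
  proof -
    have "0 < u x" if x: "x \<in> \<Omega>" for x
    proof -
      have "lipnorm u * d x \<le> lipnorm u * R"
        using bdist_le_inradius[OF x] Lip1_lipschitz(1)[OF u] by (rule mult_left_mono)
      then show ?thesis using True Lip1_lower_bound[OF u x] by linarith
    qed
    then show ?thesis by blast
  qed
  then show ?thesis using that(1) by (simp add: J_def)
next
  case False
  then have Lp: "0 < lipnorm u" using Lip1_lipschitz(1)[OF u] by (cases "lipnorm u = 0") auto
  let ?r = "1 / lipnorm u"
  have r: "0 < ?r" "?r \<le> R" using Lp False by (auto simp: field_simps)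
  have sub: "\<Omega> - K ?r \<subseteq> {x \<in> \<Omega>. u x > 0}"
  proof
    fix x assume "x \<in> \<Omega> - K ?r"
    then have x: "x \<in> \<Omega>" "d x < ?r" by (auto simp: K_def)
    then have "lipnorm u * d x < 1" using Lp by (simp add: field_simps)
    then show "x \<in> {x \<in> \<Omega>. u x > 0}" using Lip1_lower_bound[OF u x(1)] x by simp
  qed
  have "measure lebesgue (\<Omega> - K ?r) \<le> measure lebesgue {x \<in> \<Omega>. u x > 0}"
    using sub lmeasurable_positivity_set[OF u] measure_diff_K(1)[OF r(1)]
    by (intro measure_mono_fmeasurable) (auto simp: fmeasurableD)
  then have "\<Lambda> * (measure lebesgue \<Omega> - V ?r) \<le> \<Lambda> * measure lebesgue {x \<in> \<Omega>. u x > 0}"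
    using \<Lambda> by (simp add: measure_diff_K[OF r(1)])
  then show ?thesis using that(2)[OF refl r sub] by (simp add: J_def algebra_simps)
qed

lemma V_inradius: "V R = 0"
  using measure_K_inradius by (simp add: V_def)

lemma solution_iff:
  "solution \<Omega> \<Lambda> u \<longleftrightarrow> u \<in> Lip1 \<Omega> \<and> (\<forall>f\<in>Lip1 \<Omega>. J \<Omega> \<Lambda> u \<le> J \<Omega> \<Lambda> f)"
  by (auto simp: solution_def is_arg_min_linorder)

lemma v_not_constant:
  assumes r: "0 < r" "r \<le> R" shows "\<not> v \<Omega> r constant_on closure \<Omega>"
proof
  assume c: "v \<Omega> r constant_on closure \<Omega>"
  obtain x0 where x0: "x0 \<in> \<Omega>" "d x0 = R" by (rule inradius_attained)
  obtain y where y: "y \<in> frontier \<Omega>" using frontier_dom_nonempty by blast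
  have "v \<Omega> r x0 = v \<Omega> r y" 
    using c subsetD[OF closure_subset x0(1)] y by (auto simp: constant_on_def frontier_def)
  moreover have "v \<Omega> r y = 1" using bdist_frontier[OF y] by (simp add: v_def)
  moreover have "v \<Omega> r x0 = 0" using x0 r by (simp add: v_def field_simps)
  ultimately show False by simp
qed

lemma J_ge_of_Lambda_le:
  assumes u: "u \<in> Lip1 \<Omega>" and \<Lambda>: "0 < \<Lambda>" "\<Lambda> \<le> \<Lambda>0"
  shows "measure lebesgue \<Omega> * \<Lambda> \<le> J \<Omega> \<Lambda> u"
    and "\<Lambda> < \<Lambda>0 \<Longrightarrow> J \<Omega> \<Lambda> u \<le> measure lebesgue \<Omega> * \<Lambda> \<Longrightarrow> lipnorm u = 0"
proof -
  have *: "measure lebesgue \<Omega> * \<Lambda> \<le> J \<Omega> \<Lambda> u \<and> (\<Lambda> < \<Lambda>0 \<longrightarrow> J \<Omega> \<Lambda> u \<le> measure lebesgue \<Omega> * \<Lambda> \<longrightarrow> lipnorm u = 0)"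
  proof (rule J_lower_bound[OF u \<Lambda>(1)])
    assume "J \<Omega> \<Lambda> u = measure lebesgue \<Omega> * \<Lambda> + lipnorm u"
    then show ?thesis using Lip1_lipschitz(1)[OF u] by auto
  next
    fix r assume r: "0 < r" "r \<le> R" and le: "measure lebesgue \<Omega> * \<Lambda> + (1 / r - \<Lambda> * V r) \<le> J \<Omega> \<Lambda> u"
    \<comment> \<open>The radius \<open>R\<close> is outside the range of the energy estimates;
      there the volume vanishes and the energy is simply \<open>1 / R\<close>.\<close>
    have "0 \<le> 1 / r - \<Lambda> * V r \<and> (\<Lambda> < \<Lambda>0 \<longrightarrow> 0 < 1 / r - \<Lambda> * V r)"
    proof (cases "r = R")
      case True then show ?thesis using inradius_pos V_inradius by simp
    next
      case False then show ?thesis using energy_nonneg[OF \<Lambda> r(1)] r(2) by auto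
    qed
    then show ?thesis using le by auto
  qed
  show "measure lebesgue \<Omega> * \<Lambda> \<le> J \<Omega> \<Lambda> u" using * by blast
  assume "\<Lambda> < \<Lambda>0" "J \<Omega> \<Lambda> u \<le> measure lebesgue \<Omega> * \<Lambda>"
  then show "lipnorm u = 0" using * by blast
qed

lemma one_solution:
  assumes "0 < \<Lambda>" "\<Lambda> \<le> \<Lambda>0" shows "solution \<Omega> \<Lambda> (\<lambda>x. 1)"
  unfolding solution_iff
    using one_Lip1(1) J_competitors(3)[OF inradius_pos] J_ge_of_Lambda_le(1)[OF _ assms] by simp

lemma solution_below_Lambda0:
  assumes "0 < \<Lambda>" "\<Lambda> < \<Lambda>0" "solution \<Omega> \<Lambda> u" shows "u constant_on closure \<Omega>"
proof -
  have u: "u \<in> Lip1 \<Omega>" "J \<Omega> \<Lambda> u \<le> J \<Omega> \<Lambda> (\<lambda>x. 1)"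
    using assms one_Lip1(1) by (auto simp: solution_iff)
  then have "lipnorm u = 0"
    using J_ge_of_Lambda_le(2)[OF u(1) assms(1)] J_competitors(3)[OF inradius_pos] assms(2) by simp
  then have "u x = u y" if "x \<in> closure \<Omega>" "y \<in> closure \<Omega>" for x y
    using Lip1_lipschitz(2)[OF u(1) that] by simp
  moreover obtain z where "z \<in> closure \<Omega>" using nonempty_dom closure_subset by blast
  ultimately show ?thesis unfolding constant_on_def by blast
qed

lemma v_solution_Lambda0: "solution \<Omega> \<Lambda>0 (v \<Omega> rs)"
proof -
  have "J \<Omega> \<Lambda>0 (v \<Omega> rs) \<le> measure lebesgue \<Omega> * \<Lambda>0"
    using J_competitors(1)[OF r_star(1), of \<Lambda>0] energy_rs by simp
  then show ?thesis unfolding solution_iff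
    using v_Lip1(1)[OF r_star(1)] order_trans[OF _ J_ge_of_Lambda_le(1)[OF _ Lambda0_pos order_refl]]
      by blast
qed

text \<open>The second claim uses that the reduced energy has \<rho> as its only minimizer: equality
  in the lower bound determines the gradient norm.\<close>

lemma J_ge_of_Lambda_gt:
  assumes \<Lambda>: "\<Lambda>0 < \<Lambda>" and u: "u \<in> Lip1 \<Omega>"
  defines "\<rho> \<equiv> r_Lambda \<Omega> \<Lambda>"
  shows "measure lebesgue \<Omega> * \<Lambda> + (1 / \<rho> - \<Lambda> * V \<rho>) \<le> J \<Omega> \<Lambda> u"
    and "J \<Omega> \<Lambda> u \<le> measure lebesgue \<Omega> * \<Lambda> + (1 / \<rho> - \<Lambda> * V \<rho>) \<Longrightarrow> lipnorm u = 1 / \<rho>"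
proof -
  have \<Lambda>p: "0 < \<Lambda>" using \<Lambda> Lambda0_pos by simp
  note E = energy_minimizer[OF \<Lambda>, folded \<rho>_def]
  have *: "measure lebesgue \<Omega> * \<Lambda> + (1 / \<rho> - \<Lambda> * V \<rho>) \<le> J \<Omega> \<Lambda> u \<and>
     (J \<Omega> \<Lambda> u \<le> measure lebesgue \<Omega> * \<Lambda> + (1 / \<rho> - \<Lambda> * V \<rho>) \<longrightarrow> lipnorm u = 1 / \<rho>)"
  proof (rule J_lower_bound[OF u \<Lambda>p])
    assume "J \<Omega> \<Lambda> u = measure lebesgue \<Omega> * \<Lambda> + lipnorm u"
    then show ?thesis using Lip1_lipschitz(1)[OF u] E(1) by auto
  next
    fix r assume rL: "r = 1 / lipnorm u" and r: "0 < r" "r \<le> R"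
      and le: "measure lebesgue \<Omega> * \<Lambda> + (1 / r - \<Lambda> * V r) \<le> J \<Omega> \<Lambda> u"
    show ?thesis
    proof (cases "r = \<rho>")
      case True then show ?thesis using le rL r by auto
    next
      case ne: False
      have "1 / \<rho> - \<Lambda> * V \<rho> < 1 / r - \<Lambda> * V r"
      proof (cases "r = R")
        case True
        have "0 < 1 / r - \<Lambda> * V r" using True inradius_pos V_inradius by simp
        then show ?thesis using E(1) by simp
      next
        case False then show ?thesis using E(2) r ne by simp
      qed
      then show ?thesis using le by auto
    qed
  qed
  show "measure lebesgue \<Omega> * \<Lambda> + (1 / \<rho> - \<Lambda> * V \<rho>) \<le> J \<Omega> \<Lambda> u" using * by blast
  assume "J \<Omega> \<Lambda> u \<le> measure lebesgue \<Omega> * \<Lambda> + (1 / \<rho> - \<Lambda> * V \<rho>)"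
  then show "lipnorm u = 1 / \<rho>" using * by blast
qed

lemma solutions_above_Lambda0:
  assumes \<Lambda>: "\<Lambda>0 < \<Lambda>"
  shows "solution \<Omega> \<Lambda> (v \<Omega> (r_Lambda \<Omega> \<Lambda>))" "solution \<Omega> \<Lambda> (w (r_Lambda \<Omega> \<Lambda>))"
proof -
  have \<rho>: "0 < r_Lambda \<Omega> \<Lambda>" "r_Lambda \<Omega> \<Lambda> \<le> R" using r_Lambda[of \<Lambda>] \<Lambda> r_star by auto
  show "solution \<Omega> \<Lambda> (v \<Omega> (r_Lambda \<Omega> \<Lambda>))" unfolding solution_iff
    using v_Lip1(1)[OF \<rho>(1)] order_trans[OF J_competitors(1)[OF \<rho>(1)] J_ge_of_Lambda_gt(1)[OF \<Lambda>]]
      by blast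
  show "solution \<Omega> \<Lambda> (w (r_Lambda \<Omega> \<Lambda>))" unfolding solution_iff
    using w_Lip1(1)[OF \<rho>] order_trans[OF J_competitors(2)[OF \<rho>] J_ge_of_Lambda_gt(1)[OF \<Lambda>]] by blast
qed

text \<open>The infimum is attained: at \<Lambda>0 the function \<open>v \<Omega> rs\<close> ties
  with the constant 1, and for smaller positive parameters every minimizer is constant.\<close>

lemma Lambda_inf_eq: "Lambda_inf \<Omega> = \<Lambda>0"
  unfolding Lambda_inf_def
proof (rule cInf_eq_minimum)
  show "\<Lambda>0 \<in> {\<Lambda>. 0 < \<Lambda> \<and> (\<exists>u. solution \<Omega> \<Lambda> u \<and> \<not> u constant_on closure \<Omega>)}"
    using Lambda0_pos v_solution_Lambda0 v_not_constant[OF r_star(1)] r_star(2) by auto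
  fix \<Lambda> assume "\<Lambda> \<in> {\<Lambda>. 0 < \<Lambda> \<and> (\<exists>u. solution \<Omega> \<Lambda> u \<and> \<not> u constant_on closure \<Omega>)}"
  then show "\<Lambda>0 \<le> \<Lambda>" using solution_below_Lambda0 not_le by blast
qed

end

subsection \<open>The singular radius and uniqueness\<close>

text \<open>The difference of the enclosing functions has a minimum at \<open>x\<close>, so their
  derivatives agree there, and the common derivative is squeezed onto \<open>f\<close>.\<close>

lemma differentiable_sandwich:
  fixes f l u :: "'a::euclidean_space \<Rightarrow> real"
  assumes l: "l differentiable (at x)" and u: "u differentiable (at x)"
    and le: "\<And>z. l z \<le> f z" "\<And>z. f z \<le> u z" and eq: "l x = f x" "u x = f x"
  shows "f differentiable (at x)"
proof -
  obtain l' u' where l': "(l has_derivative l') (at x)" and u': "(u has_derivative u') (at x)"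
    using l u unfolding differentiable_def by blast
  have "(\<lambda>h. u' h - l' h) = (\<lambda>h. 0)"
  proof (rule differential_zero_maxmin[where f = "\<lambda>z. u z - l z" and S = UNIV and x = x])
    show "((\<lambda>z. u z - l z) has_derivative (\<lambda>h. u' h - l' h)) (at x)" using u' l'
      by (rule has_derivative_diff)
    have "0 \<le> u z - l z" for z using le[of z] by simp
    then show "(\<forall>y\<in>UNIV. u y - l y \<le> u x - l x) \<or> (\<forall>y\<in>UNIV. u x - l x \<le> u y - l y)" using eq by simp
  qed auto
  then have "u' = l'" by (auto simp: fun_eq_iff)
  with u' have u': "(u has_derivative l') (at x)" by simp
  have "(f has_derivative l') (at x)"
    unfolding has_derivative_at_alt
  proof (intro conjI allI impI)
    show "bounded_linear l'" using l' by (rule has_derivative_bounded_linear)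
    fix e :: real assume e: "0 < e"
    obtain a where a: "0 < a" "\<And>y. norm (y - x) < a \<Longrightarrow> norm (l y - l x - l' (y - x)) \<le> e * norm (y - x)"
      using l' e unfolding has_derivative_at_alt by blast
    obtain b where b: "0 < b" "\<And>y. norm (y - x) < b \<Longrightarrow> norm (u y - u x - l' (y - x)) \<le> e * norm (y - x)"
      using u' e unfolding has_derivative_at_alt by blast
    have "norm (f y - f x - l' (y - x)) \<le> e * norm (y - x)" if "norm (y - x) < min a b" for y
      using a(2)[of y] b(2)[of y] le[of y] eq that by (simp add: abs_le_iff)
    then show "\<exists>d>0. \<forall>y. norm (y - x) < d \<longrightarrow> norm (f y - f x - l' (y - x)) \<le> e * norm (y - x)"
      using a(1) b(1) by (intro exI[of _ "min a b"]) auto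
  qed
  then show ?thesis by (rule differentiableI)
qed

context convex_domain
begin

text \<open>By \<open>infdist_K_ge\<close> the distance to \<open>K r\<close> is never less than
  \<open>r - d x\<close>. Equality says that depth can be gained at unit speed from \<open>x\<close>
  until depth \<open>r\<close> is reached; it amounts to \<open>w r\<close> and
  \<open>v \<Omega> r\<close> agreeing on the domain.\<close>

definition tight :: "real \<Rightarrow> bool" where
  "tight r \<longleftrightarrow> (\<forall>x\<in>\<Omega>. d x < r \<longrightarrow> infdist x (K r) = r - d x)"

lemma tightD:
  assumes "tight r" "0 < r" "r \<le> R" "x \<in> \<Omega>" "d x < r"
  obtains p where "p \<in> K r" "dist x p = r - d x"
proof -
  obtain p where "p \<in> K r" "infdist x (K r) = dist x p"
    using infdist_attains_inf[OF compact_imp_closed[OF compact_K] K_nonempty] assms by blast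
  then show ?thesis using that assms by (simp add: tight_def)
qed

lemma differentiable_dist_at:
  fixes x y :: 'a assumes "x \<noteq> y" shows "(\<lambda>z. dist z y) differentiable (at x)"
proof -
  have "norm \<circ> (\<lambda>z. z - y) differentiable (at x)"
    using assms by (intro differentiable_chain_at) auto
  then show ?thesis by (simp add: o_def dist_norm)
qed

lemma tight_imp_differentiable:
  assumes "tight r" "0 < r" "r \<le> R" and x: "x \<in> \<Omega>" "d x < r"
  shows "d differentiable (at x)"
proof -
  obtain p where p: "p \<in> K r" "dist x p = r - d x" using assms by (rule tightD)
  obtain y where y: "y \<in> frontier \<Omega>" "d x = dist x y" by (rule bdist_foot)
  have "x \<noteq> p" "x \<noteq> y" using p x y bdist_pos[OF x(1)] by auto
  show ?thesis
  proof (rule differentiable_sandwich[of "\<lambda>z. r - dist z p" x "\<lambda>z. dist z y"])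
    show "(\<lambda>z. r - dist z p) differentiable (at x)" using differentiable_dist_at[OF \<open>x \<noteq> p\<close>] by simp
    show "(\<lambda>z. dist z y) differentiable (at x)" by (rule differentiable_dist_at[OF \<open>x \<noteq> y\<close>])
    fix z
    show "r - dist z p \<le> d z" using bdist_triangle[of p z] p by (simp add: K_def dist_commute)
    show "d z \<le> dist z y" by (rule bdist_le[OF y(1)])
  qed (use p y in auto)
qed

text \<open>At a deepest point a derivative would have to vanish, whereas \<open>d\<close> falls at
  unit rate towards a nearest boundary point. Hence the cut locus is nonempty, without which the
  \<open>setdist\<close> in \<open>r_sing\<close> would be 0 by convention.\<close>

lemma bdist_not_differentiable_somewhere: "\<exists>x\<in>\<Omega>. \<not> d differentiable (at x)"
proof -
  obtain x0 where x0: "x0 \<in> \<Omega>" "d x0 = R" by (rule inradius_attained)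
  obtain y where y: "y \<in> frontier \<Omega>" "d x0 = dist x0 y" by (rule bdist_foot)
  have "\<not> d differentiable (at x0)"
  proof
    assume "d differentiable (at x0)"
    then obtain D where D: "(d has_derivative D) (at x0)" unfolding differentiable_def by blast
    have "D = (\<lambda>h. 0)"
      by (rule differential_zero_maxmin[OF x0(1) open_dom D]) (use bdist_le_inradius x0(2) in auto)
    then have "\<forall>e>0. \<exists>\<delta>>0. \<forall>z. norm (z - x0) < \<delta> \<longrightarrow> norm (d z - d x0) \<le> e * norm (z - x0)"
      using D unfolding has_derivative_at_alt by simp
    then obtain \<delta> where \<delta>: "0 < \<delta>" "\<And>z. norm (z - x0) < \<delta> \<Longrightarrow> norm (d z - d x0) \<le> 1 / 2 * norm (z - x0)"
      by (metis half_gt_zero zero_less_one)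
    define t where "t = min 1 (\<delta> / (2 * R))"
    have t: "0 < t" "t \<le> 1" "t * R < \<delta>" using \<delta>(1) inradius_pos
      by (auto simp: t_def min_def field_simps)
    let ?z = "x0 + t *\<^sub>R (y - x0)"
    have n: "norm (?z - x0) = t * R" using t x0 y by (simp add: dist_norm norm_minus_commute)
    have "?z - y = (1 - t) *\<^sub>R (x0 - y)" by (simp add: algebra_simps)
    then have "dist ?z y = (1 - t) * R" using t x0 y by (simp add: dist_norm)
    then have "d ?z \<le> (1 - t) * R" using bdist_le[OF y(1), of ?z] by simp
    moreover have "norm (d ?z - d x0) \<le> 1 / 2 * (t * R)" using \<delta>(2)[of ?z] n t by simp
    moreover have "d x0 - d ?z \<le> norm (d ?z - d x0)" by simp
    ultimately have "R - (1 - t) * R \<le> 1 / 2 * (t * R)" using x0(2) by linarith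
    then have "t * R \<le> 1 / 2 * (t * R)" by (simp add: left_diff_distrib)
    then show False using t inradius_pos mult_pos_pos[of t R] by linarith
  qed
  then show ?thesis using x0 by blast
qed

lemma tight_imp_le_r_sing:
  assumes t: "tight r" "0 < r" "r \<le> R" shows "r \<le> r_sing \<Omega>"
  unfolding r_sing_def
proof (rule le_setdistI)
  show "cut_locus \<Omega> \<noteq> {}" using bdist_not_differentiable_somewhere closure_subset
    by (auto simp: cut_locus_def)
  show "frontier \<Omega> \<noteq> {}" by (rule frontier_dom_nonempty)
  have "closed {x. r \<le> d x}" by (intro closed_Collect_le continuous_intros continuous_bdist)
  moreover have "{x \<in> \<Omega>. \<not> d differentiable (at x)} \<subseteq> {x. r \<le> d x}"
    using tight_imp_differentiable[OF t] not_le by blast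
  ultimately have sub: "cut_locus \<Omega> \<subseteq> {x. r \<le> d x}" unfolding cut_locus_def
    by (rule closure_minimal[rotated])
  fix x y assume "x \<in> cut_locus \<Omega>" "y \<in> frontier \<Omega>"
  then show "r \<le> dist x y" using sub bdist_le[of y x] by fastforce
qed

text \<open>The gradient of \<open>d\<close> has norm at most 1, and towards the boundary point
  \<open>y\<close> the function falls at full rate. Equality in Cauchy-Schwarz then forces the
  gradient to be the unit vector from \<open>y\<close> to \<open>p\<close>.\<close>

lemma bdist_derivative_eq:
  assumes D: "(d has_derivative D) (at p)" and p: "p \<in> \<Omega>" and y: "y \<in> frontier \<Omega>" "d p = dist p y"
  shows "d p * D k = (p - y) \<bullet> k"
proof -
  define r where "r = d p"
  have r: "0 < r" using bdist_pos[OF p] by (simp add: r_def)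
  have bl: "bounded_linear D" using D by (rule has_derivative_bounded_linear)
  then have lin: "linear D" by (rule bounded_linear.linear)
  define g where "g = adjoint D 1"
  have g: "D k = k \<bullet> g" for k using adjoint_works[OF lin, of k 1] by (simp add: g_def)
  \<comment> \<open>The derivative along a single direction, with a parameter at most 1 so that the
    test point stays on the segment when \<open>k = y - p\<close>.\<close>
  have small: "\<exists>t>0. t \<le> 1 \<and> \<bar>d (p + t *\<^sub>R k) - d p - t * D k\<bar> \<le> e * t" if e: "0 < e" for e k
  proof -
    have "0 < e / (norm k + 1)" using e by (simp add: add_nonneg_pos)
    then obtain \<delta> where \<delta>: "0 < \<delta>" "\<And>z. norm (z - p) < \<delta> \<Longrightarrow> norm (d z - d p - D (z - p)) \<le> e / (norm k + 1) * norm (z - p)"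
      using D unfolding has_derivative_at_alt by blast
    define t where "t = min 1 (\<delta> / (2 * (norm k + 1)))"
    have k1: "0 < norm k + 1" by (simp add: add_nonneg_pos)
    have t: "0 < t" "t \<le> 1" using \<delta>(1) k1 by (auto simp: t_def)
    have "t \<le> \<delta> / (2 * (norm k + 1))" by (simp add: t_def)
    then have "t * (2 * (norm k + 1)) \<le> \<delta>" using k1 by (subst (asm) pos_le_divide_eq) auto
    moreover have "t * (2 * (norm k + 1)) = 2 * t + 2 * (t * norm k)" by (simp add: algebra_simps)
    moreover have "0 \<le> t * norm k" using t by simp
    ultimately have "t * norm k < \<delta>" using t by linarith
    then have "\<bar>d (p + t *\<^sub>R k) - d p - D (t *\<^sub>R k)\<bar> \<le> e / (norm k + 1) * (t * norm k)"
      using \<delta>(2)[of "p + t *\<^sub>R k"] t by simp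
    also have "\<dots> \<le> e * t" using e t k1 by (simp add: field_simps)
    finally show ?thesis using t linear_cmul[OF lin, of t k] by (intro exI[of _ t]) simp
  qed
  have "D k \<le> norm k" for k
  proof (rule field_le_epsilon)
    fix e :: real assume "0 < e"
    then obtain t where t: "0 < t" "\<bar>d (p + t *\<^sub>R k) - d p - t * D k\<bar> \<le> e * t" using small by blast
    have "d (p + t *\<^sub>R k) - d p \<le> t * norm k" using bdist_triangle[of "p + t *\<^sub>R k" p] t
      by (simp add: dist_norm)
    then have "t * D k \<le> t * (norm k + e)" using t by (simp add: algebra_simps)
    then show "D k \<le> norm k + e" using t by simp
  qed
  from this[of g] have "norm g * norm g \<le> 1 * norm g" by (simp add: g dot_square_norm power2_eq_square)
  then have g1: "norm g \<le> 1" by (cases "norm g = 0") (auto dest: mult_right_le_imp_le)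
  have "D (y - p) \<le> - r"
  proof (rule field_le_epsilon)
    fix e :: real assume "0 < e"
    then obtain t where t: "0 < t" "t \<le> 1" "\<bar>d (p + t *\<^sub>R (y - p)) - d p - t * D (y - p)\<bar> \<le> e * t"
      using small by blast
    have "p + t *\<^sub>R (y - p) - y = (1 - t) *\<^sub>R (p - y)" by (simp add: algebra_simps)
    then have "dist (p + t *\<^sub>R (y - p)) y = (1 - t) * r" using t y by (simp add: dist_norm r_def)
    then have "d (p + t *\<^sub>R (y - p)) \<le> (1 - t) * r" using bdist_le[OF y(1), of "p + t *\<^sub>R (y - p)"]
      by simp
    then have "t * D (y - p) \<le> t * (- r + e)" using t by (simp add: algebra_simps r_def)
    then show "D (y - p) \<le> - r + e" using t by simp
  qed
  then have "r \<le> (p - y) \<bullet> g" by (simp add: g inner_diff_left)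
  \<comment> \<open>Expanding the square bounds it by
    \<open>r\<^sup>2 - 2 * r * r + r\<^sup>2\<close>, which is 0.\<close>
  have "(norm (r *\<^sub>R g - (p - y)))\<^sup>2 = r\<^sup>2 * (norm g)\<^sup>2 - 2 * r * ((p - y) \<bullet> g) + r\<^sup>2"
  proof -
    define b where "b = p - y"
    have "b \<bullet> b = r\<^sup>2" using y(2) by (simp add: b_def r_def dist_norm power2_norm_eq_inner)
    then show ?thesis unfolding b_def[symmetric]
      unfolding power2_norm_eq_inner
      by (simp add: inner_diff_left inner_diff_right inner_commute power2_eq_square)
  qed
  also have "\<dots> \<le> r\<^sup>2 * 1 - 2 * r * r + r\<^sup>2"
    using r g1 \<open>r \<le> (p - y) \<bullet> g\<close> by (intro add_mono diff_mono mult_left_mono) (auto simp: power_le_one)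
  also have "\<dots> = 0" by (simp add: power2_eq_square)
  finally have "r *\<^sub>R g = p - y" by simp
  then have "(p - y) \<bullet> k = r * D k" by (metis g inner_commute inner_scaleR_left)
  then show ?thesis by (simp add: r_def)
qed

lemma tight_of_less_r_sing:
  assumes r: "0 < r" "r < R" "r < r_sing \<Omega>" shows "tight r"
  unfolding tight_def
proof (intro ballI impI)
  fix x assume x: "x \<in> \<Omega>" "d x < r"
  have cl: "closed (K r)" and ne: "K r \<noteq> {}"
    using compact_imp_closed[OF compact_K[OF r(1)]] K_nonempty r by auto
  define p where "p = closest_point (K r) x"
  have pK: "p \<in> K r" unfolding p_def by (rule closest_point_in_set[OF cl ne])
  then have p: "p \<in> \<Omega>" "r \<le> d p" by (auto simp: K_def)
  have xK: "x \<notin> K r" using x by (simp add: K_def)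
  \<comment> \<open>If \<open>p\<close> were deeper than \<open>r\<close>, a small move from
    \<open>p\<close> towards \<open>x\<close> would stay in \<open>K r\<close> and come closer to
    \<open>x\<close>.\<close>
  have dp: "d p = r"
  proof (rule ccontr)
    assume "d p \<noteq> r"
    then have gt: "r < d p" using p by simp
    have px: "0 < dist x p" using pK xK by auto
    define t where "t = min 1 ((d p - r) / dist x p)"
    have t: "0 < t" "t \<le> 1" using gt px by (auto simp: t_def)
    have "t \<le> (d p - r) / dist x p" by (simp add: t_def)
    then have tle: "t * dist x p \<le> d p - r" using px by (simp add: pos_le_divide_eq)
    let ?q = "(1 - t) *\<^sub>R p + t *\<^sub>R x"
    have "?q - p = t *\<^sub>R (x - p)" "x - ?q = (1 - t) *\<^sub>R (x - p)" by (simp_all add: algebra_simps)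
    then have dq: "dist p ?q = t * dist x p" "dist x ?q = (1 - t) * dist x p"
      using t by (simp_all add: dist_norm norm_minus_commute[of p])
    have "?q \<in> \<Omega>" using convex_dom p(1) x(1) t by (intro convexD) auto
    moreover have "r \<le> d ?q" using bdist_triangle[of p ?q] dq tle by simp
    ultimately have "?q \<in> K r" by (simp add: K_def)
    then have "dist x p \<le> dist x ?q" unfolding p_def using closest_point_le[OF cl] by blast
    then show False using dq(2) t(1) px by simp
  qed
  obtain y where y: "y \<in> frontier \<Omega>" "d p = dist p y" by (rule bdist_foot)
  \<comment> \<open>The depth of \<open>p\<close> is \<open>r\<close>, strictly less than the
    distance of the cut locus from the boundary.\<close>
  have "p \<notin> cut_locus \<Omega>"
  proof
    assume "p \<in> cut_locus \<Omega>"
    then have "r_sing \<Omega> \<le> dist p y" unfolding r_sing_def using y(1) by (rule setdist_le_dist)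
    then show False using y dp r by simp
  qed
  then have "d differentiable (at p)" 
    using p(1) subsetD[OF closure_subset[of "{x \<in> \<Omega>. \<not> d differentiable (at x)}"]]
      unfolding cut_locus_def by blast
  then obtain D where D: "(d has_derivative D) (at p)" unfolding differentiable_def by blast
  note eq = bdist_derivative_eq[OF D p(1) y, unfolded dp]
  have lin: "linear D" using has_derivative_bounded_linear[OF D] by (rule bounded_linear.linear)
  \<comment> \<open>Such a direction \<open>k\<close> increases \<open>d\<close> to first order, so
    a small step along it stays in \<open>K r\<close>; the nearest-point property then excludes an
    acute angle between \<open>x - p\<close> and \<open>k\<close>.\<close>
  have away: "(x - p) \<bullet> k \<le> 0" if k: "(y - p) \<bullet> k < 0" for k
  proof -
    have "0 < r * D k" using eq[of k] k by (simp add: inner_diff_left)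
    then have Dk: "0 < D k" using r by (simp add: zero_less_mult_iff)
    have k1: "0 < norm k" using k by auto
    obtain \<epsilon> where \<epsilon>: "0 < \<epsilon>" "ball p \<epsilon> \<subseteq> \<Omega>" using open_dom p(1) open_contains_ball by blast
    have "0 < D k / norm k" using Dk k1 by simp
    then obtain \<delta> where \<delta>: "0 < \<delta>" "\<And>z. norm (z - p) < \<delta> \<Longrightarrow> norm (d z - d p - D (z - p)) \<le> D k / norm k * norm (z - p)"
      using D unfolding has_derivative_at_alt by blast
    define t where "t = min \<delta> \<epsilon> / (2 * norm k)"
    have t: "0 < t" "t * norm k < \<delta>" "t * norm k < \<epsilon>" using \<delta>(1) \<epsilon>(1) k1 by (auto simp: t_def)
    have "norm (d (p + t *\<^sub>R k) - d p - D (t *\<^sub>R k)) \<le> t * D k"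
      using \<delta>(2)[of "p + t *\<^sub>R k"] t k1 by (simp add: mult.commute)
    then have "d p \<le> d (p + t *\<^sub>R k)" using linear_cmul[OF lin, of t k] by (simp add: abs_le_iff)
    moreover have "p + t *\<^sub>R k \<in> \<Omega>" using \<epsilon>(2) t by (auto simp: dist_norm)
    ultimately have pk: "p + t *\<^sub>R k \<in> K r" using dp by (simp add: K_def)
    have "(x - p) \<bullet> (p + t *\<^sub>R k - p) \<le> 0"
      using closest_point_dot[OF convex_K cl pk, of x] by (simp add: p_def)
    then have "t * ((x - p) \<bullet> k) \<le> 0" by simp
    then show ?thesis using t(1) by (simp add: mult_le_0_iff)
  qed
  define \<nu> where "\<nu> = (1 / r) *\<^sub>R (y - p)"
  define a where "a = x - p"
  have \<nu>: "\<nu> \<bullet> \<nu> = 1" "norm \<nu> = 1"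
  proof -
    show "norm \<nu> = 1" using y dp r by (simp add: \<nu>_def dist_norm norm_minus_commute)
    then show "\<nu> \<bullet> \<nu> = 1" by (simp add: dot_square_norm)
  qed
  have away': "a \<bullet> k \<le> 0" if "\<nu> \<bullet> k < 0" for k
  proof -
    have "(y - p) \<bullet> k < 0" using that r by (simp add: \<nu>_def divide_less_0_iff)
    then show ?thesis unfolding a_def by (rule away)
  qed
  have a0: "0 \<le> a \<bullet> \<nu>" using away'[of "- \<nu>"] \<nu> by simp
  \<comment> \<open>The test direction is the part of \<open>a\<close> orthogonal to \<nu>, tilted
    inwards by a small \<open>s\<close> to make the inner product with \<nu> negative. As
    \<open>s\<close> tends to 0, the orthogonal part must vanish.\<close>
  have "a \<bullet> a - (a \<bullet> \<nu>)\<^sup>2 \<le> 0 + e" if e: "0 < e" for e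
  proof -
    define s where "s = e / (a \<bullet> \<nu> + 1)"
    have s: "0 < s" "s * (a \<bullet> \<nu>) \<le> e" using e a0 by (auto simp: s_def field_simps)
    have "a \<bullet> (a - (a \<bullet> \<nu>) *\<^sub>R \<nu> - s *\<^sub>R \<nu>) \<le> 0"
      by (rule away') (use \<nu> s in \<open>simp add: inner_diff_right inner_commute\<close>)
    then show ?thesis using s(2) by (simp add: inner_diff_right power2_eq_square)
  qed
  then have "(norm a)\<^sup>2 \<le> (a \<bullet> \<nu>)\<^sup>2" using field_le_epsilon[of "a \<bullet> a - (a \<bullet> \<nu>)\<^sup>2" 0]
    by (simp add: power2_norm_eq_inner)
  then have "norm a \<le> a \<bullet> \<nu>" using a0 by (rule power2_le_imp_le)
  moreover have "a \<bullet> \<nu> \<le> norm a" using norm_cauchy_schwarz[of a \<nu>] \<nu> by simp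
  ultimately have "a \<bullet> \<nu> = norm a * norm \<nu>" using \<nu> by simp
  then have a: "a = norm a *\<^sub>R \<nu>" using norm_cauchy_schwarz_eq[of a \<nu>] \<nu> by simp
  define q where "q = norm a / r"
  have xq: "x = p + q *\<^sub>R (y - p)" using a by (simp add: a_def \<nu>_def q_def algebra_simps)
  have "a \<noteq> 0" using pK xK by (auto simp: a_def)
  then have q0: "0 < q" using r by (simp add: q_def)
  \<comment> \<open>Beyond \<open>y\<close> the point \<open>x\<close> cannot lie, as otherwise the
    boundary point \<open>y\<close> would be a convex combination of points of the domain.\<close>
  have "q \<le> 1"
  proof (rule ccontr)
    assume q1: "\<not> q \<le> 1"
    then have "y = (1 - 1 / q) *\<^sub>R p + (1 / q) *\<^sub>R x" using q0 unfolding xq by (simp add: algebra_simps)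
    also have "\<dots> \<in> \<Omega>" using convex_dom p(1) x(1) q1 by (intro convexD) (auto simp: field_simps)
    finally show False using frontier_dom_disjoint[OF y(1)] by blast
  qed
  moreover have "x - y = (1 - q) *\<^sub>R (p - y)" unfolding xq by (simp add: algebra_simps)
  ultimately have "dist x y = (1 - q) * r" using y dp by (simp add: dist_norm)
  then have "d x \<le> r - q * r" using bdist_le[OF y(1), of x] by (simp add: algebra_simps)
  moreover have "dist x p = q * r" using r by (simp add: q_def a_def dist_norm)
  ultimately have "infdist x (K r) \<le> r - d x" using infdist_le[OF pK, of x] by simp
  then show "infdist x (K r) = r - d x" using infdist_K_ge[of r x] r by simp
qed

text \<open>At \<open>r = r_sing \<Omega>\<close> the nearest point may lie on the cut locus, so the
  argument by normals fails. Instead the radii below \<open>r\<close>, which are tight, supply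
  points near \<open>x\<close> of depth approaching \<open>r\<close>, and compactness gives one of
  depth \<open>r\<close>.\<close>

lemma tight_of_le_r_sing:
  assumes r: "0 < r" "r < R" "r \<le> r_sing \<Omega>" shows "tight r"
  unfolding tight_def
proof (intro ballI impI)
  fix x assume x: "x \<in> \<Omega>" "d x < r"
  \<comment> \<open>Any level strictly between \<open>d x\<close> and \<open>r\<close> would do; it
    keeps all candidates in the compact body \<open>K s0\<close>.\<close>
  define s0 where "s0 = (d x + r) / 2"
  have s0: "d x < s0" "s0 < r" "0 < s0" using x bdist_pos[OF x(1)] by (auto simp: s0_def)
  define C where "C = cball x (r - d x) \<inter> K s0"
  have near: "\<exists>q\<in>C. s \<le> d q" if s: "s0 < s" "s < r" for s
  proof -
    have "tight s" using s s0 r by (intro tight_of_less_r_sing) auto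
    then obtain q where q: "q \<in> K s" "dist x q = s - d x" using s s0 r x by (elim tightD[of s x]) auto
    then have "q \<in> C" using K_antimono[of s0 s] s by (auto simp: C_def)
    then show ?thesis using q by (auto simp: K_def)
  qed
  have "compact C" unfolding C_def using compact_K[OF s0(3)] by (intro compact_Int) auto
  moreover have "C \<noteq> {}" using near[of "(s0 + r) / 2"] s0 by auto
  ultimately obtain p where p: "p \<in> C" "\<And>q. q \<in> C \<Longrightarrow> d q \<le> d p"
    using continuous_attains_sup[of C d] continuous_bdist[of C] by blast
  have "r \<le> d p"
  proof (rule dense_le_bounded[OF s0(2)])
    fix s assume "s0 < s" "s < r"
    then obtain q where "q \<in> C" "s \<le> d q" using near by blast
    then show "s \<le> d p" using p(2)[of q] by simp
  qed
  then have "p \<in> K r" "dist x p \<le> r - d x" using p(1) by (auto simp: C_def K_def)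
  then have "infdist x (K r) \<le> r - d x" using infdist_le[of p "K r" x] by simp
  then show "infdist x (K r) = r - d x" using infdist_K_ge[of r x] r by simp
qed

text \<open>Minimality fixes the gradient norm and bounds the volume of the positivity set by that
  of the complement of \<open>K \<rho>\<close>, which it already contains. What is left of it inside
  is open and null, hence empty; tightness then gives the upper bound that matches the lower one on
  the rest.\<close>

lemma solution_eq_v_of_tight:
  assumes \<Lambda>: "\<Lambda>0 < \<Lambda>" and tight: "tight (r_Lambda \<Omega> \<Lambda>)" and u: "solution \<Omega> \<Lambda> u" and x: "x \<in> closure \<Omega>"
  shows "u x = v \<Omega> (r_Lambda \<Omega> \<Lambda>) x"
proof -
  define \<rho> where "\<rho> = r_Lambda \<Omega> \<Lambda>"
  have \<rho>: "0 < \<rho>" "\<rho> < R" using r_Lambda[of \<Lambda>] \<Lambda> r_star by (auto simp: \<rho>_def)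
  have \<Lambda>p: "0 < \<Lambda>" using \<Lambda> Lambda0_pos by simp
  have uL: "u \<in> Lip1 \<Omega>" using u by (simp add: solution_iff)
  have "J \<Omega> \<Lambda> u \<le> J \<Omega> \<Lambda> (v \<Omega> \<rho>)" using u v_Lip1(1)[OF \<rho>(1)] by (simp add: solution_iff)
  then have Ju: "J \<Omega> \<Lambda> u \<le> measure lebesgue \<Omega> * \<Lambda> + (1 / \<rho> - \<Lambda> * V \<rho>)"
    using J_competitors(1)[OF \<rho>(1), of \<Lambda>] by simp
  have L: "lipnorm u = 1 / \<rho>" using J_ge_of_Lambda_gt(2)[OF \<Lambda> uL] Ju by (simp add: \<rho>_def)
  have lower: "1 - d z / \<rho> \<le> u z" if "z \<in> \<Omega>" for z using Lip1_lower_bound[OF uL that] L by simp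
  let ?P = "{x \<in> \<Omega>. u x > 0}" and ?I = "inner_parallel \<Omega> \<rho>"
  have outer: "\<Omega> - K \<rho> \<subseteq> ?P"
  proof
    fix z assume "z \<in> \<Omega> - K \<rho>"
    then have z: "z \<in> \<Omega>" "d z < \<rho>" by (auto simp: K_def)
    then have "0 < 1 - d z / \<rho>" using \<rho> by simp
    then show "z \<in> ?P" using lower[OF z(1)] z(1) by simp
  qed
  have Pm: "?P \<in> lmeasurable" by (rule lmeasurable_positivity_set[OF uL])
  have Q: "open (?P \<inter> ?I)" "?P \<inter> ?I \<in> lmeasurable"
    using open_positivity_set[OF uL] open_inner_parallel[of \<rho>] Pm lmeasurable_inner_parallel[of \<rho>]
    by (auto intro: fmeasurable_Int_fmeasurable fmeasurableD)
  have "\<Lambda> * measure lebesgue ?P \<le> \<Lambda> * (measure lebesgue \<Omega> - V \<rho>)"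
    using Ju L by (simp add: J_def algebra_simps)
  then have Ple: "measure lebesgue ?P \<le> measure lebesgue (\<Omega> - K \<rho>)"
    using \<Lambda>p measure_diff_K(2)[OF \<rho>(1)] by simp
  have dis: "(\<Omega> - K \<rho>) \<inter> (?P \<inter> ?I) = {}" using inner_parallel_subset_K by blast
  have "measure lebesgue (\<Omega> - K \<rho>) + measure lebesgue (?P \<inter> ?I) = measure lebesgue ((\<Omega> - K \<rho>) \<union> (?P \<inter> ?I))"
    by (rule measure_disjoint_Un[symmetric, OF measure_diff_K(1)[OF \<rho>(1)] Q(2) dis])
  also have "\<dots> \<le> measure lebesgue ?P"
  proof (rule measure_mono_fmeasurable[OF _ _ Pm])
    show "(\<Omega> - K \<rho>) \<union> (?P \<inter> ?I) \<subseteq> ?P" using outer by blast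
    show "(\<Omega> - K \<rho>) \<union> (?P \<inter> ?I) \<in> sets lebesgue"
      using measure_diff_K(1)[OF \<rho>(1)] Q(2) by (intro sets.Un fmeasurableD)
  qed
  finally have "measure lebesgue (?P \<inter> ?I) = 0" using Ple measure_nonneg[of lebesgue "?P \<inter> ?I"]
    by linarith
  then have "negligible (?P \<inter> ?I)" using Q(2) by (simp add: negligible_iff_measure)
  then have PI: "?P \<inter> ?I = {}" using open_not_negligible[OF Q(1)] by blast
  have zero: "u z = 0" if z: "z \<in> ?I" for z
  proof -
    have zO: "z \<in> \<Omega>" using z by (simp add: inner_parallel_def)
    then have "0 \<le> u z" using uL by (simp add: Lip1_def)
    moreover have "\<not> 0 < u z" using z zO PI by blast
    ultimately show ?thesis by simp
  qed
  have KO: "K \<rho> \<subseteq> \<Omega>" by (auto simp: K_def)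
  have uc: "continuous_on (closure \<Omega>) u" using uL by (simp add: Lip1_def)
  have zeroK: "u z = 0" if z: "z \<in> K \<rho>" for z
  proof (rule continuous_constant_on_closure[of ?I u 0 z])
    show "continuous_on (closure ?I) u"
      unfolding closure_inner_parallel[OF \<rho>]
      by (rule continuous_on_subset[OF uc order_trans[OF KO closure_subset]])
    show "z \<in> closure ?I" using z closure_inner_parallel[OF \<rho>] by simp
  qed (rule zero)
  have "u x = v \<Omega> \<rho> x"
  proof (cases "x \<in> \<Omega>")
    case False
    then have xf: "x \<in> frontier \<Omega>" using x open_dom by (simp add: frontier_def interior_open)
    then have "u x = 1" using uL by (simp add: Lip1_def)
    then show "u x = v \<Omega> \<rho> x" using bdist_frontier[OF xf] by (simp add: v_def)
  next
    case xO: True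
    show "u x = v \<Omega> \<rho> x"
    proof (cases "d x < \<rho>")
      case True
      obtain p where p: "p \<in> K \<rho>" "dist x p = \<rho> - d x"
        using tightD[OF tight[folded \<rho>_def] \<rho>(1) less_imp_le[OF \<rho>(2)] xO True] by blast
      have "\<bar>u x - u p\<bar> \<le> lipnorm u * dist x p"
        by (rule Lip1_lipschitz(2)[OF uL x]) (use p KO closure_subset in blast)
      then have "u x \<le> (\<rho> - d x) / \<rho>" using zeroK[OF p(1)] p(2) L by simp
      then have "u x = 1 - d x / \<rho>" using lower[OF xO] \<rho> by (simp add: diff_divide_distrib)
      then show ?thesis using True \<rho> by (simp add: v_def)
    next
      case False
      then have "u x = 0" using xO by (intro zeroK) (simp add: K_def)
      then show ?thesis using False \<rho> by (simp add: v_def)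
    qed
  qed
  then show ?thesis by (simp add: \<rho>_def)
qed

lemma w_neq_v_of_not_tight:
  assumes r: "0 < r" "r \<le> R" and nt: "\<not> tight r" shows "\<exists>x\<in>\<Omega>. w r x \<noteq> v \<Omega> r x"
proof -
  obtain x where x: "x \<in> \<Omega>" "d x < r" "infdist x (K r) \<noteq> r - d x" using nt by (auto simp: tight_def)
  then have "r - d x < infdist x (K r)" using infdist_K_ge[OF r(2), of x] by simp
  then have "(r - d x) / r < infdist x (K r) / r" using r by (simp add: divide_strict_right_mono)
  moreover have "(r - d x) / r = 1 - d x / r" using r by (simp add: diff_divide_distrib)
  moreover have "1 - d x / r < 1" using bdist_pos[OF x(1)] r by simp
  ultimately have "1 - d x / r < w r x" by (simp add: w_def)
  moreover have "v \<Omega> r x = 1 - d x / r" using x r by (simp add: v_def)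
  ultimately show ?thesis using x(1) by (intro bexI[of _ x]) auto
qed

section \<open>Uniqueness in terms of the singular radius\<close>

lemma unique_solution_eq:
  "\<lbrakk>unique_solution \<Omega> \<Lambda> u; solution \<Omega> \<Lambda> f; solution \<Omega> \<Lambda> g; x \<in> closure \<Omega>\<rbrakk> \<Longrightarrow> f x = g x"
  unfolding unique_solution_def by metis

lemma unique_v:
  assumes \<Lambda>: "\<Lambda>0 < \<Lambda>" "r_Lambda \<Omega> \<Lambda> \<le> r_sing \<Omega>" shows "unique_solution \<Omega> \<Lambda> (v \<Omega> (r_Lambda \<Omega> \<Lambda>))"
proof -
  have "tight (r_Lambda \<Omega> \<Lambda>)"
    using r_Lambda[of \<Lambda>] \<Lambda> r_star by (intro tight_of_le_r_sing) auto
  then show ?thesis unfolding unique_solution_def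
    using solutions_above_Lambda0(1)[OF \<Lambda>(1)] solution_eq_v_of_tight[OF \<Lambda>(1)] by blast
qed

lemma unique_imp:
  assumes \<Lambda>: "\<Lambda>0 \<le> \<Lambda>" and u: "unique_solution \<Omega> \<Lambda> u" shows "\<Lambda>0 < \<Lambda> \<and> r_Lambda \<Omega> \<Lambda> \<le> r_sing \<Omega>"
proof
  show gt: "\<Lambda>0 < \<Lambda>"
  proof (rule ccontr)
    assume "\<not> \<Lambda>0 < \<Lambda>"
    then have eq: "\<Lambda> = \<Lambda>0" using \<Lambda> by simp
    \<comment> \<open>At the threshold both the constant 1 and \<open>v \<Omega> rs\<close> are
      minimizers, so uniqueness would identify them.\<close>
    have "v \<Omega> rs x = 1" if "x \<in> closure \<Omega>" for x
      using unique_solution_eq[OF u[unfolded eq] v_solution_Lambda0 one_solution[OF Lambda0_pos order_refl] that] .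
    then have "v \<Omega> rs constant_on closure \<Omega>" unfolding constant_on_def by blast
    then show False using v_not_constant[OF r_star(1)] r_star(2) by simp
  qed
  have \<rho>: "0 < r_Lambda \<Omega> \<Lambda>" "r_Lambda \<Omega> \<Lambda> \<le> R" using r_Lambda[OF \<Lambda>] r_star by auto
  have "tight (r_Lambda \<Omega> \<Lambda>)"
  proof (rule ccontr)
    assume "\<not> tight (r_Lambda \<Omega> \<Lambda>)"
    then obtain x where x: "x \<in> \<Omega>" "w (r_Lambda \<Omega> \<Lambda>) x \<noteq> v \<Omega> (r_Lambda \<Omega> \<Lambda>) x"
      using w_neq_v_of_not_tight[OF \<rho>] by blast
    then show False
      using unique_solution_eq[OF u solutions_above_Lambda0(2,1)[OF gt] subsetD[OF closure_subset x(1)]]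
        by simp
  qed
  then show "r_Lambda \<Omega> \<Lambda> \<le> r_sing \<Omega>" using \<rho> by (rule tight_imp_le_r_sing)
qed

lemma unique_nonconstant_iff:
  assumes "0 < \<Lambda>"
  shows "(\<exists>u. unique_solution \<Omega> \<Lambda> u \<and> \<not> u constant_on closure \<Omega>) \<longleftrightarrow> \<Lambda>0 < \<Lambda> \<and> r_Lambda \<Omega> \<Lambda> \<le> r_sing \<Omega>"
proof
  assume "\<exists>u. unique_solution \<Omega> \<Lambda> u \<and> \<not> u constant_on closure \<Omega>"
  then obtain u where u: "unique_solution \<Omega> \<Lambda> u" "\<not> u constant_on closure \<Omega>" by blast
  have "\<Lambda>0 \<le> \<Lambda>"
    using solution_below_Lambda0[OF assms] u unfolding unique_solution_def by (meson not_le)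
  then show "\<Lambda>0 < \<Lambda> \<and> r_Lambda \<Omega> \<Lambda> \<le> r_sing \<Omega>" using u(1) by (rule unique_imp)
next
  assume \<Lambda>: "\<Lambda>0 < \<Lambda> \<and> r_Lambda \<Omega> \<Lambda> \<le> r_sing \<Omega>"
  then have "0 < r_Lambda \<Omega> \<Lambda>" "r_Lambda \<Omega> \<Lambda> \<le> R" using r_Lambda[of \<Lambda>] r_star by auto
  then show "\<exists>u. unique_solution \<Omega> \<Lambda> u \<and> \<not> u constant_on closure \<Omega>"
    using unique_v \<Lambda> v_not_constant by blast
qed

text \<open>For singular radius 0 both sides fail, as \<open>r_Lambda\<close> is positive. For
  values in \<open>{0<..rs}\<close> strict antitonicity of \<open>r_Lambda\<close> turns the
  comparison of radii into one of parameters; at \<open>r_sing \<Omega> = rs\<close> this means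
  \<open>L = \<Lambda>0\<close>. For larger values every \<open>r_Lambda\<close> is below the
  singular radius, and all that counts of \<open>L\<close> is that it does not exceed
  \<Lambda>0.\<close>

lemma r_Lambda_le_r_sing_iff:
  assumes L: "is_Lambda_sing \<Omega> L"
  shows "L \<le> ereal \<Lambda>0 \<Longrightarrow> \<Lambda>0 < \<Lambda> \<and> r_Lambda \<Omega> \<Lambda> \<le> r_sing \<Omega> \<longleftrightarrow> \<Lambda>0 < \<Lambda>"
    and "ereal \<Lambda>0 < L \<Longrightarrow> \<Lambda>0 < \<Lambda> \<and> r_Lambda \<Omega> \<Lambda> \<le> r_sing \<Omega> \<longleftrightarrow> L \<le> ereal \<Lambda>"
proof -
  have "0 \<le> r_sing \<Omega>" unfolding r_sing_def by (rule setdist_pos_le)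
  then consider (zero) "r_sing \<Omega> = 0" "L = \<infinity>"
    | (mid) \<Lambda>s where "L = ereal \<Lambda>s" "\<Lambda>0 \<le> \<Lambda>s" "r_Lambda \<Omega> \<Lambda>s = r_sing \<Omega>"
    | (large) "rs < r_sing \<Omega>" "L \<le> ereal \<Lambda>0"
    using L unfolding is_Lambda_sing_def Lambda_inf_eq by (meson not_le order_le_less)
  note cs = this
  have le: "r_Lambda \<Omega> \<Lambda> \<le> rs" if "\<Lambda>0 < \<Lambda>" using r_Lambda(2)[of \<Lambda>] that by simp
  have pos: "0 < r_Lambda \<Omega> \<Lambda>" if "\<Lambda>0 < \<Lambda>" using r_Lambda(1)[of \<Lambda>] that by simp
  show "\<Lambda>0 < \<Lambda> \<and> r_Lambda \<Omega> \<Lambda> \<le> r_sing \<Omega> \<longleftrightarrow> \<Lambda>0 < \<Lambda>" if "L \<le> ereal \<Lambda>0"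
  proof -
    have "rs \<le> r_sing \<Omega>" using cs
    proof cases
      case mid
      then have "\<Lambda>s = \<Lambda>0" using that by simp
      then show ?thesis using mid r_Lambda_Lambda0 by simp
    qed (use that in auto)
    then show ?thesis using le by auto
  qed
  show "\<Lambda>0 < \<Lambda> \<and> r_Lambda \<Omega> \<Lambda> \<le> r_sing \<Omega> \<longleftrightarrow> L \<le> ereal \<Lambda>" if gt: "ereal \<Lambda>0 < L"
    using cs
  proof cases
    case zero then show ?thesis using pos by auto
  next
    case mid
    then have gt': "\<Lambda>0 < \<Lambda>s" using gt by simp
    show ?thesis
    proof (cases "\<Lambda>0 < \<Lambda>")
      case True
      have "r_Lambda \<Omega> \<Lambda> \<le> r_Lambda \<Omega> \<Lambda>s \<longleftrightarrow> \<Lambda>s \<le> \<Lambda>"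
        using r_Lambda_strict_antimono[of \<Lambda> \<Lambda>s] r_Lambda_strict_antimono[of \<Lambda>s \<Lambda>] True gt'
        by (cases \<Lambda> \<Lambda>s rule: linorder_cases) auto
      then show ?thesis using mid True by simp
    next
      case False then show ?thesis using mid gt' by simp
    qed
  next
    case large then show ?thesis using gt by simp
  qed
qed

end

text \<open>For positive \<Lambda> below \<open>Lambda_inf \<Omega>\<close> the constant 1 is the
  only minimizer, so uniqueness alone does not detect the threshold. The equivalences therefore come
  in two readings: non-constant solutions for all positive \<Lambda>, and arbitrary solutions from
  \<open>Lambda_inf \<Omega>\<close> on. The singular parameter is an extended real because it is
  infinite when \<open>r_sing \<Omega> = 0\<close>.\<close>

theorem theorem8:
  fixes \<Omega> :: "'a::euclidean_space set" and \<Lambda>sing :: ereal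
  assumes "DIM('a) \<ge> 2"
    and "open \<Omega>" and "bounded \<Omega>" and "convex \<Omega>" and "\<Omega> \<noteq> {}"
    and "is_Lambda_sing \<Omega> \<Lambda>sing"
  shows
    "(\<Lambda>sing \<le> ereal (Lambda_inf \<Omega>) \<longrightarrow>
       (\<forall>\<Lambda>>0.
          ((\<exists>u. unique_solution \<Omega> \<Lambda> u \<and> \<not> u constant_on closure \<Omega>) \<longleftrightarrow> \<Lambda> > Lambda_inf \<Omega>) \<and>
          (\<Lambda> \<ge> Lambda_inf \<Omega> \<longrightarrow> ((\<exists>u. unique_solution \<Omega> \<Lambda> u) \<longleftrightarrow> \<Lambda> > Lambda_inf \<Omega>)) \<and>
          (\<Lambda> > Lambda_inf \<Omega> \<longrightarrow> unique_solution \<Omega> \<Lambda> (v \<Omega> (r_Lambda \<Omega> \<Lambda>))))) \<and>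
     (\<Lambda>sing > ereal (Lambda_inf \<Omega>) \<longrightarrow>
       (\<forall>\<Lambda>>0.
          ((\<exists>u. unique_solution \<Omega> \<Lambda> u \<and> \<not> u constant_on closure \<Omega>) \<longleftrightarrow> ereal \<Lambda> \<ge> \<Lambda>sing) \<and>
          (\<Lambda> \<ge> Lambda_inf \<Omega> \<longrightarrow> ((\<exists>u. unique_solution \<Omega> \<Lambda> u) \<longleftrightarrow> ereal \<Lambda> \<ge> \<Lambda>sing)) \<and>
          (ereal \<Lambda> \<ge> \<Lambda>sing \<longrightarrow> unique_solution \<Omega> \<Lambda> (v \<Omega> (r_Lambda \<Omega> \<Lambda>)))))"
proof -
  interpret convex_domain \<Omega> using assms by unfold_locales
  note iff = r_Lambda_le_r_sing_iff[OF assms(6)]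
  have ex: "(\<exists>u. unique_solution \<Omega> \<Lambda> u) \<longleftrightarrow> \<Lambda>0 < \<Lambda> \<and> r_Lambda \<Omega> \<Lambda> \<le> r_sing \<Omega>" if "\<Lambda>0 \<le> \<Lambda>" for \<Lambda>
    using unique_imp[OF that] unique_v by blast
  show ?thesis unfolding Lambda_inf_eq
  proof (intro conjI impI allI)
    fix \<Lambda> :: real assume \<Lambda>: "0 < \<Lambda>"
    {
      assume L: "\<Lambda>sing \<le> ereal \<Lambda>0"
      show "(\<exists>u. unique_solution \<Omega> \<Lambda> u \<and> \<not> u constant_on closure \<Omega>) \<longleftrightarrow> \<Lambda>0 < \<Lambda>"
        using unique_nonconstant_iff[OF \<Lambda>] iff(1)[OF L, of \<Lambda>] by blast
      show "(\<exists>u. unique_solution \<Omega> \<Lambda> u) \<longleftrightarrow> \<Lambda>0 < \<Lambda>" if "\<Lambda>0 \<le> \<Lambda>"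
        using ex[OF that] iff(1)[OF L, of \<Lambda>] by blast
      show "unique_solution \<Omega> \<Lambda> (v \<Omega> (r_Lambda \<Omega> \<Lambda>))" if "\<Lambda>0 < \<Lambda>"
        using that iff(1)[OF L, of \<Lambda>] unique_v by blast
    next
      assume L: "ereal \<Lambda>0 < \<Lambda>sing"
      show "(\<exists>u. unique_solution \<Omega> \<Lambda> u \<and> \<not> u constant_on closure \<Omega>) \<longleftrightarrow> \<Lambda>sing \<le> ereal \<Lambda>"
        using unique_nonconstant_iff[OF \<Lambda>] iff(2)[OF L, of \<Lambda>] by blast
      show "(\<exists>u. unique_solution \<Omega> \<Lambda> u) \<longleftrightarrow> \<Lambda>sing \<le> ereal \<Lambda>" if "\<Lambda>0 \<le> \<Lambda>"
        using ex[OF that] iff(2)[OF L, of \<Lambda>] by blast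
      show "unique_solution \<Omega> \<Lambda> (v \<Omega> (r_Lambda \<Omega> \<Lambda>))" if "\<Lambda>sing \<le> ereal \<Lambda>"
        using that iff(2)[OF L, of \<Lambda>] unique_v by blast
    }
  qed
qed

end
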